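(* Let $\eta,v,q$ be a solution of the linearized problem (equations, jump conditions and boundary conditions, as given in the context). In the non-periodic case, there is a constant $C=C(\rho_0^\pm,P_\pm,\Lambda,\varepsilon,\delta,\sigma,g,m,\ell)>0$ such that for all $t\ge0$ $$\|v(t)\|_1^2+\|v(t)\|_2^2+\|\partial_tv(t)\|_1^2\le Ce^{2\Lambda t}\left(\|\partial_tv(0)\|_1^2+\|v(0)\|_1^2+\|v(0)\|_2^2+\sigma\int_{\mathbb{R}^2}|\nabla_{x_1,x_2}v_3(0)|^2\right),$$ where the last integral is over the interface $\{x_3=0\}$. In the periodic case with $\sqrt{\sigma/(g[[\rho_0]])}<L$, the same inequality holds with $\Lambda$ replaced by $\Lambda_L$ and the integral over $\mathbb{R}^2$ replaced by an integral over $(2\pi L\mathbb{T})^2$.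
   Context: Parameters and steady state. Fix $g>0$, $\sigma\ge 0$, $m,\ell>0$ (and $L>0$ in the periodic case). Let $P_\pm\in C^\infty((0,\infty))$ be positive and strictly increasing with $1/P_\pm'\in L^\infty_{loc}((0,\infty))$; let $\varepsilon_\pm,\delta_\pm\in C^\infty((0,\infty))$ with $\varepsilon_\pm>0$, $\delta_\pm\ge0$. Put $h_\pm(z)=\int_1^z P_\pm'(r)/r\,dr$. Assume $Z=\{z>0: P_-(z)>P_+(z),\ P_-(z)\in P_+((0,\infty))\}$ is nonempty, fix $\rho_0^-\in Z$ and set $\rho_0^+=P_+^{-1}(P_-(\rho_0^-))$. Assume $h_-(\rho_0^-)+gm\in h_-((0,\infty))$ and $h_+(\rho_0^+)-g\ell\in h_+((0,\infty))$. Define $\rho_0(x_3)=h_-^{-1}(h_-(\rho_0^-)-gx_3)$ for $-m<x_3<0$ and $\rho_0(x_3)=h_+^{-1}(h_+(\rho_0^+)-gx_3)$ for $0<x_3<\ell$; then $\rho_0$ is smooth on each side, bounded above and below by positive constants, and $\frac{d}{dx_3}P(\rho_0)=-g\rho_0$ on each side. Notation. $P'(\rho_0)$, $\varepsilon_0=\varepsilon(\rho_0)$, $\delta_0=\delta(\rho_0)$ mean the $+$ functions of $\rho_0$ for $x_3>0$ and the $-$ functions for $x_3<0$. $[[f]]=f|_{x_3=0^+}-f|_{x_3=0^-}$; $[[\rho_0]]=\rho_0^+-\rho_0^->0$. $|\xi|_c=\sqrt{g[[\rho_0]]/\sigma}$ ($=+\infty$ if $\sigma=0$). Growth rates. For $|\xi|>0$,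 $s>0$, with $\tilde\varepsilon=s\varepsilon_0$, $\tilde\delta=s\delta_0$ and real $\varphi,\psi\in H^1_0((-m,\ell))$, let $$E(\varphi,\psi)=\frac{\sigma|\xi|^2}{2}\psi(0)^2+\frac12\int_{-m}^\ell(\tilde\delta+P'(\rho_0)\rho_0)(\psi'+|\xi|\varphi)^2-2g\rho_0|\xi|\varphi\psi+\frac12\int_{-m}^\ell\tilde\varepsilon\left((\varphi'-|\xi|\psi)^2+(\psi'-|\xi|\varphi)^2+\tfrac13(\psi'+|\xi|\varphi)^2\right),$$ $J(\varphi,\psi)=\frac12\int_{-m}^\ell\rho_0(\varphi^2+\psi^2)$, $\mathcal A=\{(\varphi,\psi)\in H_0^1((-m,\ell))^2: J(\varphi,\psi)=1\}$, $\mu(|\xi|,s)=\inf_{\mathcal A}E$. For $0<|\xi|<|\xi|_c$ there is a unique $s>0$ with $\mu(|\xi|,s)<0$ and $s=\sqrt{-\mu(|\xi|,s)}$; this $s$ is denoted $\lambda(|\xi|)$. The function $\lambda$ is continuous on $(0,|\xi|_c)$ and tends to $0$ at both endpoints. Non-periodic case: $\Lambda=\max_{0\le|\xi|\le|\xi|_c}\lambda(|\xi|)>0$ ($\lambda$ extended by $0$ to the endpoints). Periodic case with $\sqrt{\sigma/(g[[\rho_0]])}<L$: $\Lambda_L=\sup\{\lambda(|\xi|):\xi\in(L^{-1}\mathbb{Z})^2,\ |\xi|\in(0,|\xi|_c)\}>0$. Domain and linearized problem. Non-periodic case: $\Omega_-=\mathbb{R}^2\times(-m,0)$, $\Omega_+=\mathbb{R}^2\times(0,\ell)$.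 Periodic case: $\mathbb{R}^2$ is replaced by $(2\pi L\mathbb{T})^2$, where $2\pi L\mathbb{T}$ is the 1-torus of length $2\pi L$. $\Omega$ is the corresponding slab with $x_3\in(-m,\ell)$. The linearized problem for $\eta,v$ (vector valued) and $q$ (scalar) is, in $\Omega_\pm$ for $t>0$: $\partial_t\eta=v$, $\partial_tq+\rho_0\,\mathrm{div}\,v=0$, $$\rho_0\partial_tv+\nabla(P'(\rho_0)q)+gqe_3+g\rho_0\nabla\eta_3=\mathrm{div}\left(\varepsilon_0\left(Dv+Dv^T-\tfrac23(\mathrm{div}\,v)I\right)+\delta_0(\mathrm{div}\,v)I\right),$$ with jump conditions at $\{x_3=0\}$: $[[v]]=0$, $[[\eta]]=0$, $$[[P'(\rho_0)qI-\varepsilon_0(Dv+Dv^T)-(\delta_0-2\varepsilon_0/3)(\mathrm{div}\,v)I]]e_3=\sigma\Delta_{x_1,x_2}\eta_3e_3,$$ and boundary conditions $v=0$ at $x_3=-m$ and $x_3=\ell$. Solutions are understood to be sufficiently regular on each of $\Omega_\pm$ up to the boundary and in time (and, in the non-periodic case, sufficiently decaying as $|x'|\to\infty$) that the equations hold classically, may be differentiated once in time, all quantities in the statement are finite, and integrations by parts against $\partial_t v$ are justified. Norms. $\|v\|_1^2=\int_\Omega\rho_0|v|^2$ and $\|v\|_2^2=\int_\Omega\frac{\varepsilon_0}2\left|Dv+Dv^T-\frac23(\mathrm{div}\,v)I\right|^2+\delta_0|\mathrm{div}\,v|^2$. *)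

theory Defs
  imports "HOL-Analysis.Analysis"
begin

section \<open>Parameters\<close>

text \<open>Quantities of the lower fluid (index minus) and of the upper fluid (index plus) are
  families indexed by \<open>side\<close>.\<close>

datatype side = Lower | Upper

record rt_params =
  grav :: real                      \<comment> \<open>\<open>g\<close>\<close>
  surf :: real                      \<comment> \<open>surface tension \<open>\<sigma>\<close>\<close>
  depth :: real                     \<comment> \<open>\<open>m\<close>\<close>
  height :: real                    \<comment> \<open>\<open>\<ell>\<close>\<close>
  pres :: "side \<Rightarrow> real \<Rightarrow> real"     \<comment> \<open>pressure laws \<open>P\<close>\<close>
  shear :: "side \<Rightarrow> real \<Rightarrow> real"    \<comment> \<open>viscosities \<open>\<epsilon>\<close>\<close>
  bulk :: "side \<Rightarrow> real \<Rightarrow> real"     \<comment> \<open>viscosities \<open>\<delta>\<close>\<close>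
  rhom :: real                      \<comment> \<open>the density at the interface, seen from below\<close>

text \<open>Membership in \<open>C\<^sup>\<infinity>((0,\<infinity>))\<close>; only values at positive arguments matter.\<close>

definition smooth_pos :: "(real \<Rightarrow> real) \<Rightarrow> bool" where
  "smooth_pos f \<longleftrightarrow> (\<forall>n. \<forall>z>0. (deriv ^^ n) f field_differentiable (at z))"

text \<open>The reciprocal of \<open>f\<close> is in \<open>L\<^sup>\<infinity>\<^sub>l\<^sub>o\<^sub>c((0,\<infinity>))\<close>. The clause \<open>f z \<noteq> 0\<close> is there because of
  the convention \<open>1 / 0 = 0\<close>.\<close>

definition recip_Linf_loc :: "(real \<Rightarrow> real) \<Rightarrow> bool" where
  "recip_Linf_loc f \<longleftrightarrow>
     (\<forall>a b. 0 < a \<and> a < b \<longrightarrow>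
       (\<exists>M. AE z in lborel. z \<in> {a..b} \<longrightarrow> f z \<noteq> 0 \<and> \<bar>1 / f z\<bar> \<le> M))"

definition enthalpy :: "rt_params \<Rightarrow> side \<Rightarrow> real \<Rightarrow> real" where
  "enthalpy p s z = (LBINT r=ereal 1..ereal z. deriv (pres p s) r / r)"

definition rt_Z :: "rt_params \<Rightarrow> real set" where
  "rt_Z p = {z. z > 0 \<and> pres p Lower z > pres p Upper z \<and> pres p Lower z \<in> pres p Upper ` {0<..}}"

fun rho_bd :: "rt_params \<Rightarrow> side \<Rightarrow> real" where
  "rho_bd p Lower = rhom p"
| "rho_bd p Upper = inv_into {0<..} (pres p Upper) (pres p Lower (rhom p))"

definition rt_admissible :: "rt_params \<Rightarrow> bool" where
  "rt_admissible p \<longleftrightarrow>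
     grav p > 0 \<and> surf p \<ge> 0 \<and> depth p > 0 \<and> height p > 0 \<and>
     (\<forall>s. smooth_pos (pres p s) \<and> (\<forall>z>0. pres p s z > 0) \<and>
          strict_mono_on {0<..} (pres p s) \<and> recip_Linf_loc (deriv (pres p s))) \<and>
     (\<forall>s. smooth_pos (shear p s) \<and> (\<forall>z>0. shear p s z > 0) \<and>
          smooth_pos (bulk p s) \<and> (\<forall>z>0. bulk p s z \<ge> 0)) \<and>
     rhom p \<in> rt_Z p \<and>
     enthalpy p Lower (rho_bd p Lower) + grav p * depth p \<in> enthalpy p Lower ` {0<..} \<and>
     enthalpy p Upper (rho_bd p Upper) - grav p * height p \<in> enthalpy p Upper ` {0<..}"

section \<open>Steady state\<close>

text \<open>The profile on the closed interval of each side, so that its value at \<open>0\<close> is the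
  one-sided trace \<open>rho_bd\<close>.\<close>

definition rho :: "rt_params \<Rightarrow> side \<Rightarrow> real \<Rightarrow> real" where
  "rho p s z = inv_into {0<..} (enthalpy p s) (enthalpy p s (rho_bd p s) - grav p * z)"

definition dpres :: "rt_params \<Rightarrow> side \<Rightarrow> real \<Rightarrow> real" where
  "dpres p s z = deriv (pres p s) (rho p s z)"

definition eps0 :: "rt_params \<Rightarrow> side \<Rightarrow> real \<Rightarrow> real" where
  "eps0 p s z = shear p s (rho p s z)"

definition del0 :: "rt_params \<Rightarrow> side \<Rightarrow> real \<Rightarrow> real" where
  "del0 p s z = bulk p s (rho p s z)"

definition jump_rho :: "rt_params \<Rightarrow> real" where
  "jump_rho p = rho_bd p Upper - rho_bd p Lower"

definition xi_c :: "rt_params \<Rightarrow> ereal" where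
  "xi_c p = (if surf p = 0 then \<infinity> else ereal (sqrt (grav p * jump_rho p / surf p)))"

section \<open>Growth rates\<close>

definition side_of :: "real \<Rightarrow> side" where
  "side_of z = (if z < 0 then Lower else Upper)"

text \<open>\<open>L\<^sup>2((a,b))\<close>.\<close>

definition sq_integrable :: "real \<Rightarrow> real \<Rightarrow> (real \<Rightarrow> real) \<Rightarrow> bool" where
  "sq_integrable a b f \<longleftrightarrow>
     set_borel_measurable lborel {a<..<b} f \<and> set_integrable lborel {a<..<b} (\<lambda>x. (f x)\<^sup>2)"

text \<open>\<open>C1_compact a b \<theta> \<theta>'\<close>: \<open>\<theta>\<close> is a test function of class \<open>C\<^sup>1\<close> with compact support in
  \<open>(a,b)\<close>, and \<open>\<theta>'\<close> is its derivative.\<close>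

definition C1_compact :: "real \<Rightarrow> real \<Rightarrow> (real \<Rightarrow> real) \<Rightarrow> (real \<Rightarrow> real) \<Rightarrow> bool" where
  "C1_compact a b \<theta> \<theta>' \<longleftrightarrow>
     (\<forall>x. (\<theta> has_real_derivative \<theta>' x) (at x)) \<and> continuous_on UNIV \<theta>' \<and>
     (\<exists>c d. a < c \<and> d < b \<and> (\<forall>x. x \<notin> {c..d} \<longrightarrow> \<theta> x = 0))"

text \<open>\<open>H10 a b f f'\<close>: \<open>f\<close> belongs to \<open>H\<^sup>1\<^sub>0((a,b))\<close> and \<open>f'\<close> is (a representative of) its weak
  derivative. As \<open>f\<close> is evaluated at points, it is the continuous representative of its
  class.\<close>

definition H10 :: "real \<Rightarrow> real \<Rightarrow> (real \<Rightarrow> real) \<Rightarrow> (real \<Rightarrow> real) \<Rightarrow> bool" where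
  "H10 a b f f' \<longleftrightarrow>
     sq_integrable a b f \<and> sq_integrable a b f' \<and>
     (\<forall>\<theta> \<theta>'. C1_compact a b \<theta> \<theta>' \<longrightarrow>
        (LBINT x:{a<..<b}. f x * \<theta>' x) = - (LBINT x:{a<..<b}. f' x * \<theta> x)) \<and>
     continuous_on {a..b} f \<and> f a = 0 \<and> f b = 0"

definition energy_E ::
  "rt_params \<Rightarrow> real \<Rightarrow> real \<Rightarrow> (real \<Rightarrow> real) \<Rightarrow> (real \<Rightarrow> real) \<Rightarrow> (real \<Rightarrow> real) \<Rightarrow> (real \<Rightarrow> real) \<Rightarrow> real"
where
  "energy_E p r s \<phi> \<phi>' \<psi> \<psi>' =
     surf p * r\<^sup>2 / 2 * (\<psi> 0)\<^sup>2
     + 1 / 2 * (LBINT x:{- depth p<..<height p}.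
         (s * del0 p (side_of x) x + dpres p (side_of x) x * rho p (side_of x) x)
            * (\<psi>' x + r * \<phi> x)\<^sup>2
         - 2 * grav p * rho p (side_of x) x * r * \<phi> x * \<psi> x)
     + 1 / 2 * (LBINT x:{- depth p<..<height p}.
         s * eps0 p (side_of x) x *
           ((\<phi>' x - r * \<psi> x)\<^sup>2 + (\<psi>' x - r * \<phi> x)\<^sup>2 + 1 / 3 * (\<psi>' x + r * \<phi> x)\<^sup>2))"

definition energy_J :: "rt_params \<Rightarrow> (real \<Rightarrow> real) \<Rightarrow> (real \<Rightarrow> real) \<Rightarrow> real" where
  "energy_J p \<phi> \<psi> =
     1 / 2 * (LBINT x:{- depth p<..<height p}. rho p (side_of x) x * ((\<phi> x)\<^sup>2 + (\<psi> x)\<^sup>2))"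

definition mu :: "rt_params \<Rightarrow> real \<Rightarrow> real \<Rightarrow> real" where
  "mu p r s = Inf {energy_E p r s \<phi> \<phi>' \<psi> \<psi>' | \<phi> \<phi>' \<psi> \<psi>'.
     H10 (- depth p) (height p) \<phi> \<phi>' \<and> H10 (- depth p) (height p) \<psi> \<psi>' \<and> energy_J p \<phi> \<psi> = 1}"

definition growth :: "rt_params \<Rightarrow> real \<Rightarrow> real" where
  "growth p r = (THE s. s > 0 \<and> mu p r s < 0 \<and> s = sqrt (- mu p r s))"

text \<open>Extension of the growth rate by \<open>0\<close> to the endpoints of \<open>[0, |\<xi>|\<^sub>c]\<close>.\<close>

definition growth_ext :: "rt_params \<Rightarrow> ereal \<Rightarrow> real" where
  "growth_ext p r = (if 0 < r \<and> r < xi_c p then growth p (real_of_ereal r) else 0)"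

text \<open>\<open>\<Lambda>\<close>: the maximum over \<open>[0, |\<xi>|\<^sub>c]\<close> is attained, so it is the supremum.\<close>

definition growth_max :: "rt_params \<Rightarrow> real" where
  "growth_max p = (SUP r\<in>{0..xi_c p}. growth_ext p r)"

definition growth_sup_per :: "rt_params \<Rightarrow> real \<Rightarrow> real" where
  "growth_sup_per p L =
     Sup {growth p (norm \<xi>) | \<xi> :: real \<times> real.
       (\<exists>a b :: int. \<xi> = (of_int a / L, of_int b / L)) \<and> 0 < norm \<xi> \<and> ereal (norm \<xi>) < xi_c p}"

section \<open>Domain and differential operators\<close>

fun closed_slab :: "rt_params \<Rightarrow> side \<Rightarrow> (real^3) set" where
  "closed_slab p Lower = {x. - depth p \<le> x $ 3 \<and> x $ 3 \<le> 0}"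
| "closed_slab p Upper = {x. 0 \<le> x $ 3 \<and> x $ 3 \<le> height p}"

fun open_slab :: "rt_params \<Rightarrow> side \<Rightarrow> (real^3) set" where
  "open_slab p Lower = {x. - depth p < x $ 3 \<and> x $ 3 < 0}"
| "open_slab p Upper = {x. 0 < x $ 3 \<and> x $ 3 < height p}"

text \<open>Partial derivatives relative to a set; with a closed slab they are one-sided in the
  third direction at its boundary, and give the traces of the derivatives there.\<close>

definition pd_dom :: "(real^3) set \<Rightarrow> 3 \<Rightarrow> real^3 \<Rightarrow> real set" where
  "pd_dom S i x = {r. x + r *\<^sub>R axis i 1 \<in> S}"

definition pd :: "(real^3) set \<Rightarrow> 3 \<Rightarrow> (real^3 \<Rightarrow> 'a::real_normed_vector) \<Rightarrow> real^3 \<Rightarrow> 'a" where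
  "pd S i f x = vector_derivative (\<lambda>r. f (x + r *\<^sub>R axis i 1)) (at 0 within pd_dom S i x)"

text \<open>Time derivative, one-sided at \<open>t = 0\<close>.\<close>

definition dt :: "(real \<Rightarrow> real^3 \<Rightarrow> 'a::real_normed_vector) \<Rightarrow> real \<Rightarrow> real^3 \<Rightarrow> 'a" where
  "dt F t x = vector_derivative (\<lambda>\<tau>. F \<tau> x) (at t within {0..})"

definition grad :: "(real^3) set \<Rightarrow> (real^3 \<Rightarrow> real) \<Rightarrow> real^3 \<Rightarrow> real^3" where
  "grad S f x = (\<chi> i. pd S i f x)"

definition Dmat :: "(real^3) set \<Rightarrow> (real^3 \<Rightarrow> real^3) \<Rightarrow> real^3 \<Rightarrow> real^3^3" where
  "Dmat S u x = (\<chi> i j. pd S j (\<lambda>y. u y $ i) x)"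

definition divg :: "(real^3) set \<Rightarrow> (real^3 \<Rightarrow> real^3) \<Rightarrow> real^3 \<Rightarrow> real" where
  "divg S u x = (\<Sum>i\<in>UNIV. pd S i (\<lambda>y. u y $ i) x)"

text \<open>Divergence of a matrix field, row by row.\<close>

definition divmat :: "(real^3) set \<Rightarrow> (real^3 \<Rightarrow> real^3^3) \<Rightarrow> real^3 \<Rightarrow> real^3" where
  "divmat S A x = (\<chi> i. \<Sum>j\<in>UNIV. pd S j (\<lambda>y. A y $ i $ j) x)"

definition e3 :: "real^3" where "e3 = axis 3 1"

definition hlap :: "(real^3) set \<Rightarrow> (real^3 \<Rightarrow> real) \<Rightarrow> real^3 \<Rightarrow> real" where
  "hlap S f x = pd S 1 (pd S 1 f) x + pd S 2 (pd S 2 f) x"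

definition dev_sym :: "(real^3) set \<Rightarrow> (real^3 \<Rightarrow> real^3) \<Rightarrow> real^3 \<Rightarrow> real^3^3" where
  "dev_sym S u x = Dmat S u x + transpose (Dmat S u x) - (2 / 3 * divg S u x) *\<^sub>R mat 1"

definition visc_stress :: "rt_params \<Rightarrow> side \<Rightarrow> (real^3 \<Rightarrow> real^3) \<Rightarrow> real^3 \<Rightarrow> real^3^3" where
  "visc_stress p s u x =
     eps0 p s (x $ 3) *\<^sub>R dev_sym (closed_slab p s) u x
     + (del0 p s (x $ 3) * divg (closed_slab p s) u x) *\<^sub>R mat 1"

text \<open>The matrix inside the jump bracket of the stress condition.\<close>

definition jump_stress ::
  "rt_params \<Rightarrow> side \<Rightarrow> (real^3 \<Rightarrow> real) \<Rightarrow> (real^3 \<Rightarrow> real^3) \<Rightarrow> real^3 \<Rightarrow> real^3^3" where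
  "jump_stress p s q v x =
     (let S = closed_slab p s in
      (dpres p s (x $ 3) * q x) *\<^sub>R mat 1
      - eps0 p s (x $ 3) *\<^sub>R (Dmat S v x + transpose (Dmat S v x))
      - ((del0 p s (x $ 3) - 2 * eps0 p s (x $ 3) / 3) * divg S v x) *\<^sub>R mat 1)"

section \<open>The linearized problem\<close>

text \<open>\<open>Creg S k F\<close>: \<open>F\<close> has partial derivatives in \<open>x\<close> up to order \<open>k\<close> on \<open>S\<close>, jointly
  continuous in time and space on \<open>[0,\<infinity>) \<times> S\<close>.\<close>

fun Creg :: "(real^3) set \<Rightarrow> nat \<Rightarrow> (real \<Rightarrow> real^3 \<Rightarrow> 'a::real_normed_vector) \<Rightarrow> bool" where
  "Creg S 0 F \<longleftrightarrow> continuous_on ({0..} \<times> S) (\<lambda>(t, x). F t x)"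
| "Creg S (Suc k) F \<longleftrightarrow>
     continuous_on ({0..} \<times> S) (\<lambda>(t, x). F t x) \<and>
     (\<forall>i. (\<forall>t\<ge>0. \<forall>x\<in>S. (\<lambda>r. F t (x + r *\<^sub>R axis i 1)) differentiable (at 0 within pd_dom S i x)) \<and>
          Creg S k (\<lambda>t. pd S i (F t)))"

definition time_diff :: "(real^3) set \<Rightarrow> (real \<Rightarrow> real^3 \<Rightarrow> 'a::real_normed_vector) \<Rightarrow> bool" where
  "time_diff S F \<longleftrightarrow> (\<forall>t\<ge>0. \<forall>x\<in>S. (\<lambda>\<tau>. F \<tau> x) differentiable (at t within {0..}))"

text \<open>Fields are given on the two closed slabs separately; their values on the common face
  \<open>x\<^sub>3 = 0\<close> are the two traces entering the jumps. The regularity required is that all terms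
  of the equations, and of the equations differentiated once in time, are continuous on
  each side up to the boundary and up to \<open>t = 0\<close>.\<close>

definition regular_fields ::
  "rt_params \<Rightarrow> (side \<Rightarrow> real \<Rightarrow> real^3 \<Rightarrow> real^3) \<Rightarrow> (side \<Rightarrow> real \<Rightarrow> real^3 \<Rightarrow> real^3)
     \<Rightarrow> (side \<Rightarrow> real \<Rightarrow> real^3 \<Rightarrow> real) \<Rightarrow> bool" where
  "regular_fields p \<eta> v q \<longleftrightarrow>
     (\<forall>s. let S = closed_slab p s in
        time_diff S (\<eta> s) \<and> Creg S 2 (\<eta> s) \<and> Creg S 2 (dt (\<eta> s)) \<and>
        time_diff S (v s) \<and> Creg S 2 (v s) \<and> Creg S 2 (dt (v s)) \<and>
        time_diff S (dt (v s)) \<and> Creg S 0 (dt (dt (v s))) \<and>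
        time_diff S (q s) \<and> Creg S 1 (q s) \<and> Creg S 1 (dt (q s)))"

definition lin_solution ::
  "rt_params \<Rightarrow> (side \<Rightarrow> real \<Rightarrow> real^3 \<Rightarrow> real^3) \<Rightarrow> (side \<Rightarrow> real \<Rightarrow> real^3 \<Rightarrow> real^3)
     \<Rightarrow> (side \<Rightarrow> real \<Rightarrow> real^3 \<Rightarrow> real) \<Rightarrow> bool" where
  "lin_solution p \<eta> v q \<longleftrightarrow>
     regular_fields p \<eta> v q \<and>
     (\<forall>t>0. \<forall>s. \<forall>x\<in>open_slab p s. let S = closed_slab p s; \<rho> = rho p s (x $ 3) in
        dt (\<eta> s) t x = v s t x \<and>
        dt (q s) t x + \<rho> * divg S (v s t) x = 0 \<and>
        \<rho> *\<^sub>R dt (v s) t x + grad S (\<lambda>y. dpres p s (y $ 3) * q s t y) x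
          + (grav p * q s t x) *\<^sub>R e3 + (grav p * \<rho>) *\<^sub>R grad S (\<lambda>y. \<eta> s t y $ 3) x
        = divmat S (visc_stress p s (v s t)) x) \<and>
     (\<forall>t>0. \<forall>x. x $ 3 = 0 \<longrightarrow>
        v Upper t x - v Lower t x = 0 \<and>
        \<eta> Upper t x - \<eta> Lower t x = 0 \<and>
        (jump_stress p Upper (q Upper t) (v Upper t) x
           - jump_stress p Lower (q Lower t) (v Lower t) x) *v e3
        = (surf p * hlap (closed_slab p Upper) (\<lambda>y. \<eta> Upper t y $ 3) x) *\<^sub>R e3) \<and>
     (\<forall>t>0. \<forall>x. (x $ 3 = - depth p \<longrightarrow> v Lower t x = 0) \<and> (x $ 3 = height p \<longrightarrow> v Upper t x = 0))"

text \<open>Functions on the slab over the torus \<open>(2\<pi>L\<T>)\<^sup>2\<close> are periodic functions on the slab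
  over \<open>\<real>\<^sup>2\<close>; integrals are taken over a period cell.\<close>

definition periodic_field :: "rt_params \<Rightarrow> real \<Rightarrow> (side \<Rightarrow> real \<Rightarrow> real^3 \<Rightarrow> 'a) \<Rightarrow> bool" where
  "periodic_field p L F \<longleftrightarrow>
     (\<forall>s. \<forall>t\<ge>0. \<forall>x\<in>closed_slab p s. \<forall>i\<in>{1, 2}. F s t (x + (2 * pi * L) *\<^sub>R axis i 1) = F s t x)"

definition cell :: "real \<Rightarrow> (real \<times> real) set" where
  "cell L = {0..2 * pi * L} \<times> {0..2 * pi * L}"

section \<open>Norms\<close>

text \<open>\<open>D\<close> is the horizontal cross section, \<open>UNIV\<close> or a period cell. The matrix norm
  on \<open>real^3^3\<close> is the Frobenius norm.\<close>

definition slab_over :: "rt_params \<Rightarrow> (real \<times> real) set \<Rightarrow> side \<Rightarrow> (real^3) set" where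
  "slab_over p D s = {x \<in> open_slab p s. (x $ 1, x $ 2) \<in> D}"

definition norm1_sq :: "rt_params \<Rightarrow> (real \<times> real) set \<Rightarrow> (side \<Rightarrow> real^3 \<Rightarrow> real^3) \<Rightarrow> real" where
  "norm1_sq p D u =
     (\<Sum>s\<in>{Lower, Upper}. LBINT x:slab_over p D s. rho p s (x $ 3) * (norm (u s x))\<^sup>2)"

definition norm2_sq :: "rt_params \<Rightarrow> (real \<times> real) set \<Rightarrow> (side \<Rightarrow> real^3 \<Rightarrow> real^3) \<Rightarrow> real" where
  "norm2_sq p D u =
     (\<Sum>s\<in>{Lower, Upper}. LBINT x:slab_over p D s.
        eps0 p s (x $ 3) / 2 * (norm (dev_sym (closed_slab p s) (u s) x))\<^sup>2
        + del0 p s (x $ 3) * \<bar>divg (closed_slab p s) (u s) x\<bar>\<^sup>2)"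

text \<open>Squared horizontal gradient of the third component on the interface, where the two
  sides agree.\<close>

definition hgrad3_sq :: "rt_params \<Rightarrow> (side \<Rightarrow> real^3 \<Rightarrow> real^3) \<Rightarrow> real \<times> real \<Rightarrow> real" where
  "hgrad3_sq p u y =
     (let S = closed_slab p Upper; x = vector [fst y, snd y, 0] :: real^3
      in (pd S 1 (\<lambda>z. u Upper z $ 3) x)\<^sup>2 + (pd S 2 (\<lambda>z. u Upper z $ 3) x)\<^sup>2)"

definition interface_int :: "rt_params \<Rightarrow> (real \<times> real) set \<Rightarrow> (side \<Rightarrow> real^3 \<Rightarrow> real^3) \<Rightarrow> real" where
  "interface_int p D u = (LBINT y:D. hgrad3_sq p u y)"

text \<open>Decay in the non-periodic case: \<open>v\<close>, \<open>\<partial>\<^sub>t v\<close> and their first spatial derivatives are square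
  integrable, locally uniformly in time, and so is the interface gradient if \<open>\<sigma> > 0\<close>.\<close>

definition decaying :: "rt_params \<Rightarrow> (side \<Rightarrow> real \<Rightarrow> real^3 \<Rightarrow> real^3) \<Rightarrow> bool" where
  "decaying p v \<longleftrightarrow>
     (\<forall>T\<ge>0. \<exists>M. \<forall>t\<in>{0..T}.
        (\<forall>s. let S = closed_slab p s;
                 f = (\<lambda>x. (norm (v s t x))\<^sup>2 + (norm (Dmat S (v s t) x))\<^sup>2
                        + (norm (dt (v s) t x))\<^sup>2 + (norm (Dmat S (dt (v s) t) x))\<^sup>2)
             in set_integrable lborel (open_slab p s) f \<and> (LBINT x:open_slab p s. f x) \<le> M) \<and>
        (surf p > 0 \<longrightarrow>
           integrable lborel (hgrad3_sq p (\<lambda>s. v s t)) \<and>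
           (LBINT y. hgrad3_sq p (\<lambda>s. v s t) y) \<le> M))"

section \<open>The estimate\<close>

definition growth_estimate ::
  "rt_params \<Rightarrow> (real \<times> real) set \<Rightarrow> real \<Rightarrow> real \<Rightarrow> (side \<Rightarrow> real \<Rightarrow> real^3 \<Rightarrow> real^3) \<Rightarrow> bool" where
  "growth_estimate p D K lam v \<longleftrightarrow>
     (\<forall>t\<ge>0.
        norm1_sq p D (\<lambda>s. v s t) + norm2_sq p D (\<lambda>s. v s t) + norm1_sq p D (\<lambda>s. dt (v s) t)
        \<le> K * exp (2 * lam * t) *
            (norm1_sq p D (\<lambda>s. dt (v s) 0) + norm1_sq p D (\<lambda>s. v s 0) + norm2_sq p D (\<lambda>s. v s 0)
             + surf p * interface_int p D (\<lambda>s. v s 0)))"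

end

theory Submission
  imports Defs
begin

text \<open>
  The estimate is an energy argument whose sharp rate comes from a static inequality that is
  proved frequency by frequency.

  Differentiating the momentum equation in time eliminates \<open>\<eta>\<close> and \<open>q\<close>: for \<open>v\<close> alone, \<open>\<rho> v\<^sub>t\<^sub>t\<close> plus the
  derivative of a potential energy is the viscous force of \<open>v\<^sub>t\<close>, in the weak sense of
  \<open>weak_form_dt\<close>. The test field \<open>v\<^sub>t\<close> gives \<open>(S/2 + V)' = - G\<close> with \<open>S = \<parallel>v\<^sub>t\<parallel>\<^sub>1\<^sup>2\<close>, \<open>G = \<parallel>v\<^sub>t\<parallel>\<^sub>2\<^sup>2\<close> and
  \<open>V = \<integral> P' \<rho> (div v)\<^sup>2 / 2 - g \<rho> v\<^sub>3 (\<partial>\<^sub>1 v\<^sub>1 + \<partial>\<^sub>2 v\<^sub>2) + \<sigma> / 2 \<integral> |\<nabla>' v\<^sub>3|\<^sup>2\<close>. The form \<open>V\<close> is indefinite; this is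
  the instability. Its size is limited by \<open>V \<ge> - \<Lambda>\<^sup>2 N / 2 - \<Lambda> D / 2\<close> with \<open>N = \<parallel>v\<parallel>\<^sub>1\<^sup>2\<close> and \<open>D = \<parallel>v\<parallel>\<^sub>2\<^sup>2\<close>
  (\<open>potential_lower\<close>), and \<open>N' \<le> \<Lambda> N + S / \<Lambda>\<close>, \<open>D' \<le> \<Lambda> D + G / \<Lambda>\<close> by the Cauchy-Schwarz inequality. The
  three facts together bound \<open>N + D + S\<close> with the rate \<open>2 \<Lambda>\<close> (\<open>energy_gronwall\<close>).

  The lower bound of \<open>V\<close> is where the growth rates enter. All coefficients depend on \<open>x\<^sub>3\<close> only, so
  the form \<open>2 V + \<Lambda> D + \<Lambda>\<^sup>2 N\<close> decouples over the horizontal frequencies \<open>\<xi>\<close>. On one frequency, after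
  rotating the horizontal components into the direction of \<open>\<xi>\<close> (\<open>qform_mode\<close>), its values are values of
  \<open>2 (E + \<Lambda>\<^sup>2 J)\<close> with \<open>s = \<Lambda>\<close>, up to nonnegative terms, and these are nonnegative because \<open>\<mu>(|\<xi>|, \<cdot>)\<close> is increasing and
  \<open>\<lambda>(|\<xi>|) \<le> \<Lambda>\<close>; above the critical frequency a completed square replaces the growth rate
  (\<open>mode_energy_nonneg\<close>). The passage from modes to fields (\<open>quadratic_nonneg_from_modes\<close>) uses
  kernels instead of series: with a kernel that is a nonnegative combination of cosines inserted between
  two copies of the field, the form is a nonnegative combination of its values on modes, and a
  sequence of such kernels approximates the identity.

  The initial value of \<open>V\<close> is bounded by \<open>N\<close>, \<open>D\<close> and the interface term by the same
  device. Here the viscous form of one mode controls \<open>|\<xi>| \<phi>\<close> pointwise (\<open>viscous_mode_nonneg\<close>).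

  Everything is done on a horizontal square with a cutoff \<open>\<theta>\<close> (locale \<open>cut_sol\<close>), whose gradient
  \<open>\<kappa>\<close> multiplies all error terms (\<open>box_estimate\<close>). For periodic solutions the square is a period cell,
  \<open>\<theta> = 1\<close> and \<open>\<kappa> = 0\<close>. For decaying solutions the square has side \<open>2 R\<close>, \<open>\<kappa>\<close> is of order \<open>1 / R\<close>, and
  \<open>R\<close> tends to infinity.
\<close>


section \<open>Integration over boxes of \<open>\<real>\<^sup>3\<close>\<close>

definition pt3 :: "real \<times> real \<times> real => real^3" where
 "pt3 X = vector [fst X, fst (snd X), snd (snd X)]"

definition co3 :: "real^3 => real \<times> real \<times> real" where
 "co3 x = (x $ 1, x $ 2, x $ 3)"

lemma pt3_nth [simp]: "pt3 (x, y, z) $ 1 = x" "pt3 (x, y, z) $ 2 = y" "pt3 (x, y, z) $ 3 = z"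
 by (simp_all add: pt3_def)

lemma pt3_co3 [simp]: "pt3 (co3 x) = x"
 by (simp add: pt3_def co3_def vec_eq_iff forall_3)

lemma co3_pt3 [simp]: "co3 (pt3 X) = X"
 by (simp add: pt3_def co3_def)

lemma continuous_on_pt3 [continuous_intros]: 
 assumes "continuous_on S f" shows "continuous_on S (%x. pt3 (f x))"
proof -
 have 1: "pt3 X = (fst X) *\<^sub>R axis 1 1 + (fst (snd X)) *\<^sub>R axis 2 1 + (snd (snd X)) *\<^sub>R axis 3 1" for X
  by (auto simp: pt3_def vec_eq_iff forall_3 axis_def)
 show ?thesis unfolding 1 using assms by (intro continuous_intros)
qed


lemma co3_mem_cbox: "co3 x \<in> cbox (co3 a) (co3 b) \<longleftrightarrow> x \<in> cbox a b"
 by (auto simp add: mem_box_cart forall_3 co3_def cbox_Pair_eq)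

lemma co3_image_cbox: "co3 ` cbox a b = cbox (co3 a) (co3 b)"
proof (intro equalityI subsetI)
 fix X assume "X \<in> cbox (co3 a) (co3 b)"
 then have "pt3 X \<in> cbox a b" using co3_mem_cbox[of "pt3 X" a b] by simp
 then show "X \<in> co3 ` cbox a b" by (metis co3_pt3 imageI)
next
 fix X assume "X \<in> co3 ` cbox a b"
 then show "X \<in> cbox (co3 a) (co3 b)" using co3_mem_cbox by blast
qed

lemma pt3_image_cbox: "pt3 ` cbox a b = cbox (pt3 a) (pt3 b)"
proof -
 have "pt3 ` (co3 ` cbox (pt3 a) (pt3 b)) = cbox (pt3 a) (pt3 b)" by (simp add: image_image)
 then show ?thesis by (simp add: co3_image_cbox)
qed

lemma prod_UNIV_3: "prod f (UNIV :: 3 set) = f 1 * f 2 * (f 3 :: 'a::comm_monoid_mult)"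
 unfolding UNIV_3 by (simp add: ac_simps)

lemma content_pt3: "measure lborel (cbox (pt3 a) (pt3 b)) = measure lborel (cbox a b)"
proof -
 obtain a1 a2 a3 b1 b2 b3 where 1: "a = (a1, a2, a3)" "b = (b1, b2, b3)" by (metis surj_pair)
 show ?thesis
 proof (cases "cbox (pt3 a) (pt3 b) = {}")
  case True
  then have "cbox a b = {}" using pt3_image_cbox[of a b] by auto
  then show ?thesis using True by (simp only: content_empty)
 next
  case False
  then have "a1 <= b1" "a2 <= b2" "a3 <= b3" 
   using 1 by (auto simp: interval_ne_empty_cart forall_3)
  then have "measure lborel (cbox a b) = (b1 - a1) * (b2 - a2) * (b3 - a3)"
   by (simp add: 1 content_Pair)
  moreover have "measure lborel (cbox (pt3 a) (pt3 b)) = (b1 - a1) * (b2 - a2) * (b3 - a3)"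
   unfolding content_cbox_cart[OF False] by (simp only: prod_UNIV_3 1 pt3_nth)
  ultimately show ?thesis by simp
 qed
qed

lemma integral_pt3:
 fixes f :: "real^3 => 'b::banach"
 assumes "continuous_on (cbox (pt3 a) (pt3 b)) f"
 shows "integral (cbox (pt3 a) (pt3 b)) f = integral (cbox a b) (%X. f (pt3 X))"
proof -
 have i: "(f has_integral integral (cbox (pt3 a) (pt3 b)) f) (cbox (pt3 a) (pt3 b))"
  using assms by (simp add: integrable_continuous integrable_integral)
 have 1: "\<exists>w z. pt3 ` cbox u v = cbox w z" for u v by (metis pt3_image_cbox)
 have 2: "\<exists>w z. co3 ` cbox u v = cbox w z" for u v by (metis co3_image_cbox)
 have 3: "isCont pt3 X" for X 
  using continuous_on_pt3[OF continuous_on_id, of UNIV] continuous_on_eq_continuous_at[OF open_UNIV] by blast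
 have 4: "measure lborel (pt3 ` cbox u v) = 1 * measure lborel (cbox u v)" for u v
  by (simp add: pt3_image_cbox content_pt3)
 have "((%x. f (pt3 x)) has_integral (1 / 1) *\<^sub>R integral (cbox (pt3 a) (pt3 b)) f) (co3 ` cbox (pt3 a) (pt3 b))"
  by (rule has_integral_twiddle[OF _ co3_pt3 pt3_co3 3 1 2 4 i]) simp
 then show ?thesis by (simp add: co3_image_cbox integral_unique)
qed

lemma integral_box3_iterated:
 fixes f :: "real^3 => 'b::banach"
 assumes "continuous_on (cbox (pt3 (a1,a2,a3)) (pt3 (b1,b2,b3))) f"
 shows "integral (cbox (pt3 (a1,a2,a3)) (pt3 (b1,b2,b3))) f =
  integral {a1..b1} (%x. integral {a2..b2} (%y. integral {a3..b3} (%z. f (pt3 (x,y,z)))))"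
proof -
 have c: "continuous_on (cbox (a1,a2,a3) (b1,b2,b3)) (%X. f (pt3 X))"
  by (rule continuous_on_compose2[OF assms]) (auto intro!: continuous_intros simp: pt3_image_cbox[symmetric])
 have "integral (cbox (pt3 (a1,a2,a3)) (pt3 (b1,b2,b3))) f = integral (cbox (a1,a2,a3) (b1,b2,b3)) (%X. f (pt3 X))"
  by (rule integral_pt3[OF assms])
 also have "\<dots> = integral (cbox a1 b1) (%x. integral (cbox (a2,a3) (b2,b3)) (%Y. f (pt3 (x,Y))))"
  by (rule integral_prod_continuous[OF c])
 also have "\<dots> = integral {a1..b1} (%x. integral {a2..b2} (%y. integral {a3..b3} (%z. f (pt3 (x,y,z)))))"
 proof (unfold cbox_interval[symmetric], intro integral_cong)
  fix x assume "x \<in> cbox a1 b1"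
  have "continuous_on (cbox (a2,a3) (b2,b3)) (%Y. f (pt3 (x,Y)))"
   by (rule continuous_on_compose2[OF c]) (use \<open>x \<in> cbox a1 b1\<close> in \<open>auto intro!: continuous_intros simp: cbox_Pair_eq\<close>)
  from integral_prod_continuous[OF this]
  show "integral (cbox (a2,a3) (b2,b3)) (%Y. f (pt3 (x,Y))) = integral (cbox a2 b2) (%y. integral (cbox a3 b3) (%z. f (pt3 (x,y,z))))" .
 qed
 finally show ?thesis .
qed

text \<open>The slab coordinates can be integrated in any order; the vertical one is used outermost
  when passing to Fourier modes.\<close>

lemma integral_box3_vertical:
 fixes f :: "real^3 => 'b::banach"
 assumes c: "continuous_on (cbox (pt3 (a1,a2,a3)) (pt3 (b1,b2,b3))) f"
 shows "integral (cbox (pt3 (a1,a2,a3)) (pt3 (b1,b2,b3))) f =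
  integral {a3..b3} (%z. integral (cbox (a1,a2) (b1,b2)) (%(x,y). f (pt3 (x,y,z))))"
  and "integral (cbox (pt3 (a1,a2,a3)) (pt3 (b1,b2,b3))) f =
  integral (cbox (a1,a2) (b1,b2)) (%(x,y). integral {a3..b3} (%z. f (pt3 (x,y,z))))"
proof -
 have c2: "continuous_on (cbox ((a1,a2),a3) ((b1,b2),b3)) (%(X,z). f (pt3 (fst X, snd X, z)))"
  unfolding case_prod_beta
  by (rule continuous_on_compose2[OF c]) (auto intro!: continuous_intros simp: pt3_image_cbox[symmetric] cbox_Pair_eq)
 have c3: "continuous_on (cbox (a1,a2) (b1,b2)) (%(x,y). integral {a3..b3} (%z. f (pt3 (x,y,z))))"
  using integral_continuous_on_param[of "cbox (a1,a2) (b1,b2)" a3 b3 "%X z. f (pt3 (fst X, snd X, z))"] c2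
  by (simp add: cbox_Pair_eq case_prod_beta)
 have "integral (cbox (a1,a2) (b1,b2)) (%(x,y). integral {a3..b3} (%z. f (pt3 (x,y,z))))
  = integral {a1..b1} (%x. integral {a2..b2} (%y. integral {a3..b3} (%z. f (pt3 (x,y,z)))))"
  using integral_prod_continuous[OF c3] by simp
 then show 2: "integral (cbox (pt3 (a1,a2,a3)) (pt3 (b1,b2,b3))) f =
  integral (cbox (a1,a2) (b1,b2)) (%(x,y). integral {a3..b3} (%z. f (pt3 (x,y,z))))"
  using integral_box3_iterated[OF c] by simp
 show "integral (cbox (pt3 (a1,a2,a3)) (pt3 (b1,b2,b3))) f =
  integral {a3..b3} (%z. integral (cbox (a1,a2) (b1,b2)) (%(x,y). f (pt3 (x,y,z))))"
  unfolding 2 case_prod_beta using integral_swap_continuous[OF c2] by (simp add: case_prod_unfold)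
qed

section \<open>Partial derivatives and integration by parts\<close>

text \<open>A relational form of the one-sided partial derivatives.\<close>

definition has_pd :: "(real^3) set => 3 => (real^3 => 'a::real_normed_vector) => (real^3 => 'a) => bool" where
 "has_pd S i f f' \<longleftrightarrow>
  (\<forall>x\<in>S. ((%r. f (x + r *\<^sub>R axis i 1)) has_vector_derivative f' x) (at 0 within pd_dom S i x))"

lemma has_pd_subset:
 assumes "has_pd S i f f'" "T \<subseteq> S" shows "has_pd T i f f'"
 unfolding has_pd_def
proof
 fix x assume "x \<in> T"
 then have "x \<in> S" using assms(2) by blast
 have "pd_dom T i x \<subseteq> pd_dom S i x" using assms(2) by (auto simp: pd_dom_def)
 from has_vector_derivative_within_subset[OF bspec[OF assms(1)[unfolded has_pd_def] \<open>x \<in> S\<close>] this]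
 show "((%r. f (x + r *\<^sub>R axis i 1)) has_vector_derivative f' x) (at 0 within pd_dom T i x)" .
qed

lemma pt3_axis: 
 "pt3 (x,y,z) + r *\<^sub>R axis 1 1 = pt3 (x + r,y,z)"
 "pt3 (x,y,z) + r *\<^sub>R axis 2 1 = pt3 (x,y + r,z)"
 "pt3 (x,y,z) + r *\<^sub>R axis 3 1 = pt3 (x,y,z + r)"
 by (simp_all add: vec_eq_iff forall_3 axis_def)

text \<open>Partial derivatives are taken at increment zero within a shifted set; this turns them into ordinary
  one-sided derivatives at the point.\<close>

lemma shift_vector_derivative:
 assumes "((%r. g (x + r)) has_vector_derivative d) (at (0::real) within {r. x + r \<in> A})"
 shows "(g has_vector_derivative d) (at x within A)"
proof -
 have "((%r. g (x + r)) \<circ> (%y. y - x) has_vector_derivative (1 *\<^sub>R d)) (at x within A)"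
 proof (rule vector_diff_chain_within)
  show "((%y. y - x) has_vector_derivative 1) (at x within A)" 
   by (auto intro!: derivative_eq_intros)
  have "(%y. y - x) ` A = {r. x + r \<in> A}" 
  proof (intro equalityI subsetI)
   fix r assume "r \<in> {r. x + r \<in> A}"
   then show "r \<in> (%y. y - x) ` A" by (intro image_eqI[of _ _ "x + r"]) auto
  qed auto
  then show "((%r. g (x + r)) has_vector_derivative d) (at (x - x) within (%y. y - x) ` A)" 
   using assms by simp
 qed
 then show ?thesis by (simp add: o_def)
qed

lemma has_pd_coord:
 assumes "has_pd S i f f'" "pt3 (x,y,z) \<in> S"
 shows "i = 1 ==> ((%r. f (pt3 (r,y,z))) has_vector_derivative f' (pt3 (x,y,z))) (at x within {r. pt3 (r,y,z) \<in> S})"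
  and "i = 2 ==> ((%r. f (pt3 (x,r,z))) has_vector_derivative f' (pt3 (x,y,z))) (at y within {r. pt3 (x,r,z) \<in> S})"
  and "i = 3 ==> ((%r. f (pt3 (x,y,r))) has_vector_derivative f' (pt3 (x,y,z))) (at z within {r. pt3 (x,y,r) \<in> S})"
proof -
 have d: "((%r. f (pt3 (x,y,z) + r *\<^sub>R axis i 1)) has_vector_derivative f' (pt3 (x,y,z)))
   (at 0 within {r. pt3 (x,y,z) + r *\<^sub>R axis i 1 \<in> S})"
  using bspec[OF assms(1)[unfolded has_pd_def pd_dom_def] assms(2)] .
 show "((%r. f (pt3 (r,y,z))) has_vector_derivative f' (pt3 (x,y,z))) (at x within {r. pt3 (r,y,z) \<in> S})" if i: "i = 1"
  by (rule shift_vector_derivative) (use d[unfolded i pt3_axis] in simp)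
 show "((%r. f (pt3 (x,r,z))) has_vector_derivative f' (pt3 (x,y,z))) (at y within {r. pt3 (x,r,z) \<in> S})" if i: "i = 2"
  by (rule shift_vector_derivative) (use d[unfolded i pt3_axis] in simp)
 show "((%r. f (pt3 (x,y,r))) has_vector_derivative f' (pt3 (x,y,z))) (at z within {r. pt3 (x,y,r) \<in> S})" if i: "i = 3"
  by (rule shift_vector_derivative) (use d[unfolded i pt3_axis] in simp)
qed

definition hbox :: "real => real => (real \<times> real) set" where
 "hbox a b = cbox (a,a) (b,b)"

definition box3 :: "real => real => real => real => (real^3) set" where
 "box3 a b c d = cbox (pt3 (a,a,c)) (pt3 (b,b,d))"

lemma mem_hbox: "(x,y) \<in> hbox a b \<longleftrightarrow> x \<in> {a..b} \<and> y \<in> {a..b}"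
 by (auto simp: hbox_def cbox_Pair_eq)

lemma mem_box3: "x \<in> box3 a b c d \<longleftrightarrow> x $ 1 \<in> {a..b} \<and> x $ 2 \<in> {a..b} \<and> x $ 3 \<in> {c..d}"
 by (auto simp: box3_def mem_box_cart forall_3)

lemma compact_box3: "compact (box3 a b c d)" by (simp add: box3_def)

text \<open>Equality of the traces on opposite lateral faces at one height. It makes horizontal integrations by
  parts free of boundary terms, both for periodic functions and for functions that vanish on the
  faces.\<close>

definition faces_match :: "real => real => real => (real^3 => 'a) => bool" where
 "faces_match a b z f \<longleftrightarrow> (\<forall>r\<in>{a..b}. f (pt3 (b,r,z)) = f (pt3 (a,r,z)) \<and> f (pt3 (r,b,z)) = f (pt3 (r,a,z)))"

lemma integral_hbox_pd_eq_0:
 fixes f f' :: "real^3 => 'a::banach"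
 assumes ab: "a <= b" and d: "has_pd S i f f'" and i: "i \<noteq> 3"
  and S: "\<And>x y. x \<in> {a..b} ==> y \<in> {a..b} ==> pt3 (x,y,z) \<in> S"
  and c: "continuous_on (hbox a b) (%(x,y). f' (pt3 (x,y,z)))"
  and m: "faces_match a b z f"
 shows "integral (hbox a b) (%(x,y). f' (pt3 (x,y,z))) = 0"
proof -
 consider "i = 1" | "i = 2" using i exhaust_3[of i] by blast
 then show ?thesis
 proof cases
  case 1
  have "integral {a..b} (%x. f' (pt3 (x,y,z))) = 0" if y: "y \<in> {a..b}" for y
  proof -
   have "((%x. f' (pt3 (x,y,z))) has_integral f (pt3 (b,y,z)) - f (pt3 (a,y,z))) {a..b}"
   proof (rule fundamental_theorem_of_calculus[OF ab])
    fix x assume x: "x \<in> {a..b}"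
    show "((%x. f (pt3 (x,y,z))) has_vector_derivative f' (pt3 (x,y,z))) (at x within {a..b})"
     by (rule has_vector_derivative_within_subset[OF has_pd_coord(1)[OF d S[OF x y] 1]]) (use S y in blast)
   qed
   then show ?thesis using m y by (simp add: faces_match_def integral_unique)
  qed
  note * = this
  have "integral (hbox a b) (%(x,y). f' (pt3 (x,y,z))) = integral (cbox a b) (%y. integral (cbox a b) (%x. f' (pt3 (x,y,z))))"
   using integral_prod_continuous[OF c[unfolded hbox_def]] integral_swap_continuous[OF c[unfolded hbox_def]]
   by (simp add: hbox_def)
  also have "\<dots> = integral (cbox a b) (%y. 0)"
   by (rule integral_cong) (use * in simp)
  finally show ?thesis by simp
 next
  case 2
  have *: "integral {a..b} (%y. f' (pt3 (x,y,z))) = 0" if x: "x \<in> {a..b}" for x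
  proof -
   have "((%y. f' (pt3 (x,y,z))) has_integral f (pt3 (x,b,z)) - f (pt3 (x,a,z))) {a..b}"
   proof (rule fundamental_theorem_of_calculus[OF ab])
    fix y assume y: "y \<in> {a..b}"
    show "((%y. f (pt3 (x,y,z))) has_vector_derivative f' (pt3 (x,y,z))) (at y within {a..b})"
     by (rule has_vector_derivative_within_subset[OF has_pd_coord(2)[OF d S[OF x y] 2]]) (use S x in blast)
   qed
   then show ?thesis using m x by (simp add: faces_match_def integral_unique)
  qed
  have "integral (hbox a b) (%(x,y). f' (pt3 (x,y,z))) = integral (cbox a b) (%x. integral (cbox a b) (%y. f' (pt3 (x,y,z))))"
   using integral_prod_continuous[OF c[unfolded hbox_def]] by (simp add: hbox_def)
  also have "\<dots> = integral (cbox a b) (%y. 0)"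
   by (rule integral_cong) (use * in simp)
  finally show ?thesis by simp
 qed
qed

lemma continuous_on_box3_slice:
 assumes "continuous_on (box3 a b c d) f" "z \<in> {c..d}"
 shows "continuous_on (hbox a b) (%(x,y). f (pt3 (x,y,z)))"
 unfolding case_prod_beta
 by (rule continuous_on_compose2[OF assms(1)])
  (use assms(2) in \<open>auto intro!: continuous_intros simp: mem_box3 hbox_def cbox_Pair_eq\<close>)

lemma integral_box3_pd_horizontal:
 fixes f f' :: "real^3 => 'a::banach"
 assumes ab: "a <= b" and d: "has_pd (box3 a b c d) i f f'" and i: "i \<noteq> 3"
  and c: "continuous_on (box3 a b c d) f'"
  and m: "\<And>z. z \<in> {c..d} ==> faces_match a b z f"
 shows "integral (box3 a b c d) f' = 0"
proof -
 have "integral (box3 a b c d) f' = integral (cbox c d) (%z. integral (hbox a b) (%(x,y). f' (pt3 (x,y,z))))"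
  using integral_box3_vertical(1)[OF c[unfolded box3_def]] by (simp add: box3_def hbox_def)
 also have "\<dots> = integral (cbox c d) (%z. 0)"
 proof (rule integral_cong)
  fix z assume z: "z \<in> cbox c d"
  show "integral (hbox a b) (%(x,y). f' (pt3 (x,y,z))) = 0"
   by (rule integral_hbox_pd_eq_0[OF ab d i _ continuous_on_box3_slice[OF c] m]) (use z in \<open>auto simp: mem_box3\<close>)
 qed
 finally show ?thesis by simp
qed

lemma integral_box3_pd_vertical:
 fixes f f' :: "real^3 => 'a::banach"
 assumes cd: "c <= d" and d: "has_pd (box3 a b c d) 3 f f'"
  and c: "continuous_on (box3 a b c d) f'"
  and c0: "continuous_on (box3 a b c d) f"
 shows "integral (box3 a b c d) f' =
  integral (hbox a b) (%(x,y). f (pt3 (x,y,d))) - integral (hbox a b) (%(x,y). f (pt3 (x,y,c)))"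
proof -
 have i: "g integrable_on hbox a b" if "continuous_on (hbox a b) g" for g :: "real \<times> real => 'a"
  using that unfolding hbox_def by (rule integrable_continuous)
 have "integral (box3 a b c d) f' = integral (hbox a b) (%(x,y). integral {c..d} (%z. f' (pt3 (x,y,z))))"
  using integral_box3_vertical(2)[OF c[unfolded box3_def]] by (simp add: box3_def hbox_def)
 also have "\<dots> = integral (hbox a b) (%X. (%(x,y). f (pt3 (x,y,d))) X - (%(x,y). f (pt3 (x,y,c))) X)"
 proof (rule integral_cong)
  fix X assume X: "X \<in> hbox a b"
  obtain x y where xy: "X = (x,y)" by (cases X)
  have "((%z. f' (pt3 (x,y,z))) has_integral f (pt3 (x,y,d)) - f (pt3 (x,y,c))) {c..d}"
  proof (rule fundamental_theorem_of_calculus[OF cd])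
   fix z assume z: "z \<in> {c..d}"
   have p: "pt3 (x,y,r) \<in> box3 a b c d" if "r \<in> {c..d}" for r
    using X that by (simp add: mem_box3 xy mem_hbox)
   show "((%z. f (pt3 (x,y,z))) has_vector_derivative f' (pt3 (x,y,z))) (at z within {c..d})"
    by (rule has_vector_derivative_within_subset[OF has_pd_coord(3)[OF d p[OF z]]]) (use p in auto)
  qed
  then show "(%(x,y). integral {c..d} (%z. f' (pt3 (x,y,z)))) X = (%(x,y). f (pt3 (x,y,d))) X - (%(x,y). f (pt3 (x,y,c))) X"
   by (simp add: xy integral_unique)
 qed
 also have "\<dots> = integral (hbox a b) (%(x,y). f (pt3 (x,y,d))) - integral (hbox a b) (%(x,y). f (pt3 (x,y,c)))"
  by (intro integral_diff i continuous_on_box3_slice[OF c0]) (use cd in auto)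
 finally show ?thesis .
qed


section \<open>The steady state\<close>

fun zlo :: "rt_params => side => real" where
 "zlo p Lower = - depth p" | "zlo p Upper = 0"

fun zhi :: "rt_params => side => real" where
 "zhi p Lower = 0" | "zhi p Upper = height p"

abbreviation ivl :: "rt_params => side => real set" where "ivl p s \<equiv> {zlo p s..zhi p s}"

text \<open>The form in which the almost everywhere condition on \<open>1 / P'\<close> is used: its bound holds
  at points arbitrarily close to any given one.\<close>

lemma AE_lborel_ex_in_interval:
 fixes u v :: real
 assumes "AE x in lborel. P x" "u < v" shows "\<exists>x\<in>{u<..<v}. P x"
proof (rule ccontr)
 assume "\<not> ?thesis"
 then have "AE x in lborel. x \<notin> {u<..<v}" using assms(1) by (auto elim!: eventually_mono)
 then have "{u<..<v} \<in> null_sets lborel" by (subst AE_iff_null_sets) auto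
 then show False using assms(2) by (simp add: null_sets_def)
qed

locale rt =
 fixes p :: rt_params
 assumes adm: "rt_admissible p"
begin

lemma g_pos: "grav p > 0" and surf_nonneg: "surf p \<ge> 0" and depth_pos: "depth p > 0" and height_pos: "height p > 0"
 using adm by (auto simp: rt_admissible_def)

lemma zlo_less_zhi: "zlo p s < zhi p s"
 using depth_pos height_pos by (cases s) auto

lemma smooth: "smooth_pos (pres p s)" "smooth_pos (shear p s)" "smooth_pos (bulk p s)"
 using adm by (auto simp: rt_admissible_def)

lemma smooth_pos_deriv:
 assumes "smooth_pos f" "z > 0"
 shows "(f has_real_derivative deriv f z) (at z)" "(deriv f has_real_derivative deriv (deriv f) z) (at z)"
proof -
 have "(deriv ^^ 0) f field_differentiable (at z)" "(deriv ^^ 1) f field_differentiable (at z)"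
  using assms unfolding smooth_pos_def by blast+
 then show "(f has_real_derivative deriv f z) (at z)" "(deriv f has_real_derivative deriv (deriv f) z) (at z)"
  by (simp_all add: DERIV_deriv_iff_field_differentiable)
qed

lemma dP_continuous: "z > 0 ==> isCont (deriv (pres p s)) z"
 using smooth_pos_deriv(2)[OF smooth(1)] DERIV_isCont by blast

text \<open>A monotone smooth function has nonnegative derivative, and a zero of the derivative would make its
  reciprocal unbounded nearby.\<close>

lemma dP_pos:
 assumes z: "z > 0" shows "deriv (pres p s) z > 0"
proof -
 let ?f = "deriv (pres p s)"
 have sm: "strict_mono_on {0<..} (pres p s)" using adm by (auto simp: rt_admissible_def)
 have "?f z \<ge> 0"
 proof (rule ccontr)
  assume "\<not> ?thesis"
  then obtain d where d: "d > 0" "\<forall>h>0. h < d \<longrightarrow> pres p s (z + h) < pres p s z"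
   using DERIV_neg_dec_right[OF smooth_pos_deriv(1)[OF smooth(1) z]] by (auto simp: not_le)
  then have "pres p s (z + d/2) < pres p s z" by auto
  moreover have "pres p s z < pres p s (z + d/2)"
   using strict_mono_onD[OF sm, of z "z + d/2"] z d by auto
  ultimately show False by simp
 qed
 moreover have "?f z \<noteq> 0"
 proof
  assume 0: "?f z = 0"
  have rec: "recip_Linf_loc ?f" using adm by (auto simp: rt_admissible_def)
  have "0 < z/2 \<and> z/2 < 2*z" using z by simp
  then obtain M where M: "AE x in lborel. x \<in> {z/2..2*z} \<longrightarrow> ?f x \<noteq> 0 \<and> \<bar>1 / ?f x\<bar> <= M"
   using rec unfolding recip_Linf_loc_def by blast
  define e where "e = 1 / (\<bar>M\<bar> + 1)"
  have e: "e > 0" by (simp add: e_def add_nonneg_pos)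
  obtain d where d: "d > 0" "\<And>x. dist x z < d ==> dist (?f x) (?f z) < e"
   using dP_continuous[OF z, of s] e unfolding continuous_at_eps_delta by (auto simp: dist_real_def)
  have "z < z + min d z" using d z by simp
  from AE_lborel_ex_in_interval[OF M this] obtain x where x: "z < x" "x < z + min d z"
   "x \<in> {z/2..2*z} \<longrightarrow> ?f x \<noteq> 0 \<and> \<bar>1 / ?f x\<bar> <= M" by auto
  then have "?f x \<noteq> 0" "\<bar>1 / ?f x\<bar> <= M" using z by auto
  moreover have "\<bar>?f x\<bar> < e" using d(2)[of x] x 0 by (auto simp: dist_real_def)
  ultimately have "1 / \<bar>?f x\<bar> <= M" "1 / e < 1 / \<bar>?f x\<bar>" 
   using e by (auto simp: field_simps)
  then show False by (simp add: e_def)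
 qed
 ultimately show ?thesis by simp
qed

lemma enthalpy_deriv:
 assumes z: "z > 0"
 shows "(enthalpy p s has_real_derivative deriv (pres p s) z / z) (at z)"
proof -
 let ?a = "min 1 z / 2" and ?b = "max 1 z + 1"
 have c: "continuous_on {?a..?b} (%r. deriv (pres p s) r / r)"
 proof (rule continuous_at_imp_continuous_on, rule ballI)
  fix r assume "r \<in> {?a..?b}"
  then have "r > 0" using z by (auto simp: min_def split: if_splits)
  then show "isCont (%r. deriv (pres p s) r / r) r" using dP_continuous by (intro continuous_intros) auto
 qed
 have "((%u. LBINT r=ereal 1..ereal u. deriv (pres p s) r / r) has_vector_derivative deriv (pres p s) z / z) (at z within {?a..?b})"
  by (rule interval_integral_FTC2[OF _ _ c]) (use z in \<open>auto simp: min_def max_def\<close>)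
 moreover have "at z within {?a..?b} = at z"
  by (rule at_within_Icc_at) (use z in \<open>auto simp: min_def max_def\<close>)
 ultimately show ?thesis by (simp add: enthalpy_def[abs_def] has_real_derivative_iff_has_vector_derivative)
qed

lemma enthalpy_continuous: "continuous_on {0<..} (enthalpy p s)"
 by (intro continuous_at_imp_continuous_on ballI DERIV_isCont[OF enthalpy_deriv]) simp

lemma enthalpy_strict_mono: "0 < x ==> x < y ==> enthalpy p s x < enthalpy p s y"
proof -
 assume xy: "0 < x" "x < y"
 show ?thesis
 proof (rule DERIV_pos_imp_increasing[OF xy(2)])
  fix z assume "x <= z" "z <= y"
  then have "z > 0" using xy by simp
  then show "\<exists>d. (enthalpy p s has_real_derivative d) (at z) \<and> 0 < d"
   using enthalpy_deriv[of z s] dP_pos[of z s] by (intro exI[of _ "deriv (pres p s) z / z"]) auto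
 qed
qed

lemma enthalpy_inj: "inj_on (enthalpy p s) {0<..}"
proof (rule inj_onI)
 fix x y assume "x \<in> {0<..}" "y \<in> {0<..}" "enthalpy p s x = enthalpy p s y"
 then show "x = y" using enthalpy_strict_mono[of x y s] enthalpy_strict_mono[of y x s] by (cases x y rule: linorder_cases) auto
qed

lemma rhom_Z: "rhom p \<in> rt_Z p"
 using adm by (auto simp: rt_admissible_def)

lemma rho_bd_Upper: "rho_bd p Upper > 0" "pres p Upper (rho_bd p Upper) = pres p Lower (rhom p)"
proof -
 have "pres p Lower (rhom p) \<in> pres p Upper ` {0<..}" using rhom_Z by (auto simp: rt_Z_def)
 from inv_into_into[OF this] f_inv_into_f[OF this]
 show "rho_bd p Upper > 0" "pres p Upper (rho_bd p Upper) = pres p Lower (rhom p)" by auto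
qed

lemma rho_bd_pos: "rho_bd p s > 0"
 using rhom_Z rho_bd_Upper by (cases s) (auto simp: rt_Z_def)

lemma jump_rho_pos: "jump_rho p > 0"
proof -
 have sm: "strict_mono_on {0<..} (pres p Upper)" using adm by (auto simp: rt_admissible_def)
 have "pres p Upper (rhom p) < pres p Upper (rho_bd p Upper)" "rhom p > 0"
  using rhom_Z rho_bd_Upper by (auto simp: rt_Z_def)
 then have "rhom p < rho_bd p Upper"
  using strict_mono_on_leD[OF sm, of "rho_bd p Upper" "rhom p"] rho_bd_Upper by (auto simp: not_less[symmetric])
 then show ?thesis by (simp add: jump_rho_def)
qed

lemma enthalpy_range:
 assumes z: "z \<in> (ivl p s)"
 shows "enthalpy p s (rho_bd p s) - grav p * z \<in> enthalpy p s ` {0<..}"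
proof -
 have con: "connected (enthalpy p s ` {0<..})"
  by (rule connected_continuous_image[OF enthalpy_continuous]) (rule connected_Ioi)
 have bd: "enthalpy p s (rho_bd p s) \<in> enthalpy p s ` {0<..}" using rho_bd_pos by auto
 show ?thesis
 proof (cases s)
  case Lower
  have "enthalpy p s (rho_bd p s) + grav p * depth p \<in> enthalpy p s ` {0<..}" 
   using adm by (auto simp: rt_admissible_def Lower)
  from connected_contains_Icc[OF con bd this] show ?thesis
   using z g_pos mult_left_mono[of "- depth p" z "grav p"] by (auto simp: Lower mult_nonneg_nonpos)
 next
  case Upper
  have "enthalpy p s (rho_bd p s) - grav p * height p \<in> enthalpy p s ` {0<..}" 
   using adm by (auto simp: rt_admissible_def Upper simp del: rho_bd.simps)
  from connected_contains_Icc[OF con this bd] show ?thesis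
   using z g_pos mult_left_mono[of z "height p" "grav p"] by (auto simp: Upper simp del: rho_bd.simps)
 qed
qed

lemma rho_pos: "z \<in> (ivl p s) ==> rho p s z > 0"
 and enthalpy_rho: "z \<in> (ivl p s) ==> enthalpy p s (rho p s z) = enthalpy p s (rho_bd p s) - grav p * z"
 using inv_into_into[OF enthalpy_range] f_inv_into_f[OF enthalpy_range] by (auto simp: rho_def)

lemma rho_0: "rho p s 0 = rho_bd p s"
 using inv_into_f_f[OF enthalpy_inj, of "rho_bd p s" s] rho_bd_pos by (simp add: rho_def)

text \<open>The profile is the inverse enthalpy of an affine function, so that \<open>P'(\<rho>) \<rho>' = - g
  \<rho>\<close> by the inverse function rule.\<close>

lemma rho_deriv:
 assumes z: "z \<in> (ivl p s)"
 shows "(rho p s has_real_derivative - grav p * rho p s z / dpres p s z) (at z)"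
proof -
 let ?h = "enthalpy p s" and ?r = "rho p s z"
 have r: "?r > 0" by (rule rho_pos[OF z])
 have d: "deriv (pres p s) ?r / ?r \<noteq> 0" using dP_pos[OF r, of s] r by auto
 have "(inv_into {0<..} ?h has_real_derivative inverse (deriv (pres p s) ?r / ?r)) (at (?h ?r))"
  unfolding has_field_derivative_def
  by (rule has_derivative_inverse_strong[of "{0<..}" ?r _ _ "(*) (deriv (pres p s) ?r / ?r)"])
   (use r d enthalpy_continuous enthalpy_inj enthalpy_deriv[OF r] in \<open>auto simp: has_field_derivative_def o_def fun_eq_iff\<close>)
 then have "(inv_into {0<..} ?h has_real_derivative ?r / deriv (pres p s) ?r) (at (?h (rho_bd p s) - grav p * z))"
  by (simp add: enthalpy_rho[OF z])
 moreover have "((%z. ?h (rho_bd p s) - grav p * z) has_real_derivative - grav p) (at z)"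
  by (auto intro!: derivative_eq_intros)
 ultimately have "((%z. inv_into {0<..} ?h (?h (rho_bd p s) - grav p * z)) has_real_derivative ?r / deriv (pres p s) ?r * - grav p) (at z)"
  by (rule DERIV_chain2)
 then show ?thesis by (simp add: rho_def[abs_def] dpres_def mult.commute)
qed

lemma smooth_pos_rho_deriv:
 assumes f: "smooth_pos f" and z: "z \<in> (ivl p s)"
 shows "\<exists>d. ((%z. f (rho p s z)) has_real_derivative d) (at z)" "\<exists>d. ((%z. deriv f (rho p s z)) has_real_derivative d) (at z)"
 using DERIV_chain2[OF smooth_pos_deriv(1)[OF f rho_pos[OF z]] rho_deriv[OF z]]
  DERIV_chain2[OF smooth_pos_deriv(2)[OF f rho_pos[OF z]] rho_deriv[OF z]] by blast+

lemma dpres_pos: "z \<in> (ivl p s) ==> dpres p s z > 0"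
 using dP_pos rho_pos by (auto simp: dpres_def)

lemma eps0_pos: "z \<in> (ivl p s) ==> eps0 p s z > 0"
 and del0_nonneg: "z \<in> (ivl p s) ==> del0 p s z \<ge> 0"
 using adm rho_pos[of z s] by (auto simp: eps0_def del0_def rt_admissible_def)

lemma coeff_deriv:
 assumes "z \<in> (ivl p s)"
 shows "\<exists>d. (dpres p s has_real_derivative d) (at z)" "\<exists>d. (eps0 p s has_real_derivative d) (at z)"
  "\<exists>d. (del0 p s has_real_derivative d) (at z)"
 using smooth_pos_rho_deriv[OF smooth(1) assms] smooth_pos_rho_deriv[OF smooth(2) assms] smooth_pos_rho_deriv[OF smooth(3) assms]
 by (auto simp: dpres_def[abs_def] eps0_def[abs_def] del0_def[abs_def])

lemma coeff_cont:
 "continuous_on (ivl p s) (rho p s)" "continuous_on (ivl p s) (dpres p s)"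
 "continuous_on (ivl p s) (eps0 p s)" "continuous_on (ivl p s) (del0 p s)"
 using rho_deriv coeff_deriv by (blast intro: continuous_at_imp_continuous_on DERIV_isCont)+

lemma pos_bounds:
 assumes c: "continuous_on (ivl p s) f" and f: "\<And>z. z \<in> (ivl p s) ==> f z > 0"
 shows "\<exists>a>0. \<forall>z\<in>(ivl p s). a <= (f z :: real)" "\<exists>b>0. \<forall>z\<in>(ivl p s). f z <= b"
proof -
 have ne: "(ivl p s) \<noteq> {}" using zlo_less_zhi[of s] by auto
 obtain x where "x \<in> (ivl p s)" "\<forall>z\<in>(ivl p s). f x <= f z"
  using continuous_attains_inf[OF compact_Icc ne c] by blast
 then show "\<exists>a>0. \<forall>z\<in>(ivl p s). a <= f z" using f by blast
 obtain x where "x \<in> (ivl p s)" "\<forall>z\<in>(ivl p s). f z <= f x"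
  using continuous_attains_sup[OF compact_Icc ne c] by blast
 then show "\<exists>b>0. \<forall>z\<in>(ivl p s). f z <= b" using f by blast
qed

end


section \<open>One-dimensional modes\<close>

definition vmode :: "rt_params => (side => real => real) => (side => real => real) => bool" where
 "vmode p f f' \<longleftrightarrow>
  (\<forall>s. (\<forall>z\<in>(ivl p s). (f s has_real_derivative f' s z) (at z within (ivl p s))) \<and>
     continuous_on (ivl p s) (f' s)) \<and>
  f Lower 0 = f Upper 0 \<and> f Lower (- depth p) = 0 \<and> f Upper (height p) = 0"

text \<open>A mode given on the two sides, as one function on the whole interval; the value at \<open>0\<close>
  is taken from above.\<close>

definition glue :: "(side => real => real) => real => real" where
 "glue f z = f (side_of z) z"

lemma vmode_cont: 
 assumes "vmode p f f'" shows "continuous_on (ivl p s) (f s)" "continuous_on (ivl p s) (f' s)"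
proof -
 show "continuous_on (ivl p s) (f s)"
  using assms unfolding vmode_def by (intro DERIV_continuous_on) blast
 show "continuous_on (ivl p s) (f' s)"
  using assms unfolding vmode_def by blast
qed

lemma vmode_scale: "vmode p f f' ==> vmode p (%s z. k * f s z) (%s z. k * f' s z)"
 unfolding vmode_def by (auto intro!: continuous_intros DERIV_cmult)

abbreviation sides :: "side set" where "sides \<equiv> {Lower, Upper}"



context rt begin

abbreviation "slab \<equiv> {- depth p<..<height p}"

lemma set_integrable_glue:
 fixes F :: "side => real => real"
 assumes c: "\<And>s. continuous_on (ivl p s) (F s)"
 shows "set_integrable lborel slab (%x. F (side_of x) x)"
  and "(LBINT x:slab. F (side_of x) x) = (\<Sum>s\<in>sides. integral (ivl p s) (F s))"
proof -
 let ?f = "%x. F (side_of x) x"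
 let ?A = "{- depth p<..<0}" and ?B = "{0..<height p}"
 have i: "set_integrable lborel (ivl p s) (F s)" for s
  using borel_integrable_compact[OF compact_Icc c[of s]] by (simp add: set_integrable_def mult.commute)
 have A: "set_integrable lborel ?A (F Lower)" 
  by (rule set_integrable_subset[OF i[of Lower]]) auto
 have B: "set_integrable lborel ?B (F Upper)" 
  by (rule set_integrable_subset[OF i[of Upper]]) auto
 have A': "set_integrable lborel ?A ?f"
  using A by (subst set_integrable_cong[of lborel lborel ?A ?A ?f "F Lower"]) (auto simp: side_of_def)
 have B': "set_integrable lborel ?B ?f"
  using B by (subst set_integrable_cong[of lborel lborel ?B ?B ?f "F Upper"]) (auto simp: side_of_def)
 have un: "slab = ?A \<union> ?B" using depth_pos height_pos by auto
 show "set_integrable lborel slab ?f"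
  unfolding un by (intro set_integrable_Un A' B') auto
 have "(LBINT x:slab. ?f x) = (LBINT x:?A. ?f x) + (LBINT x:?B. ?f x)"
  unfolding un by (intro set_integral_Un A' B') auto
 also have "(LBINT x:?A. ?f x) = (LBINT x:?A. F Lower x)"
  by (intro set_lebesgue_integral_cong) (auto simp: side_of_def)
 also have "\<dots> = integral ?A (F Lower)" by (rule set_borel_integral_eq_integral(2)[OF A])
 also have "\<dots> = integral {zlo p Lower..zhi p Lower} (F Lower)"
  by (simp add: integral_open_interval_real)
 also have "(LBINT x:?B. ?f x) = (LBINT x:?B. F Upper x)"
  by (intro set_lebesgue_integral_cong) (auto simp: side_of_def)
 also have "\<dots> = integral ?B (F Upper)" by (rule set_borel_integral_eq_integral(2)[OF B])
 also have "\<dots> = integral {zlo p Upper..zhi p Upper} (F Upper)"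
  by (rule integral_subset_negligible[symmetric, symmetric]) (auto intro: negligible_subset[of "{height p}"])
 finally show "(LBINT x:slab. ?f x) = (\<Sum>s\<in>sides. integral (ivl p s) (F s))" by simp
qed

lemma integrable_side: "continuous_on (ivl p s) f ==> (f :: real => real) integrable_on (ivl p s)"
 by (rule integrable_continuous_real)

lemma integral_side_nonneg:
 assumes "\<And>z. z \<in> (ivl p s) ==> 0 <= (f z :: real)" 
 shows "0 <= integral (ivl p s) f"
proof (cases "f integrable_on (ivl p s)")
 case True then show ?thesis using assms by (rule integral_nonneg)
qed (simp add: not_integrable_integral)

lemma vmode_sum_deriv:
 assumes d: "\<And>s z. z \<in> (ivl p s) ==> (F s has_real_derivative F' s z) (at z within (ivl p s))"
  and 0: "F Lower (- depth p) = 0" "F Upper (height p) = 0"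
 shows "(\<Sum>s\<in>sides. integral (ivl p s) (F' s)) = F Lower 0 - F Upper 0"
proof -
 have "integral (ivl p s) (F' s) = F s (zhi p s) - F s (zlo p s)" for s
  by (intro integral_unique fundamental_theorem_of_calculus)
   (use d zlo_less_zhi[of s] in \<open>auto simp: has_real_derivative_iff_has_vector_derivative[symmetric]\<close>)
 then show ?thesis using 0 by simp
qed

lemma sq_integrable_glue:
 assumes c: "\<And>s. continuous_on (ivl p s) (F s)"
 shows "sq_integrable (- depth p) (height p) (glue F)"
proof -
 have "set_integrable lborel slab (glue F)"
  unfolding glue_def using c by (rule set_integrable_glue)
 then have "set_borel_measurable lborel slab (glue F)"
  by (simp add: set_integrable_def set_borel_measurable_def borel_measurable_integrable)
 moreover have "set_integrable lborel slab (%x. (%s x. (F s x)\<^sup>2) (side_of x) x)"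
  by (rule set_integrable_glue) (intro continuous_intros c)
 ultimately show ?thesis by (simp add: sq_integrable_def glue_def)
qed

lemma continuous_on_glue:
 assumes c: "\<And>s. continuous_on (ivl p s) (F s)" and m: "F Lower 0 = F Upper 0"
 shows "continuous_on {- depth p..height p} (glue F)"
proof -
 have un: "{- depth p..height p} = {- depth p..0} \<union> {0..height p}" using depth_pos height_pos by auto
 have "continuous_on ({- depth p..0} \<union> {0..height p}) (%x. if x <= 0 then F Lower x else F Upper x)"
  by (rule continuous_on_If) (use c[of Lower] c[of Upper] m in auto)
 then show ?thesis unfolding un
  by (rule continuous_on_eq) (auto simp: glue_def side_of_def m)
qed

text \<open>Matching at the interface and vanishing at the ends are exactly what makes the weak derivative of
  the glued function the glued derivative.\<close>

lemma H10_glue: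
 assumes v: "vmode p f f'" 
 shows "H10 (- depth p) (height p) (glue f) (glue f')"
 unfolding H10_def
proof (intro conjI allI impI)
 show "sq_integrable (- depth p) (height p) (glue f)" "sq_integrable (- depth p) (height p) (glue f')"
  by (intro sq_integrable_glue vmode_cont[OF v])+
 show "continuous_on {- depth p..height p} (glue f)"
  by (rule continuous_on_glue) (use v vmode_cont[OF v] in \<open>auto simp: vmode_def\<close>)
 show "glue f (- depth p) = 0" "glue f (height p) = 0"
  using v depth_pos height_pos by (auto simp: vmode_def glue_def side_of_def)
next
 fix \<theta> \<theta>' assume t: "C1_compact (- depth p) (height p) \<theta> \<theta>'"
 have td: "(\<theta> has_real_derivative \<theta>' x) (at x)" for x using t by (auto simp: C1_compact_def)
 have tc: "continuous_on A \<theta>'" "continuous_on A \<theta>" for A 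
  using t td by (auto simp: C1_compact_def intro: continuous_on_subset DERIV_continuous_on DERIV_subset)
 have t0: "\<theta> (- depth p) = 0" "\<theta> (height p) = 0"
  using t by (auto simp: C1_compact_def)
 have "(\<Sum>s\<in>sides. integral (ivl p s) (%z. f s z * \<theta>' z + f' s z * \<theta> z)) = f Lower 0 * \<theta> 0 - f Upper 0 * \<theta> 0"
  by (rule vmode_sum_deriv[where F="%s z. f s z * \<theta> z"])
   (use v t0 in \<open>auto simp: vmode_def intro!: derivative_eq_intros DERIV_subset[OF td]\<close>)
 also have "\<dots> = 0" using v by (simp add: vmode_def)
 finally have 1: "(\<Sum>s\<in>sides. integral (ivl p s) (%z. f s z * \<theta>' z)) + (\<Sum>s\<in>sides. integral (ivl p s) (%z. f' s z * \<theta> z)) = 0"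
  by (subst (asm) integral_add integral_add) (auto simp: integral_add intro!: integrable_side continuous_intros vmode_cont[OF v] tc)
 have "(LBINT x:slab. glue f x * \<theta>' x) = (\<Sum>s\<in>sides. integral (ivl p s) (%z. f s z * \<theta>' z))"
  unfolding glue_def by (rule set_integrable_glue(2)[where F="%s z. f s z * \<theta>' z"]) (intro continuous_intros vmode_cont[OF v] tc)
 moreover have "(LBINT x:slab. glue f' x * \<theta> x) = (\<Sum>s\<in>sides. integral (ivl p s) (%z. f' s z * \<theta> z))"
  unfolding glue_def by (rule set_integrable_glue(2)[where F="%s z. f' s z * \<theta> z"]) (intro continuous_intros vmode_cont[OF v] tc)
 ultimately show "(LBINT x:slab. glue f x * \<theta>' x) = - (LBINT x:slab. glue f' x * \<theta> x)"
  using 1 by simp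
qed

end


section \<open>Fixed points of infima of affine families\<close>

definition aff_inf :: "(real \<times> real) set => real => real" where
 "aff_inf A s = Inf ((%(e0, e1). e0 + s * e1) ` A)"

text \<open>The pairs are the conservative and the viscous energies of the normalized competitors of one
  frequency. The bound \<open>bd\<close> says that viscosity absorbs gravity at small scales, and
  \<open>neg\<close> is the instability.\<close>

locale affine_family =
 fixes A :: "(real \<times> real) set" and k c :: real
 assumes e1: "(e0, e1) \<in> A ==> e1 \<ge> 0"
  and e0: "(e0, e1) \<in> A ==> e0 \<ge> - k"
  and bd: "(e0, e1) \<in> A ==> s > 0 ==> e0 + s * e1 \<ge> - c / s"
  and neg: "\<exists>(e0, e1)\<in>A. e0 < 0"
begin

lemma aff_bdd: assumes "s > 0" shows "bdd_below ((%(e0, e1). e0 + s * e1) ` A)"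
proof (rule bdd_belowI[of _ "- c / s"])
 fix x assume "x \<in> (%(e0, e1). e0 + s * e1) ` A"
 then obtain a b where ab: "(a, b) \<in> A" "x = a + s * b" by (auto split: prod.splits)
 show "- c / s <= x" unfolding ab(2) by (rule bd[OF ab(1) assms])
qed

lemma aff_lower: "(a, b) \<in> A ==> s > 0 ==> aff_inf A s <= a + s * b"
 unfolding aff_inf_def by (rule cInf_lower[OF _ aff_bdd]) force+

lemma aff_greatest: "(\<And>a b. (a, b) \<in> A ==> x <= a + s * b) ==> x <= aff_inf A s"
 unfolding aff_inf_def by (rule cInf_greatest) (use neg in auto)

lemma aff_mono: "0 < s ==> s <= t ==> aff_inf A s <= aff_inf A t"
 by (rule aff_greatest) (use e1 mult_right_mono aff_lower[of _ _ s] in \<open>smt (verit, best)\<close>)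

lemma aff_ge: "s > 0 ==> - c / s <= aff_inf A s"
 by (rule aff_greatest) (rule bd)

text \<open>Rescaling the slope part of a competitor changes its value by a controlled amount, which
  gives continuity of the infimum.\<close>

lemma aff_scale:
 assumes s: "0 < s" "s <= t"
 shows "aff_inf A t <= (t / s) * aff_inf A s + (t / s - 1) * k"
proof -
 have "(s / t) * (aff_inf A t - (t / s - 1) * k) <= aff_inf A s"
 proof (rule aff_greatest)
  fix a b assume ab: "(a, b) \<in> A"
  have "aff_inf A t <= a + t * b" using aff_lower[OF ab] s by simp
  also have "\<dots> = (t / s) * (a + s * b) - (t / s - 1) * a" using s by (simp add: field_simps)
  also have "\<dots> <= (t / s) * (a + s * b) + (t / s - 1) * k" 
   using mult_left_mono[OF e0[OF ab], of "t / s - 1"] s by (simp add: algebra_simps)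
  finally have "aff_inf A t - (t / s - 1) * k <= (t / s) * (a + s * b)" by simp
  then have "(s / t) * (aff_inf A t - (t / s - 1) * k) <= (s / t) * ((t / s) * (a + s * b))"
   by (rule mult_left_mono) (use s in simp)
  also have "\<dots> = a + s * b" using s by simp
  finally show "(s / t) * (aff_inf A t - (t / s - 1) * k) <= a + s * b" .
 qed
 then have "(t / s) * ((s / t) * (aff_inf A t - (t / s - 1) * k)) <= (t / s) * aff_inf A s"
  by (rule mult_left_mono) (use s in simp)
 moreover have "(t / s) * ((s / t) * (aff_inf A t - (t / s - 1) * k)) = aff_inf A t - (t / s - 1) * k" using s by simp
 ultimately show ?thesis by simp
qed

text \<open>The bounds of \<open>aff_scale\<close> squeeze the infimum from both sides.\<close>

lemma aff_cont: 
 assumes s: "s > 0" shows "isCont (aff_inf A) s"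
proof -
 let ?m = "aff_inf A"
 have up: "(%t. (t / s) * ?m s + (t / s - 1) * k) \<midarrow>s\<rightarrow> ?m s"
  by (rule tendsto_eq_intros | use s in simp)+
 have lo: "(%t. (t / s) * (?m s - (s / t - 1) * k)) \<midarrow>s\<rightarrow> ?m s"
  by (rule tendsto_eq_intros | use s in simp)+
 have ev: "eventually (%t. t > 0) (at s)"
  using order_tendstoD(1)[OF tendsto_ident_at s, of UNIV] .
 have "(%t. max (?m s) ((t / s) * ?m s + (t / s - 1) * k)) \<midarrow>s\<rightarrow> max (?m s) (?m s)"
  by (intro tendsto_max up tendsto_const)
 then have up': "(%t. max (?m s) ((t / s) * ?m s + (t / s - 1) * k)) \<midarrow>s\<rightarrow> ?m s" by simp
 have "(%t. min (?m s) ((t / s) * (?m s - (s / t - 1) * k))) \<midarrow>s\<rightarrow> min (?m s) (?m s)"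
  by (intro tendsto_min lo tendsto_const)
 then have lo': "(%t. min (?m s) ((t / s) * (?m s - (s / t - 1) * k))) \<midarrow>s\<rightarrow> ?m s" by simp
 have "?m \<midarrow>s\<rightarrow> ?m s"
 proof (rule tendsto_sandwich[OF _ _ lo' up'])
  show "eventually (%t. min (?m s) ((t / s) * (?m s - (s / t - 1) * k)) <= ?m t) (at s)"
   using ev
  proof eventually_elim
   case (elim t)
   show ?case
   proof (cases "t <= s")
    case True
    from aff_scale[OF elim True] have "?m s - (s / t - 1) * k <= (s / t) * ?m t" by simp
    from mult_left_mono[OF this, of "t / s"] have "(t / s) * (?m s - (s / t - 1) * k) <= ?m t"
     using elim s by simp
    then show ?thesis by simp
   next
    case False then show ?thesis using aff_mono[OF s, of t] by simp
   qed
  qed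
  show "eventually (%t. ?m t <= max (?m s) ((t / s) * ?m s + (t / s - 1) * k)) (at s)"
   using ev
  proof eventually_elim
   case (elim t)
   show ?case
    using aff_mono[OF elim, of s] aff_scale[OF s, of t] by (cases "t <= s") auto
  qed
 qed
 then show ?thesis by (simp add: isCont_def)
qed

lemma c_pos: "c > 0"
proof -
 obtain a b where ab: "(a, b) \<in> A" "a < 0" using neg by auto
 define s where "s = - a / (2 * (b + 1))"
 have b: "b \<ge> 0" using e1[OF ab(1)] .
 then have s: "s > 0" using ab by (simp add: s_def divide_neg_pos)
 have "s * b <= - a / 2" using b ab by (simp add: s_def field_simps)
 then have "a + s * b < 0" using ab by simp
 then have "- c / s < 0" using bd[OF ab(1) s] by simp
 then show ?thesis using s by (simp add: zero_less_divide_iff)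
qed

text \<open>The function \<open>s\<^sup>2 + inf\<close> is strictly increasing and continuous, negative for
  small \<open>s\<close> and positive for large \<open>s\<close>, hence has exactly one zero.\<close>

lemma fixed_point:
 shows "\<exists>!s. s > 0 \<and> aff_inf A s < 0 \<and> s = sqrt (- aff_inf A s)"
  and "s > 0 \<and> aff_inf A s < 0 \<and> s = sqrt (- aff_inf A s) ==> s ^ 3 <= c \<and> (\<forall>t\<ge>s. \<forall>(a,b)\<in>A. a + t * b \<ge> - t\<^sup>2)"
proof -
 let ?m = "aff_inf A" and ?f = "%s. s\<^sup>2 + aff_inf A s"
 have char: "s > 0 \<and> ?m s < 0 \<and> s = sqrt (- ?m s) \<longleftrightarrow> s > 0 \<and> ?f s = 0" for s
 proof
  assume l: "s > 0 \<and> ?m s < 0 \<and> s = sqrt (- ?m s)"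
  then have "s\<^sup>2 = - ?m s" using real_sqrt_pow2[of "- ?m s"] by auto
  then show "s > 0 \<and> ?f s = 0" using l by simp
 next
  assume r: "s > 0 \<and> ?f s = 0"
  then have m: "?m s = - s\<^sup>2" by linarith
  show "s > 0 \<and> ?m s < 0 \<and> s = sqrt (- ?m s)" unfolding m using r by simp
 qed
 have strict: "?f s < ?f t" if "0 < s" "s < t" for s t
  using aff_mono[of s t] that power_strict_mono[of s t 2] by simp
 obtain a b where ab: "(a, b) \<in> A" "a < 0" using neg by auto
 have b: "b \<ge> 0" using e1[OF ab(1)] .
 define s0 where "s0 = min 1 (- a / (2 * (b + 1)))"
 have s0: "s0 > 0" "s0 <= 1" using ab b by (auto simp: s0_def divide_neg_pos)
 have "s0 * (b + 1) <= - a / (2 * (b + 1)) * (b + 1)" by (rule mult_right_mono) (use b in \<open>auto simp: s0_def\<close>)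
 also have "\<dots> = - a / 2" using b by (simp add: field_simps)
 finally have "s0 * (b + 1) <= - a / 2" .
 moreover have "s0\<^sup>2 <= s0" using s0 by (simp add: power2_eq_square mult_left_le_one_le)
 ultimately have "?f s0 < 0" using aff_lower[OF ab(1) s0(1)] ab by (simp add: algebra_simps)
 define s1 where "s1 = max s0 1 + c"
 have s1: "s1 > 1" "s1 > s0" "s1 \<ge> c" using c_pos by (auto simp: s1_def)
 have "c / s1 <= 1" using s1 c_pos by simp
 moreover have "s1\<^sup>2 > 1" using s1 by (simp add: one_less_power)
 moreover have "- (c / s1) <= ?m s1" using aff_ge[of s1] s1 by simp
 ultimately have "?f s1 > 0" by linarith
 have "\<exists>x\<ge>s0. x <= s1 \<and> ?f x = 0"
 proof (rule IVT)
  show "\<forall>x. s0 <= x \<and> x <= s1 \<longrightarrow> isCont ?f x"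
   using aff_cont s0 by (auto intro!: continuous_intros)
 qed (use \<open>?f s0 < 0\<close> \<open>?f s1 > 0\<close> s1 in auto)
 then obtain x where x: "x \<ge> s0" "?f x = 0" by blast
 show "\<exists>!s. s > 0 \<and> aff_inf A s < 0 \<and> s = sqrt (- aff_inf A s)"
  unfolding char
 proof (rule ex1I[of _ x])
  show "x > 0 \<and> ?f x = 0" using x s0 by simp
  fix y assume y: "y > 0 \<and> ?f y = 0"
  then show "y = x" using strict[of x y] strict[of y x] x s0 by (cases x y rule: linorder_cases) auto
 qed
 assume "s > 0 \<and> aff_inf A s < 0 \<and> s = sqrt (- aff_inf A s)"
 then have s: "s > 0" "?f s = 0" unfolding char by auto
 have "s\<^sup>2 <= c / s" using aff_ge[OF s(1)] s(2) by simp
 then have "s ^ 3 <= c" using s(1) by (simp add: pos_le_divide_eq power3_eq_cube power2_eq_square)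
 moreover have "a + t * b \<ge> - t\<^sup>2" if t: "t \<ge> s" "(a,b) \<in> A" for t a b
 proof -
  have "?f s <= ?f t" using strict[of s t] s t by (cases "s = t") auto
  then show ?thesis using s aff_lower[OF t(2), of t] t by simp
 qed
 ultimately show "s ^ 3 <= c \<and> (\<forall>t\<ge>s. \<forall>(a,b)\<in>A. a + t * b \<ge> - t\<^sup>2)" by blast
qed

end

section \<open>Growth rates\<close>

context rt begin

text \<open>The conservative and the viscous part of the energy: \<open>E = E\<^sub>0 + s E\<^sub>1\<close>.\<close>

definition dens0 where
 "dens0 r \<phi> \<psi> \<psi>' x = dpres p (side_of x) x * rho p (side_of x) x * (\<psi>' x + r * \<phi> x)\<^sup>2
  - 2 * grav p * rho p (side_of x) x * r * \<phi> x * \<psi> x"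

definition dens1 where
 "dens1 r \<phi> \<phi>' \<psi> \<psi>' x = del0 p (side_of x) x * (\<psi>' x + r * \<phi> x)\<^sup>2
  + eps0 p (side_of x) x * ((\<phi>' x - r * \<psi> x)\<^sup>2 + (\<psi>' x - r * \<phi> x)\<^sup>2 + 1 / 3 * (\<psi>' x + r * \<phi> x)\<^sup>2)"

definition E0 where
 "E0 r \<phi> \<psi> \<psi>' = surf p * r\<^sup>2 / 2 * (\<psi> 0)\<^sup>2 + 1 / 2 * (LBINT x:slab. dens0 r \<phi> \<psi> \<psi>' x)"

definition E1 where
 "E1 r \<phi> \<phi>' \<psi> \<psi>' = 1 / 2 * (LBINT x:slab. dens1 r \<phi> \<phi>' \<psi> \<psi>' x)"

lemma side_of_mem: "x \<in> slab ==> x \<in> {zlo p (side_of x)..zhi p (side_of x)}"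
 by (auto simp: side_of_def)

lemma integrable_coeff_mult:
 assumes c: "\<And>s. continuous_on (ivl p s) (F s)"
  and u: "sq_integrable (- depth p) (height p) u" and w: "sq_integrable (- depth p) (height p) w"
 shows "set_integrable lborel slab (%x. F (side_of x) x * (u x * w x))"
proof -
 have "\<exists>M. \<forall>x\<in>slab. \<bar>F (side_of x) x\<bar> <= M"
 proof -
  have "bounded (F s ` (ivl p s))" for s
   by (intro compact_imp_bounded compact_continuous_image c compact_Icc)
  then have "\<forall>s. \<exists>M. \<forall>x\<in>(ivl p s). \<bar>F s x\<bar> <= M" by (auto simp: bounded_iff)
  then obtain M where M: "\<And>s x. x\<in>(ivl p s) ==> \<bar>F s x\<bar> <= M s" by metis
  show ?thesis
  proof (intro exI ballI)
   fix x assume "x \<in> slab"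
   from M[OF side_of_mem[OF this]] show "\<bar>F (side_of x) x\<bar> <= max (M Lower) (M Upper)"
    by (cases "side_of x") auto
  qed
 qed
 then obtain M where M: "\<And>x. x \<in> slab ==> \<bar>F (side_of x) x\<bar> <= M" by blast
 have i: "set_integrable lborel slab (%x. M * ((u x)\<^sup>2 + (w x)\<^sup>2))"
  using u w unfolding sq_integrable_def by auto
 have mF: "(%x. indicator slab x *\<^sub>R F (side_of x) x) \<in> borel_measurable lborel"
  using set_integrable_glue(1)[of F, OF c] by (simp add: set_integrable_def borel_measurable_integrable)
 have mu: "(%x. indicator slab x *\<^sub>R u x) \<in> borel_measurable lborel" "(%x. indicator slab x *\<^sub>R w x) \<in> borel_measurable lborel"
  using u w unfolding sq_integrable_def set_borel_measurable_def by auto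
 have "(%x. (indicator slab x *\<^sub>R F (side_of x) x) * ((indicator slab x *\<^sub>R u x) * (indicator slab x *\<^sub>R w x))) \<in> borel_measurable lborel"
  using mF mu by measurable
 also have "(%x. (indicator slab x *\<^sub>R F (side_of x) x) * ((indicator slab x *\<^sub>R u x) * (indicator slab x *\<^sub>R w x)))
  = (%x. indicator slab x *\<^sub>R (F (side_of x) x * (u x * w x)))"
  by (auto simp: indicator_def)
 finally have m: "set_borel_measurable lborel slab (%x. F (side_of x) x * (u x * w x))"
  by (simp add: set_borel_measurable_def)
 show ?thesis
 proof (rule set_integrable_bound[OF i m], intro AE_I2 impI)
  fix x assume x: "x \<in> slab"
  have "M \<ge> 0" using M[OF x] by linarith
  have "2 * \<bar>u x * w x\<bar> <= (u x)\<^sup>2 + (w x)\<^sup>2"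
   using sum_squares_bound[of "\<bar>u x\<bar>" "\<bar>w x\<bar>"] by (simp add: abs_mult)
  moreover have "(u x)\<^sup>2 + (w x)\<^sup>2 \<ge> 0" by simp
  ultimately have "\<bar>u x * w x\<bar> <= (u x)\<^sup>2 + (w x)\<^sup>2" by linarith
  then have "\<bar>F (side_of x) x\<bar> * \<bar>u x * w x\<bar> <= M * ((u x)\<^sup>2 + (w x)\<^sup>2)"
   using M[OF x] \<open>M \<ge> 0\<close> by (intro mult_mono) auto
  then show "norm (F (side_of x) x * (u x * w x)) <= norm (M * ((u x)\<^sup>2 + (w x)\<^sup>2))"
   using \<open>M \<ge> 0\<close> by (simp add: abs_mult)
 qed
qed

lemma sq_integrable_lincomb:
 assumes "sq_integrable a b u" "sq_integrable a b w"
 shows "sq_integrable a b (%x. u x + k * w x)"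
proof -
 have mu: "(%x. indicator {a<..<b} x *\<^sub>R u x) \<in> borel_measurable lborel" "(%x. indicator {a<..<b} x *\<^sub>R w x) \<in> borel_measurable lborel"
  using assms unfolding sq_integrable_def set_borel_measurable_def by auto
 have "(%x. (indicator {a<..<b} x *\<^sub>R u x) + k * (indicator {a<..<b} x *\<^sub>R w x)) \<in> borel_measurable lborel"
  using mu by measurable
 also have "(%x. (indicator {a<..<b} x *\<^sub>R u x) + k * (indicator {a<..<b} x *\<^sub>R w x)) = (%x. indicator {a<..<b} x *\<^sub>R (u x + k * w x))"
  by (auto simp: indicator_def)
 finally have m: "set_borel_measurable lborel {a<..<b} (%x. u x + k * w x)" by (simp add: set_borel_measurable_def)
 have i: "set_integrable lborel {a<..<b} (%x. 2 * (u x)\<^sup>2 + (2 * k\<^sup>2) * (w x)\<^sup>2)"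
  using assms unfolding sq_integrable_def by auto
 have m2: "set_borel_measurable lborel {a<..<b} (%x. (u x + k * w x)\<^sup>2)"
 proof -
  have "(%x. (indicator {a<..<b} x *\<^sub>R (u x + k * w x))\<^sup>2) \<in> borel_measurable lborel"
   using m unfolding set_borel_measurable_def by measurable
  also have "(%x. (indicator {a<..<b} x *\<^sub>R (u x + k * w x))\<^sup>2) = (%x. indicator {a<..<b} x *\<^sub>R ((u x + k * w x)\<^sup>2))"
   by (auto simp: indicator_def)
  finally show ?thesis by (simp add: set_borel_measurable_def)
 qed
 have "set_integrable lborel {a<..<b} (%x. (u x + k * w x)\<^sup>2)"
 proof (rule set_integrable_bound[OF i m2], intro AE_I2 impI)
  fix x
  have "0 <= (u x - k * w x)\<^sup>2" by simp
  then have "(u x + k * w x)\<^sup>2 <= 2 * (u x)\<^sup>2 + (2 * k\<^sup>2) * (w x)\<^sup>2"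
   by (simp add: power2_eq_square algebra_simps)
  then show "norm ((u x + k * w x)\<^sup>2) <= norm (2 * (u x)\<^sup>2 + (2 * k\<^sup>2) * (w x)\<^sup>2)"
   by simp
 qed
 then show ?thesis using m by (simp add: sq_integrable_def)
qed

context
 fixes \<phi> \<phi>' \<psi> \<psi>' :: "real => real"
 assumes H: "H10 (- depth p) (height p) \<phi> \<phi>'" "H10 (- depth p) (height p) \<psi> \<psi>'"
begin

lemma dens_integrable:
 shows "set_integrable lborel slab (dens0 r \<phi> \<psi> \<psi>')" "set_integrable lborel slab (dens1 r \<phi> \<phi>' \<psi> \<psi>')"
  "set_integrable lborel slab (%x. rho p (side_of x) x * ((\<phi> x)\<^sup>2 + (\<psi> x)\<^sup>2))"
  "set_integrable lborel slab (%x. rho p (side_of x) x * (\<psi> x)\<^sup>2)"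
proof -
 have sq: "sq_integrable (- depth p) (height p) \<phi>" "sq_integrable (- depth p) (height p) \<phi>'"
  "sq_integrable (- depth p) (height p) \<psi>" "sq_integrable (- depth p) (height p) \<psi>'"
  using H by (auto simp: H10_def)
 note lc = sq_integrable_lincomb[OF sq(4) sq(1), of r] sq_integrable_lincomb[OF sq(2) sq(3), of "-r"]
  sq_integrable_lincomb[OF sq(4) sq(1), of "-r"]
 note I = integrable_coeff_mult
 show "set_integrable lborel slab (dens0 r \<phi> \<psi> \<psi>')"
 proof -
  have "set_integrable lborel slab (%x. (dpres p (side_of x) x * rho p (side_of x) x) * ((\<psi>' x + r * \<phi> x) * (\<psi>' x + r * \<phi> x))
    - (2 * grav p * r * rho p (side_of x) x) * (\<phi> x * \<psi> x))"
   by (intro set_integral_diff(1) I[of "%s x. dpres p s x * rho p s x"] I[of "%s x. 2 * grav p * r * rho p s x"] lc sq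
    continuous_intros coeff_cont)
  then show ?thesis by (simp add: dens0_def[abs_def] power2_eq_square algebra_simps)
 qed
 show "set_integrable lborel slab (dens1 r \<phi> \<phi>' \<psi> \<psi>')"
 proof -
  have "set_integrable lborel slab (%x. (del0 p (side_of x) x + eps0 p (side_of x) x / 3) * ((\<psi>' x + r * \<phi> x) * (\<psi>' x + r * \<phi> x))
    + eps0 p (side_of x) x * ((\<phi>' x + - r * \<psi> x) * (\<phi>' x + - r * \<psi> x)) + eps0 p (side_of x) x * ((\<psi>' x + - r * \<phi> x) * (\<psi>' x + - r * \<phi> x)))"
   by (intro set_integral_add(1) I[of "%s x. del0 p s x + eps0 p s x / 3"] I[of "%s x. eps0 p s x"] lc sq
    continuous_intros coeff_cont) auto
  then show ?thesis by (simp add: dens1_def[abs_def] power2_eq_square algebra_simps)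
 qed
 show 1: "set_integrable lborel slab (%x. rho p (side_of x) x * (\<psi> x)\<^sup>2)"
  using I[of "%s x. rho p s x", OF _ sq(3) sq(3)] coeff_cont by (simp add: power2_eq_square)
 have 2: "set_integrable lborel slab (%x. rho p (side_of x) x * (\<phi> x)\<^sup>2)"
  using I[of "%s x. rho p s x", OF _ sq(1) sq(1)] coeff_cont by (simp add: power2_eq_square)
 show "set_integrable lborel slab (%x. rho p (side_of x) x * ((\<phi> x)\<^sup>2 + (\<psi> x)\<^sup>2))"
  using set_integral_add(1)[OF 2 1] by (simp add: algebra_simps)
qed

lemma energy_split: "energy_E p r s \<phi> \<phi>' \<psi> \<psi>' = E0 r \<phi> \<psi> \<psi>' + s * E1 r \<phi> \<phi>' \<psi> \<psi>'"
proof -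
 note sq = H[unfolded H10_def]
 have sq: "sq_integrable (- depth p) (height p) \<phi>" "sq_integrable (- depth p) (height p) \<phi>'"
  "sq_integrable (- depth p) (height p) \<psi>" "sq_integrable (- depth p) (height p) \<psi>'"
  using H by (auto simp: H10_def)
 note lc = sq_integrable_lincomb[OF sq(4) sq(1), of r]
 have del: "set_integrable lborel slab (%x. s * (del0 p (side_of x) x * (\<psi>' x + r * \<phi> x)\<^sup>2))"
  using integrable_coeff_mult[of "%s x. del0 p s x", OF _ lc lc] coeff_cont
  by (auto simp: power2_eq_square)
 have d1: "set_integrable lborel slab (%x. s * dens1 r \<phi> \<phi>' \<psi> \<psi>' x)" using dens_integrable(2) by simp
 let ?a = "%x. (s * del0 p (side_of x) x + dpres p (side_of x) x * rho p (side_of x) x) * (\<psi>' x + r * \<phi> x)\<^sup>2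
  - 2 * grav p * rho p (side_of x) x * r * \<phi> x * \<psi> x"
 let ?b = "%x. s * eps0 p (side_of x) x * ((\<phi>' x - r * \<psi> x)\<^sup>2 + (\<psi>' x - r * \<phi> x)\<^sup>2 + 1 / 3 * (\<psi>' x + r * \<phi> x)\<^sup>2)"
 have a: "?a = (%x. dens0 r \<phi> \<psi> \<psi>' x + s * (del0 p (side_of x) x * (\<psi>' x + r * \<phi> x)\<^sup>2))"
  by (auto simp: dens0_def algebra_simps)
 have b: "?b = (%x. s * dens1 r \<phi> \<phi>' \<psi> \<psi>' x - s * (del0 p (side_of x) x * (\<psi>' x + r * \<phi> x)\<^sup>2))"
  by (auto simp: dens1_def algebra_simps)
 have "(LBINT x:slab. ?a x) + (LBINT x:slab. ?b x) = (LBINT x:slab. dens0 r \<phi> \<psi> \<psi>' x) + s * (LBINT x:slab. dens1 r \<phi> \<phi>' \<psi> \<psi>' x)"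
  unfolding a b by (subst set_integral_add(2)[OF dens_integrable(1) del]) (simp add: set_integral_diff(2)[OF d1 del])
 then show ?thesis by (simp add: energy_E_def E0_def E1_def algebra_simps)
qed

lemma E1_nonneg: "E1 r \<phi> \<phi>' \<psi> \<psi>' \<ge> 0"
proof -
 have "(LBINT x:slab. dens1 r \<phi> \<phi>' \<psi> \<psi>' x) \<ge> 0"
  unfolding set_lebesgue_integral_def
 proof (rule Bochner_Integration.integral_nonneg)
  fix x 
  show "0 <= indicator slab x *\<^sub>R dens1 r \<phi> \<phi>' \<psi> \<psi>' x"
  proof (cases "x \<in> slab")
   case True
   then have "eps0 p (side_of x) x > 0" "del0 p (side_of x) x \<ge> 0" using eps0_pos del0_nonneg side_of_mem by blast+
   then show ?thesis by (simp add: dens1_def)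
  qed simp
 qed
 then show ?thesis by (simp add: E1_def)
qed

text \<open>Without viscosity, gravity is bounded by the density weighted mass: Young's inequality with the
  factor \<open>r\<close>.\<close>

lemma E0_ge:
 assumes r: "r \<ge> 0" shows "E0 r \<phi> \<psi> \<psi>' \<ge> - (grav p * r) * energy_J p \<phi> \<psi>"
proof -
 have "(LBINT x:slab. - (grav p * r) * (rho p (side_of x) x * ((\<phi> x)\<^sup>2 + (\<psi> x)\<^sup>2))) <= (LBINT x:slab. dens0 r \<phi> \<psi> \<psi>' x)"
 proof (rule set_integral_mono[OF _ dens_integrable(1)])
  show "set_integrable lborel slab (%x. - (grav p * r) * (rho p (side_of x) x * ((\<phi> x)\<^sup>2 + (\<psi> x)\<^sup>2)))"
   by (rule set_integrable_mult_right) (rule dens_integrable(3))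
  fix x assume "x \<in> slab"
  then have pos: "dpres p (side_of x) x > 0" "rho p (side_of x) x > 0" using dpres_pos rho_pos side_of_mem by blast+
  have "2 * (\<phi> x * \<psi> x) <= (\<phi> x)\<^sup>2 + (\<psi> x)\<^sup>2" using sum_squares_bound[of "\<phi> x" "\<psi> x"] by simp
  from mult_left_mono[OF this, of "grav p * r * rho p (side_of x) x"]
  have "grav p * r * rho p (side_of x) x * (2 * (\<phi> x * \<psi> x)) <= grav p * r * rho p (side_of x) x * ((\<phi> x)\<^sup>2 + (\<psi> x)\<^sup>2)"
   using pos g_pos r by simp
  moreover have "0 <= dpres p (side_of x) x * rho p (side_of x) x * (\<psi>' x + r * \<phi> x)\<^sup>2" using pos by simp
  ultimately show "- (grav p * r) * (rho p (side_of x) x * ((\<phi> x)\<^sup>2 + (\<psi> x)\<^sup>2)) <= dens0 r \<phi> \<psi> \<psi>' x"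
   unfolding dens0_def by (simp add: algebra_simps)
 qed
 then have "- (grav p * r) * (LBINT x:slab. rho p (side_of x) x * ((\<phi> x)\<^sup>2 + (\<psi> x)\<^sup>2)) <= (LBINT x:slab. dens0 r \<phi> \<psi> \<psi>' x)"
  by (simp only: set_integral_mult_right)
 moreover have "0 <= surf p * r\<^sup>2 / 2 * (\<psi> 0)\<^sup>2" using surf_nonneg by simp
 ultimately show ?thesis by (simp add: E0_def energy_J_def)
qed

text \<open>The shear viscosity controls \<open>r \<phi>\<close>, because \<open>(a - b)\<^sup>2 + (a + b)\<^sup>2 / 3 \<ge> b\<^sup>2\<close>. Hence the
  destabilizing term is bounded below uniformly in the frequency.\<close>

lemma E_ge:
 assumes s: "s > 0" and c: "\<And>s x. x \<in> (ivl p s) ==> (grav p)\<^sup>2 * rho p s x <= c * eps0 p s x" and c0: "c \<ge> 0"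
 shows "E0 r \<phi> \<psi> \<psi>' + s * E1 r \<phi> \<phi>' \<psi> \<psi>' \<ge> - c / s * energy_J p \<phi> \<psi>"
proof -
 have "(LBINT x:slab. - c / s * (rho p (side_of x) x * ((\<phi> x)\<^sup>2 + (\<psi> x)\<^sup>2))) <= (LBINT x:slab. dens0 r \<phi> \<psi> \<psi>' x + s * dens1 r \<phi> \<phi>' \<psi> \<psi>' x)"
 proof (rule set_integral_mono)
  show "set_integrable lborel slab (%x. - c / s * (rho p (side_of x) x * ((\<phi> x)\<^sup>2 + (\<psi> x)\<^sup>2)))"
   by (rule set_integrable_mult_right) (rule dens_integrable(3))
  show "set_integrable lborel slab (%x. dens0 r \<phi> \<psi> \<psi>' x + s * dens1 r \<phi> \<phi>' \<psi> \<psi>' x)"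
   using dens_integrable(1,2) by (intro set_integral_add(1)) auto
  fix x assume "x \<in> slab"
  note m = side_of_mem[OF this]
  define R Q e d where "R = rho p (side_of x) x" and "Q = dpres p (side_of x) x" and "e = eps0 p (side_of x) x" and "d = del0 p (side_of x) x"
  have pos: "R > 0" "Q > 0" "e > 0" "d \<ge> 0" using rho_pos[OF m] dpres_pos[OF m] eps0_pos[OF m] del0_nonneg[OF m] by (simp_all add: R_def Q_def e_def d_def)
  have ce: "(grav p)\<^sup>2 * R <= c * e" using c[OF m] by (simp add: R_def e_def)
  define a b where "a = \<psi>' x" and "b = r * \<phi> x"
  have ab: "(a - b)\<^sup>2 + 1/3 * (a + b)\<^sup>2 \<ge> b\<^sup>2"
   using zero_le_power2[of "2 * a - b"] by (simp add: power2_eq_square algebra_simps)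
  have "0 <= (s * e * b - grav p * R * \<psi> x)\<^sup>2" by simp
  then have "2 * (s * e) * (grav p * R * b * \<psi> x) <= (s * e * b)\<^sup>2 + (grav p * R * \<psi> x)\<^sup>2"
   by (simp add: power2_eq_square algebra_simps)
  also have "(grav p * R * \<psi> x)\<^sup>2 <= (c * e) * R * (\<psi> x)\<^sup>2"
   using mult_right_mono[OF ce, of "R * (\<psi> x)\<^sup>2"] pos by (simp add: power_mult_distrib power2_eq_square mult_ac)
  also have "(s * e * b)\<^sup>2 + (c * e) * R * (\<psi> x)\<^sup>2 = (s * e) * (s * e * b\<^sup>2 + c / s * R * (\<psi> x)\<^sup>2)"
   using s by (simp add: power2_eq_square field_simps)
  finally have "(s * e) * (2 * (grav p * R * b * \<psi> x)) <= (s * e) * (s * e * b\<^sup>2 + c / s * R * (\<psi> x)\<^sup>2)"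
   by (simp add: mult_ac)
  then have 1: "2 * (grav p * R * b * \<psi> x) <= s * e * b\<^sup>2 + c / s * R * (\<psi> x)\<^sup>2"
   using s pos by (simp add: mult_le_cancel_left)
  have 2: "s * e * b\<^sup>2 <= s * e * ((a - b)\<^sup>2 + 1/3 * (a + b)\<^sup>2)" by (rule mult_left_mono[OF ab]) (use s pos in simp)
  have 3: "0 <= Q * R * (a + b)\<^sup>2" "0 <= s * (d * (a + b)\<^sup>2)" "0 <= s * (e * (\<phi>' x - r * \<psi> x)\<^sup>2)" "0 <= c / s * R * (\<phi> x)\<^sup>2" using pos s c0 by simp_all
  have "dens0 r \<phi> \<psi> \<psi>' x + s * dens1 r \<phi> \<phi>' \<psi> \<psi>' x =
   Q * R * (a + b)\<^sup>2 - 2 * (grav p * R * b * \<psi> x) + s * (d * (a + b)\<^sup>2) + s * (e * (\<phi>' x - r * \<psi> x)\<^sup>2) + s * e * ((a - b)\<^sup>2 + 1/3 * (a + b)\<^sup>2)"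
   by (simp add: dens0_def dens1_def R_def Q_def e_def d_def a_def b_def algebra_simps)
  moreover have "- c / s * (R * ((\<phi> x)\<^sup>2 + (\<psi> x)\<^sup>2)) = - (c / s * R * (\<phi> x)\<^sup>2) - c / s * R * (\<psi> x)\<^sup>2"
   by (simp add: algebra_simps)
  ultimately show "- c / s * (rho p (side_of x) x * ((\<phi> x)\<^sup>2 + (\<psi> x)\<^sup>2)) <= dens0 r \<phi> \<psi> \<psi>' x + s * dens1 r \<phi> \<phi>' \<psi> \<psi>' x"
   using 1 2 3 unfolding R_def[symmetric] by linarith
 qed
 also have "\<dots> = (LBINT x:slab. dens0 r \<phi> \<psi> \<psi>' x) + s * (LBINT x:slab. dens1 r \<phi> \<phi>' \<psi> \<psi>' x)"
  using dens_integrable(1,2) by (subst set_integral_add(2)) auto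
 finally have "- c / s * (LBINT x:slab. rho p (side_of x) x * ((\<phi> x)\<^sup>2 + (\<psi> x)\<^sup>2)) <= (LBINT x:slab. dens0 r \<phi> \<psi> \<psi>' x) + s * (LBINT x:slab. dens1 r \<phi> \<phi>' \<psi> \<psi>' x)"
  by (simp only: set_integral_mult_right)
 moreover have "0 <= surf p * r\<^sup>2 / 2 * (\<psi> 0)\<^sup>2" using surf_nonneg by simp
 moreover have "- c / s * energy_J p \<phi> \<psi> = 1/2 * (- c / s * (LBINT x:slab. rho p (side_of x) x * ((\<phi> x)\<^sup>2 + (\<psi> x)\<^sup>2)))"
  by (simp add: energy_J_def)
 moreover have "s * E1 r \<phi> \<phi>' \<psi> \<psi>' = 1/2 * (s * (LBINT x:slab. dens1 r \<phi> \<phi>' \<psi> \<psi>' x))" by (simp add: E1_def)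
 ultimately show ?thesis unfolding E0_def by linarith
qed

end

end


lemma DERIV_pos_part_power:
 "((%t. (max 0 t) ^ Suc (Suc n)) has_real_derivative real (Suc (Suc n)) * (max 0 t) ^ Suc n) (at t)"
proof -
 have z: "((%t::real. max 0 t ^ Suc (Suc n)) has_real_derivative 0) (at 0)"
 proof -
  have "((%h::real. max 0 h ^ Suc (Suc n) / h) \<longlongrightarrow> 0) (at 0)"
  proof (rule Lim_null_comparison)
   show "\<forall>\<^sub>F h in at 0. norm (max 0 h ^ Suc (Suc n) / h) <= \<bar>h :: real\<bar> ^ Suc n"
   proof (rule always_eventually, rule allI)
    fix h :: real
    show "norm (max 0 h ^ Suc (Suc n) / h) <= \<bar>h\<bar> ^ Suc n"
    proof (cases "h <= 0")
     case True
     then have "max 0 h = 0" by simp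
     then have "norm (max 0 h ^ Suc (Suc n) / h) = 0" by simp
     then show ?thesis by (simp only: zero_le_power abs_ge_zero)
    qed (simp add: max_def)
   qed
   show "((%h::real. \<bar>h\<bar> ^ Suc n) \<longlongrightarrow> 0) (at 0)"
    by (rule tendsto_eq_intros refl | simp)+
  qed
  then show ?thesis by (simp add: DERIV_def)
 qed
 consider "t > 0" | "t < 0" | "t = 0" by linarith
 then show ?thesis
 proof cases
  case 1
  have "((%t. t ^ Suc (Suc n)) has_real_derivative real (Suc (Suc n)) * t ^ Suc n) (at t)"
   using DERIV_pow[of "Suc (Suc n)" t] by simp
  then have "((%t. (max 0 t) ^ Suc (Suc n)) has_real_derivative real (Suc (Suc n)) * t ^ Suc n) (at t)"
   by (rule has_field_derivative_transform_within[where d=t]) (use 1 in \<open>auto simp: dist_real_def max_def\<close>)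
  then show ?thesis using 1 by (simp add: max_def)
 next
  case 2
  have "((%t::real. 0) has_real_derivative 0) (at t)" by simp
  then have "((%t. (max 0 t) ^ Suc (Suc n)) has_real_derivative 0) (at t)"
   by (rule has_field_derivative_transform_within[where d="-t"]) (use 2 in \<open>auto simp: dist_real_def max_def\<close>)
  then show ?thesis using 2 by (simp add: max_def)
 next
  case 3 then show ?thesis using z by simp
 qed
qed

definition "bump d z = (max 0 (1 - (z / d)\<^sup>2)) ^ 3" for d z :: real
definition "bump1 d z = 3 * (max 0 (1 - (z / d)\<^sup>2)) ^ 2 * (- 2 * z / d\<^sup>2)" for d z :: real
definition "bump2 d z = 6 * (max 0 (1 - (z / d)\<^sup>2)) * (- 2 * z / d\<^sup>2)\<^sup>2 + 3 * (max 0 (1 - (z / d)\<^sup>2)) ^ 2 * (- 2 / d\<^sup>2)" for d z :: real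

lemma bump_deriv:
 assumes d: "d > 0"
 shows "(bump d has_real_derivative bump1 d z) (at z)" "(bump1 d has_real_derivative bump2 d z) (at z)"
proof -
 have i: "((%z. 1 - (z / d)\<^sup>2) has_real_derivative - 2 * z / d\<^sup>2) (at z)" for z
  using d by (auto intro!: derivative_eq_intros simp: power2_eq_square field_simps)
 show "(bump d has_real_derivative bump1 d z) (at z)"
  using DERIV_chain2[OF DERIV_pos_part_power[of 1] i] by (simp add: bump_def[abs_def] bump1_def eval_nat_numeral)
 have j: "((%z. (max 0 (1 - (z / d)\<^sup>2)) ^ 2) has_real_derivative 2 * (max 0 (1 - (z / d)\<^sup>2)) * (- 2 * z / d\<^sup>2)) (at z)"
  using DERIV_chain2[OF DERIV_pos_part_power[of 0] i] by (simp add: eval_nat_numeral)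
 have k: "((%z. - 2 * z / d\<^sup>2) has_real_derivative - 2 / d\<^sup>2) (at z)"
  using DERIV_cdivide[OF DERIV_cmult_Id[of "- 2" z UNIV], of "d\<^sup>2"] by simp
 from DERIV_cmult[OF DERIV_mult[OF j k], of 3]
 show "(bump1 d has_real_derivative bump2 d z) (at z)"
  by (rule DERIV_cong[OF DERIV_cong_ev[OF refl _ refl, THEN iffD1, rotated]])
   (auto simp: bump1_def[abs_def] bump2_def algebra_simps power2_eq_square)
qed

lemma bump_0: "bump d 0 = 1" "bump1 d 0 = 0" by (simp_all add: bump_def bump1_def)

lemma bump_outside:
 assumes "0 < d" "d <= \<bar>z\<bar>" shows "bump d z = 0" "bump1 d z = 0"
proof -
 have "(z / d)\<^sup>2 \<ge> 1" using assms by (simp add: abs_le_square_iff[of 1, simplified, symmetric])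
 then show "bump d z = 0" "bump1 d z = 0" by (auto simp: bump_def bump1_def max_def)
qed

text \<open>The bump is dominated by a Lorentzian, whose integral is elementary.\<close>

lemma bump_sq_le: "(bump d z)\<^sup>2 <= 1 / (1 + (z / d)\<^sup>2)"
proof -
 define t where "t = (z / d)\<^sup>2"
 define u where "u = max 0 (1 - t)"
 have t: "t \<ge> 0" by (simp add: t_def)
 have u: "0 <= u" "u <= 1" using t by (auto simp: u_def)
 have "(bump d z)\<^sup>2 = u ^ 6" by (simp add: bump_def u_def t_def flip: power_mult)
 also have "u ^ 6 <= u ^ 1" by (rule power_decreasing) (use u in auto)
 also have "u * (1 + t) <= 1" 
  using t by (auto simp: u_def max_def algebra_simps)
 then have "u ^ 1 <= 1 / (1 + t)" using t by (simp add: field_simps)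
 finally show ?thesis by (simp add: t_def)
qed

lemma integral_arctan_scale:
 assumes d: "d > 0" and ab: "a <= b"
 shows "(%z. 1 / (1 + (z / d)\<^sup>2)) integrable_on {a..b}" "integral {a..b} (%z. 1 / (1 + (z / d)\<^sup>2)) <= d * pi"
proof -
 have "((%z. 1 / (1 + (z / d)\<^sup>2)) has_integral d * arctan (b / d) - d * arctan (a / d)) {a..b}"
  by (rule fundamental_theorem_of_calculus[OF ab])
   (use d in \<open>auto intro!: derivative_eq_intros simp: has_real_derivative_iff_has_vector_derivative[symmetric] divide_inverse\<close>)
 moreover have "d * (arctan (b / d) - arctan (a / d)) <= d * pi"
  by (rule mult_left_mono) (use arctan_ubound[of "b/d"] arctan_lbound[of "a/d"] d in auto)
 ultimately show "(%z. 1 / (1 + (z / d)\<^sup>2)) integrable_on {a..b}" "integral {a..b} (%z. 1 / (1 + (z / d)\<^sup>2)) <= d * pi"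
  by (auto simp: integral_unique right_diff_distrib)
qed

context rt begin

lemma xi_c_iff: "r \<ge> 0 ==> ereal r < xi_c p \<longleftrightarrow> surf p * r\<^sup>2 < grav p * jump_rho p"
proof (cases "surf p = 0")
 case True then show ?thesis using g_pos jump_rho_pos by (simp add: xi_c_def)
next
 case False
 then have s: "surf p > 0" using surf_nonneg by simp
 assume r: "r \<ge> 0"
 have "ereal r < xi_c p \<longleftrightarrow> r < sqrt (grav p * jump_rho p / surf p)" using False by (simp add: xi_c_def)
 also have "\<dots> \<longleftrightarrow> r\<^sup>2 < grav p * jump_rho p / surf p" using r real_less_rsqrt real_sqrt_less_iff by (metis abs_of_nonneg real_sqrt_abs)
 also have "\<dots> \<longleftrightarrow> surf p * r\<^sup>2 < grav p * jump_rho p" using s by (simp add: field_simps)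
 finally show ?thesis .
qed

abbreviation dens0s where
 "dens0s r \<phi> \<psi> \<psi>' s x \<equiv> dpres p s x * rho p s x * (\<psi>' s x + r * \<phi> s x)\<^sup>2
  - 2 * grav p * rho p s x * r * \<phi> s x * \<psi> s x"

abbreviation dens1s where
 "dens1s r \<phi> \<phi>' \<psi> \<psi>' s x \<equiv> del0 p s x * (\<psi>' s x + r * \<phi> s x)\<^sup>2
  + eps0 p s x * ((\<phi>' s x - r * \<psi> s x)\<^sup>2 + (\<psi>' s x - r * \<phi> s x)\<^sup>2 + 1 / 3 * (\<psi>' s x + r * \<phi> s x)\<^sup>2)"

context
 fixes \<phi> \<phi>' \<psi> \<psi>' :: "side => real => real"
 assumes v: "vmode p \<phi> \<phi>'" "vmode p \<psi> \<psi>'"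
begin

lemmas mode_cont = vmode_cont[OF v(1)] vmode_cont[OF v(2)] coeff_cont

lemma E0_glue: "2 * E0 r (glue \<phi>) (glue \<psi>) (glue \<psi>') = surf p * r\<^sup>2 * (\<psi> Upper 0)\<^sup>2 + (\<Sum>s\<in>sides. integral (ivl p s) (dens0s r \<phi> \<psi> \<psi>' s))"
proof -
 have "(LBINT x:slab. dens0 r (glue \<phi>) (glue \<psi>) (glue \<psi>') x) = (\<Sum>s\<in>sides. integral (ivl p s) (dens0s r \<phi> \<psi> \<psi>' s))"
  unfolding dens0_def glue_def 
  by (rule set_integrable_glue(2)[where F="dens0s r \<phi> \<psi> \<psi>'"]) (intro continuous_intros mode_cont)
 then show ?thesis by (simp add: E0_def glue_def side_of_def)
qed

lemma E1_glue: "2 * E1 r (glue \<phi>) (glue \<phi>') (glue \<psi>) (glue \<psi>') = (\<Sum>s\<in>sides. integral (ivl p s) (dens1s r \<phi> \<phi>' \<psi> \<psi>' s))"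
proof -
 have "(LBINT x:slab. dens1 r (glue \<phi>) (glue \<phi>') (glue \<psi>) (glue \<psi>') x) = (\<Sum>s\<in>sides. integral (ivl p s) (dens1s r \<phi> \<phi>' \<psi> \<psi>' s))"
  unfolding dens1_def glue_def 
  by (rule set_integrable_glue(2)[where F="dens1s r \<phi> \<phi>' \<psi> \<psi>'"]) (intro continuous_intros mode_cont)
 then show ?thesis by (simp add: E1_def)
qed

lemma J_glue: "2 * energy_J p (glue \<phi>) (glue \<psi>) = (\<Sum>s\<in>sides. integral (ivl p s) (%x. rho p s x * ((\<phi> s x)\<^sup>2 + (\<psi> s x)\<^sup>2)))"
proof -
 have "(LBINT x:slab. rho p (side_of x) x * ((glue \<phi> x)\<^sup>2 + (glue \<psi> x)\<^sup>2)) = (\<Sum>s\<in>sides. integral (ivl p s) (%x. rho p s x * ((\<phi> s x)\<^sup>2 + (\<psi> s x)\<^sup>2)))"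
  unfolding glue_def 
  by (rule set_integrable_glue(2)[where F="%s x. rho p s x * ((\<phi> s x)\<^sup>2 + (\<psi> s x)\<^sup>2)"]) (intro continuous_intros mode_cont)
 then show ?thesis by (simp add: energy_J_def)
qed

text \<open>Completing the square: the gravitational term equals the total derivative of
  \<open>g \<rho>\<^sub>0 \<psi>\<^sup>2\<close> up to a square, and its jump at the interface is the destabilizing term.\<close>

lemma dens0_complete_square:
 "(\<Sum>s\<in>sides. integral (ivl p s) (dens0s r \<phi> \<psi> \<psi>' s)) =
 (\<Sum>s\<in>sides. integral (ivl p s) (%x. dpres p s x * rho p s x * (\<psi>' s x + r * \<phi> s x - grav p * \<psi> s x / dpres p s x)\<^sup>2))
  - grav p * jump_rho p * (\<psi> Upper 0)\<^sup>2"
proof -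
 let ?sq = "%s x. dpres p s x * rho p s x * (\<psi>' s x + r * \<phi> s x - grav p * \<psi> s x / dpres p s x)\<^sup>2"
 let ?d = "%s x. grav p * (- grav p * rho p s x / dpres p s x) * (\<psi> s x)\<^sup>2 + grav p * rho p s x * (2 * \<psi> s x * \<psi>' s x)"
 have nz: "x \<in> (ivl p s) ==> dpres p s x \<noteq> 0" for s x using dpres_pos[of x s] by auto
 have c1: "continuous_on (ivl p s) (?sq s)" for s
  by (intro continuous_intros mode_cont) (use nz in auto)
 have c2: "continuous_on (ivl p s) (?d s)" for s
  by (intro continuous_intros mode_cont) (use nz in auto)
 have "integral (ivl p s) (dens0s r \<phi> \<psi> \<psi>' s) = integral (ivl p s) (?sq s) + integral (ivl p s) (?d s)" for s
 proof -
  have "integral (ivl p s) (dens0s r \<phi> \<psi> \<psi>' s) = integral (ivl p s) (%x. ?sq s x + ?d s x)"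
   by (rule integral_cong) (use nz in \<open>auto simp: power2_eq_square field_simps\<close>)
  also have "\<dots> = integral (ivl p s) (?sq s) + integral (ivl p s) (?d s)"
   by (intro integral_add integrable_side c1 c2)
  finally show ?thesis .
 qed
 moreover have "(\<Sum>s\<in>sides. integral (ivl p s) (?d s)) = grav p * rho p Lower 0 * (\<psi> Lower 0)\<^sup>2 - grav p * rho p Upper 0 * (\<psi> Upper 0)\<^sup>2"
 proof (rule vmode_sum_deriv[where F="%s x. grav p * rho p s x * (\<psi> s x)\<^sup>2"])
  fix s z assume z: "z \<in> (ivl p s)"
  have "(\<psi> s has_real_derivative \<psi>' s z) (at z within (ivl p s))" using v(2) z by (auto simp: vmode_def)
  then show "((%x. grav p * rho p s x * (\<psi> s x)\<^sup>2) has_real_derivative ?d s z) (at z within (ivl p s))"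
   by (auto intro!: derivative_eq_intros DERIV_subset[OF rho_deriv[OF z]] simp: algebra_simps)
 qed (use v(2) in \<open>auto simp: vmode_def\<close>)
 moreover have "\<psi> Lower 0 = \<psi> Upper 0" using v(2) by (auto simp: vmode_def)
 ultimately show ?thesis by (simp add: rho_0 jump_rho_def algebra_simps)
qed

end

lemma E0_scale: "E0 r (%x. k * \<phi> x) (%x. k * \<psi> x) (%x. k * \<psi>' x) = k\<^sup>2 * E0 r \<phi> \<psi> \<psi>'"
proof -
 have "dens0 r (%x. k * \<phi> x) (%x. k * \<psi> x) (%x. k * \<psi>' x) = (%x. k\<^sup>2 * dens0 r \<phi> \<psi> \<psi>' x)"
  by (auto simp: dens0_def power2_eq_square algebra_simps)
 then show ?thesis by (simp add: E0_def power_mult_distrib algebra_simps)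
qed

lemma E1_scale: "E1 r (%x. k * \<phi> x) (%x. k * \<phi>' x) (%x. k * \<psi> x) (%x. k * \<psi>' x) = k\<^sup>2 * E1 r \<phi> \<phi>' \<psi> \<psi>'"
proof -
 have "dens1 r (%x. k * \<phi> x) (%x. k * \<phi>' x) (%x. k * \<psi> x) (%x. k * \<psi>' x) = (%x. k\<^sup>2 * dens1 r \<phi> \<phi>' \<psi> \<psi>' x)"
  by (auto simp: dens1_def power2_eq_square algebra_simps)
 then show ?thesis by (simp add: E1_def)
qed

lemma J_scale: "energy_J p (%x. k * \<phi> x) (%x. k * \<psi> x) = k\<^sup>2 * energy_J p \<phi> \<psi>"
proof -
 have "(%x. rho p (side_of x) x * ((k * \<phi> x)\<^sup>2 + (k * \<psi> x)\<^sup>2)) = (%x. k\<^sup>2 * (rho p (side_of x) x * ((\<phi> x)\<^sup>2 + (\<psi> x)\<^sup>2)))"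
  by (auto simp: power_mult_distrib algebra_simps)
 then show ?thesis by (simp add: energy_J_def)
qed

definition competitors :: "real => (real \<times> real) set" where
 "competitors r = {(E0 r \<phi> \<psi> \<psi>', E1 r \<phi> \<phi>' \<psi> \<psi>') | \<phi> \<phi>' \<psi> \<psi>'.
  H10 (- depth p) (height p) \<phi> \<phi>' \<and> H10 (- depth p) (height p) \<psi> \<psi>' \<and> energy_J p \<phi> \<psi> = 1}"

lemma mu_aff_inf: "mu p r s = aff_inf (competitors r) s"
proof -
 have "{energy_E p r s \<phi> \<phi>' \<psi> \<psi>' | \<phi> \<phi>' \<psi> \<psi>'.
  H10 (- depth p) (height p) \<phi> \<phi>' \<and> H10 (- depth p) (height p) \<psi> \<psi>' \<and> energy_J p \<phi> \<psi> = 1}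
  = (%(e0, e1). e0 + s * e1) ` competitors r" (is "?L = ?R")
 proof (intro equalityI subsetI)
  fix x assume "x \<in> ?L"
  then obtain \<phi> \<phi>' \<psi> \<psi>' where h: "H10 (- depth p) (height p) \<phi> \<phi>'" "H10 (- depth p) (height p) \<psi> \<psi>'" "energy_J p \<phi> \<psi> = 1"
   and x: "x = energy_E p r s \<phi> \<phi>' \<psi> \<psi>'" by blast
  have "(E0 r \<phi> \<psi> \<psi>', E1 r \<phi> \<phi>' \<psi> \<psi>') \<in> competitors r" using h unfolding competitors_def by blast
  then show "x \<in> ?R" unfolding x energy_split[OF h(1,2)] by force
 next
  fix x assume "x \<in> ?R"
  then obtain \<phi> \<phi>' \<psi> \<psi>' where h: "H10 (- depth p) (height p) \<phi> \<phi>'" "H10 (- depth p) (height p) \<psi> \<psi>'" "energy_J p \<phi> \<psi> = 1"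
   and x: "x = E0 r \<phi> \<psi> \<psi>' + s * E1 r \<phi> \<phi>' \<psi> \<psi>'" unfolding competitors_def by auto
  show "x \<in> ?L" unfolding x energy_split[OF h(1,2), symmetric] using h by blast
 qed
 then show ?thesis unfolding mu_def aff_inf_def by simp
qed

lemma competitors_mode:
 assumes v: "vmode p \<phi> \<phi>'" "vmode p \<psi> \<psi>'" and J: "energy_J p (glue \<phi>) (glue \<psi>) > 0"
 shows "(E0 r (glue \<phi>) (glue \<psi>) (glue \<psi>') / energy_J p (glue \<phi>) (glue \<psi>),
   E1 r (glue \<phi>) (glue \<phi>') (glue \<psi>) (glue \<psi>') / energy_J p (glue \<phi>) (glue \<psi>)) \<in> competitors r"
proof -
 define k where "k = 1 / sqrt (energy_J p (glue \<phi>) (glue \<psi>))"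
 have k2: "k\<^sup>2 = 1 / energy_J p (glue \<phi>) (glue \<psi>)" using J by (simp add: k_def power_divide)
 have g: "(%x. k * glue f x) = glue (%s x. k * f s x)" for f by (simp add: glue_def fun_eq_iff)
 note H = H10_glue[OF vmode_scale[OF v(1), of k], folded g] H10_glue[OF vmode_scale[OF v(2), of k], folded g]
 have "energy_J p (%x. k * glue \<phi> x) (%x. k * glue \<psi> x) = 1" using J by (simp add: J_scale k2)
 then have "(E0 r (%x. k * glue \<phi> x) (%x. k * glue \<psi> x) (%x. k * glue \<psi>' x),
  E1 r (%x. k * glue \<phi> x) (%x. k * glue \<phi>' x) (%x. k * glue \<psi> x) (%x. k * glue \<psi>' x)) \<in> competitors r"
  using H unfolding competitors_def by blast
 then show ?thesis unfolding E0_scale E1_scale k2 by simp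
qed

text \<open>For subcritical frequencies a vertical displacement concentrated near the interface,
  with divergence-free horizontal compensation, has negative energy.\<close>

lemma unstable_competitor:
 assumes r: "r > 0" and sub: "surf p * r\<^sup>2 < grav p * jump_rho p"
 shows "\<exists>(e0, e1)\<in>competitors r. e0 < 0"
proof -
 have "\<exists>b>0. \<forall>z\<in>(ivl p s). (grav p)\<^sup>2 * rho p s z / dpres p s z <= b" for s
  using dpres_pos[of _ s] rho_pos[of _ s] g_pos
  by (intro pos_bounds(2)) (force intro!: continuous_intros coeff_cont divide_pos_pos mult_pos_pos)+
 then obtain M where M: "\<And>s. M s > 0" "\<And>s z. z\<in>(ivl p s) ==> (grav p)\<^sup>2 * rho p s z / dpres p s z <= M s" by metis
 define K where "K = (\<Sum>s\<in>sides. M s * pi)"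
 have K: "K > 0" using M(1)[of Lower] M(1)[of Upper] by (simp add: K_def add_pos_pos)
 define gap where "gap = grav p * jump_rho p - surf p * r\<^sup>2"
 have gap: "gap > 0" using sub by (simp add: gap_def)
 define d where "d = min (min (depth p) (height p)) (gap / (2 * K))"
 have d: "d > 0" "d <= depth p" "d <= height p" using depth_pos height_pos gap K by (auto simp: d_def)
 have "d <= gap / (2 * K)" by (simp add: d_def)
 then have dK: "K * d < gap" using K gap by (simp add: field_simps)
 define \<psi> where "\<psi> = (%s::side. bump d)"
 define \<psi>' where "\<psi>' = (%s::side. bump1 d)"
 define \<phi> where "\<phi> = (%(s::side) z. - bump1 d z / r)"
 define \<phi>' where "\<phi>' = (%(s::side) z. - bump2 d z / r)"
 have c2: "continuous_on A (bump2 d)" for A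
  using d by (auto simp: bump2_def[abs_def] intro!: continuous_intros)
 have c1: "continuous_on A (bump1 d)" for A
  using bump_deriv(2)[OF d(1)] by (blast intro: continuous_at_imp_continuous_on DERIV_isCont)
 have v1: "vmode p \<psi> \<psi>'"
  using d bump_deriv(1)[OF d(1)] by (auto simp: vmode_def \<psi>_def \<psi>'_def bump_outside c1 intro!: DERIV_subset[OF bump_deriv(1)[OF d(1)]])
 have v2: "vmode p \<phi> \<phi>'"
  using d r by (auto simp: vmode_def \<phi>_def \<phi>'_def bump_outside intro!: derivative_eq_intros continuous_intros c2 DERIV_subset[OF bump_deriv(2)[OF d(1)]])
 have "(\<Sum>s\<in>sides. integral (ivl p s) (%x. dpres p s x * rho p s x * (\<psi>' s x + r * \<phi> s x - grav p * \<psi> s x / dpres p s x)\<^sup>2)) <= (\<Sum>s\<in>sides. M s * (d * pi))"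
 proof (rule sum_mono)
  fix s
  let ?f = "%x. dpres p s x * rho p s x * (\<psi>' s x + r * \<phi> s x - grav p * \<psi> s x / dpres p s x)\<^sup>2"
  note ar = integral_arctan_scale[OF d(1), of "zlo p s" "zhi p s"]
  have "integral (ivl p s) ?f <= integral (ivl p s) (%z. M s * (1 / (1 + (z / d)\<^sup>2)))"
  proof (rule integral_le)
   have "dpres p s x \<noteq> 0" if "x \<in> (ivl p s)" for x using dpres_pos[OF that] by simp
   then show "?f integrable_on (ivl p s)"
    by (intro integrable_side continuous_intros vmode_cont[OF v1] vmode_cont[OF v2] coeff_cont) auto
   show "(%z. M s * (1 / (1 + (z / d)\<^sup>2))) integrable_on (ivl p s)"
    using ar(1) zlo_less_zhi[of s] by (intro integrable_on_mult_right) simp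
   fix x assume x: "x \<in> (ivl p s)"
   have "?f x = ((grav p)\<^sup>2 * rho p s x / dpres p s x) * (bump d x)\<^sup>2"
    using dpres_pos[OF x] r by (simp add: \<psi>_def \<psi>'_def \<phi>_def power2_eq_square field_simps)
   also have "\<dots> <= M s * (1 / (1 + (x / d)\<^sup>2))"
    using M(2)[OF x] bump_sq_le[of d x] M(1)[of s] by (intro mult_mono) auto
   finally show "?f x <= M s * (1 / (1 + (x / d)\<^sup>2))" .
  qed
  also have "\<dots> = M s * integral (ivl p s) (%z. 1 / (1 + (z / d)\<^sup>2))" by (rule integral_mult_right)
  also have "\<dots> <= M s * (d * pi)"
   using ar(2) zlo_less_zhi[of s] M(1)[of s] by (intro mult_left_mono) auto
  finally show "integral (ivl p s) ?f <= M s * (d * pi)" .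
 qed
 also have "\<dots> = K * d" by (simp add: K_def algebra_simps)
 also have "\<dots> < gap" by (rule dK)
 finally have "2 * E0 r (glue \<phi>) (glue \<psi>) (glue \<psi>') < 0"
  unfolding E0_glue[OF v2 v1] dens0_complete_square[OF v2 v1]
  by (simp add: \<psi>_def bump_0 gap_def)
 then have neg: "E0 r (glue \<phi>) (glue \<psi>) (glue \<psi>') < 0" by simp
 have "- (grav p * r) * energy_J p (glue \<phi>) (glue \<psi>) < 0"
  using E0_ge[OF H10_glue[OF v2] H10_glue[OF v1], of r] r neg by simp
 then have J: "energy_J p (glue \<phi>) (glue \<psi>) > 0"
  using g_pos r by (simp add: mult_less_0_iff zero_less_mult_iff)
 show ?thesis
  using competitors_mode[OF v2 v1 J, of r] divide_neg_pos[OF neg J] by auto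
qed

lemma rate_const: "\<exists>c\<ge>0. \<forall>s. \<forall>x\<in>(ivl p s). (grav p)\<^sup>2 * rho p s x <= c * eps0 p s x"
proof -
 have "\<exists>b>0. \<forall>z\<in>(ivl p s). (grav p)\<^sup>2 * rho p s z / eps0 p s z <= b" for s
  using eps0_pos[of _ s] rho_pos[of _ s] g_pos
  by (intro pos_bounds(2)) (force intro!: continuous_intros coeff_cont divide_pos_pos mult_pos_pos)+
 then obtain M where M: "\<And>s. M s > 0" "\<And>s z. z\<in>(ivl p s) ==> (grav p)\<^sup>2 * rho p s z / eps0 p s z <= M s" by metis
 have "(grav p)\<^sup>2 * rho p s x <= max (M Lower) (M Upper) * eps0 p s x" if x: "x\<in>(ivl p s)" for s x
 proof -
  have "M s <= max (M Lower) (M Upper)" by (cases s) auto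
  then have "(grav p)\<^sup>2 * rho p s x / eps0 p s x <= max (M Lower) (M Upper)" using M(2)[OF x] by linarith
  then show ?thesis using eps0_pos[OF x] by (simp add: pos_divide_le_eq)
 qed
 moreover have "max (M Lower) (M Upper) \<ge> 0" using M(1)[of Lower] by linarith
 ultimately show ?thesis by blast
qed

text \<open>Below the critical frequency the competitors of one frequency form an affine family, so the abstract
  fixed point is the growth rate.\<close>

lemma growth_facts:
 assumes c: "\<And>s x. x \<in> (ivl p s) ==> (grav p)\<^sup>2 * rho p s x <= c * eps0 p s x" "c \<ge> 0"
  and r: "r > 0" "ereal r < xi_c p"
 shows "growth p r > 0" "growth p r ^ 3 <= c"
  "\<And>t a b. t \<ge> growth p r ==> (a, b) \<in> competitors r ==> a + t * b \<ge> - t\<^sup>2"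
proof -
 interpret A: affine_family "competitors r" "grav p * r" c
 proof
  fix e0 e1 assume "(e0, e1) \<in> competitors r"
  then obtain \<phi> \<phi>' \<psi> \<psi>' where h: "H10 (- depth p) (height p) \<phi> \<phi>'" "H10 (- depth p) (height p) \<psi> \<psi>'" "energy_J p \<phi> \<psi> = 1"
   and x: "e0 = E0 r \<phi> \<psi> \<psi>'" "e1 = E1 r \<phi> \<phi>' \<psi> \<psi>'" unfolding competitors_def by auto
  show "e1 \<ge> 0" using E1_nonneg[OF h(1,2)] x by simp
  show "e0 \<ge> - (grav p * r)" using E0_ge[OF h(1,2), of r] r x h(3) by simp
  show "e0 + s * e1 \<ge> - c / s" if "s > 0" for s
   using E_ge[OF h(1,2) that c, of r] x h(3) by simp
 next
  show "\<exists>(e0, e1)\<in>competitors r. e0 < 0"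
   using unstable_competitor[OF r(1)] xi_c_iff[of r] r by simp
 qed
 have g: "growth p r > 0 \<and> aff_inf (competitors r) (growth p r) < 0 \<and> growth p r = sqrt (- aff_inf (competitors r) (growth p r))"
  unfolding growth_def mu_aff_inf by (rule theI'[OF A.fixed_point(1)])
 then show "growth p r > 0" by blast
 show "growth p r ^ 3 <= c" "\<And>t a b. t \<ge> growth p r ==> (a, b) \<in> competitors r ==> a + t * b \<ge> - t\<^sup>2"
  using A.fixed_point(2)[OF g] by auto
qed

text \<open>At a rate not below the growth rate of a frequency, the energy of every mode of that
  frequency is compensated by the kinetic part.\<close>

lemma mode_energy_nonneg:
 assumes r: "r \<ge> 0" and L: "L > 0" and gr: "0 < r ==> ereal r < xi_c p ==> growth p r <= L"
  and v: "vmode p \<phi> \<phi>'" "vmode p \<psi> \<psi>'"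
 shows "0 <= surf p * r\<^sup>2 * (\<psi> Upper 0)\<^sup>2 + (\<Sum>s\<in>sides. integral (ivl p s)
  (%x. dens0s r \<phi> \<psi> \<psi>' s x + L * dens1s r \<phi> \<phi>' \<psi> \<psi>' s x + L\<^sup>2 * (rho p s x * ((\<phi> s x)\<^sup>2 + (\<psi> s x)\<^sup>2))))"
proof -
 let ?J = "energy_J p (glue \<phi>) (glue \<psi>)" and ?E0 = "E0 r (glue \<phi>) (glue \<psi>) (glue \<psi>')" and ?E1 = "E1 r (glue \<phi>) (glue \<phi>') (glue \<psi>) (glue \<psi>')"
 note mc = vmode_cont[OF v(1)] vmode_cont[OF v(2)] coeff_cont
 have J0: "?J \<ge> 0"
 proof -
  have "(\<Sum>s\<in>sides. integral (ivl p s) (%x. rho p s x * ((\<phi> s x)\<^sup>2 + (\<psi> s x)\<^sup>2))) \<ge> 0"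
   by (intro sum_nonneg integral_side_nonneg) (use rho_pos less_imp_le in \<open>blast intro!: mult_nonneg_nonneg add_nonneg_nonneg zero_le_power2\<close>)
  then show ?thesis using J_glue[OF v] by simp
 qed
 have E1: "?E1 \<ge> 0" by (rule E1_nonneg[OF H10_glue[OF v(1)] H10_glue[OF v(2)]])
 have main: "?E0 + L * ?E1 + L\<^sup>2 * ?J \<ge> 0"
 proof (cases "r = 0")
  case True
  have "?E0 \<ge> 0" using E0_ge[OF H10_glue[OF v(1)] H10_glue[OF v(2)], of 0] True by simp
  then show ?thesis using E1 J0 L by simp
 next
  case False
  then have r: "r > 0" using r by simp
  show ?thesis
  proof (cases "ereal r < xi_c p")
   case True
   show ?thesis
   proof (cases "?J = 0")
    case J: True
    have "?E0 \<ge> 0" using E0_ge[OF H10_glue[OF v(1)] H10_glue[OF v(2)], of r] r J by simp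
    then show ?thesis using E1 J0 L by simp
   next
    case False
    then have J: "?J > 0" using J0 by simp
    obtain c where c: "c \<ge> 0" "\<And>s x. x \<in> (ivl p s) ==> (grav p)\<^sup>2 * rho p s x <= c * eps0 p s x"
     using rate_const by blast
    have "?E0 / ?J + L * (?E1 / ?J) \<ge> - L\<^sup>2"
     by (rule growth_facts(3)[OF c(2,1) r True gr[OF r True] competitors_mode[OF v J]])
    then have "0 <= (?E0 / ?J + L * (?E1 / ?J) + L\<^sup>2) * ?J" using J by simp
    also have "\<dots> = ?E0 + L * ?E1 + L\<^sup>2 * ?J" using J by (simp add: distrib_right)
    finally show ?thesis .
   qed
  next
   case False
   then have sup: "surf p * r\<^sup>2 \<ge> grav p * jump_rho p" using xi_c_iff[of r] r by simp
   have "(\<Sum>s\<in>sides. integral (ivl p s) (%x. dpres p s x * rho p s x * (\<psi>' s x + r * \<phi> s x - grav p * \<psi> s x / dpres p s x)\<^sup>2)) \<ge> 0"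
    by (intro sum_nonneg integral_side_nonneg mult_nonneg_nonneg) (use rho_pos dpres_pos in \<open>auto intro!: less_imp_le\<close>)
   moreover have "(surf p * r\<^sup>2 - grav p * jump_rho p) * (\<psi> Upper 0)\<^sup>2 \<ge> 0" using sup by simp
   ultimately have "2 * ?E0 \<ge> 0"
    unfolding E0_glue[OF v] dens0_complete_square[OF v] by (simp add: algebra_simps)
   then show ?thesis using E1 J0 L by simp
  qed
 qed
 have "integral (ivl p s) (%x. dens0s r \<phi> \<psi> \<psi>' s x + L * dens1s r \<phi> \<phi>' \<psi> \<psi>' s x + L\<^sup>2 * (rho p s x * ((\<phi> s x)\<^sup>2 + (\<psi> s x)\<^sup>2)))
  = integral (ivl p s) (dens0s r \<phi> \<psi> \<psi>' s) + L * integral (ivl p s) (dens1s r \<phi> \<phi>' \<psi> \<psi>' s)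
   + L\<^sup>2 * integral (ivl p s) (%x. rho p s x * ((\<phi> s x)\<^sup>2 + (\<psi> s x)\<^sup>2))" for s
 proof -
  have i: "dens0s r \<phi> \<psi> \<psi>' s integrable_on (ivl p s)" "(%x. L * dens1s r \<phi> \<phi>' \<psi> \<psi>' s x) integrable_on (ivl p s)"
   "(%x. L\<^sup>2 * (rho p s x * ((\<phi> s x)\<^sup>2 + (\<psi> s x)\<^sup>2))) integrable_on (ivl p s)"
   by (intro integrable_side continuous_intros mc)+
  show ?thesis
   by (subst integral_add[OF integrable_add[OF i(1,2)] i(3)], subst integral_add[OF i(1,2)]) (simp only: integral_mult_right)
 qed
 then have "(\<Sum>s\<in>sides. integral (ivl p s) (%x. dens0s r \<phi> \<psi> \<psi>' s x + L * dens1s r \<phi> \<phi>' \<psi> \<psi>' s x + L\<^sup>2 * (rho p s x * ((\<phi> s x)\<^sup>2 + (\<psi> s x)\<^sup>2))))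
  = (\<Sum>s\<in>sides. integral (ivl p s) (dens0s r \<phi> \<psi> \<psi>' s)) + L * (2 * ?E1) + L\<^sup>2 * (2 * ?J)"
  by (simp only: E1_glue[OF v] J_glue[OF v] sum.distrib sum_distrib_left)
 then show ?thesis using main E0_glue[OF v, of r] by simp
qed

lemma growth_max_facts:
 "growth_max p > 0" "0 < r ==> ereal r < xi_c p ==> growth p r <= growth_max p"
proof -
 obtain c where c: "c \<ge> 0" "\<And>s x. x \<in> (ivl p s) ==> (grav p)\<^sup>2 * rho p s x <= c * eps0 p s x"
  using rate_const by blast
 have b: "growth p r <= 1 + c" if "0 < r" "ereal r < xi_c p" for r
 proof (rule ccontr)
  assume "\<not> ?thesis"
  then have "growth p r > 1 + c" by simp
  moreover have "growth p r ^ 1 <= growth p r ^ 3" by (rule power_increasing) (use calculation c(1) in auto)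
  ultimately show False using growth_facts(2)[OF c(2,1) that] by simp
 qed
 have xc: "xi_c p > 0" using xi_c_iff[of 0] g_pos jump_rho_pos by (simp add: zero_ereal_def)
 have bdd: "bdd_above (growth_ext p ` {0..xi_c p})"
 proof (rule bdd_aboveI2)
  fix e :: ereal
  show "growth_ext p e <= 1 + c"
  proof (cases "0 < e \<and> e < xi_c p")
   case True
   then obtain r where "e = ereal r" by (cases e) auto
   then show ?thesis using True b[of r] by (simp add: growth_ext_def)
  qed (use c(1) in \<open>auto simp: growth_ext_def\<close>)
 qed
 show le: "growth p r <= growth_max p" if "0 < r" "ereal r < xi_c p" for r
 proof -
  have "growth_ext p (ereal r) <= growth_max p" unfolding growth_max_def
   by (rule cSUP_upper[OF _ bdd]) (use that in auto)
  then show ?thesis using that by (simp add: growth_ext_def)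
 qed
 obtain e where e: "0 < e" "e < xi_c p" using dense[OF xc] by blast
 then obtain r where "e = ereal r" by (cases e) auto
 then have r: "0 < r" "ereal r < xi_c p" using e by auto
 show "growth_max p > 0" using growth_facts(1)[OF c(2,1) r] le[OF r] by linarith
qed

text \<open>The smallest nonzero frequency of the cell is \<open>1 / L\<close>; the condition on
  \<open>L\<close> says that it is subcritical.\<close>

lemma growth_sup_per_facts:
 assumes L: "L > 0" "sqrt (surf p / (grav p * jump_rho p)) < L"
 shows "growth_sup_per p L > 0"
  "0 < norm (of_int a / L, of_int b / L) ==> ereal (norm (of_int a / L, of_int b / L)) < xi_c p ==>
   growth p (norm (of_int a / L, of_int b / L)) <= growth_sup_per p L"
proof -
 let ?S = "{growth p (norm \<xi>) | \<xi> :: real \<times> real.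
   (\<exists>a b :: int. \<xi> = (of_int a / L, of_int b / L)) \<and> 0 < norm \<xi> \<and> ereal (norm \<xi>) < xi_c p}"
 have bdd: "bdd_above ?S"
  by (rule bdd_aboveI[of _ "growth_max p"]) (use growth_max_facts(2) in auto)
 show le: "growth p (norm (of_int a / L, of_int b / L)) <= growth_sup_per p L"
  if "0 < norm (of_int a / L, of_int b / L)" "ereal (norm (of_int a / L, of_int b / L)) < xi_c p" for a b
  unfolding growth_sup_per_def by (rule cSup_upper[OF _ bdd]) (use that in blast)
 have gp: "grav p * jump_rho p > 0" using g_pos jump_rho_pos by simp
 have "surf p / (grav p * jump_rho p) < L\<^sup>2"
  using L real_sqrt_less_iff[of "surf p / (grav p * jump_rho p)" "L\<^sup>2"] by simp
 then have "surf p * (1 / L)\<^sup>2 < grav p * jump_rho p" using L gp by (simp add: field_simps power2_eq_square)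
 then have x: "ereal (1 / L) < xi_c p" using xi_c_iff[of "1 / L"] L by simp
 obtain c where c: "c \<ge> 0" "\<And>s x. x \<in> (ivl p s) ==> (grav p)\<^sup>2 * rho p s x <= c * eps0 p s x"
  using rate_const by blast
 have n: "norm (of_int 1 / L, of_int 0 / L :: real) = 1 / L" using L by (simp add: norm_Pair)
 show "growth_sup_per p L > 0"
  using le[of 1 0] growth_facts(1)[OF c(2,1), of "1 / L"] x L unfolding n by simp
qed

end


section \<open>Positive trigonometric kernels\<close>

inductive postrig :: "real => (real \<times> real => real) => bool" for w where
 base: "postrig w (%(x, y). cos (w * (of_int m * x + of_int k * y)))"
| add: "postrig w F ==> postrig w G ==> postrig w (%x. F x + G x)"
| scale: "postrig w F ==> c \<ge> 0 ==> postrig w (%x. c * F x)"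

text \<open>Finite combinations of horizontal cosines with nonnegative coefficients are closed under
  multiplication by such cosines, by the product-to-sum formula.\<close>

lemma postrig_mult_cos:
 assumes "postrig w F" 
 shows "postrig w (%(x, y). F (x, y) * cos (w * (of_int m * x + of_int k * y)))"
 using assms
proof induction
 case (base m' k')
 have "(%(x, y). (%(x, y). cos (w * (of_int m' * x + of_int k' * y))) (x, y) * cos (w * (of_int m * x + of_int k * y)))
  = (%x. 1/2 * (%(x, y). cos (w * (of_int (m' - m) * x + of_int (k' - k) * y))) x + 1/2 * (%(x, y). cos (w * (of_int (m' + m) * x + of_int (k' + k) * y))) x)"
 proof (clarsimp simp: fun_eq_iff)
  fix x y :: real
  let ?A = "w * (of_int m' * x + of_int k' * y)" and ?B = "w * (of_int m * x + of_int k * y)"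
  have "cos ?A * cos ?B = cos (?A - ?B) / 2 + cos (?A + ?B) / 2" by (simp add: cos_times_cos add_divide_distrib)
  also have "?A - ?B = w * ((of_int m' - of_int m) * x + (of_int k' - of_int k) * y)" by (simp add: algebra_simps)
  also have "?A + ?B = w * ((of_int m' + of_int m) * x + (of_int k' + of_int k) * y)" by (simp add: algebra_simps)
  finally show "cos ?A * cos ?B = cos (w * ((of_int m' - of_int m) * x + (of_int k' - of_int k) * y)) / 2 +
   cos (w * ((of_int m' + of_int m) * x + (of_int k' + of_int k) * y)) / 2" .
 qed
 then show ?case by (simp only:) (intro postrig.intros; simp)
next
 case (add F G)
 have "(%(x, y). (F (x, y) + G (x, y)) * cos (w * (of_int m * x + of_int k * y)))
  = (%x. (%(x, y). F (x, y) * cos (w * (of_int m * x + of_int k * y))) x + (%(x, y). G (x, y) * cos (w * (of_int m * x + of_int k * y))) x)"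
  by (auto simp: fun_eq_iff algebra_simps)
 then show ?case using postrig.add[OF add.IH] by simp
next
 case (scale F c)
 have "(%(x, y). (c * F (x, y)) * cos (w * (of_int m * x + of_int k * y)))
  = (%x. c * (%(x, y). F (x, y) * cos (w * (of_int m * x + of_int k * y))) x)"
  by (auto simp: fun_eq_iff algebra_simps)
 then show ?case using postrig.scale[OF scale.IH scale.hyps(2)] by simp
qed

text \<open>A power of \<open>(1 + cos)(1 + cos)\<close>: nonnegative, concentrated at the lattice points, and
  with nonnegative Fourier coefficients.\<close>

definition ckern :: "real => nat => real \<times> real => real" where
 "ckern w n = (%(x, y). (1 + cos (w * x)) ^ n * (1 + cos (w * y)) ^ n)"

lemma postrig_ckern: "postrig w (ckern w n)"
proof (induction n)
 case 0
 have "ckern w 0 = (%(x, y). cos (w * (of_int 0 * x + of_int 0 * y)))" by (auto simp: ckern_def fun_eq_iff)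
 then show ?case by (simp only: postrig.base)
next
 case (Suc n)
 let ?c1 = "%F. %(x, y). F (x, y) * cos (w * (of_int 1 * x + of_int 0 * y))"
 let ?c2 = "%F. %(x, y). F (x, y) * cos (w * (of_int 0 * x + of_int 1 * y))"
 have 1: "postrig w (%x. ckern w n x + ?c1 (ckern w n) x)"
  by (rule postrig.add[OF Suc postrig_mult_cos[OF Suc]])
 have 2: "postrig w (%x. (%x. ckern w n x + ?c1 (ckern w n) x) x + ?c2 (%x. ckern w n x + ?c1 (ckern w n) x) x)"
  by (rule postrig.add[OF 1 postrig_mult_cos[OF 1]])
 have "ckern w (Suc n) = (%x. (%x. ckern w n x + ?c1 (ckern w n) x) x + ?c2 (%x. ckern w n x + ?c1 (ckern w n) x) x)"
  by (auto simp: ckern_def fun_eq_iff algebra_simps)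
 then show ?case using 2 by simp
qed

lemma postrig_continuous: "postrig w F ==> continuous_on UNIV F"
proof (induction rule: postrig.induct)
 case (base m k) show ?case unfolding case_prod_beta by (intro continuous_intros)
qed (intro continuous_intros; assumption)+

lemma integrable_hbox: "continuous_on (hbox a b) f ==> (f :: real \<times> real => 'b::banach) integrable_on hbox a b"
 unfolding hbox_def by (rule integrable_continuous)

lemma integrable_box3: "continuous_on (box3 a b c d) f ==> (f :: real^3 => 'b::banach) integrable_on box3 a b c d"
 unfolding box3_def by (rule integrable_continuous)

lemma continuous_on_shift_kernel:
 fixes K :: "real \<times> real => real"
 assumes "continuous_on UNIV K" shows "continuous_on A (%z. K (x - z))"
 by (rule continuous_on_compose2[OF assms continuous_on_diff[OF continuous_on_const continuous_on_id]]) simp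

text \<open>A full period of a nonconstant oscillation integrates to zero, so the mass of the kernel
  over a period cell does not depend on the centre.\<close>

lemma integral_cos_shift:
 assumes ab: "a < b" and w: "w = 2 * pi / (b - a)"
 shows "\<exists>c. \<forall>x y. integral (hbox a b) (%(u, v). cos (w * (of_int m * (x - u) + of_int k * (y - v)))) = c"
proof -
 have c: "continuous_on (hbox a b) (%(u, v). cos (w * (of_int m * (x - u) + of_int k * (y - v))))" for x y
  unfolding case_prod_beta by (intro continuous_intros)
 have w0: "w \<noteq> 0" using ab w by auto
 have per: "sin (w * (of_int m * (x - b) + r)) = sin (w * (of_int m * (x - a) + r))" for x r :: real and m :: int
 proof -
  have "w * (of_int m * (x - a) + r) = w * (of_int m * (x - b) + r) + w * (b - a) * of_int m" by (simp add: algebra_simps)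
  also have "w * (b - a) = 2 * pi" using w ab by simp
  also have "sin (w * (of_int m * (x - b) + r) + 2 * pi * of_int m) = sin (w * (of_int m * (x - b) + r))"
   using sin_integer_2pi[of "of_int m"] cos_integer_2pi[of "of_int m"] by (simp add: sin_add)
  finally show ?thesis by simp
 qed
 have 0: "integral {a..b} (%u. cos (w * (of_int m * (x - u) + r))) = 0" if "m \<noteq> 0" for x r :: real and m :: int
 proof -
  have "((%u. cos (w * (of_int m * (x - u) + r))) has_integral
   - sin (w * (of_int m * (x - b) + r)) / (w * of_int m) - - sin (w * (of_int m * (x - a) + r)) / (w * of_int m)) {a..b}"
   by (rule fundamental_theorem_of_calculus)
    (use ab w0 that in \<open>auto intro!: derivative_eq_intros simp: has_real_derivative_iff_has_vector_derivative[symmetric]\<close>)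
  then show ?thesis by (simp add: per integral_unique)
 qed
 have it1: "integral (hbox a b) (%(u, v). cos (w * (of_int m * (x - u) + of_int k * (y - v))))
  = integral (cbox a b) (%v. integral (cbox a b) (%u. cos (w * (of_int m * (x - u) + of_int k * (y - v)))))" 
 and it2: "integral (hbox a b) (%(u, v). cos (w * (of_int m * (x - u) + of_int k * (y - v))))
  = integral (cbox a b) (%u. integral (cbox a b) (%v. cos (w * (of_int m * (x - u) + of_int k * (y - v)))))" for x y
  using integral_prod_continuous[OF c[unfolded hbox_def], of x y] integral_swap_continuous[OF c[unfolded hbox_def], of x y]
  by (simp_all add: hbox_def)
 consider "m \<noteq> 0" | "k \<noteq> 0" | "m = 0" "k = 0" by blast
 then show ?thesis
 proof cases
  case 1
  then show ?thesis by (intro exI[of _ 0] allI) (simp add: it1 0)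
 next
  case 2
  have "integral {a..b} (%v. cos (w * (of_int m * (x - u) + of_int k * (y - v)))) = 0" for x y u
   using 0[OF 2, of y "of_int m * (x - u)"] by (simp add: add.commute)
  then show ?thesis by (intro exI[of _ 0] allI) (simp add: it2)
 qed auto
qed

lemma postrig_mass:
 assumes "postrig w F" and ab: "a < b" and w: "w = 2 * pi / (b - a)"
 shows "\<exists>c. \<forall>x. integral (hbox a b) (%z. F (x - z)) = c"
 using assms(1)
proof induction
 case (base m k)
 obtain c where c: "\<And>x y. integral (hbox a b) (%(u, v). cos (w * (of_int m * (x - u) + of_int k * (y - v)))) = c"
  using integral_cos_shift[OF ab w, of m k] by blast
 show ?case
 proof (intro exI allI)
  fix X :: "real \<times> real"
  show "integral (hbox a b) (%z. (%(x, y). cos (w * (of_int m * x + of_int k * y))) (X - z)) = c"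
   using c[of "fst X" "snd X"] by (simp add: case_prod_unfold)
 qed
next
 case (add F G)
 have i: "(%z. F (x - z)) integrable_on hbox a b" "(%z. G (x - z)) integrable_on hbox a b" for x
  by (rule integrable_hbox[OF continuous_on_shift_kernel[OF postrig_continuous[OF add.hyps(1)]]])
   (rule integrable_hbox[OF continuous_on_shift_kernel[OF postrig_continuous[OF add.hyps(2)]]])
 obtain c d where "\<And>x. integral (hbox a b) (%z. F (x - z)) = c" "\<And>x. integral (hbox a b) (%z. G (x - z)) = d"
  using add.IH by blast
 then have "\<And>x. integral (hbox a b) (%z. F (x - z) + G (x - z)) = c + d"
  by (simp only: integral_add[OF i])
 then show ?case by blast
next
 case (scale F c) 
 then obtain d where "\<And>x. integral (hbox a b) (%z. F (x - z)) = d" by blast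
 then have "\<And>x. integral (hbox a b) (%z. c * F (x - z)) = c * d" by (simp only: integral_mult_right)
 then show ?case by blast
qed

definition cmass :: "real => real => nat => real" where
 "cmass a b n = integral (hbox a b) (%z. ckern (2 * pi / (b - a)) n (- z))"

lemma cmass_eq: "a < b ==> integral (hbox a b) (%z. ckern (2 * pi / (b - a)) n (x - z)) = cmass a b n"
proof -
 assume "a < b"
 from postrig_mass[OF postrig_ckern this refl, of n] 
 obtain c where c: "\<And>x. integral (hbox a b) (%z. ckern (2 * pi / (b - a)) n (x - z)) = c" by blast
 show ?thesis using c[of x] c[of 0] by (simp add: cmass_def)
qed

lemma ckern_nonneg: "ckern w n x \<ge> 0"
proof -
 have "1 + cos u \<ge> 0" for u :: real using cos_ge_minus_one[of u] by linarith
 then show ?thesis unfolding ckern_def case_prod_beta by (intro mult_nonneg_nonneg zero_le_power)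
qed

lemma ckern_cont: "continuous_on A (%z. ckern w n (x - z))"
 by (rule continuous_on_shift_kernel[OF postrig_continuous[OF postrig_ckern]])

lemma ckern_ge:
 assumes "\<bar>w * fst y\<bar> <= t" "\<bar>w * snd y\<bar> <= t" "t <= pi"
 shows "((1 + cos t)\<^sup>2) ^ n <= ckern w n y"
proof -
 have c: "cos t <= cos u" if "\<bar>u\<bar> <= t" for u
  using cos_monotone_0_pi_le[of "\<bar>u\<bar>" t] that assms(3) by simp
 have "1 + cos t \<ge> 0" using cos_ge_minus_one[of t] by linarith
 then have "(1 + cos t) ^ n * (1 + cos t) ^ n <= (1 + cos (w * fst y)) ^ n * (1 + cos (w * snd y)) ^ n"
  using c[OF assms(1)] c[OF assms(2)] by (intro mult_mono power_mono) auto
 then show ?thesis by (simp add: ckern_def case_prod_beta power2_eq_square power_mult_distrib)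
qed

lemma ckern_le:
 assumes "(t <= \<bar>w * fst y\<bar> \<and> \<bar>w * fst y\<bar> <= 2 * pi - t) \<or> (t <= \<bar>w * snd y\<bar> \<and> \<bar>w * snd y\<bar> <= 2 * pi - t)"
  and t: "0 <= t" "t <= pi"
 shows "ckern w n y <= (2 * (1 + cos t)) ^ n"
proof -
 have far: "cos u <= cos t" if "t <= \<bar>u\<bar>" "\<bar>u\<bar> <= 2 * pi - t" for u :: real
 proof (cases "\<bar>u\<bar> <= pi")
  case True
  then show ?thesis using cos_monotone_0_pi_le[of t "\<bar>u\<bar>"] that t by simp
 next
  case False
  have "cos (2 * pi - \<bar>u\<bar>) <= cos t" using False that t by (intro cos_monotone_0_pi_le) auto
  then show ?thesis by (simp add: cos_diff)
 qed
 have nn: "1 + cos u \<ge> 0" for u :: real using cos_ge_minus_one[of u] by linarith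
 have le2: "1 + cos u <= 2" for u :: real using cos_le_one[of u] by linarith
 have 2: "(1 + cos (w * fst y)) * (1 + cos (w * snd y)) <= 2 * (1 + cos t)"
  using assms(1)
 proof
  assume h: "t <= \<bar>w * fst y\<bar> \<and> \<bar>w * fst y\<bar> <= 2 * pi - t"
  have "(1 + cos (w * fst y)) * (1 + cos (w * snd y)) <= (1 + cos t) * 2"
   using far[of "w * fst y"] h nn le2 by (intro mult_mono) auto
  then show ?thesis by simp
 next
  assume h: "t <= \<bar>w * snd y\<bar> \<and> \<bar>w * snd y\<bar> <= 2 * pi - t"
  show ?thesis using far[of "w * snd y"] h nn le2 by (intro mult_mono) auto
 qed
 have "ckern w n y = ((1 + cos (w * fst y)) * (1 + cos (w * snd y))) ^ n"
  by (simp add: ckern_def case_prod_beta power_mult_distrib)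
 also have "\<dots> <= (2 * (1 + cos t)) ^ n" using 2 nn by (intro power_mono) auto
 finally show ?thesis .
qed

lemma ratio_bound:
 fixes A c y d B l :: real
 assumes "c > 0" "\<bar>A - y * c\<bar> <= d * c + B" "B \<ge> 0" "0 < l" "l <= c"
 shows "\<bar>A / c - y\<bar> <= d + B / l"
proof -
 have "A / c - y = (A - y * c) / c" using assms(1) by (simp add: diff_divide_distrib)
 then have "\<bar>A / c - y\<bar> = \<bar>A - y * c\<bar> / c" using assms(1) by simp
 also have "\<dots> <= (d * c + B) / c" using assms(1,2) by (intro divide_right_mono) auto
 also have "\<dots> = d + B / c" using assms(1) by (simp add: add_divide_distrib)
 also have "B / c <= B / l" using assms by (intro divide_left_mono) auto
 finally show ?thesis by simp
qed

text \<open>The kernels concentrate: compared with the mass, they are geometrically small away from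
  the centre.\<close>

lemma ckern_approx_identity:
 fixes f :: "real \<times> real => real"
 assumes ab: "a < b" and f: "continuous_on (hbox a b) f" and x: "fst x \<in> {a<..<b}" "snd x \<in> {a<..<b}"
 shows "(%n. integral (hbox a b) (%z. ckern (2 * pi / (b - a)) n (x - z) * f z) / cmass a b n) \<longlonglongrightarrow> f x"
  and "cmass a b n > 0"
proof -
 define w where "w = 2 * pi / (b - a)"
 have w: "w > 0" "w * (b - a) = 2 * pi" using ab by (auto simp: w_def)
 have xin: "x \<in> hbox a b" using x by (cases x) (auto simp: mem_hbox)
 obtain M where M: "\<And>z. z \<in> hbox a b ==> \<bar>f z\<bar> <= M"
  using compact_imp_bounded[OF compact_continuous_image[OF f]] by (auto simp: hbox_def bounded_iff)
 have M0: "M \<ge> 0" using M[OF xin] by linarith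
 let ?K = "%n z. ckern w n (x - z)"
 have Kf: "(%z. ?K n z * f z) integrable_on hbox a b" for n
  by (intro integrable_hbox continuous_intros f ckern_cont)
 have Ki: "(%z. ?K n z) integrable_on hbox a b" for n
  by (intro integrable_hbox ckern_cont)
 have mass: "integral (hbox a b) (?K n) = cmass a b n" for n using cmass_eq[OF ab] by (simp add: w_def)
 have area: "measure lborel (hbox a b) = (b - a)\<^sup>2" using ab by (simp add: hbox_def content_Pair power2_eq_square)
 (* lower bound for the mass from a small square around the centre *)
 have lower: "(2 * \<delta>)\<^sup>2 * ((1 + cos (w * \<delta>))\<^sup>2) ^ n <= cmass a b n"
  if d: "\<delta> > 0" "w * \<delta> <= pi" "a <= fst x - \<delta>" "fst x + \<delta> <= b" "a <= snd x - \<delta>" "snd x + \<delta> <= b" for \<delta> n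
 proof -
  let ?B = "cbox (fst x - \<delta>, snd x - \<delta>) (fst x + \<delta>, snd x + \<delta>)"
  have sub: "?B \<subseteq> hbox a b" using d by (auto simp: hbox_def cbox_Pair_eq)
  have cB: "measure lborel ?B = (2 * \<delta>)\<^sup>2" using d by (simp add: content_Pair power2_eq_square)
  have iB: "?K n integrable_on ?B" by (intro integrable_continuous ckern_cont)
  have "(2 * \<delta>)\<^sup>2 * ((1 + cos (w * \<delta>))\<^sup>2) ^ n = integral ?B (%z. ((1 + cos (w * \<delta>))\<^sup>2) ^ n)"
   by (simp only: integral_const cB real_scaleR_def)
  also have "\<dots> <= integral ?B (?K n)"
  proof (rule integral_le[OF _ iB])
   fix z assume z: "z \<in> ?B"
   have "\<bar>fst x - fst z\<bar> <= \<delta>" "\<bar>snd x - snd z\<bar> <= \<delta>" using z by (auto simp: cbox_Pair_eq)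
   then show "((1 + cos (w * \<delta>))\<^sup>2) ^ n <= ?K n z"
    using w d by (intro ckern_ge) (auto simp: abs_mult)
  qed auto
  also have "\<dots> <= integral (hbox a b) (?K n)"
   by (rule integral_subset_le[OF sub iB Ki]) (simp add: ckern_nonneg)
  finally show ?thesis by (simp add: mass)
 qed
 define m where "m = Min {fst x - a, b - fst x, snd x - a, b - snd x, (b - a) / 2}"
 have m: "m > 0" "m <= fst x - a" "m <= b - fst x" "m <= snd x - a" "m <= b - snd x" "m <= (b - a) / 2"
 proof -
  have "m \<in> {fst x - a, b - fst x, snd x - a, b - snd x, (b - a) / 2}" unfolding m_def by (rule Min_in) auto
  then show "m > 0" using x ab by auto
  show "m <= fst x - a" "m <= b - fst x" "m <= snd x - a" "m <= b - snd x" "m <= (b - a) / 2"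
   unfolding m_def by (rule Min_le; simp)+
 qed
 have "w * m <= w * ((b - a) / 2)" using m w by (intro mult_left_mono) auto
 also have "\<dots> = pi" using w by simp
 finally have wm: "w * m <= pi" .
 have pos: "cmass a b n > 0" for n
 proof -
  have wm2: "0 < w * (m / 2)" "w * (m / 2) < pi" proof -
   have "w * (m / 2) = w * m / 2" "w * m > 0" using w m by simp_all
   then show "0 < w * (m / 2)" "w * (m / 2) < pi" using wm pi_gt_zero by linarith+
  qed
  have "cos (w * (m / 2)) > cos pi" using wm2 by (intro cos_monotone_0_pi) auto
  then have "0 < (2 * (m / 2))\<^sup>2 * ((1 + cos (w * (m / 2)))\<^sup>2) ^ n" using m by simp
  also have "\<dots> <= cmass a b n" using lower[of "m / 2" n] m wm2 by simp
  finally show ?thesis .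
 qed
 then show "cmass a b n > 0" .
 have "(%n. integral (hbox a b) (%z. ?K n z * f z) / cmass a b n) \<longlonglongrightarrow> f x"
 proof (rule LIMSEQ_I)
  fix e :: real assume e: "e > 0"
  obtain d0 where d0: "d0 > 0" "\<And>z. z \<in> hbox a b ==> dist z x < d0 ==> dist (f z) (f x) < e / 2"
   using f xin e unfolding continuous_on_iff by (meson half_gt_zero)
  define d where "d = min (d0 / 2) m"
  have d: "d > 0" "d <= d0 / 2" "d <= m" using d0 m by (auto simp: d_def)
  have "w * d <= w * m" using d(3) w by simp
  then have "w * d <= pi" using wm by (rule order_trans)
  moreover have "0 < w * d" using w d by simp
  ultimately have wd: "0 < w * d" "w * d <= pi" by simp_all
  define q where "q = 2 * (1 + cos (w * d))"
  have "cos (w * d) < cos 0" using wd by (intro cos_monotone_0_pi) auto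
  then have q4: "q < 4" by (simp add: q_def)
  have "1 + cos u \<ge> 0" for u :: real using cos_ge_minus_one[of u] by linarith
  then have q0: "q \<ge> 0" unfolding q_def by (intro mult_nonneg_nonneg) auto
  have "((%h. (1 + cos (w * h))\<^sup>2) \<longlongrightarrow> (1 + cos (w * 0))\<^sup>2) (at_right 0)"
   by (intro tendsto_intros)
  then have "\<forall>\<^sub>F h in at_right 0. q < (1 + cos (w * h))\<^sup>2"
   by (rule order_tendstoD(1)) (use q4 in simp)
  moreover have "\<forall>\<^sub>F h in at_right 0. h \<in> {0<..<m}" using eventually_at_right_real[OF m(1)] .
  ultimately have "\<forall>\<^sub>F h in at_right 0. q < (1 + cos (w * h))\<^sup>2 \<and> h \<in> {0<..<m}" by eventually_elim auto
  then obtain h where h: "q < (1 + cos (w * h))\<^sup>2" "0 < h" "h < m"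
   using eventually_happens'[of "at_right (0::real)"] by (auto simp: trivial_limit_at_right_real)
  have "w * h <= w * m" using h(3) w by simp
  then have wh: "w * h <= pi" using wm by (rule order_trans)
  define Q where "Q = (1 + cos (w * h))\<^sup>2"
  have Q: "Q > 0" "q < Q" using h q0 by (auto simp: Q_def)
  have low: "(2 * h)\<^sup>2 * Q ^ n <= cmass a b n" for n
   unfolding Q_def using lower[of h n] h wh m by simp
  have bound: "\<bar>integral (hbox a b) (%z. ?K n z * f z) / cmass a b n - f x\<bar> <= e / 2 + (2 * M * (b - a)\<^sup>2 / (2 * h)\<^sup>2) * (q / Q) ^ n" for n
  proof -
   have "\<bar>integral (hbox a b) (%z. ?K n z * f z) - f x * cmass a b n\<bar> = \<bar>integral (hbox a b) (%z. ?K n z * (f z - f x))\<bar>"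
   proof -
    have "integral (hbox a b) (%z. ?K n z * (f z - f x)) = integral (hbox a b) (%z. ?K n z * f z - f x * ?K n z)"
     by (simp add: algebra_simps)
    also have "\<dots> = integral (hbox a b) (%z. ?K n z * f z) - f x * cmass a b n"
     by (subst integral_diff[OF Kf integrable_on_mult_right[OF Ki]]) (simp only: integral_mult_right mass)
    finally show ?thesis by simp
   qed
   also have "\<dots> <= integral (hbox a b) (%z. e / 2 * ?K n z + 2 * M * q ^ n)"
   proof (subst real_norm_def[symmetric], rule integral_norm_bound_integral)
    show "(%z. ?K n z * (f z - f x)) integrable_on hbox a b"
     by (intro integrable_hbox continuous_intros f ckern_cont)
    show "(%z. e / 2 * ?K n z + 2 * M * q ^ n) integrable_on hbox a b"
     by (intro integrable_hbox continuous_intros f ckern_cont)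
    fix z assume z: "z \<in> hbox a b"
    have K0: "?K n z \<ge> 0" by (rule ckern_nonneg)
    show "norm (?K n z * (f z - f x)) <= e / 2 * ?K n z + 2 * M * q ^ n"
    proof (cases "dist z x < d0")
     case True
     have "\<bar>f z - f x\<bar> <= e / 2" using d0(2)[OF z True] by (simp add: dist_real_def)
     from mult_left_mono[OF this K0]
     have "norm (?K n z * (f z - f x)) <= ?K n z * (e / 2)" using K0 by (simp only: real_norm_def abs_mult abs_of_nonneg)
     also have "\<dots> <= e / 2 * ?K n z + 2 * M * q ^ n" using M0 q0 by simp
     finally show ?thesis .
    next
     case False
     have "dist z x <= \<bar>fst x - fst z\<bar> + \<bar>snd x - snd z\<bar>"
      using sqrt_sum_squares_le_sum_abs[of "\<bar>fst z - fst x\<bar>" "\<bar>snd z - snd x\<bar>"]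
      unfolding dist_prod_def dist_real_def by (simp add: abs_minus_commute)
     then have far: "d <= \<bar>fst x - fst z\<bar> \<or> d <= \<bar>snd x - snd z\<bar>" using False d by linarith
     have near: "\<bar>fst x - fst z\<bar> <= b - a - d" "\<bar>snd x - snd z\<bar> <= b - a - d"
      using z d m by (cases z; auto simp: mem_hbox)+
     have sc: "t <= s ==> w * t <= w * s" for s t using w by simp
     have "w * (b - a - d) = 2 * pi - w * d" using w by (simp add: algebra_simps)
     then have "?K n z <= q ^ n"
      unfolding q_def using far sc[OF near(1)] sc[OF near(2)] sc[of d "\<bar>fst x - fst z\<bar>"] sc[of d "\<bar>snd x - snd z\<bar>"] wd w
      by (intro ckern_le) (auto simp: abs_mult)
     moreover have "\<bar>f z - f x\<bar> <= 2 * M" using M[OF z] M[OF xin] by linarith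
     ultimately have "?K n z * \<bar>f z - f x\<bar> <= q ^ n * (2 * M)" using K0 q0 by (intro mult_mono) auto
     moreover have "norm (?K n z * (f z - f x)) = ?K n z * \<bar>f z - f x\<bar>" using K0 by (simp only: real_norm_def abs_mult abs_of_nonneg)
     moreover have "0 <= e / 2 * ?K n z" using K0 e by simp
     ultimately show ?thesis by (simp only: mult_ac)
    qed
   qed
   also have "\<dots> = e / 2 * cmass a b n + 2 * M * q ^ n * (b - a)\<^sup>2"
   proof -
    have "integral (hbox a b) (%z. e / 2 * ?K n z + 2 * M * q ^ n) = integral (hbox a b) (%z. e / 2 * ?K n z) + integral (hbox a b) (%z. 2 * M * q ^ n)"
     by (intro integral_add integrable_hbox continuous_intros ckern_cont)
    also have "integral (hbox a b) (%z. 2 * M * q ^ n) = (b - a)\<^sup>2 * (2 * M * q ^ n)"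
     unfolding area[symmetric] hbox_def by simp
    finally show ?thesis by (simp add: mass)
   qed
   finally have 1: "\<bar>integral (hbox a b) (%z. ?K n z * f z) - f x * cmass a b n\<bar> <= e / 2 * cmass a b n + 2 * M * q ^ n * (b - a)\<^sup>2" .
   have "2 * M * q ^ n * (b - a)\<^sup>2 \<ge> 0" using M0 q0 by simp
   moreover have "0 < (2 * h)\<^sup>2 * Q ^ n" using h Q by simp
   ultimately have "\<bar>integral (hbox a b) (%z. ?K n z * f z) / cmass a b n - f x\<bar> <= e / 2 + 2 * M * q ^ n * (b - a)\<^sup>2 / ((2 * h)\<^sup>2 * Q ^ n)"
    by (rule ratio_bound[OF pos 1 _ _ low])
   also have "2 * M * q ^ n * (b - a)\<^sup>2 / ((2 * h)\<^sup>2 * Q ^ n) = (2 * M * (b - a)\<^sup>2 / (2 * h)\<^sup>2) * (q / Q) ^ n"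
    by (simp only: power_divide times_divide_times_eq mult_ac)
   finally show ?thesis .
  qed
  have "(%n. (2 * M * (b - a)\<^sup>2 / (2 * h)\<^sup>2) * (q / Q) ^ n) \<longlonglongrightarrow> (2 * M * (b - a)\<^sup>2 / (2 * h)\<^sup>2) * 0"
   using Q q0 by (intro tendsto_intros LIMSEQ_power_zero) (auto simp: abs_less_iff)
  then have "\<forall>\<^sub>F n in sequentially. (2 * M * (b - a)\<^sup>2 / (2 * h)\<^sup>2) * (q / Q) ^ n < e / 2"
   by (intro order_tendstoD(2)) (use e in auto)
  then obtain N where N: "\<And>n. n \<ge> N ==> (2 * M * (b - a)\<^sup>2 / (2 * h)\<^sup>2) * (q / Q) ^ n < e / 2"
   unfolding eventually_sequentially by blast
  show "\<exists>N. \<forall>n\<ge>N. norm (integral (hbox a b) (%z. ?K n z * f z) / cmass a b n - f x) < e"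
  proof (intro exI allI impI)
   fix n assume "N <= n"
   from N[OF this] bound[of n] show "norm (integral (hbox a b) (%z. ?K n z * f z) / cmass a b n - f x) < e"
    unfolding real_norm_def by linarith
  qed
 qed
 then show "(%n. integral (hbox a b) (%z. ckern (2 * pi / (b - a)) n (x - z) * f z) / cmass a b n) \<longlonglongrightarrow> f x"
  by (simp add: w_def)
qed


section \<open>Positivity of quadratic forms from positivity on Fourier modes\<close>

definition kconv :: "real => real => (real \<times> real => real) => (real^3 => real) => real^3 => real" where
 "kconv a b K f x = integral (hbox a b) (%z. K ((x $ 1, x $ 2) - z) * f (pt3 (fst z, snd z, x $ 3)))"

definition fcos :: "real => real => int => int => (real^3 => real) => real => real" where
 "fcos a b m k f z = integral (hbox a b) (%(x, y). f (pt3 (x, y, z)) * cos (2 * pi / (b - a) * (of_int m * x + of_int k * y)))"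

definition fsin :: "real => real => int => int => (real^3 => real) => real => real" where
 "fsin a b m k f z = integral (hbox a b) (%(x, y). f (pt3 (x, y, z)) * sin (2 * pi / (b - a) * (of_int m * x + of_int k * y)))"

lemma pt3_in_box3: "z \<in> hbox a b ==> t \<in> {lo..hi} ==> pt3 (fst z, snd z, t) \<in> box3 a b lo hi"
 by (cases z) (simp add: mem_box3 mem_hbox)

lemma continuous_on_third:
 assumes "continuous_on {lo..hi} c" shows "continuous_on (box3 a b lo hi) (%x. c (x $ 3))"
 by (rule continuous_on_compose2[OF assms]) (auto intro!: continuous_intros simp: mem_box3)

lemma kernel_integrand_cont:
 fixes K :: "real \<times> real => real" and f :: "real^3 => real"
 assumes K: "continuous_on UNIV K" and f: "continuous_on (box3 a b lo hi) f"
 shows "continuous_on (box3 a b lo hi \<times> hbox a b) (%(x, z). K ((x $ 1, x $ 2) - z) * f (pt3 (fst z, snd z, x $ 3)))"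
proof -
 have 1: "continuous_on (box3 a b lo hi \<times> hbox a b) (%X. K ((fst X $ 1, fst X $ 2) - snd X))"
  by (rule continuous_on_compose2[OF K]) (auto intro!: continuous_intros)
 have 2: "continuous_on (box3 a b lo hi \<times> hbox a b) (%X. f (pt3 (fst (snd X), snd (snd X), fst X $ 3)))"
  by (rule continuous_on_compose2[OF f]) (auto intro!: continuous_intros pt3_in_box3 simp: mem_box3)
 show ?thesis unfolding case_prod_beta by (intro continuous_intros 1 2)
qed

lemma kconv_cont:
 fixes K :: "real \<times> real => real" and f :: "real^3 => real"
 assumes K: "continuous_on UNIV K" and f: "continuous_on (box3 a b lo hi) f"
 shows "continuous_on (box3 a b lo hi) (kconv a b K f)"
 using integral_continuous_on_param[OF kernel_integrand_cont[OF assms, unfolded hbox_def]]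
 by (simp add: kconv_def[abs_def] hbox_def)

lemma kconv_integrable:
 fixes K :: "real \<times> real => real" and f :: "real^3 => real"
 assumes K: "continuous_on UNIV K" and f: "continuous_on (box3 a b lo hi) f" and x: "x \<in> box3 a b lo hi"
 shows "(%z. K ((x $ 1, x $ 2) - z) * f (pt3 (fst z, snd z, x $ 3))) integrable_on hbox a b"
proof (rule integrable_hbox)
 show "continuous_on (hbox a b) (%z. K ((x $ 1, x $ 2) - z) * f (pt3 (fst z, snd z, x $ 3)))"
 proof -
  have "continuous_on (hbox a b) (%z. (%(x, z). K ((x $ 1, x $ 2) - z) * f (pt3 (fst z, snd z, x $ 3))) (x, z))"
   by (rule continuous_on_compose2[OF kernel_integrand_cont[OF K f] continuous_on_Pair[OF continuous_on_const continuous_on_id]]) (use x in auto)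
  then show ?thesis by simp
 qed
qed

lemma kconv_add:
 assumes "continuous_on UNIV F" "continuous_on UNIV G" and f: "continuous_on (box3 a b lo hi) f" and x: "x \<in> box3 a b lo hi"
 shows "kconv a b (%z. F z + G z) f x = kconv a b F f x + kconv a b G f x"
 unfolding kconv_def distrib_right
 by (rule integral_add[OF kconv_integrable[OF assms(1) f x] kconv_integrable[OF assms(2) f x]])

lemma kconv_scale: "kconv a b (%z. c * F z) f x = c * kconv a b F f x"
 unfolding kconv_def mult.assoc by (rule integral_mult_right)

lemma slice_cos_cont:
 assumes f: "continuous_on (box3 a b lo hi) f" and z: "z \<in> {lo..hi}"
 shows "continuous_on (hbox a b) (%(x, y). f (pt3 (x, y, z)) * cos (w * (of_int m * x + of_int k * y)))"
  "continuous_on (hbox a b) (%(x, y). f (pt3 (x, y, z)) * sin (w * (of_int m * x + of_int k * y)))"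
 using continuous_on_box3_slice[OF assms] unfolding case_prod_beta
 by (auto intro!: continuous_intros)

text \<open>The addition theorem separates the two variables of the kernel, which produces the squares of the
  Fourier coefficients of the field.\<close>

lemma kconv_cos:
 assumes f: "continuous_on (box3 a b lo hi) f" and x: "x \<in> box3 a b lo hi" 
 shows "kconv a b (%(x, y). cos (2 * pi / (b - a) * (of_int m * x + of_int k * y))) f x =
  cos (2 * pi / (b - a) * (of_int m * x $ 1 + of_int k * x $ 2)) * fcos a b m k f (x $ 3)
  + sin (2 * pi / (b - a) * (of_int m * x $ 1 + of_int k * x $ 2)) * fsin a b m k f (x $ 3)"
proof -
 let ?t = "2 * pi / (b - a) * (of_int m * x $ 1 + of_int k * x $ 2)"
 let ?w = "2 * pi / (b - a)"
 have x3: "x $ 3 \<in> {lo..hi}" using x by (simp add: mem_box3)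
 have "kconv a b (%(x, y). cos (?w * (of_int m * x + of_int k * y))) f x =
  integral (hbox a b) (%X. cos ?t * (%(u, v). f (pt3 (u, v, x $ 3)) * cos (?w * (of_int m * u + of_int k * v))) X
   + sin ?t * (%(u, v). f (pt3 (u, v, x $ 3)) * sin (?w * (of_int m * u + of_int k * v))) X)"
  unfolding kconv_def
 proof (rule integral_cong)
  fix z :: "real \<times> real"
  obtain u v where z: "z = (u, v)" by (cases z)
  have "?w * (of_int m * (x $ 1 - u) + of_int k * (x $ 2 - v)) = ?t - ?w * (of_int m * u + of_int k * v)"
   by (simp add: algebra_simps)
  then have e: "cos (?w * (of_int m * (x $ 1 - u) + of_int k * (x $ 2 - v))) =
    cos ?t * cos (?w * (of_int m * u + of_int k * v)) + sin ?t * sin (?w * (of_int m * u + of_int k * v))"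
   by (simp only: cos_diff)
  show "(%(x, y). cos (?w * (of_int m * x + of_int k * y))) ((x $ 1, x $ 2) - z) * f (pt3 (fst z, snd z, x $ 3)) =
   cos ?t * (%(u, v). f (pt3 (u, v, x $ 3)) * cos (?w * (of_int m * u + of_int k * v))) z
   + sin ?t * (%(u, v). f (pt3 (u, v, x $ 3)) * sin (?w * (of_int m * u + of_int k * v))) z"
   unfolding z diff_Pair prod.case fst_conv snd_conv e by (simp only: distrib_right distrib_left mult_ac)
 qed
 also have "\<dots> = cos ?t * fcos a b m k f (x $ 3) + sin ?t * fsin a b m k f (x $ 3)"
  unfolding fcos_def fsin_def
  by (subst integral_add) (intro integrable_hbox continuous_on_mult_left slice_cos_cont[OF f x3], 
   intro integrable_hbox continuous_on_mult_left slice_cos_cont[OF f x3], simp only: integral_mult_right)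
 finally show ?thesis .
qed

lemma mode_term:
 assumes lh: "lo <= hi" and c: "continuous_on {lo..hi} c" and f: "continuous_on (box3 a b lo hi) f" and g: "continuous_on (box3 a b lo hi) g"
 shows "integral (box3 a b lo hi) (%x. c (x $ 3) * f x * kconv a b (%(x, y). cos (2 * pi / (b - a) * (of_int m * x + of_int k * y))) g x)
  = integral {lo..hi} (%z. c z * (fcos a b m k f z * fcos a b m k g z + fsin a b m k f z * fsin a b m k g z))"
proof -
 let ?w = "2 * pi / (b - a)"
 let ?K = "%(x, y). cos (?w * (of_int m * x + of_int k * y))"
 have K: "continuous_on UNIV ?K" unfolding case_prod_beta by (intro continuous_intros)
 have cont: "continuous_on (box3 a b lo hi) (%x. c (x $ 3) * f x * kconv a b ?K g x)"
  by (intro continuous_intros continuous_on_third[OF c] f kconv_cont[OF K g])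
 have "integral (box3 a b lo hi) (%x. c (x $ 3) * f x * kconv a b ?K g x)
  = integral {lo..hi} (%z. integral (hbox a b) (%(x,y). c z * f (pt3 (x,y,z)) * kconv a b ?K g (pt3 (x,y,z))))"
  using integral_box3_vertical(1)[OF cont[unfolded box3_def]] by (simp add: box3_def hbox_def)
 also have "\<dots> = integral {lo..hi} (%z. c z * (fcos a b m k f z * fcos a b m k g z + fsin a b m k f z * fsin a b m k g z))"
 proof (rule integral_cong)
  fix z assume z: "z \<in> {lo..hi}"
  have "integral (hbox a b) (%(x,y). c z * f (pt3 (x,y,z)) * kconv a b ?K g (pt3 (x,y,z)))
   = integral (hbox a b) (%X. (c z * fcos a b m k g z) * (%(u, v). f (pt3 (u, v, z)) * cos (?w * (of_int m * u + of_int k * v))) X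
    + (c z * fsin a b m k g z) * (%(u, v). f (pt3 (u, v, z)) * sin (?w * (of_int m * u + of_int k * v))) X)"
  proof (rule integral_cong)
   fix X assume X: "X \<in> hbox a b"
   obtain u v where uv: "X = (u, v)" by (cases X)
   have "pt3 (u,v,z) \<in> box3 a b lo hi" using pt3_in_box3[OF X z] by (simp add: uv)
   then show "(%(x,y). c z * f (pt3 (x,y,z)) * kconv a b ?K g (pt3 (x,y,z))) X = (c z * fcos a b m k g z) * (%(u, v). f (pt3 (u, v, z)) * cos (?w * (of_int m * u + of_int k * v))) X
    + (c z * fsin a b m k g z) * (%(u, v). f (pt3 (u, v, z)) * sin (?w * (of_int m * u + of_int k * v))) X"
    unfolding uv prod.case by (subst kconv_cos[OF g]) (simp_all add: algebra_simps)
  qed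
  also have "\<dots> = (c z * fcos a b m k g z) * fcos a b m k f z + (c z * fsin a b m k g z) * fsin a b m k f z"
   unfolding fcos_def[of _ _ _ _ f] fsin_def[of _ _ _ _ f]
   by (subst integral_add) (intro integrable_hbox continuous_on_mult_left slice_cos_cont[OF f z], 
    intro integrable_hbox continuous_on_mult_left slice_cos_cont[OF f z], simp only: integral_mult_right)
  also have "\<dots> = c z * (fcos a b m k f z * fcos a b m k g z + fsin a b m k f z * fsin a b m k g z)"
   by (simp add: algebra_simps)
  finally show "integral (hbox a b) (%(x,y). c z * f (pt3 (x,y,z)) * kconv a b ?K g (pt3 (x,y,z))) = \<dots>" .
 qed
 finally show ?thesis .
qed

lemma kconv_limit:
 assumes ab: "a < b" and f: "continuous_on (box3 a b lo hi) f" and x: "x \<in> box3 a b lo hi" and int: "x $ 1 \<in> {a<..<b}" "x $ 2 \<in> {a<..<b}"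
 shows "(%n. kconv a b (ckern (2 * pi / (b - a)) n) f x / cmass a b n) \<longlonglongrightarrow> f x"
proof -
 have x3: "x $ 3 \<in> {lo..hi}" using x by (simp add: mem_box3)
 have "pt3 (x $ 1, x $ 2, x $ 3) = x" using pt3_co3[of x] by (simp add: co3_def)
 then show ?thesis
  using ckern_approx_identity(1)[OF ab continuous_on_box3_slice[OF f x3], of "(x $ 1, x $ 2)"] int
  by (simp add: kconv_def case_prod_unfold)
qed

lemma kconv_bound:
 assumes ab: "a < b" and f: "continuous_on (box3 a b lo hi) f" and x: "x \<in> box3 a b lo hi" 
  and M: "\<And>x. x \<in> box3 a b lo hi ==> \<bar>f x\<bar> <= M"
 shows "\<bar>kconv a b (ckern (2 * pi / (b - a)) n) f x / cmass a b n\<bar> <= M"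
proof -
 let ?K = "ckern (2 * pi / (b - a)) n"
 have x3: "x $ 3 \<in> {lo..hi}" using x by (simp add: mem_box3)
 have m: "cmass a b n > 0" 
  by (rule ckern_approx_identity(2)[OF ab continuous_on_const[of _ 0], of "((a+b)/2, (a+b)/2)"]) (use ab in auto)
 have "\<bar>kconv a b ?K f x\<bar> <= integral (hbox a b) (%z. M * ?K ((x $ 1, x $ 2) - z))"
  unfolding kconv_def
 proof (subst real_norm_def[symmetric], rule integral_norm_bound_integral)
  show "(%z. ?K ((x $ 1, x $ 2) - z) * f (pt3 (fst z, snd z, x $ 3))) integrable_on hbox a b"
   by (rule kconv_integrable[OF postrig_continuous[OF postrig_ckern] f x])
  show "(%z. M * ?K ((x $ 1, x $ 2) - z)) integrable_on hbox a b"
   by (intro integrable_hbox continuous_on_mult_left ckern_cont)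
  fix z assume z: "z \<in> hbox a b"
  have "\<bar>f (pt3 (fst z, snd z, x $ 3))\<bar> <= M" by (rule M[OF pt3_in_box3[OF z x3]])
  from mult_left_mono[OF this ckern_nonneg[of "2 * pi / (b - a)" n "(x $ 1, x $ 2) - z"]]
  show "norm (?K ((x $ 1, x $ 2) - z) * f (pt3 (fst z, snd z, x $ 3))) <= M * ?K ((x $ 1, x $ 2) - z)"
   by (simp only: real_norm_def abs_mult abs_of_nonneg[OF ckern_nonneg] mult.commute[of M])
 qed
 also have "\<dots> = M * cmass a b n" by (simp only: integral_mult_right cmass_eq[OF ab])
 finally show ?thesis using m by (simp add: pos_divide_le_eq)
qed

text \<open>The averages recover the field at interior points, which suffices since the lateral faces are a null
  set, and they are bounded by the bound of the field, so that dominated convergence applies.\<close>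

lemma term_limit:
 assumes ab: "a < b" and c: "continuous_on {lo..hi} c" and f: "continuous_on (box3 a b lo hi) f" and g: "continuous_on (box3 a b lo hi) g"
 shows "(%n. integral (box3 a b lo hi) (%x. c (x $ 3) * f x * kconv a b (ckern (2 * pi / (b - a)) n) g x) / cmass a b n)
  \<longlonglongrightarrow> integral (box3 a b lo hi) (%x. c (x $ 3) * f x * g x)"
proof -
 let ?B = "box (pt3 (a,a,lo)) (pt3 (b,b,hi))"
 have op: "integral (box3 a b lo hi) h = integral ?B h" for h :: "real^3 => real"
  by (simp add: box3_def integral_open_interval)
 have sub: "?B \<subseteq> box3 a b lo hi" unfolding box3_def by (rule box_subset_cbox)
 have int: "x $ 1 \<in> {a<..<b}" "x $ 2 \<in> {a<..<b}" if "x \<in> ?B" for x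
  using spec[OF that[unfolded mem_box_cart], of 1] spec[OF that[unfolded mem_box_cart], of 2] by (auto simp: pt3_def)
 have intb: "h integrable_on ?B" if "continuous_on (box3 a b lo hi) h" for h :: "real^3 => real"
  using that integrable_box3[of a b lo hi h] by (simp add: box3_def integrable_on_open_interval)
 define F where "F x = c (x $ 3) * f x" for x
 have F: "continuous_on (box3 a b lo hi) F" unfolding F_def by (intro continuous_intros continuous_on_third[OF c] f)
 have "\<exists>M. \<forall>x\<in>box3 a b lo hi. \<bar>h x\<bar> <= M" if "continuous_on (box3 a b lo hi) h" for h :: "real^3 => real"
  using compact_imp_bounded[OF compact_continuous_image[OF that compact_box3]] by (auto simp: bounded_iff)
 then obtain M N where M: "\<And>x. x \<in> box3 a b lo hi ==> \<bar>F x\<bar> <= M" and N: "\<And>x. x \<in> box3 a b lo hi ==> \<bar>g x\<bar> <= N"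
  using F g by metis
 have kc: "continuous_on (box3 a b lo hi) (kconv a b (ckern (2 * pi / (b - a)) n) g)" for n
  by (rule kconv_cont[OF postrig_continuous[OF postrig_ckern] g])
 have "(%n. integral ?B (%x. F x * (kconv a b (ckern (2 * pi / (b - a)) n) g x / cmass a b n))) \<longlonglongrightarrow> integral ?B (%x. F x * g x)"
 proof (rule dominated_convergence(2)[where h="%x. M * N"])
  show "(%x. F x * (kconv a b (ckern (2 * pi / (b - a)) n) g x / cmass a b n)) integrable_on ?B" for n
  proof (rule intb)
   have "continuous_on (box3 a b lo hi) (%x. F x * (kconv a b (ckern (2 * pi / (b - a)) n) g x * (1 / cmass a b n)))"
    by (intro continuous_on_mult F kc continuous_on_const)
   then show "continuous_on (box3 a b lo hi) (%x. F x * (kconv a b (ckern (2 * pi / (b - a)) n) g x / cmass a b n))" by simp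
  qed
  show "(%x. M * N) integrable_on ?B" by (rule intb) simp
  fix x assume x: "x \<in> ?B"
  then have xb: "x \<in> box3 a b lo hi" using sub by blast
  show "norm (F x * (kconv a b (ckern (2 * pi / (b - a)) n) g x / cmass a b n)) <= M * N" for n
   unfolding real_norm_def abs_mult[of "F x"]
   by (rule mult_mono[OF M[OF xb] kconv_bound[OF ab g xb N]]) (use M[OF xb] in auto)
  show "(%n. F x * (kconv a b (ckern (2 * pi / (b - a)) n) g x / cmass a b n)) \<longlonglongrightarrow> F x * g x"
   by (intro tendsto_mult tendsto_const kconv_limit[OF ab g xb int[OF x]])
 qed
 moreover have "integral ?B (%x. F x * (kconv a b (ckern (2 * pi / (b - a)) n) g x / cmass a b n)) = 
  integral ?B (%x. F x * kconv a b (ckern (2 * pi / (b - a)) n) g x) / cmass a b n" for n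
  using integral_mult_right[of ?B "1 / cmass a b n" "%x. F x * kconv a b (ckern (2 * pi / (b - a)) n) g x"] by (simp add: mult_ac)
 ultimately show ?thesis unfolding op F_def by simp
qed

text \<open>A quadratic functional whose values on all Fourier modes are nonnegative is nonnegative.
  Smoothing one of the two arguments with a kernel having nonnegative Fourier coefficients
  turns the functional into a nonnegative combination of its values on modes.\<close>

type_synonym qterm = "real \<times> real \<times> (real => real) \<times> (real^3 => real) \<times> (real^3 => real)"

theorem quadratic_nonneg_from_modes:
 fixes xs :: "qterm list"
 assumes ab: "a < b"
  and ok: "\<And>lo hi c f g. (lo, hi, c, f, g) \<in> set xs ==>
   lo <= hi \<and> continuous_on {lo..hi} c \<and> continuous_on (box3 a b lo hi) f \<and> continuous_on (box3 a b lo hi) g"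
  and modes: "\<And>m k. 0 <= (\<Sum>(lo, hi, c, f, g)\<leftarrow>xs. integral {lo..hi} (%z. c z * (fcos a b m k f z * fcos a b m k g z + fsin a b m k f z * fsin a b m k g z)))"
 shows "0 <= (\<Sum>(lo, hi, c, f, g)\<leftarrow>xs. integral (box3 a b lo hi) (%x. c (x $ 3) * f x * g x))"
proof -
 define \<Phi> where "\<Phi> K = (\<Sum>(lo, hi, c, f, g)\<leftarrow>xs. integral (box3 a b lo hi) (%x. c (x $ 3) * f x * kconv a b K g x))" for K
 have pos: "0 <= \<Phi> K" if "postrig (2 * pi / (b - a)) K" for K
  using that
 proof induction
  case (base m k)
  have "\<Phi> (%(x, y). cos (2 * pi / (b - a) * (of_int m * x + of_int k * y))) =
   (\<Sum>(lo, hi, c, f, g)\<leftarrow>xs. integral {lo..hi} (%z. c z * (fcos a b m k f z * fcos a b m k g z + fsin a b m k f z * fsin a b m k g z)))"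
   unfolding \<Phi>_def
  proof (intro arg_cong[of _ _ sum_list] map_cong refl)
   fix X assume X: "X \<in> set xs"
   obtain lo hi c f g where eq: "X = (lo, hi, c, f, g)" by (cases X) 
   have "lo <= hi" "continuous_on {lo..hi} c" "continuous_on (box3 a b lo hi) f" "continuous_on (box3 a b lo hi) g" using ok X eq by blast+
   from mode_term[OF this] show "(case X of (lo, hi, c, f, g) => integral (box3 a b lo hi) (%x. c (x $ 3) * f x * kconv a b (%(x, y). cos (2 * pi / (b - a) * (of_int m * x + of_int k * y))) g x))
    = (case X of (lo, hi, c, f, g) => integral {lo..hi} (%z. c z * (fcos a b m k f z * fcos a b m k g z + fsin a b m k f z * fsin a b m k g z)))"
    by (simp only: eq prod.case)
  qed
  then show ?case using modes by simp
 next
  case (add F G)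
  note FG = postrig_continuous[OF add.hyps(1)] postrig_continuous[OF add.hyps(2)]
  have "\<Phi> (%x. F x + G x) = \<Phi> F + \<Phi> G"
   unfolding \<Phi>_def sum_list_addf[symmetric]
  proof (intro arg_cong[of _ _ sum_list] map_cong refl)
   fix X assume X: "X \<in> set xs"
   obtain lo hi c f g where eq: "X = (lo, hi, c, f, g)" by (cases X) 
   have o: "continuous_on {lo..hi} c" "continuous_on (box3 a b lo hi) f" "continuous_on (box3 a b lo hi) g" using ok X eq by blast+
   have i: "(%x. c (x $ 3) * f x * kconv a b K g x) integrable_on box3 a b lo hi" if "continuous_on UNIV K" for K
    by (intro integrable_box3 continuous_intros continuous_on_third o kconv_cont[OF that])
   have "integral (box3 a b lo hi) (%x. c (x $ 3) * f x * kconv a b (%x. F x + G x) g x)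
    = integral (box3 a b lo hi) (%x. c (x $ 3) * f x * kconv a b F g x + c (x $ 3) * f x * kconv a b G g x)"
    by (rule integral_cong) (simp add: kconv_add[OF FG o(3)] algebra_simps)
   also have "\<dots> = integral (box3 a b lo hi) (%x. c (x $ 3) * f x * kconv a b F g x) + integral (box3 a b lo hi) (%x. c (x $ 3) * f x * kconv a b G g x)"
    by (rule integral_add[OF i[OF FG(1)] i[OF FG(2)]])
   finally show "(case X of (lo, hi, c, f, g) => integral (box3 a b lo hi) (%x. c (x $ 3) * f x * kconv a b (%x. F x + G x) g x)) = 
    (case X of (lo, hi, c, f, g) => integral (box3 a b lo hi) (%x. c (x $ 3) * f x * kconv a b F g x)) + (case X of (lo, hi, c, f, g) => integral (box3 a b lo hi) (%x. c (x $ 3) * f x * kconv a b G g x))"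
    by (simp add: eq)
  qed
  then show ?case using add.IH by simp
 next
  case (scale F d)
  have "\<Phi> (%x. d * F x) = d * \<Phi> F"
   unfolding \<Phi>_def sum_list_const_mult[symmetric] 
  proof (intro arg_cong[of _ _ sum_list] map_cong refl)
   fix X :: qterm
   obtain lo hi c f g where eq: "X = (lo, hi, c, f, g)" by (cases X) 
   have "integral (box3 a b lo hi) (%x. c (x $ 3) * f x * (d * kconv a b F g x)) = d * integral (box3 a b lo hi) (%x. c (x $ 3) * f x * kconv a b F g x)"
    unfolding integral_mult_right[symmetric] by (simp add: mult_ac)
   then show "(case X of (lo, hi, c, f, g) => integral (box3 a b lo hi) (%x. c (x $ 3) * f x * kconv a b (%x. d * F x) g x)) = 
    d * (case X of (lo, hi, c, f, g) => integral (box3 a b lo hi) (%x. c (x $ 3) * f x * kconv a b F g x))"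
    by (simp add: eq kconv_scale)
  qed
  then show ?case using scale by simp
 qed
 have m: "cmass a b n > 0" for n
  by (rule ckern_approx_identity(2)[OF ab continuous_on_const[of _ 0], of "((a+b)/2, (a+b)/2)"]) (use ab in auto)
 have lim: "(%n. \<Sum>X\<leftarrow>ys. (case X of (lo, hi, c, f, g) => integral (box3 a b lo hi) (%x. c (x $ 3) * f x * kconv a b (ckern (2 * pi / (b - a)) n) g x)) / cmass a b n)
  \<longlonglongrightarrow> (\<Sum>X\<leftarrow>ys. case X of (lo, hi, c, f, g) => integral (box3 a b lo hi) (%x. c (x $ 3) * f x * g x))" if "set ys \<subseteq> set xs" for ys
  using that
 proof (induction ys)
  case (Cons X ys)
  obtain lo hi c f g where eq: "X = (lo, hi, c, f, g)" by (cases X) 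
  have "(lo, hi, c, f, g) \<in> set xs" using Cons.prems eq by simp
  from ok[OF this] have o: "continuous_on {lo..hi} c" "continuous_on (box3 a b lo hi) f" "continuous_on (box3 a b lo hi) g" by blast+
  show ?case using tendsto_add[OF term_limit[OF ab o] Cons.IH] Cons.prems by (simp add: eq)
 qed simp
 have sd: "(\<Sum>X\<leftarrow>ys. h X / d) = (\<Sum>X\<leftarrow>ys. h X) / d" for ys :: "qterm list" and h and d :: real
  by (induction ys) (auto simp: add_divide_distrib)
 have "(%n. \<Phi> (ckern (2 * pi / (b - a)) n) / cmass a b n) \<longlonglongrightarrow> (\<Sum>(lo, hi, c, f, g)\<leftarrow>xs. integral (box3 a b lo hi) (%x. c (x $ 3) * f x * g x))"
  using lim[of xs] unfolding sd \<Phi>_def by (simp add: case_prod_unfold)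
 then show ?thesis
  by (rule LIMSEQ_le_const) (use pos[OF postrig_ckern] m in \<open>auto intro!: divide_nonneg_pos\<close>)
qed


section \<open>Quadratic forms of a vector field and its gradient\<close>

text \<open>Half the squared norm of the trace-free symmetric part \<open>A + A\<^sup>T - (2/3) tr A I\<close>.\<close>

definition dev_energy :: "real^3^3 => real" where
 "dev_energy A = (A$1$2 + A$2$1)\<^sup>2 + (A$1$3 + A$3$1)\<^sup>2 + (A$2$3 + A$3$2)\<^sup>2
  + 2 * ((A$1$1)\<^sup>2 + (A$2$2)\<^sup>2 + (A$3$3)\<^sup>2) - 2 / 3 * (A$1$1 + A$2$2 + A$3$3)\<^sup>2"

text \<open>The quadratic forms invariant under horizontal rotations that occur in the energy
  estimate; the mixed term is the gravitational one.\<close>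

definition qform :: "real => real => real => real => real^3 => real^3^3 => real" where
 "qform \<alpha> \<beta> \<gamma> \<kappa> w A = \<alpha> * (A$1$1 + A$2$2 + A$3$3)\<^sup>2 + \<beta> * dev_energy A
  - 2 * \<gamma> * w$3 * (A$1$1 + A$2$2) + \<kappa> * ((w$1)\<^sup>2 + (w$2)\<^sup>2 + (w$3)\<^sup>2)"

abbreviation mode_dens where
 "mode_dens \<alpha> \<beta> \<gamma> \<kappa> r \<phi> \<phi>' \<psi> \<psi>' \<equiv> \<alpha> * (\<psi>' + r * \<phi>)\<^sup>2
  + \<beta> * ((\<phi>' - r * \<psi>)\<^sup>2 + (\<psi>' - r * \<phi>)\<^sup>2 + 1 / 3 * (\<psi>' + r * \<phi>)\<^sup>2)
  - 2 * \<gamma> * r * \<phi> * \<psi> + \<kappa> * (\<phi>\<^sup>2 + \<psi>\<^sup>2 :: real)"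

text \<open>Rotating a horizontal Fourier mode into the direction of its frequency decouples the form into
  two planar modes and a nonnegative transversal part. Here \<open>W\<close>, \<open>V\<close> are the cosine and sine
  coefficients of the field and \<open>(r n\<^sub>1, r n\<^sub>2)\<close> is the frequency.\<close>

lemma qform_mode:
 fixes n1 n2 r :: real and W W' V V' :: "real^3"
 assumes n: "n1\<^sup>2 + n2\<^sup>2 = 1"
  and A: "A$1$1 = r*n1*V$1" "A$2$1 = r*n1*V$2" "A$3$1 = r*n1*V$3" "A$1$2 = r*n2*V$1" "A$2$2 = r*n2*V$2" "A$3$2 = r*n2*V$3"
   "A$1$3 = W'$1" "A$2$3 = W'$2" "A$3$3 = W'$3"
  and B: "B$1$1 = - (r*n1*W$1)" "B$2$1 = - (r*n1*W$2)" "B$3$1 = - (r*n1*W$3)" "B$1$2 = - (r*n2*W$1)" "B$2$2 = - (r*n2*W$2)" "B$3$2 = - (r*n2*W$3)"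
   "B$1$3 = V'$1" "B$2$3 = V'$2" "B$3$3 = V'$3"
 shows "qform \<alpha> \<beta> \<gamma> \<kappa> W A + qform \<alpha> \<beta> \<gamma> \<kappa> V B =
  mode_dens \<alpha> \<beta> \<gamma> \<kappa> r (n1*V$1+n2*V$2) (n1*V'$1+n2*V'$2) (W$3) (W'$3)
 + mode_dens \<alpha> \<beta> \<gamma> \<kappa> r (- (n1*W$1+n2*W$2)) (- (n1*W'$1+n2*W'$2)) (V$3) (V'$3)
 + \<beta> * ((n1*V'$2-n2*V'$1)\<^sup>2 + (n1*W'$2-n2*W'$1)\<^sup>2 + r\<^sup>2 * ((n1*V$2-n2*V$1)\<^sup>2 + (n1*W$2-n2*W$1)\<^sup>2))
 + \<kappa> * ((n1*V$2-n2*V$1)\<^sup>2 + (n1*W$2-n2*W$1)\<^sup>2)"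
proof -
 have rot: "x\<^sup>2 + y\<^sup>2 = (n1*x+n2*y)\<^sup>2 + (n1*y-n2*x)\<^sup>2" for x y :: real
 proof -
  have "(n1*x+n2*y)\<^sup>2 + (n1*y-n2*x)\<^sup>2 = (n1\<^sup>2 + n2\<^sup>2) * (x\<^sup>2 + y\<^sup>2)" by (simp add: power2_eq_square algebra_simps)
  then show ?thesis by (simp add: n)
 qed
 have shear: "(x' + r*n1*z)\<^sup>2 + (y' + r*n2*z)\<^sup>2 = (n1*x'+n2*y' + r*z)\<^sup>2 + (n1*y'-n2*x')\<^sup>2" for x' y' z :: real
 proof -
  have "n1*(x' + r*n1*z) + n2*(y' + r*n2*z) = n1*x'+n2*y' + (n1\<^sup>2+n2\<^sup>2)*(r*z)" by (simp add: power2_eq_square algebra_simps)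
  moreover have "n1*(y' + r*n2*z) - n2*(x' + r*n1*z) = n1*y'-n2*x'" by (simp add: algebra_simps)
  ultimately show ?thesis using rot[of "x' + r*n1*z" "y' + r*n2*z"] by (simp add: n)
 qed
 have plane: "(r*n2*x + r*n1*y)\<^sup>2 + 2 * ((r*n1*x)\<^sup>2 + (r*n2*y)\<^sup>2) = 2 * (r*(n1*x+n2*y))\<^sup>2 + r\<^sup>2 * (n1*y-n2*x)\<^sup>2" for x y :: real
  by (simp add: power2_eq_square algebra_simps)
 have fin: "2 * a\<^sup>2 + 2 * b\<^sup>2 - 2 / 3 * (a + b)\<^sup>2 = (b - a)\<^sup>2 + 1 / 3 * (a + b)\<^sup>2" for a b :: real
  by (simp add: power2_eq_square field_simps)
 have devA: "dev_energy A = (n1*W'$1+n2*W'$2 + r*V$3)\<^sup>2 + (n1*W'$2-n2*W'$1)\<^sup>2 + r\<^sup>2 * (n1*V$2-n2*V$1)\<^sup>2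
  + (W'$3 - r*(n1*V$1+n2*V$2))\<^sup>2 + 1 / 3 * (r*(n1*V$1+n2*V$2) + W'$3)\<^sup>2"
 proof -
  have "dev_energy A = ((r*n2*V$1 + r*n1*V$2)\<^sup>2 + 2 * ((r*n1*V$1)\<^sup>2 + (r*n2*V$2)\<^sup>2)) + ((W'$1 + r*n1*V$3)\<^sup>2 + (W'$2 + r*n2*V$3)\<^sup>2)
   + 2 * (W'$3)\<^sup>2 - 2 / 3 * (r*(n1*V$1+n2*V$2) + W'$3)\<^sup>2"
   by (simp add: dev_energy_def A algebra_simps)
  then show ?thesis unfolding plane shear using fin[of "r*(n1*V$1+n2*V$2)" "W'$3"] by linarith
 qed
 have devB: "dev_energy B = (n1*V'$1+n2*V'$2 - r*W$3)\<^sup>2 + (n1*V'$2-n2*V'$1)\<^sup>2 + r\<^sup>2 * (n1*W$2-n2*W$1)\<^sup>2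
  + (V'$3 + r*(n1*W$1+n2*W$2))\<^sup>2 + 1 / 3 * (V'$3 - r*(n1*W$1+n2*W$2))\<^sup>2"
 proof -
  have "dev_energy B = ((r*n2*W$1 + r*n1*W$2)\<^sup>2 + 2 * ((r*n1*W$1)\<^sup>2 + (r*n2*W$2)\<^sup>2)) + ((V'$1 + r*n1*(- W$3))\<^sup>2 + (V'$2 + r*n2*(- W$3))\<^sup>2)
   + 2 * (V'$3)\<^sup>2 - 2 / 3 * (- (r*(n1*W$1+n2*W$2)) + V'$3)\<^sup>2"
   by (simp add: dev_energy_def B power2_eq_square algebra_simps)
  then show ?thesis unfolding plane shear using fin[of "- (r*(n1*W$1+n2*W$2))" "V'$3"] by (simp add: add.commute)
 qed
 have trA: "A$1$1 + A$2$2 = r*(n1*V$1+n2*V$2)" "A$3$3 = W'$3" by (simp_all add: A algebra_simps)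
 have trB: "B$1$1 + B$2$2 = - (r*(n1*W$1+n2*W$2))" "B$3$3 = V'$3" by (simp_all add: B algebra_simps)
 have w: "(W$1)\<^sup>2 + (W$2)\<^sup>2 + (W$3)\<^sup>2 = (n1*W$1+n2*W$2)\<^sup>2 + (n1*W$2-n2*W$1)\<^sup>2 + (W$3)\<^sup>2"
  "(V$1)\<^sup>2 + (V$2)\<^sup>2 + (V$3)\<^sup>2 = (n1*V$1+n2*V$2)\<^sup>2 + (n1*V$2-n2*V$1)\<^sup>2 + (V$3)\<^sup>2"
  using rot by simp_all
 show ?thesis unfolding qform_def devA devB trA trB w
 proof goal_cases
  case 1
  define a b a' b' where "a = n1*V$1+n2*V$2" and "b = n1*W$1+n2*W$2" and "a' = n1*V'$1+n2*V'$2" and "b' = n1*W'$1+n2*W'$2"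
  define c d c' d' where "c = n1*V$2-n2*V$1" and "d = n1*W$2-n2*W$1" and "c' = n1*V'$2-n2*V'$1" and "d' = n1*W'$2-n2*W'$1"
  show ?case
   unfolding a_def[symmetric] b_def[symmetric] a'_def[symmetric] b'_def[symmetric] c_def[symmetric] d_def[symmetric] c'_def[symmetric] d'_def[symmetric]
   by (simp add: power2_eq_square algebra_simps)
 qed
qed

lemma fcos_add:
 assumes "continuous_on (box3 a b lo hi) f" "continuous_on (box3 a b lo hi) g" "z \<in> {lo..hi}"
 shows "fcos a b m k (%x. f x + g x) z = fcos a b m k f z + fcos a b m k g z"
  "fsin a b m k (%x. f x + g x) z = fsin a b m k f z + fsin a b m k g z"
 unfolding fcos_def fsin_def distrib_right case_prod_beta
 by (rule integral_add integrable_hbox slice_cos_cont[OF assms(1,3), unfolded case_prod_beta] slice_cos_cont[OF assms(2,3), unfolded case_prod_beta])+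

lemma fcos_cont:
 assumes f: "continuous_on (box3 a b lo hi) f"
 shows "continuous_on {lo..hi} (fcos a b m k f)" "continuous_on {lo..hi} (fsin a b m k f)"
proof -
 have 1: "continuous_on ({lo..hi} \<times> hbox a b) (%X. f (pt3 (fst (snd X), snd (snd X), fst X)))"
  by (rule continuous_on_compose2[OF f]) (auto intro!: continuous_intros simp: mem_box3 mem_hbox)
 have "continuous_on ({lo..hi} \<times> hbox a b) (%(z, Y). f (pt3 (fst Y, snd Y, z)) * cos (2 * pi / (b - a) * (of_int m * fst Y + of_int k * snd Y)))"
  unfolding case_prod_beta by (intro continuous_intros 1)
 from integral_continuous_on_param[OF this[unfolded hbox_def]]
 show "continuous_on {lo..hi} (fcos a b m k f)" by (simp add: fcos_def[abs_def] hbox_def case_prod_unfold)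
 have "continuous_on ({lo..hi} \<times> hbox a b) (%(z, Y). f (pt3 (fst Y, snd Y, z)) * sin (2 * pi / (b - a) * (of_int m * fst Y + of_int k * snd Y)))"
  unfolding case_prod_beta by (intro continuous_intros 1)
 from integral_continuous_on_param[OF this[unfolded hbox_def]]
 show "continuous_on {lo..hi} (fsin a b m k f)" by (simp add: fsin_def[abs_def] hbox_def case_prod_unfold)
qed

lemma fcos_vertical_deriv:
 assumes f: "continuous_on (box3 a b lo hi) f" and f': "continuous_on (box3 a b lo hi) f'" 
  and d: "has_pd (box3 a b lo hi) 3 f f'" and z: "z \<in> {lo..hi}"
 shows "(fcos a b m k f has_real_derivative fcos a b m k f' z) (at z within {lo..hi})"
  "(fsin a b m k f has_real_derivative fsin a b m k f' z) (at z within {lo..hi})"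
proof -
 let ?t = "%Y. 2 * pi / (b - a) * (of_int m * fst Y + of_int k * snd Y)"
 have p: "pt3 (fst Y, snd Y, r) \<in> box3 a b lo hi" if "Y \<in> hbox a b" "r \<in> {lo..hi}" for Y r using pt3_in_box3[OF that] .
 have fz: "((%z. f (pt3 (fst Y, snd Y, z))) has_real_derivative f' (pt3 (fst Y, snd Y, z))) (at z within {lo..hi})"
  if Y: "Y \<in> hbox a b" and z: "z \<in> {lo..hi}" for Y z
  unfolding has_real_derivative_iff_has_vector_derivative
  by (rule has_vector_derivative_within_subset[OF has_pd_coord(3)[OF d p[OF Y z] refl]]) (use p[OF Y] in auto)
 have 1: "continuous_on ({lo..hi} \<times> hbox a b) (%X. f' (pt3 (fst (snd X), snd (snd X), fst X)))"
  by (rule continuous_on_compose2[OF f']) (auto intro!: continuous_intros simp: mem_box3 mem_hbox)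
 have 2: "continuous_on (hbox a b) (%Y. f (pt3 (fst Y, snd Y, z)))" if "z \<in> {lo..hi}" for z
  using continuous_on_box3_slice[OF f that] by (simp add: case_prod_unfold)
 have "((%z. integral (cbox (a,a) (b,b)) (%Y. f (pt3 (fst Y, snd Y, z)) * cos (?t Y))) has_field_derivative
   integral (cbox (a,a) (b,b)) (%Y. f' (pt3 (fst Y, snd Y, z)) * cos (?t Y))) (at z within {lo..hi})"
 proof (rule leibniz_rule_field_derivative)
  fix z Y assume "z \<in> {lo..hi}" "Y \<in> cbox (a,a) (b,b)"
  then show "((%z. f (pt3 (fst Y, snd Y, z)) * cos (?t Y)) has_field_derivative f' (pt3 (fst Y, snd Y, z)) * cos (?t Y)) (at z within {lo..hi})"
   by (intro DERIV_cmult_right fz) (simp_all add: hbox_def)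
 next
  fix z assume "z \<in> {lo..hi}"
  then show "(%Y. f (pt3 (fst Y, snd Y, z)) * cos (?t Y)) integrable_on cbox (a,a) (b,b)"
   unfolding hbox_def[symmetric] by (intro integrable_hbox continuous_intros 2)
 next
  show "continuous_on ({lo..hi} \<times> cbox (a,a) (b,b)) (%(z, Y). f' (pt3 (fst Y, snd Y, z)) * cos (?t Y))"
   using 1 unfolding case_prod_beta hbox_def by (intro continuous_intros)
 qed (use z in auto)
 then show "(fcos a b m k f has_real_derivative fcos a b m k f' z) (at z within {lo..hi})"
  by (simp add: fcos_def[abs_def] hbox_def case_prod_unfold)
 have "((%z. integral (cbox (a,a) (b,b)) (%Y. f (pt3 (fst Y, snd Y, z)) * sin (?t Y))) has_field_derivative
   integral (cbox (a,a) (b,b)) (%Y. f' (pt3 (fst Y, snd Y, z)) * sin (?t Y))) (at z within {lo..hi})"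
 proof (rule leibniz_rule_field_derivative)
  fix z Y assume "z \<in> {lo..hi}" "Y \<in> cbox (a,a) (b,b)"
  then show "((%z. f (pt3 (fst Y, snd Y, z)) * sin (?t Y)) has_field_derivative f' (pt3 (fst Y, snd Y, z)) * sin (?t Y)) (at z within {lo..hi})"
   by (intro DERIV_cmult_right fz) (simp_all add: hbox_def)
 next
  fix z assume "z \<in> {lo..hi}"
  then show "(%Y. f (pt3 (fst Y, snd Y, z)) * sin (?t Y)) integrable_on cbox (a,a) (b,b)"
   unfolding hbox_def[symmetric] by (intro integrable_hbox continuous_intros 2)
 next
  show "continuous_on ({lo..hi} \<times> cbox (a,a) (b,b)) (%(z, Y). f' (pt3 (fst Y, snd Y, z)) * sin (?t Y))"
   using 1 unfolding case_prod_beta hbox_def by (intro continuous_intros)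
 qed (use z in auto)
 then show "(fsin a b m k f has_real_derivative fsin a b m k f' z) (at z within {lo..hi})"
  by (simp add: fsin_def[abs_def] hbox_def case_prod_unfold)
qed

lemma has_pd_mult:
 fixes f g :: "real^3 => real"
 assumes "has_pd S i f f'" "has_pd S i g g'"
 shows "has_pd S i (%x. f x * g x) (%x. f x * g' x + f' x * g x)"
 unfolding has_pd_def
proof
 fix x assume "x \<in> S"
 from has_vector_derivative_mult[OF bspec[OF assms(1)[unfolded has_pd_def] this] bspec[OF assms(2)[unfolded has_pd_def] this]]
 show "((%r. f (x + r *\<^sub>R axis i 1) * g (x + r *\<^sub>R axis i 1)) has_vector_derivative f x * g' x + f' x * g x) (at 0 within pd_dom S i x)"
  by simp
qed

lemma has_pd_phase:
 fixes w :: real and m k :: int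
 defines "c i \<equiv> w * (if i = 1 then of_int m else if i = 2 then of_int k else (0::real))"
 shows "has_pd S i (%x. cos (w * (of_int m * x $ 1 + of_int k * x $ 2))) (%x. - c i * sin (w * (of_int m * x $ 1 + of_int k * x $ 2)))"
  "has_pd S i (%x. sin (w * (of_int m * x $ 1 + of_int k * x $ 2))) (%x. c i * cos (w * (of_int m * x $ 1 + of_int k * x $ 2)))"
proof -
 have ci: "c i = w * (of_int m * axis i 1 $ 1 + of_int k * axis i 1 $ 2)"
  using exhaust_3[of i] by (auto simp: c_def axis_def)
 have d: "((%r. w * (of_int m * (x + r *\<^sub>R axis i 1) $ 1 + of_int k * (x + r *\<^sub>R axis i 1) $ 2)) has_real_derivative c i) (at 0 within T)" for x :: "real^3" and T
  unfolding ci by (auto intro!: derivative_eq_intros simp: algebra_simps)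
 show "has_pd S i (%x. cos (w * (of_int m * x $ 1 + of_int k * x $ 2))) (%x. - c i * sin (w * (of_int m * x $ 1 + of_int k * x $ 2)))"
  unfolding has_pd_def has_real_derivative_iff_has_vector_derivative[symmetric]
  by (intro ballI) (rule derivative_eq_intros d refl | simp)+
 show "has_pd S i (%x. sin (w * (of_int m * x $ 1 + of_int k * x $ 2))) (%x. c i * cos (w * (of_int m * x $ 1 + of_int k * x $ 2)))"
  unfolding has_pd_def has_real_derivative_iff_has_vector_derivative[symmetric]
  by (intro ballI) (rule derivative_eq_intros d refl | simp)+
qed

lemma periodic_phase:
 assumes ab: "a < b"
 shows "cos (2 * pi / (b - a) * (of_int m * b + y)) = cos (2 * pi / (b - a) * (of_int m * a + y))"
  "sin (2 * pi / (b - a) * (of_int m * b + y)) = sin (2 * pi / (b - a) * (of_int m * a + y))"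
proof -
 define q where "q = 2 * pi / (b - a)"
 have "q * (of_int m * b + y) = q * (of_int m * a + y) + q * (b - a) * of_int m" by (simp add: algebra_simps)
 also have "q * (b - a) = 2 * pi" using ab by (simp add: q_def)
 finally have e: "2 * pi / (b - a) * (of_int m * b + y) = 2 * pi / (b - a) * (of_int m * a + y) + 2 * pi * of_int m" by (simp only: q_def)
 show "cos (2 * pi / (b - a) * (of_int m * b + y)) = cos (2 * pi / (b - a) * (of_int m * a + y))"
  "sin (2 * pi / (b - a) * (of_int m * b + y)) = sin (2 * pi / (b - a) * (of_int m * a + y))"
  unfolding e using sin_integer_2pi[of "of_int m"] cos_integer_2pi[of "of_int m"] by (simp_all add: sin_add cos_add)
qed

lemma fcos_horizontal_deriv:
 fixes m' k :: int
 assumes ab: "a < b" and f: "continuous_on (box3 a b lo hi) f" and f': "continuous_on (box3 a b lo hi) f'" 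
  and d: "has_pd (box3 a b lo hi) i f f'" and i: "i \<noteq> 3" and z: "z \<in> {lo..hi}" and m: "faces_match a b z f"
 defines "c \<equiv> 2 * pi / (b - a) * (if i = 1 then of_int m' else if i = 2 then of_int k else (0::real))"
 shows "fcos a b m' k f' z = c * fsin a b m' k f z" "fsin a b m' k f' z = - c * fcos a b m' k f z"
proof -
 let ?C = "%x::real^3. cos (2 * pi / (b - a) * (of_int m' * x $ 1 + of_int k * x $ 2))"
 let ?S = "%x::real^3. sin (2 * pi / (b - a) * (of_int m' * x $ 1 + of_int k * x $ 2))"
 have fm: "faces_match a b z (%x. f x * ?C x)" "faces_match a b z (%x. f x * ?S x)"
  using m periodic_phase[OF ab, of m'] periodic_phase[OF ab, of k]
  unfolding faces_match_def by (simp_all add: add.commute[of "of_int m' * _"])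
 have pS: "pt3 (x,y,z) \<in> box3 a b lo hi" if "x \<in> {a..b}" "y \<in> {a..b}" for x y using that z by (simp add: mem_box3)
 have sl: "continuous_on (box3 a b lo hi) g ==> continuous_on (hbox a b) (%(x,y). g (pt3 (x,y,z)))" for g :: "real^3 => real"
  by (rule continuous_on_box3_slice[OF _ z])
 note ii = integrable_hbox slice_cos_cont[OF f z] slice_cos_cont[OF f' z] continuous_on_mult_left
 have pd: "has_pd (box3 a b lo hi) i (%x. f x * ?C x) (%x. f x * (- c * ?S x) + f' x * ?C x)"
  using has_pd_mult[OF d has_pd_phase(1)[where w="2 * pi / (b - a)" and m=m' and k=k]] unfolding c_def by simp
 have "integral (hbox a b) (%(x,y). (%x. f x * (- c * ?S x) + f' x * ?C x) (pt3 (x,y,z))) = 0"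
 proof (rule integral_hbox_pd_eq_0[OF _ pd i pS _ fm(1)])
  show "continuous_on (hbox a b) (%(x,y). (%x. f x * (- c * ?S x) + f' x * ?C x) (pt3 (x,y,z)))"
   by (rule sl) (intro continuous_intros f f')
 qed (use ab in auto)
 then have "0 = integral (hbox a b) (%(x,y). (%x. f x * (- c * ?S x) + f' x * ?C x) (pt3 (x,y,z)))" by simp
 also have "\<dots> = integral (hbox a b) (%X. - c * (%(x,y). f (pt3 (x,y,z)) * sin (2 * pi / (b - a) * (of_int m' * x + of_int k * y))) X + (%(x,y). f' (pt3 (x,y,z)) * cos (2 * pi / (b - a) * (of_int m' * x + of_int k * y))) X)"
  by (rule integral_cong) (simp add: case_prod_unfold mult_ac)
 also have "\<dots> = - c * fsin a b m' k f z + fcos a b m' k f' z"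
  unfolding fcos_def fsin_def by (subst integral_add) (intro ii, intro ii, simp only: integral_mult_right)
 finally show "fcos a b m' k f' z = c * fsin a b m' k f z" by simp
 have pd: "has_pd (box3 a b lo hi) i (%x. f x * ?S x) (%x. f x * (c * ?C x) + f' x * ?S x)"
  using has_pd_mult[OF d has_pd_phase(2)[where w="2 * pi / (b - a)" and m=m' and k=k]] unfolding c_def by simp
 have "integral (hbox a b) (%(x,y). (%x. f x * (c * ?C x) + f' x * ?S x) (pt3 (x,y,z))) = 0"
 proof (rule integral_hbox_pd_eq_0[OF _ pd i pS _ fm(2)])
  show "continuous_on (hbox a b) (%(x,y). (%x. f x * (c * ?C x) + f' x * ?S x) (pt3 (x,y,z)))"
   by (rule sl) (intro continuous_intros f f')
 qed (use ab in auto)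
 then have "0 = integral (hbox a b) (%(x,y). (%x. f x * (c * ?C x) + f' x * ?S x) (pt3 (x,y,z)))" by simp
 also have "\<dots> = integral (hbox a b) (%X. c * (%(x,y). f (pt3 (x,y,z)) * cos (2 * pi / (b - a) * (of_int m' * x + of_int k * y))) X + (%(x,y). f' (pt3 (x,y,z)) * sin (2 * pi / (b - a) * (of_int m' * x + of_int k * y))) X)"
  by (rule integral_cong) (simp add: case_prod_unfold mult_ac)
 also have "\<dots> = c * fcos a b m' k f z + fsin a b m' k f' z"
  unfolding fcos_def fsin_def by (subst integral_add) (intro ii, intro ii, simp only: integral_mult_right)
 finally show "fsin a b m' k f' z = - c * fcos a b m' k f z" by simp
qed


lemma integral_sum_list:
 fixes h :: "'c => 'a::euclidean_space => 'b::banach"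
 assumes "\<And>t. t \<in> set ts ==> h t integrable_on S"
 shows "(\<Sum>t\<leftarrow>ts. integral S (h t)) = integral S (%x. \<Sum>t\<leftarrow>ts. h t x) \<and> (%x. \<Sum>t\<leftarrow>ts. h t x) integrable_on S"
 using assms
proof (induction ts)
 case (Cons t ts)
 then have "h t integrable_on S" "(\<Sum>t\<leftarrow>ts. integral S (h t)) = integral S (%x. \<Sum>t\<leftarrow>ts. h t x)" "(%x. \<Sum>t\<leftarrow>ts. h t x) integrable_on S" by auto
 then show ?case by (simp add: integral_add integrable_add)
qed (simp add: integrable_0)

text \<open>Polar coordinates of the frequency.\<close>

lemma unit_vector_decomp: "\<exists>n1 n2 :: real. n1\<^sup>2 + n2\<^sup>2 = 1 \<and> x = sqrt (x\<^sup>2 + y\<^sup>2) * n1 \<and> y = sqrt (x\<^sup>2 + y\<^sup>2) * n2" for x y :: real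
proof (cases "x = 0 \<and> y = 0")
 case True then show ?thesis by (intro exI[of _ 1] exI[of _ 0]) simp
next
 case False
 then have "x\<^sup>2 + y\<^sup>2 > 0" by (simp add: sum_power2_gt_zero_iff)
 then obtain q where q: "q = sqrt (x\<^sup>2 + y\<^sup>2)" "q > 0" "q\<^sup>2 = x\<^sup>2 + y\<^sup>2" by simp
 have "(x / q)\<^sup>2 + (y / q)\<^sup>2 = q\<^sup>2 / q\<^sup>2" unfolding q(3) by (simp only: power_divide q(3) add_divide_distrib)
 then show ?thesis using q(2) unfolding q(1)[symmetric]
  by (intro exI[of _ "x / q"] exI[of _ "y / q"]) simp
qed

lemma vmode_lincomb:
 assumes f: "vmode p f f'" and g: "vmode p g g'"
 shows "vmode p (%s z. c * f s z + d * g s z) (%s z. c * f' s z + d * g' s z)"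
 unfolding vmode_def
proof (intro conjI allI ballI)
 fix s z assume "z \<in> (ivl p s)"
 then have "(f s has_real_derivative f' s z) (at z within (ivl p s))" "(g s has_real_derivative g' s z) (at z within (ivl p s))"
  using f g by (simp_all add: vmode_def)
 then show "((%z. c * f s z + d * g s z) has_real_derivative c * f' s z + d * g' s z) (at z within (ivl p s))"
  by (intro DERIV_add DERIV_cmult)
next
 fix s show "continuous_on (ivl p s) (%z. c * f' s z + d * g' s z)"
  by (intro continuous_intros vmode_cont[OF f] vmode_cont[OF g])
qed (use f g in \<open>simp_all add: vmode_def\<close>)

context rt begin

abbreviation "slabbox a b s \<equiv> box3 a b (zlo p s) (zhi p s)"

definition field_on :: "real => real => (side => real^3 => real^3) => (side => real^3 => real^3^3) => bool" where
 "field_on a b w A \<longleftrightarrow>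
  (\<forall>s i j. has_pd (slabbox a b s) j (%x. w s x $ i) (%x. A s x $ i $ j)) \<and>
  (\<forall>s. continuous_on (slabbox a b s) (w s)) \<and> (\<forall>s. continuous_on (slabbox a b s) (A s)) \<and>
  (\<forall>s. \<forall>z\<in>(ivl p s). faces_match a b z (w s)) \<and>
  (\<forall>x\<in>{a..b}. \<forall>y\<in>{a..b}. w Lower (pt3 (x,y,0)) = w Upper (pt3 (x,y,0)) \<and>
    w Lower (pt3 (x,y,- depth p)) = 0 \<and> w Upper (pt3 (x,y,height p)) = 0)"

text \<open>The frequencies of the period cell are the multiples of \<open>2 \<pi> / (b - a)\<close> by integer vectors.\<close>

definition cell_freq :: "real => real => int => int => real" where
 "cell_freq a b m k = sqrt ((2 * pi / (b - a) * of_int m)\<^sup>2 + (2 * pi / (b - a) * of_int k)\<^sup>2)"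

text \<open>The form is a sum of squares of linear expressions in the field and its gradient. On one Fourier
  mode these are the same expressions in the vertical coefficient functions, of which two families
  occur, the longitudinal one that sees the mode energy and the transversal one whose contribution is
  nonnegative.\<close>

theorem qform_nonneg_from_modes:
 fixes \<alpha> \<beta> \<gamma> \<kappa> :: "side => real => real"
 assumes ab: "a < b" and F: "field_on a b w A"
  and co: "\<And>s. continuous_on (ivl p s) (\<alpha> s)" "\<And>s. continuous_on (ivl p s) (\<beta> s)"
   "\<And>s. continuous_on (ivl p s) (\<gamma> s)" "\<And>s. continuous_on (ivl p s) (\<kappa> s)"
  and nn: "\<And>s z. z \<in> (ivl p s) ==> \<beta> s z \<ge> 0" "\<And>s z. z \<in> (ivl p s) ==> \<kappa> s z \<ge> 0"
  and modes: "\<And>m k \<phi> \<phi>' \<psi> \<psi>'. vmode p \<phi> \<phi>' ==> vmode p \<psi> \<psi>' ==>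
   0 <= \<tau> * (cell_freq a b m k)\<^sup>2 * (\<psi> Upper 0)\<^sup>2 + (\<Sum>s\<in>sides. integral (ivl p s)
    (%z. mode_dens (\<alpha> s z) (\<beta> s z) (\<gamma> s z) (\<kappa> s z) (cell_freq a b m k) (\<phi> s z) (\<phi>' s z) (\<psi> s z) (\<psi>' s z)))"
 shows "0 <= (\<Sum>s\<in>sides. integral (slabbox a b s) (%x. qform (\<alpha> s (x$3)) (\<beta> s (x$3)) (\<gamma> s (x$3)) (\<kappa> s (x$3)) (w s x) (A s x)))
  + \<tau> * integral (hbox a b) (%(x,y). (A Upper (pt3 (x,y,0)) $3$1)\<^sup>2 + (A Upper (pt3 (x,y,0)) $3$2)\<^sup>2)"
proof -
 have pd: "has_pd (slabbox a b s) j (%x. w s x $ i) (%x. A s x $ i $ j)" for s i j using F by (simp add: field_on_def)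
 have cw: "continuous_on (slabbox a b s) (%x. w s x $ i)" for s i using F by (auto simp: field_on_def intro!: continuous_intros)
 have cA: "continuous_on (slabbox a b s) (%x. A s x $ i $ j)" for s i j using F by (auto simp: field_on_def intro!: continuous_intros)
 have fm: "faces_match a b z (%x. w s x $ i)" if "z \<in> (ivl p s)" for s z i 
  using F that by (auto simp: field_on_def faces_match_def)
 have lh: "zlo p s <= zhi p s" for s using zlo_less_zhi[of s] by simp
 define terms where "terms s = [
   (%z. \<alpha> s z - 2/3 * \<beta> s z, %x. (A s x$1$1 + A s x$2$2) + A s x$3$3, %x. (A s x$1$1 + A s x$2$2) + A s x$3$3),
   (\<beta> s, %x. A s x$1$2 + A s x$2$1, %x. A s x$1$2 + A s x$2$1),
   (\<beta> s, %x. A s x$1$3 + A s x$3$1, %x. A s x$1$3 + A s x$3$1),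
   (\<beta> s, %x. A s x$2$3 + A s x$3$2, %x. A s x$2$3 + A s x$3$2),
   (%z. 2 * \<beta> s z, %x. A s x$1$1, %x. A s x$1$1),
   (%z. 2 * \<beta> s z, %x. A s x$2$2, %x. A s x$2$2),
   (%z. 2 * \<beta> s z, %x. A s x$3$3, %x. A s x$3$3),
   (%z. - 2 * \<gamma> s z, %x. w s x$3, %x. A s x$1$1 + A s x$2$2),
   (\<kappa> s, %x. w s x$1, %x. w s x$1), (\<kappa> s, %x. w s x$2, %x. w s x$2), (\<kappa> s, %x. w s x$3, %x. w s x$3)]" for s
 define side_terms where "side_terms s = map (%(c, f, g). (zlo p s, zhi p s, c, f, g)) (terms s)" for s
 define iface :: "qterm list" where "iface = [
   (0, 1, %z. \<tau>, %x. A Upper (pt3 (x$1,x$2,0))$3$1, %x. A Upper (pt3 (x$1,x$2,0))$3$1),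
   (0, 1, %z. \<tau>, %x. A Upper (pt3 (x$1,x$2,0))$3$2, %x. A Upper (pt3 (x$1,x$2,0))$3$2)]"
 have tcont: "continuous_on (ivl p s) c \<and> continuous_on (slabbox a b s) f \<and> continuous_on (slabbox a b s) g"
  if "(c, f, g) \<in> set (terms s)" for c f g s
  using that unfolding terms_def by (auto intro!: continuous_intros co cA cw)
 have icont: "continuous_on (box3 a b 0 1) (%x. A Upper (pt3 (x$1,x$2,0))$3$j)" for j
  by (rule continuous_on_compose2[OF cA[of Upper 3 j]]) (auto intro!: continuous_intros simp: mem_box3 less_imp_le[OF height_pos])
 have "0 <= (\<Sum>(lo, hi, c, f, g)\<leftarrow>side_terms Lower @ side_terms Upper @ iface. integral (box3 a b lo hi) (%x. c (x $ 3) * f x * g x))"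
 proof (rule quadratic_nonneg_from_modes[OF ab])
  fix lo hi c f g assume "(lo, hi, c, f, g) \<in> set (side_terms Lower @ side_terms Upper @ iface)"
  then consider s where "(c, f, g) \<in> set (terms s)" "lo = zlo p s" "hi = zhi p s" | "(lo, hi, c, f, g) \<in> set iface"
   unfolding side_terms_def by auto
  then show "lo <= hi \<and> continuous_on {lo..hi} c \<and> continuous_on (box3 a b lo hi) f \<and> continuous_on (box3 a b lo hi) g"
  proof cases
   case 1 then show ?thesis using tcont[OF 1(1)] lh by simp
  next
   case 2 then show ?thesis using icont by (auto simp: iface_def)
  qed
 next
  fix m k :: int
  define r where "r = cell_freq a b m k"
  define x1 x2 where "x1 = 2 * pi / (b - a) * of_int m" and "x2 = 2 * pi / (b - a) * of_int k"
  obtain n1 n2 where n: "n1\<^sup>2 + n2\<^sup>2 = 1" "x1 = r * n1" "x2 = r * n2"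
   using unit_vector_decomp[of x1 x2] unfolding r_def cell_freq_def x1_def x2_def by blast
  have r2: "x1\<^sup>2 + x2\<^sup>2 = r\<^sup>2"
  proof -
   have "x1\<^sup>2 + x2\<^sup>2 = r\<^sup>2 * (n1\<^sup>2 + n2\<^sup>2)" unfolding n(2,3) by (simp add: power_mult_distrib algebra_simps)
   then show ?thesis by (simp add: n)
  qed
  define W V W' V' where "W s z = (\<chi> i. fcos a b m k (%x. w s x $ i) z)" and "V s z = (\<chi> i. fsin a b m k (%x. w s x $ i) z)"
   and "W' s z = (\<chi> i. fcos a b m k (%x. A s x $ i $ 3) z)" and "V' s z = (\<chi> i. fsin a b m k (%x. A s x $ i $ 3) z)" for s z
  define C B where "C s z = (\<chi> i j. fcos a b m k (%x. A s x $ i $ j) z)" and "B s z = (\<chi> i j. fsin a b m k (%x. A s x $ i $ j) z)" for s z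
  have C3: "C s z $ i $ 3 = W' s z $ i" "B s z $ i $ 3 = V' s z $ i" for s z i by (simp_all add: C_def B_def W'_def V'_def)
  have C1: "C s z $ i $ 1 = r * n1 * V s z $ i" "B s z $ i $ 1 = - (r * n1 * W s z $ i)" if "z \<in> (ivl p s)" for s z i
   using fcos_horizontal_deriv[where m'=m and k=k and i=1, OF ab cw cA pd _ that fm[OF that]] n(2)[unfolded x1_def]
   by (simp_all add: C_def B_def W_def V_def del: times_divide_eq_left times_divide_eq_right)
  have C2: "C s z $ i $ 2 = r * n2 * V s z $ i" "B s z $ i $ 2 = - (r * n2 * W s z $ i)" if "z \<in> (ivl p s)" for s z i
   using fcos_horizontal_deriv[where m'=m and k=k and i=2, OF ab cw cA pd _ that fm[OF that]] n(3)[unfolded x2_def]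
   by (simp_all add: C_def B_def W_def V_def del: times_divide_eq_left times_divide_eq_right)
  have dW: "((%z. W s z $ i) has_real_derivative W' s z $ i) (at z within (ivl p s))"
   "((%z. V s z $ i) has_real_derivative V' s z $ i) (at z within (ivl p s))" if "z \<in> (ivl p s)" for s z i
   using fcos_vertical_deriv[where m=m and k=k, OF cw cA pd that] by (simp_all add: W_def V_def W'_def V'_def)
  have cW': "continuous_on (ivl p s) (%z. W' s z $ i)" "continuous_on (ivl p s) (%z. V' s z $ i)" for s i
   using fcos_cont[OF cA] by (simp_all add: W'_def V'_def)
  have cWV: "continuous_on (ivl p s) (%z. W s z $ i)" "continuous_on (ivl p s) (%z. V s z $ i)" for s i
   using fcos_cont[OF cw] by (simp_all add: W_def V_def)
  have bdry: "W Lower 0 = W Upper 0" "V Lower 0 = V Upper 0" "W Lower (- depth p) = 0" "V Lower (- depth p) = 0" "W Upper (height p) = 0" "V Upper (height p) = 0"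
  proof -
   have e: "integral (hbox a b) f = integral (hbox a b) g" if "\<And>x y. x \<in> {a..b} ==> y \<in> {a..b} ==> f (x,y) = g (x,y)" for f g :: "real \<times> real => real"
    by (rule integral_cong) (use that in \<open>auto simp: hbox_def cbox_Pair_eq\<close>)
   have F': "\<And>x y. x\<in>{a..b} ==> y\<in>{a..b} ==> w Lower (pt3 (x,y,0)) = w Upper (pt3 (x,y,0)) \<and>
    w Lower (pt3 (x,y,- depth p)) = 0 \<and> w Upper (pt3 (x,y,height p)) = 0" using F unfolding field_on_def by blast
   show "W Lower 0 = W Upper 0" "V Lower 0 = V Upper 0" unfolding W_def V_def vec_eq_iff vec_lambda_beta fcos_def fsin_def
    using F' by (auto intro!: e)
   have z: "integral (hbox a b) f = 0" if "\<And>x y. x \<in> {a..b} ==> y \<in> {a..b} ==> f (x,y) = 0" for f :: "real \<times> real => real"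
    using e[of f "%x. 0"] that by simp
   show "W Lower (- depth p) = 0" "V Lower (- depth p) = 0" "W Upper (height p) = 0" "V Upper (height p) = 0"
    unfolding W_def V_def vec_eq_iff vec_lambda_beta fcos_def fsin_def zero_index
    using F' by (auto intro!: z)
  qed
  define p1 p1' q1 q1' where "p1 s z = n1 * V s z $ 1 + n2 * V s z $ 2" and "p1' s z = n1 * V' s z $ 1 + n2 * V' s z $ 2"
   and "q1 s z = W s z $ 3" and "q1' s z = W' s z $ 3" for s z
  define p2 p2' q2 q2' where "p2 s z = - (n1 * W s z $ 1 + n2 * W s z $ 2)" and "p2' s z = - (n1 * W' s z $ 1 + n2 * W' s z $ 2)"
   and "q2 s z = V s z $ 3" and "q2' s z = V' s z $ 3" for s z
  have vW: "vmode p (%s z. W s z $ i) (%s z. W' s z $ i)" for i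
   unfolding vmode_def using dW(1) cW'(1) bdry by simp
  have vV: "vmode p (%s z. V s z $ i) (%s z. V' s z $ i)" for i
   unfolding vmode_def using dW(2) cW'(2) bdry by simp
  have p2: "p2 = (%s z. (- n1) * W s z $ 1 + (- n2) * W s z $ 2)" "p2' = (%s z. (- n1) * W' s z $ 1 + (- n2) * W' s z $ 2)"
   by (simp_all add: p2_def p2'_def fun_eq_iff)
  have e1: "p1 = (%s z. n1 * V s z $ 1 + n2 * V s z $ 2)" "p1' = (%s z. n1 * V' s z $ 1 + n2 * V' s z $ 2)"
   "q1 = (%s z. W s z $ 3)" "q1' = (%s z. W' s z $ 3)" "q2 = (%s z. V s z $ 3)" "q2' = (%s z. V' s z $ 3)"
   by (simp_all only: p1_def p1'_def q1_def q1'_def q2_def q2'_def fun_eq_iff simp_thms)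
  have vm1: "vmode p p1 p1'" unfolding e1(1,2) by (rule vmode_lincomb[OF vV[of 1] vV[of 2]])
  have vm2: "vmode p q1 q1'" unfolding e1(3,4) by (rule vW)
  have vm3: "vmode p p2 p2'" unfolding p2 by (rule vmode_lincomb[OF vW[of 1] vW[of 2]])
  have vm4: "vmode p q2 q2'" unfolding e1(5,6) by (rule vV)
  note vm = vm1 vm2 vm3 vm4
  define rest where "rest s z = \<beta> s z * ((n1*V' s z$2-n2*V' s z$1)\<^sup>2 + (n1*W' s z$2-n2*W' s z$1)\<^sup>2 + r\<^sup>2 * ((n1*V s z$2-n2*V s z$1)\<^sup>2 + (n1*W s z$2-n2*W s z$1)\<^sup>2))
   + \<kappa> s z * ((n1*V s z$2-n2*V s z$1)\<^sup>2 + (n1*W s z$2-n2*W s z$1)\<^sup>2)" for s z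
  define M1 where "M1 s z = mode_dens (\<alpha> s z) (\<beta> s z) (\<gamma> s z) (\<kappa> s z) r (p1 s z) (p1' s z) (q1 s z) (q1' s z)" for s z
  define M2 where "M2 s z = mode_dens (\<alpha> s z) (\<beta> s z) (\<gamma> s z) (\<kappa> s z) r (p2 s z) (p2' s z) (q2 s z) (q2' s z)" for s z
  have cont: "continuous_on (ivl p s) (M1 s)" "continuous_on (ivl p s) (M2 s)" "continuous_on (ivl p s) (rest s)" for s
  proof -
   note mc = vmode_cont[OF vm1] vmode_cont[OF vm2] vmode_cont[OF vm3] vmode_cont[OF vm4]
   have cr: "continuous_on (ivl p s) (%z. n1 * V' s z $ 2 - n2 * V' s z $ 1)" "continuous_on (ivl p s) (%z. n1 * W' s z $ 2 - n2 * W' s z $ 1)"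
    "continuous_on (ivl p s) (%z. n1 * V s z $ 2 - n2 * V s z $ 1)" "continuous_on (ivl p s) (%z. n1 * W s z $ 2 - n2 * W s z $ 1)"
    by (rule continuous_on_diff[OF continuous_on_mult_left[OF cW'(2)] continuous_on_mult_left[OF cW'(2)]]
     continuous_on_diff[OF continuous_on_mult_left[OF cW'(1)] continuous_on_mult_left[OF cW'(1)]]
     continuous_on_diff[OF continuous_on_mult_left[OF cWV(2)] continuous_on_mult_left[OF cWV(2)]]
     continuous_on_diff[OF continuous_on_mult_left[OF cWV(1)] continuous_on_mult_left[OF cWV(1)]])+
   show "continuous_on (ivl p s) (M1 s)" unfolding M1_def[abs_def]
    by (intro continuous_on_add continuous_on_diff continuous_on_mult continuous_on_power continuous_on_const co mc)
   show "continuous_on (ivl p s) (M2 s)" unfolding M2_def[abs_def]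
    by (intro continuous_on_add continuous_on_diff continuous_on_mult continuous_on_power continuous_on_const co mc)
   show "continuous_on (ivl p s) (rest s)"
    unfolding rest_def[abs_def] by (intro continuous_on_add continuous_on_mult continuous_on_power continuous_on_const co cr)
  qed
  have side: "(\<Sum>(lo, hi, c, f, g)\<leftarrow>side_terms s. integral {lo..hi} (%z. c z * (fcos a b m k f z * fcos a b m k g z + fsin a b m k f z * fsin a b m k g z)))
   = integral (ivl p s) (M1 s) + integral (ivl p s) (M2 s) + integral (ivl p s) (rest s)" for s
  proof -
   let ?h = "%(c, f, g) z. c z * (fcos a b m k f z * fcos a b m k g z + fsin a b m k f z * fsin a b m k g z)"
   have "(\<Sum>(lo, hi, c, f, g)\<leftarrow>side_terms s. integral {lo..hi} (%z. c z * (fcos a b m k f z * fcos a b m k g z + fsin a b m k f z * fsin a b m k g z)))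
    = (\<Sum>t\<leftarrow>terms s. integral (ivl p s) (?h t))"
    unfolding side_terms_def map_map by (intro arg_cong[of _ _ sum_list] map_cong refl) (auto simp: o_def)
   also have "\<dots> = integral (ivl p s) (%z. \<Sum>t\<leftarrow>terms s. ?h t z)"
   proof (rule conjunct1[OF integral_sum_list])
    fix t assume t: "t \<in> set (terms s)"
    obtain c f g where e: "t = (c, f, g)" by (cases t)
    have "continuous_on (ivl p s) c" "continuous_on (slabbox a b s) f" "continuous_on (slabbox a b s) g" using tcont t e by blast+
    then show "?h t integrable_on (ivl p s)"
     unfolding e prod.case by (intro integrable_side continuous_intros fcos_cont)
   qed
   also have "\<dots> = integral (ivl p s) (%z. M1 s z + M2 s z + rest s z)"
   proof (rule integral_cong)
    fix z assume z: "z \<in> (ivl p s)"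
    have add: "fcos a b m k (%x. f x + g x) z = fcos a b m k f z + fcos a b m k g z" "fsin a b m k (%x. f x + g x) z = fsin a b m k f z + fsin a b m k g z"
     if "continuous_on (slabbox a b s) f" "continuous_on (slabbox a b s) g" for f g using fcos_add[OF that z] by simp_all
    have cAA: "continuous_on (slabbox a b s) (%x. A s x$i$j + A s x$i'$j')" for i j i' j' by (intro continuous_intros cA)
    have "(\<Sum>t\<leftarrow>terms s. ?h t z) = qform (\<alpha> s z) (\<beta> s z) (\<gamma> s z) (\<kappa> s z) (W s z) (C s z) + qform (\<alpha> s z) (\<beta> s z) (\<gamma> s z) (\<kappa> s z) (V s z) (B s z)"
     unfolding terms_def
     by (simp only: list.map sum_list.Cons sum_list.Nil prod.case add[OF cA cA] add[OF cAA cA] qform_def dev_energy_def W_def V_def C_def B_def vec_lambda_beta)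
      (simp add: power2_eq_square algebra_simps)
    also have "\<dots> = M1 s z + M2 s z + rest s z"
     unfolding M1_def M2_def rest_def p1_def p1'_def q1_def q1'_def p2_def p2'_def q2_def q2'_def
     by (subst qform_mode[OF n(1), where W'="W' s z" and V'="V' s z" and r=r]) (simp_all only: C1[OF z] C2[OF z] C3 add.assoc)
    finally show "(\<Sum>t\<leftarrow>terms s. ?h t z) = M1 s z + M2 s z + rest s z" .
   qed
   also have "\<dots> = integral (ivl p s) (M1 s) + integral (ivl p s) (M2 s) + integral (ivl p s) (rest s)"
    by (subst integral_add[OF integrable_add[OF integrable_side[OF cont(1)] integrable_side[OF cont(2)]] integrable_side[OF cont(3)]],
      subst integral_add[OF integrable_side[OF cont(1)] integrable_side[OF cont(2)]]) simp
   finally show ?thesis .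
  qed
  have if0: "(\<Sum>(lo, hi, c, f, g)\<leftarrow>iface. integral {lo..hi} (%z. c z * (fcos a b m k f z * fcos a b m k g z + fsin a b m k f z * fsin a b m k g z)))
   = \<tau> * r\<^sup>2 * (q1 Upper 0)\<^sup>2 + \<tau> * r\<^sup>2 * (q2 Upper 0)\<^sup>2"
  proof -
   have c: "fcos a b m k (%x. A Upper (pt3 (x$1,x$2,0))$3$j) z = C Upper 0 $ 3 $ j" "fsin a b m k (%x. A Upper (pt3 (x$1,x$2,0))$3$j) z = B Upper 0 $ 3 $ j" for z j
    by (simp_all add: fcos_def fsin_def C_def B_def)
   have 0: "0 \<in> {zlo p Upper..zhi p Upper}" using height_pos by simp
   have "(\<Sum>(lo, hi, c, f, g)\<leftarrow>iface. integral {lo..hi} (%z. c z * (fcos a b m k f z * fcos a b m k g z + fsin a b m k f z * fsin a b m k g z)))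
    = \<tau> * ((r*n1*V Upper 0$3)\<^sup>2 + (r*n1*W Upper 0$3)\<^sup>2) + \<tau> * ((r*n2*V Upper 0$3)\<^sup>2 + (r*n2*W Upper 0$3)\<^sup>2)"
    unfolding iface_def by (simp add: c C1[OF 0] C2[OF 0] power2_eq_square)
   also have "\<dots> = \<tau> * (x1\<^sup>2 + x2\<^sup>2) * ((V Upper 0$3)\<^sup>2 + (W Upper 0$3)\<^sup>2)"
    unfolding n(2,3) by (simp add: power_mult_distrib algebra_simps)
   finally show ?thesis unfolding r2 q1_def q2_def by (simp add: algebra_simps)
  qed
  have "0 <= (\<Sum>s\<in>sides. integral (ivl p s) (rest s))"
   unfolding rest_def by (intro sum_nonneg integral_side_nonneg add_nonneg_nonneg mult_nonneg_nonneg nn) auto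
  moreover have "0 <= \<tau> * r\<^sup>2 * (q1 Upper 0)\<^sup>2 + (\<Sum>s\<in>sides. integral (ivl p s) (M1 s))"
   unfolding M1_def r_def by (rule modes[OF vm(1,2)])
  moreover have "0 <= \<tau> * r\<^sup>2 * (q2 Upper 0)\<^sup>2 + (\<Sum>s\<in>sides. integral (ivl p s) (M2 s))"
   unfolding M2_def r_def by (rule modes[OF vm(3,4)])
  ultimately show "0 <= (\<Sum>(lo, hi, c, f, g)\<leftarrow>side_terms Lower @ side_terms Upper @ iface.
   integral {lo..hi} (%z. c z * (fcos a b m k f z * fcos a b m k g z + fsin a b m k f z * fsin a b m k g z)))"
   by (simp add: side if0)
 qed
 moreover have "(\<Sum>(lo, hi, c, f, g)\<leftarrow>side_terms s. integral (box3 a b lo hi) (%x. c (x $ 3) * f x * g x))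
  = integral (slabbox a b s) (%x. qform (\<alpha> s (x$3)) (\<beta> s (x$3)) (\<gamma> s (x$3)) (\<kappa> s (x$3)) (w s x) (A s x))" for s
 proof -
  let ?h = "%(c, f, g) x. c (x $ 3) * f x * g x"
  have "(\<Sum>(lo, hi, c, f, g)\<leftarrow>side_terms s. integral (box3 a b lo hi) (%x. c (x $ 3) * f x * g x)) = (\<Sum>t\<leftarrow>terms s. integral (slabbox a b s) (?h t))"
   unfolding side_terms_def map_map by (intro arg_cong[of _ _ sum_list] map_cong refl) (auto simp: o_def)
  also have "\<dots> = integral (slabbox a b s) (%x. \<Sum>t\<leftarrow>terms s. ?h t x)"
  proof (rule conjunct1[OF integral_sum_list])
   fix t assume t: "t \<in> set (terms s)"
   obtain c f g where e: "t = (c, f, g)" by (cases t)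
   have "continuous_on (ivl p s) c" "continuous_on (slabbox a b s) f" "continuous_on (slabbox a b s) g" using tcont t e by blast+
   then show "?h t integrable_on slabbox a b s"
    unfolding e prod.case by (intro integrable_box3 continuous_intros continuous_on_third)
  qed
  also have "\<dots> = integral (slabbox a b s) (%x. qform (\<alpha> s (x$3)) (\<beta> s (x$3)) (\<gamma> s (x$3)) (\<kappa> s (x$3)) (w s x) (A s x))"
   unfolding terms_def by (rule integral_cong) (simp add: qform_def dev_energy_def power2_eq_square algebra_simps add_divide_distrib)
  finally show ?thesis .
 qed
 moreover have "(\<Sum>(lo, hi, c, f, g)\<leftarrow>iface. integral (box3 a b lo hi) (%x. c (x $ 3) * f x * g x))
  = \<tau> * integral (hbox a b) (%(x,y). (A Upper (pt3 (x,y,0)) $3$1)\<^sup>2 + (A Upper (pt3 (x,y,0)) $3$2)\<^sup>2)"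
 proof -
  have hc: "continuous_on (hbox a b) (%(x,y). A Upper (pt3 (x,y,0))$3$j)" for j
   using continuous_on_box3_slice[OF cA[of Upper 3 j], of 0] height_pos by simp
  have hc2: "(%X. \<tau> * (A Upper (pt3 (fst X,snd X,0))$3$j)\<^sup>2) integrable_on hbox a b" for j
   by (intro integrable_hbox continuous_on_mult_left continuous_on_power hc[unfolded case_prod_unfold])
  have "integral (box3 a b 0 1) (%x. \<tau> * A Upper (pt3 (x$1,x$2,0))$3$j * A Upper (pt3 (x$1,x$2,0))$3$j)
   = integral (hbox a b) (%X. \<tau> * (A Upper (pt3 (fst X,snd X,0))$3$j)\<^sup>2)" for j
  proof -
   have "continuous_on (box3 a b 0 1) (%x. \<tau> * A Upper (pt3 (x$1,x$2,0))$3$j * A Upper (pt3 (x$1,x$2,0))$3$j)"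
    by (intro continuous_intros icont)
   from integral_box3_vertical(1)[OF this[unfolded box3_def]] show ?thesis
    by (simp add: box3_def hbox_def case_prod_unfold power2_eq_square mult.assoc)
  qed
  then have "(\<Sum>(lo, hi, c, f, g)\<leftarrow>iface. integral (box3 a b lo hi) (%x. c (x $ 3) * f x * g x))
   = integral (hbox a b) (%X. \<tau> * (A Upper (pt3 (fst X,snd X,0))$3$1)\<^sup>2) + integral (hbox a b) (%X. \<tau> * (A Upper (pt3 (fst X,snd X,0))$3$2)\<^sup>2)"
   by (simp add: iface_def)
  also have "\<dots> = integral (hbox a b) (%X. \<tau> * ((A Upper (pt3 (fst X,snd X,0))$3$1)\<^sup>2 + (A Upper (pt3 (fst X,snd X,0))$3$2)\<^sup>2))"
   by (subst integral_add[OF hc2 hc2, symmetric]) (simp add: distrib_left)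
  finally show ?thesis by (simp only: integral_mult_right case_prod_unfold)
 qed
 ultimately show ?thesis by simp
qed

end


section \<open>Calculus on the closed slabs\<close>

lemma has_pd_bounded_linear:
 assumes "has_pd S i f f'" "bounded_linear h"
 shows "has_pd S i (%x. h (f x)) (%x. h (f' x))"
 using assms(1) bounded_linear.has_vector_derivative[OF assms(2)] unfolding has_pd_def by blast

lemma has_pd_component: "has_pd S i f f' ==> has_pd S i (%x. f x $ j) (%x. f' x $ j)"
 by (rule has_pd_bounded_linear[OF _ bounded_linear_vec_nth])

lemma has_pd_add: "has_pd S i f f' ==> has_pd S i g g' ==> has_pd S i (%x. f x + g x) (%x. f' x + g' x)"
 unfolding has_pd_def by (intro ballI has_vector_derivative_add; simp)

lemma has_pd_const: "has_pd S i (%x. c) (%x. 0)"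
 unfolding has_pd_def by simp

lemma has_pd_cong:
 assumes d: "has_pd S i f f'" and e: "\<And>x. x \<in> S ==> f x = g x"
 shows "has_pd S i g f'"
 unfolding has_pd_def
proof
 fix x assume x: "x \<in> S"
 have 0: "0 \<in> pd_dom S i x" using x by (simp add: pd_dom_def)
 show "((%r. g (x + r *\<^sub>R axis i 1)) has_vector_derivative f' x) (at 0 within pd_dom S i x)"
  by (rule has_vector_derivative_transform[OF 0 _ bspec[OF d[unfolded has_pd_def] x]]) (simp add: pd_dom_def e)
qed

context rt begin

abbreviation "cs s \<equiv> closed_slab p s"

lemma mem_cs: "x \<in> cs s \<longleftrightarrow> x $ 3 \<in> (ivl p s)"
 by (cases s) auto

lemma mem_open_slab: "x \<in> open_slab p s \<longleftrightarrow> x $ 3 \<in> {zlo p s<..<zhi p s}"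
 by (cases s) auto

lemma slabbox_subset_cs: "slabbox a b s \<subseteq> cs s"
 by (rule subsetI) (simp add: mem_cs mem_box3)

lemma pd_dom_cs: "pd_dom (cs s) i x = (if i = 3 then {zlo p s - x $ 3..zhi p s - x $ 3} else (if x \<in> cs s then UNIV else {}))"
proof (cases "i = 3")
 case True then show ?thesis by (auto simp: pd_dom_def mem_cs axis_def)
next
 case False 
 then have "axis i (1::real) $ 3 = 0" by (simp add: axis_def)
 then show ?thesis using False by (simp add: pd_dom_def mem_cs)
qed

lemma pd_dom_nontrivial: 
 assumes "x \<in> cs s" shows "at (0::real) within pd_dom (cs s) i x \<noteq> bot"
proof (cases "i = 3")
 case True
 have "(0::real) islimpt {zlo p s - x $ 3..zhi p s - x $ 3}"
  using assms zlo_less_zhi[of s] by (subst islimpt_Icc) (auto simp: mem_cs)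
 then show ?thesis using True by (simp add: pd_dom_cs trivial_limit_within)
qed (use assms in \<open>simp add: pd_dom_cs\<close>)

lemma has_pd_unique:
 assumes "has_pd (cs s) i f f'" "has_pd (cs s) i f f''" "x \<in> cs s" shows "f' x = f'' x"
 using vector_derivative_unique_within[OF pd_dom_nontrivial[OF assms(3)]] assms unfolding has_pd_def by blast

text \<open>At every point of a closed slab the set of admissible increments accumulates at zero, so that one-
  sided partial derivatives are unique.\<close>

lemma pd_eq: "has_pd (cs s) i f f' ==> x \<in> cs s ==> pd (cs s) i f x = f' x"
 unfolding pd_def has_pd_def using vector_derivative_within[OF pd_dom_nontrivial] by blast

lemma convex_pd_dom: "convex (pd_dom (cs s) i x)"
 by (auto simp: pd_dom_cs)

definition C1on :: "side => (real^3 => real) => bool" where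
 "C1on s f \<longleftrightarrow> continuous_on (cs s) f \<and> (\<forall>i. has_pd (cs s) i f (pd (cs s) i f) \<and> continuous_on (cs s) (pd (cs s) i f))"

text \<open>The partial derivatives are determined by the field, so any continuous candidates suffice.\<close>

lemma C1onI:
 assumes "continuous_on (cs s) f" "\<And>i. has_pd (cs s) i f (f' i)" "\<And>i. continuous_on (cs s) (f' i)"
 shows "C1on s f"
proof -
 have e: "pd (cs s) i f x = f' i x" if "x \<in> cs s" for i x by (rule pd_eq[OF assms(2) that])
 have "has_pd (cs s) i f (pd (cs s) i f)" for i
  using assms(2)[of i] unfolding has_pd_def by (simp add: e)
 moreover have "continuous_on (cs s) (pd (cs s) i f)" for i
  using assms(3)[of i] by (rule continuous_on_eq) (simp add: e)
 ultimately show ?thesis using assms(1) by (simp add: C1on_def)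
qed

lemma C1on_cont: "C1on s f ==> continuous_on (cs s) f"
 and C1on_pd: "C1on s f ==> has_pd (cs s) i f (pd (cs s) i f)"
 and C1on_pd_cont: "C1on s f ==> continuous_on (cs s) (pd (cs s) i f)"
 by (simp_all add: C1on_def)

lemma C1on_add: "C1on s f ==> C1on s g ==> C1on s (%x. f x + g x)"
 by (rule C1onI[where f'="%i x. pd (cs s) i f x + pd (cs s) i g x"])
  (auto intro!: continuous_intros has_pd_add simp: C1on_def)

lemma C1on_mult: "C1on s f ==> C1on s g ==> C1on s (%x. f x * g x)"
 by (rule C1onI[where f'="%i x. f x * pd (cs s) i g x + pd (cs s) i f x * g x"])
  (auto intro!: continuous_intros has_pd_mult simp: C1on_def)

lemma C1on_const: "C1on s (%x. c)"
 by (rule C1onI[where f'="%i x. 0"]) (auto intro!: has_pd_const)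

lemma C1on_third:
 assumes d: "\<And>z. z \<in> (ivl p s) ==> (c has_real_derivative c' z) (at z)" and c: "continuous_on (ivl p s) c'"
 shows "C1on s (%x. c (x $ 3))"
proof (rule C1onI)
 have "continuous_on (ivl p s) c" 
  by (rule DERIV_continuous_on) (rule DERIV_subset[OF d], auto)
 then show "continuous_on (cs s) (%x. c (x $ 3))"
  by (rule continuous_on_compose2) (auto intro!: continuous_intros simp: mem_cs)
 show "continuous_on (cs s) (%x. if i = 3 then c' (x $ 3) else 0)" for i :: 3
 proof (cases "i = 3")
  case True
  have "continuous_on (cs s) (%x. c' (x $ 3))" by (rule continuous_on_compose2[OF c]) (auto intro!: continuous_intros simp: mem_cs)
  then show ?thesis using True by simp
 qed simp
 fix i :: 3
 show "has_pd (cs s) i (%x. c (x $ 3)) (%x. if i = 3 then c' (x $ 3) else 0)"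
  unfolding has_pd_def
 proof
  fix x assume x: "x \<in> cs s"
  have "((%r. (x + r *\<^sub>R axis i 1) $ 3) has_real_derivative (if i = 3 then 1 else 0)) (at 0 within pd_dom (cs s) i x)"
   by (auto intro!: derivative_eq_intros simp: axis_def)
  moreover have "(c has_real_derivative c' (x $ 3)) (at ((x + 0 *\<^sub>R axis i 1) $ 3))" using d[of "x $ 3"] x by (simp add: mem_cs)
  ultimately have "((%r. c ((x + r *\<^sub>R axis i 1) $ 3)) has_real_derivative c' (x $ 3) * (if i = 3 then 1 else 0)) (at 0 within pd_dom (cs s) i x)"
   by (intro DERIV_chain2)
  then show "((%r. c ((x + r *\<^sub>R axis i 1) $ 3)) has_vector_derivative (if i = 3 then c' (x $ 3) else 0)) (at 0 within pd_dom (cs s) i x)"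
   unfolding has_real_derivative_iff_has_vector_derivative[symmetric] by (simp split: if_splits)
 qed
qed

lemma smooth_rho_third:
 assumes f: "smooth_pos f" shows "C1on s (%x. f (rho p s (x $ 3)))" "C1on s (%x. deriv f (rho p s (x $ 3)))"
proof -
 have nz: "dpres p s z \<noteq> 0" if "z \<in> (ivl p s)" for z using dpres_pos[OF that] by simp
 have cc: "continuous_on (ivl p s) (%z. g (rho p s z))" if "\<And>z. z > 0 ==> isCont g z" for g :: "real => real"
 proof (rule continuous_on_compose2[OF _ coeff_cont(1)])
  show "continuous_on {0<..} g" using that by (intro continuous_at_imp_continuous_on) auto
 qed (use rho_pos in auto)
 have d2: "isCont (deriv (deriv f)) z" if "z > 0" for z
 proof -
  have "(deriv ^^ 2) f field_differentiable (at z)" using f that unfolding smooth_pos_def by blast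
  then show ?thesis by (auto simp: eval_nat_numeral field_differentiable_def intro: DERIV_isCont)
 qed
 have d1: "isCont (deriv f) z" if "z > 0" for z using smooth_pos_deriv(2)[OF f that] by (rule DERIV_isCont)
 show "C1on s (%x. f (rho p s (x $ 3)))"
 proof (rule C1on_third)
  fix z assume z: "z \<in> (ivl p s)"
  show "((%z. f (rho p s z)) has_real_derivative deriv f (rho p s z) * (- grav p * rho p s z / dpres p s z)) (at z)"
   by (rule DERIV_chain2[OF smooth_pos_deriv(1)[OF f rho_pos[OF z]] rho_deriv[OF z]])
 qed (intro continuous_intros cc d1 coeff_cont; use nz in auto)
 show "C1on s (%x. deriv f (rho p s (x $ 3)))"
 proof (rule C1on_third)
  fix z assume z: "z \<in> (ivl p s)"
  show "((%z. deriv f (rho p s z)) has_real_derivative deriv (deriv f) (rho p s z) * (- grav p * rho p s z / dpres p s z)) (at z)"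
   by (rule DERIV_chain2[OF smooth_pos_deriv(2)[OF f rho_pos[OF z]] rho_deriv[OF z]])
 qed (intro continuous_intros cc d2 coeff_cont; use nz in auto)
qed

lemma coeff_C1: "C1on s (%x. dpres p s (x $ 3))" "C1on s (%x. eps0 p s (x $ 3))" "C1on s (%x. del0 p s (x $ 3))"
 using smooth_rho_third(2)[OF smooth(1)] smooth_rho_third(1)[OF smooth(2)] smooth_rho_third(1)[OF smooth(3)]
 by (simp_all add: dpres_def eps0_def del0_def)

end

section \<open>Regularity in time and space\<close>

lemma Creg_continuous: "Creg S k F ==> continuous_on ({0..} \<times> S) (%(t, x). F t x)"
 by (cases k) auto

lemma Creg_Suc_has_pd: "Creg S (Suc k) F ==> t \<ge> 0 ==> has_pd S i (F t) (pd S i (F t))"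
 unfolding has_pd_def pd_def by (simp add: vector_derivative_works[symmetric])

lemma Creg_Suc_pd: "Creg S (Suc k) F ==> Creg S k (%t. pd S i (F t))"
 by simp

lemma continuous_on_slice_x: 
 assumes "continuous_on ({0..} \<times> S) (%(t, x). F t x)" "t \<ge> 0" shows "continuous_on S (F t)"
proof -
 have "continuous_on S (%x. (%(t, x). F t x) (t, x))"
  by (rule continuous_on_compose2[OF assms(1)]) (use assms(2) in \<open>auto intro!: continuous_intros\<close>)
 then show ?thesis by simp
qed

lemma continuous_on_slice_t: 
 assumes "continuous_on ({0..} \<times> S) (%(t, x). F t x)" "x \<in> S" shows "continuous_on {0..} (%t. F t x)"
proof -
 have "continuous_on {0..} (%t. (%(t, x). F t x) (t, x))"
  by (rule continuous_on_compose2[OF assms(1)]) (use assms(2) in \<open>auto intro!: continuous_intros\<close>)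
 then show ?thesis by simp
qed

lemma time_diff_dt: "time_diff S F ==> t \<ge> 0 ==> x \<in> S ==> ((%\<tau>. F \<tau> x) has_vector_derivative dt F t x) (at t within {0..})"
 unfolding time_diff_def dt_def by (simp add: vector_derivative_works[symmetric])

lemma time_nontrivial: "t \<ge> 0 ==> at (t::real) within {0..} \<noteq> bot"
proof -
 assume "t \<ge> 0"
 then have "t islimpt {0..t+1}" by (subst islimpt_Icc) auto
 then have "t islimpt {0..}" by (rule islimpt_subset) auto
 then show ?thesis by (simp add: trivial_limit_within)
qed

text \<open>Time and space derivatives commute, because the field is the time integral of its time
  derivative.\<close>

lemma (in rt) pd_dt_commute:
 fixes F :: "real => real^3 => 'a::euclidean_space"
 assumes d: "time_diff (cs s) F" and F: "Creg (cs s) (Suc k) F" and G: "Creg (cs s) (Suc l) (dt F)"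
  and x: "x \<in> cs s" and t: "t \<ge> 0"
 shows "((%\<tau>. pd (cs s) i (F \<tau>) x) has_vector_derivative pd (cs s) i (dt F t) x) (at t within {0..})"
proof -
 let ?P = "pd_dom (cs s) i x"
 have in_cs: "x + r *\<^sub>R axis i 1 \<in> cs s" if "r \<in> ?P" for r using that by (simp add: pd_dom_def)
 have 0: "0 \<in> ?P" using x by (simp add: pd_dom_def)
 have cG: "continuous_on ({0..} \<times> cs s) (%(t, x). dt F t x)" by (rule Creg_continuous[OF G])
 have cpG: "continuous_on ({0..} \<times> cs s) (%(t, x). pd (cs s) i (dt F t) x)" by (rule Creg_continuous[OF Creg_Suc_pd[OF G]])
 have int: "((%\<sigma>. dt F \<sigma> y) has_integral (F \<tau> y - F 0 y)) {0..\<tau>}" if "y \<in> cs s" "\<tau> \<ge> 0" for y \<tau>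
  by (rule fundamental_theorem_of_calculus[OF that(2)])
   (rule has_vector_derivative_within_subset[OF time_diff_dt[OF d _ that(1)]], auto)
 have dG: "((%r. dt F \<sigma> (x + r *\<^sub>R axis i 1)) has_vector_derivative pd (cs s) i (dt F \<sigma>) (x + r *\<^sub>R axis i 1)) (at r within ?P)"
  if r: "r \<in> ?P" and s: "\<sigma> \<ge> 0" for r \<sigma>
 proof -
  let ?y = "x + r *\<^sub>R axis i 1"
  have "((%q. dt F \<sigma> (?y + q *\<^sub>R axis i 1)) has_vector_derivative pd (cs s) i (dt F \<sigma>) ?y) (at 0 within pd_dom (cs s) i ?y)"
   using Creg_Suc_has_pd[OF G s] in_cs[OF r] unfolding has_pd_def by blast
  moreover have "pd_dom (cs s) i ?y = {q. r + q \<in> ?P}" by (auto simp: pd_dom_def algebra_simps)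
  ultimately have "((%q. (%r. dt F \<sigma> (x + r *\<^sub>R axis i 1)) (r + q)) has_vector_derivative pd (cs s) i (dt F \<sigma>) ?y) (at 0 within {q. r + q \<in> ?P})"
   by (simp add: algebra_simps)
  from shift_vector_derivative[OF this] show ?thesis .
 qed
 have pdF: "pd (cs s) i (F \<tau>) x = pd (cs s) i (F 0) x + integral {0..\<tau>} (%\<sigma>. pd (cs s) i (dt F \<sigma>) x)" if "\<tau> \<ge> 0" for \<tau>
 proof -
  have A: "((%r. integral (cbox 0 \<tau>) (%\<sigma>. dt F \<sigma> (x + r *\<^sub>R axis i 1))) has_vector_derivative
    integral (cbox 0 \<tau>) (%\<sigma>. pd (cs s) i (dt F \<sigma>) (x + 0 *\<^sub>R axis i 1))) (at 0 within ?P)"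
  proof (rule leibniz_rule_vector_derivative[where fx="%r \<sigma>. pd (cs s) i (dt F \<sigma>) (x + r *\<^sub>R axis i 1)"])
   fix r \<sigma> assume "r \<in> ?P" "\<sigma> \<in> cbox 0 \<tau>"
   then show "((%r. dt F \<sigma> (x + r *\<^sub>R axis i 1)) has_vector_derivative pd (cs s) i (dt F \<sigma>) (x + r *\<^sub>R axis i 1)) (at r within ?P)"
    by (intro dG) auto
  next
   fix r assume "r \<in> ?P"
   show "(%\<sigma>. dt F \<sigma> (x + r *\<^sub>R axis i 1)) integrable_on cbox 0 \<tau>"
    by (intro integrable_continuous continuous_on_subset[OF continuous_on_slice_t[OF cG in_cs[OF \<open>r \<in> ?P\<close>]]]) auto
  next
   have "continuous_on (?P \<times> cbox 0 \<tau>) (%X. (%(t, x). pd (cs s) i (dt F t) x) (snd X, x + fst X *\<^sub>R axis i 1))"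
    by (rule continuous_on_compose2[OF cpG]) (auto intro!: continuous_intros in_cs)
   then show "continuous_on (?P \<times> cbox 0 \<tau>) (%(r, \<sigma>). pd (cs s) i (dt F \<sigma>) (x + r *\<^sub>R axis i 1))"
    by (simp add: case_prod_unfold)
  qed (use 0 convex_pd_dom in auto)
  have B: "F \<tau> (x + r *\<^sub>R axis i 1) - F 0 (x + r *\<^sub>R axis i 1) = integral (cbox 0 \<tau>) (%\<sigma>. dt F \<sigma> (x + r *\<^sub>R axis i 1))" if "r \<in> ?P" for r
   using int[OF in_cs[OF that] \<open>\<tau> \<ge> 0\<close>] by (simp add: integral_unique)
  have z: "x + 0 *\<^sub>R axis i 1 = x" by simp
  from A[unfolded z cbox_interval] have 1: "((%r. F \<tau> (x + r *\<^sub>R axis i 1) - F 0 (x + r *\<^sub>R axis i 1)) has_vector_derivative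
    integral {0..\<tau>} (%\<sigma>. pd (cs s) i (dt F \<sigma>) x)) (at 0 within ?P)"
   by (rule has_vector_derivative_transform[OF 0, rotated]) (rule B[unfolded cbox_interval])
  have 2: "((%r. F \<tau>' (x + r *\<^sub>R axis i 1)) has_vector_derivative pd (cs s) i (F \<tau>') x) (at 0 within ?P)" if "\<tau>' \<ge> 0" for \<tau>'
   using Creg_Suc_has_pd[OF F that] x unfolding has_pd_def by blast
  from vector_derivative_unique_within[OF pd_dom_nontrivial[OF x] 1 has_vector_derivative_diff[OF 2[OF that] 2[of 0]]]
  show ?thesis by simp
 qed
 have "((%u. integral {0..u} (%\<sigma>. pd (cs s) i (dt F \<sigma>) x)) has_vector_derivative pd (cs s) i (dt F t) x) (at t within {0..t+1})"
  by (rule integral_has_vector_derivative) (use t in \<open>auto intro!: continuous_on_subset[OF continuous_on_slice_t[OF cpG x]]\<close>)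
 then have "((%u. pd (cs s) i (F 0) x + integral {0..u} (%\<sigma>. pd (cs s) i (dt F \<sigma>) x)) has_vector_derivative pd (cs s) i (dt F t) x) (at t within {0..t+1})"
  by (auto intro!: derivative_eq_intros)
 then have "((%\<tau>. pd (cs s) i (F \<tau>) x) has_vector_derivative pd (cs s) i (dt F t) x) (at t within {0..t+1})"
 proof (rule has_vector_derivative_transform[rotated 2])
  show "t \<in> {0..t+1}" using t by simp
  fix u assume "u \<in> {0..t+1}"
  then show "pd (cs s) i (F u) x = pd (cs s) i (F 0) x + integral {0..u} (%\<sigma>. pd (cs s) i (dt F \<sigma>) x)"
   by (intro pdF) simp
 qed
 moreover have "at t within {0..t+1} = at t within {0..}"
  by (rule at_within_nhd[of _ "{..<t+1}"]) (use t in auto)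
 ultimately show ?thesis by simp
qed


lemma has_vector_derivative_vec:
 fixes f :: "real => 'a::euclidean_space ^ 'n::finite"
 assumes "\<And>i. ((%t. f t $ i) has_vector_derivative f' $ i) F"
 shows "(f has_vector_derivative f') F"
proof -
 have bl: "bounded_linear (axis i :: 'a => 'a ^ 'n)" for i
  by (rule linear_conv_bounded_linear[THEN iffD1]) (auto intro!: linearI simp: vec_eq_iff axis_def)
 have e: "x = (\<Sum>i\<in>UNIV. axis i (x $ i))" for x :: "'a ^ 'n"
  by (simp add: vec_eq_iff axis_def if_distrib[of "%v. v $ _"] cong: if_cong)
 have "((%t. \<Sum>i\<in>UNIV. axis i (f t $ i)) has_vector_derivative (\<Sum>i\<in>UNIV. axis i (f' $ i))) F"
  by (intro has_vector_derivative_sum bounded_linear.has_vector_derivative[OF bl] assms)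
 then show ?thesis by (simp only: e[symmetric])
qed

context rt begin

lemma Dmat_nth:
 assumes "\<And>j. has_pd (cs s) j u (pd (cs s) j u)" "x \<in> cs s"
 shows "Dmat (cs s) u x $ i $ j = pd (cs s) j u x $ i"
 using pd_eq[OF has_pd_component[OF assms(1)] assms(2)] by (simp add: Dmat_def)

lemma divg_trace: "divg S u x = trace (Dmat S u x)"
 by (simp add: divg_def trace_def Dmat_def)

lemma Dmat_has_pd:
 fixes F :: "real => real^3 => real^3"
 assumes F: "Creg (cs s) (Suc k) F" and t: "t \<ge> 0"
 shows "has_pd (cs s) j (%x. F t x $ i) (%x. Dmat (cs s) (F t) x $ i $ j)"
proof -
 have h: "has_pd (cs s) j (F t) (pd (cs s) j (F t))" for j by (rule Creg_Suc_has_pd[OF F t])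
 show ?thesis using has_pd_component[OF h[of j], of i] unfolding has_pd_def by (simp add: Dmat_nth[OF h])
qed

lemma Dmat_cont:
 fixes F :: "real => real^3 => real^3"
 assumes F: "Creg (cs s) (Suc k) F"
 shows "continuous_on ({0..} \<times> cs s) (%(t, x). Dmat (cs s) (F t) x)"
proof (rule continuous_on_eq)
 have c: "continuous_on ({0..} \<times> cs s) (%X. pd (cs s) j (F (fst X)) (snd X))" for j
  using Creg_continuous[OF Creg_Suc_pd[OF F], of j] by (simp add: case_prod_unfold)
 show "continuous_on ({0..} \<times> cs s) (%X. (\<chi> i j. pd (cs s) j (F (fst X)) (snd X) $ i) :: real^3^3)"
  by (intro continuous_on_vec_lambda continuous_on_component c)
 fix X :: "real \<times> (real^3)" assume "X \<in> {0..} \<times> cs s"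
 then show "(\<chi> i j. pd (cs s) j (F (fst X)) (snd X) $ i) = (case X of (t, x) => Dmat (cs s) (F t) x)"
  using Dmat_nth[OF Creg_Suc_has_pd[OF F]] by (cases X) (simp add: vec_eq_iff)
qed

text \<open>Entrywise form of the commutation of derivatives.\<close>

lemma Dmat_dt:
 fixes F :: "real => real^3 => real^3"
 assumes d: "time_diff (cs s) F" and F: "Creg (cs s) (Suc k) F" and G: "Creg (cs s) (Suc l) (dt F)"
  and x: "x \<in> cs s" and t: "t \<ge> 0"
 shows "((%\<tau>. Dmat (cs s) (F \<tau>) x) has_vector_derivative Dmat (cs s) (dt F t) x) (at t within {0..})"
proof (intro has_vector_derivative_vec)
 fix i j
 have "((%\<tau>. pd (cs s) j (F \<tau>) x $ i) has_vector_derivative pd (cs s) j (dt F t) x $ i) (at t within {0..})"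
  by (rule bounded_linear.has_vector_derivative[OF bounded_linear_vec_nth pd_dt_commute[OF d F G x t]])
 then have "((%\<tau>. pd (cs s) j (F \<tau>) x $ i) has_vector_derivative Dmat (cs s) (dt F t) x $ i $ j) (at t within {0..})"
  by (simp only: Dmat_nth[OF Creg_Suc_has_pd[OF G t] x])
 then show "((%\<tau>. Dmat (cs s) (F \<tau>) x $ i $ j) has_vector_derivative Dmat (cs s) (dt F t) x $ i $ j) (at t within {0..})"
 proof (rule has_vector_derivative_transform[rotated 2])
  show "t \<in> {0..}" using t by simp
  fix \<tau> :: real assume "\<tau> \<in> {0..}"
  then show "Dmat (cs s) (F \<tau>) x $ i $ j = pd (cs s) j (F \<tau>) x $ i" by (intro Dmat_nth[OF Creg_Suc_has_pd[OF F] x]) simp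
 qed
qed

lemma C1on_cong: "C1on s f ==> (\<And>x. x \<in> cs s ==> f x = g x) ==> C1on s g"
proof -
 assume f: "C1on s f" and e: "\<And>x. x \<in> cs s ==> f x = g x"
 show ?thesis
 proof (rule C1onI)
  show "continuous_on (cs s) g" by (rule continuous_on_eq[OF C1on_cont[OF f] e])
  show "has_pd (cs s) i g (pd (cs s) i f)" for i by (rule has_pd_cong[OF C1on_pd[OF f] e])
  show "continuous_on (cs s) (pd (cs s) i f)" for i by (rule C1on_pd_cont[OF f])
 qed
qed

lemma C1on_Creg: 
 fixes F :: "real => real^3 => real"
 assumes F: "Creg (cs s) (Suc k) F" and t: "t \<ge> 0" shows "C1on s (F t)"
 using continuous_on_slice_x[OF Creg_continuous[OF F] t] Creg_Suc_has_pd[OF F t]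
  continuous_on_slice_x[OF Creg_continuous[OF Creg_Suc_pd[OF F]] t] by (simp add: C1on_def)

lemma C1on_Creg_nth:
 fixes F :: "real => real^3 => real^3"
 assumes F: "Creg (cs s) (Suc k) F" and t: "t \<ge> 0" shows "C1on s (%x. F t x $ i)"
proof (rule C1onI)
 show "continuous_on (cs s) (%x. F t x $ i)" by (intro continuous_on_component continuous_on_slice_x[OF Creg_continuous[OF F] t])
 show "has_pd (cs s) j (%x. F t x $ i) (%x. pd (cs s) j (F t) x $ i)" for j by (rule has_pd_component[OF Creg_Suc_has_pd[OF F t]])
 show "continuous_on (cs s) (%x. pd (cs s) j (F t) x $ i)" for j 
  by (intro continuous_on_component continuous_on_slice_x[OF Creg_continuous[OF Creg_Suc_pd[OF F]] t])
qed

lemma C1on_Dmat: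
 fixes F :: "real => real^3 => real^3"
 assumes F: "Creg (cs s) (Suc (Suc k)) F" and t: "t \<ge> 0" shows "C1on s (%x. Dmat (cs s) (F t) x $ i $ j)"
 by (rule C1on_cong[OF C1on_Creg_nth[OF Creg_Suc_pd[OF F, of j] t]]) (simp add: Dmat_nth[OF Creg_Suc_has_pd[OF F t]])

text \<open>A function continuous on a closed slab is determined by its values on the open slab.\<close>

lemma eq_on_closed_slab:
 fixes f g :: "real^3 => 'a::real_normed_vector"
 assumes f: "continuous_on (cs s) f" and g: "continuous_on (cs s) g" and e: "\<And>x. x \<in> open_slab p s ==> f x = g x" and x: "x \<in> cs s"
 shows "f x = g x"
proof -
 let ?y = "%z. x + (z - x $ 3) *\<^sub>R axis 3 1"
 have y3: "?y z $ 3 = z" for z by (simp add: axis_def)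
 have c: "continuous_on (ivl p s) (%z. f (?y z) - g (?y z))"
  by (intro continuous_on_diff continuous_on_compose2[OF f] continuous_on_compose2[OF g] continuous_intros) (use y3 in \<open>auto simp: mem_cs\<close>)
 have cl: "closure {zlo p s<..<zhi p s} = (ivl p s)" using zlo_less_zhi[of s] by (rule closure_greaterThanLessThan)
 have i: "f (?y z) - g (?y z) = 0" if "z \<in> {zlo p s<..<zhi p s}" for z
 proof -
  have "?y z \<in> open_slab p s" unfolding mem_open_slab y3 by (rule that)
  then show ?thesis by (simp only: e diff_self)
 qed
 have "x $ 3 \<in> closure {zlo p s<..<zhi p s}" unfolding cl using x by (simp only: mem_cs)
 from continuous_constant_on_closure[OF c[folded cl] i this]
 have "f (?y (x $ 3)) - g (?y (x $ 3)) = 0" .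
 then show ?thesis by (simp only: diff_self scaleR_zero_left add_0_right eq_iff_diff_eq_0[symmetric])
qed

text \<open>The viscous stress as a linear function of the velocity gradient.\<close>

definition stressm :: "side => real => real^3^3 => real^3^3" where
 "stressm s z A = eps0 p s z *\<^sub>R (A + transpose A - (2 / 3 * trace A) *\<^sub>R mat 1) + (del0 p s z * trace A) *\<^sub>R mat 1"

lemma visc_stress_eq: "visc_stress p s u x = stressm s (x $ 3) (Dmat (cs s) u x)"
 by (simp add: visc_stress_def stressm_def dev_sym_def divg_trace)

lemma stressm_nth: "stressm s z A $ i $ j = eps0 p s z * (A $ i $ j + A $ j $ i - 2 / 3 * (A$1$1 + A$2$2 + A$3$3) * (if i = j then 1 else 0))
 + del0 p s z * (A$1$1 + A$2$2 + A$3$3) * (if i = j then 1 else 0)"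
 by (simp add: stressm_def transpose_def mat_def trace_def sum_3)

lemma stressm_bounded_linear: "bounded_linear (stressm s z)"
 by (rule linear_conv_bounded_linear[THEN iffD1]) 
  (auto intro!: linearI simp: vec_eq_iff stressm_nth algebra_simps)

lemma stressm_cont:
 assumes A: "continuous_on T A" and z: "continuous_on T z" "\<And>x. x \<in> T ==> z x \<in> (ivl p s)"
 shows "continuous_on T (%x. stressm s (z x) (A x))"
proof -
 have c: "continuous_on T (%x. eps0 p s (z x))" "continuous_on T (%x. del0 p s (z x))"
  using z by (auto intro: continuous_on_compose2[OF coeff_cont(3)] continuous_on_compose2[OF coeff_cont(4)])
 have "continuous_on T (%x. \<chi> i j. stressm s (z x) (A x) $ i $ j)"
  unfolding stressm_nth
  by (intro continuous_on_vec_lambda continuous_on_add continuous_on_diff continuous_on_mult continuous_on_const continuous_on_component c A)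
 then show ?thesis by simp
qed

lemma integral_slabbox_cong:
 fixes f g :: "real^3 => real"
 assumes "\<And>x. x \<in> slabbox a b s ==> x \<in> open_slab p s ==> f x = g x"
 shows "integral (slabbox a b s) f = integral (slabbox a b s) g"
proof -
 have "integral (box (pt3 (a,a,zlo p s)) (pt3 (b,b,zhi p s))) f = integral (box (pt3 (a,a,zlo p s)) (pt3 (b,b,zhi p s))) g"
 proof (rule integral_cong)
  fix x assume x: "x \<in> box (pt3 (a,a,zlo p s)) (pt3 (b,b,zhi p s))"
  have "x \<in> slabbox a b s" using x box_subset_cbox[of "pt3 (a,a,zlo p s)" "pt3 (b,b,zhi p s)"] by (auto simp: box3_def)
  moreover have "x \<in> open_slab p s" using spec[OF x[unfolded mem_box_cart], of 3] by (simp add: mem_open_slab)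
  ultimately show "f x = g x" by (rule assms)
 qed
 then show ?thesis by (simp add: integral_open_interval box3_def)
qed

lemma slab_plane: "x \<in> {a..b} ==> y \<in> {a..b} ==> pt3 (x,y,0) \<in> slabbox a b s"
 using depth_pos height_pos by (cases s) (auto simp: mem_box3)

text \<open>Test fields: continuous across the interface and zero on the rigid boundaries.\<close>

definition test_field :: "real => real => (side => real^3 => real^3) => (side => real^3 => real^3^3) => bool" where
 "test_field a b \<zeta> Z \<longleftrightarrow>
  (\<forall>s i j. has_pd (slabbox a b s) j (%x. \<zeta> s x $ i) (%x. Z s x $ i $ j)) \<and>
  (\<forall>s. continuous_on (slabbox a b s) (\<zeta> s)) \<and> (\<forall>s. continuous_on (slabbox a b s) (Z s)) \<and>
  (\<forall>x\<in>{a..b}. \<forall>y\<in>{a..b}. \<zeta> Lower (pt3 (x,y,0)) = \<zeta> Upper (pt3 (x,y,0)) \<and>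
    \<zeta> Lower (pt3 (x,y,- depth p)) = 0 \<and> \<zeta> Upper (pt3 (x,y,height p)) = 0)"

text \<open>The interface terms of the two slabs combine to the jump of the stress, because the test field is
  continuous there.\<close>

lemma test_integral_by_parts:
 assumes ab: "a <= b" and tf: "test_field a b \<zeta> Z" and T: "\<And>s i j. C1on s (%x. T s x $ i $ j)"
  and m: "\<And>s z i j. z \<in> (ivl p s) ==> faces_match a b z (%x. \<zeta> s x $ i * T s x $ i $ j)"
 shows "(\<Sum>s\<in>sides. integral (slabbox a b s) (%x. (\<Sum>i\<in>UNIV. \<zeta> s x $ i * (\<Sum>j\<in>UNIV. pd (cs s) j (%y. T s y $ i $ j) x)) + Z s x \<bullet> (T s x :: real^3^3)))
  = - integral (hbox a b) (%(x,y). \<Sum>i\<in>UNIV. \<zeta> Upper (pt3 (x,y,0)) $ i * (T Upper (pt3 (x,y,0)) $ i $ 3 - T Lower (pt3 (x,y,0)) $ i $ 3))"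
proof -
 define P where "P s i j = (%x. \<zeta> s x $ i * pd (cs s) j (%y. T s y $ i $ j) x + Z s x $ i $ j * T s x $ i $ j)" for s i j
 have pdT: "has_pd (slabbox a b s) j (%x. T s x $ i $ j) (pd (cs s) j (%y. T s y $ i $ j))" for s i j
  by (rule has_pd_subset[OF C1on_pd[OF T] slabbox_subset_cs])
 have cT: "continuous_on (slabbox a b s) (%x. T s x $ i $ j)" "continuous_on (slabbox a b s) (pd (cs s) j (%y. T s y $ i $ j))" for s i j
  using continuous_on_subset[OF C1on_cont[OF T] slabbox_subset_cs] continuous_on_subset[OF C1on_pd_cont[OF T] slabbox_subset_cs] by blast+
 have cz: "continuous_on (slabbox a b s) (%x. \<zeta> s x $ i)" "continuous_on (slabbox a b s) (%x. Z s x $ i $ j)" for s i j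
  using tf unfolding test_field_def by (intro continuous_on_component; blast)+
 have pdz: "has_pd (slabbox a b s) j (%x. \<zeta> s x $ i) (%x. Z s x $ i $ j)" for s i j using tf by (simp add: test_field_def)
 have pdP: "has_pd (slabbox a b s) j (%x. \<zeta> s x $ i * T s x $ i $ j) (P s i j)" for s i j
  unfolding P_def by (rule has_pd_mult[OF pdz pdT])
 have cP: "continuous_on (slabbox a b s) (P s i j)" for s i j unfolding P_def by (intro continuous_on_add continuous_on_mult cT cz)
 have cG: "continuous_on (slabbox a b s) (%x. \<zeta> s x $ i * T s x $ i $ j)" for s i j by (intro continuous_on_mult cT cz)
 have lh: "zlo p s <= zhi p s" for s using zlo_less_zhi[of s] by simp
 have hor: "integral (slabbox a b s) (P s i j) = 0" if "j \<noteq> 3" for s i j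
  by (rule integral_box3_pd_horizontal[OF ab pdP that cP m])
 define B where "B s i z = integral (hbox a b) (%(x,y). \<zeta> s (pt3 (x,y,z)) $ i * T s (pt3 (x,y,z)) $ i $ 3)" for s i z
 have ver: "integral (slabbox a b s) (P s i 3) = B s i (zhi p s) - B s i (zlo p s)" for s i
  unfolding B_def by (rule integral_box3_pd_vertical[OF lh pdP cP cG])
 have Bz: "B Lower i (- depth p) = 0" "B Upper i (height p) = 0" for i
 proof -
  have z: "integral (hbox a b) f = 0" if "\<And>x y. x \<in> {a..b} ==> y \<in> {a..b} ==> f (x,y) = 0" for f :: "real \<times> real => real"
   using integral_cong[of "hbox a b" f "%x. 0"] that by (auto simp: hbox_def cbox_Pair_eq)
  show "B Lower i (- depth p) = 0" "B Upper i (height p) = 0" unfolding B_def using tf by (auto intro!: z simp: test_field_def)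
 qed
 have "integral (slabbox a b s) (%x. (\<Sum>i\<in>UNIV. \<zeta> s x $ i * (\<Sum>j\<in>UNIV. pd (cs s) j (%y. T s y $ i $ j) x)) + Z s x \<bullet> T s x)
  = (\<Sum>i\<in>UNIV. \<Sum>j\<in>UNIV. integral (slabbox a b s) (P s i j))" for s
 proof -
  have "integral (slabbox a b s) (%x. (\<Sum>i\<in>UNIV. \<zeta> s x $ i * (\<Sum>j\<in>UNIV. pd (cs s) j (%y. T s y $ i $ j) x)) + Z s x \<bullet> T s x)
   = integral (slabbox a b s) (%x. \<Sum>i\<in>UNIV. \<Sum>j\<in>UNIV. P s i j x)"
   by (rule integral_cong) (simp add: P_def inner_vec_def sum.distrib sum_distrib_left)
  also have "\<dots> = (\<Sum>i\<in>UNIV. integral (slabbox a b s) (%x. \<Sum>j\<in>UNIV. P s i j x))"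
   by (intro integral_sum integrable_box3 continuous_on_sum cP) auto
  also have "\<dots> = (\<Sum>i\<in>UNIV. \<Sum>j\<in>UNIV. integral (slabbox a b s) (P s i j))"
   by (intro sum.cong refl integral_sum integrable_box3 cP) auto
  finally show ?thesis .
 qed
 also have "(\<Sum>i\<in>UNIV. \<Sum>j\<in>UNIV. integral (slabbox a b s) (P s i j)) = (\<Sum>i\<in>UNIV. B s i (zhi p s) - B s i (zlo p s))" for s
  by (simp add: sum_3 hor ver)
 finally have "(\<Sum>s\<in>sides. integral (slabbox a b s) (%x. (\<Sum>i\<in>UNIV. \<zeta> s x $ i * (\<Sum>j\<in>UNIV. pd (cs s) j (%y. T s y $ i $ j) x)) + Z s x \<bullet> T s x))
  = (\<Sum>i\<in>UNIV. B Lower i 0) - (\<Sum>i\<in>UNIV. B Upper i 0)"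
  by (simp add: Bz sum_negf)
 also have "\<dots> = - integral (hbox a b) (%(x,y). \<Sum>i\<in>UNIV. \<zeta> Upper (pt3 (x,y,0)) $ i * (T Upper (pt3 (x,y,0)) $ i $ 3 - T Lower (pt3 (x,y,0)) $ i $ 3))"
 proof -
  have 0: "0 \<in> (ivl p s)" for s using depth_pos height_pos by (cases s) auto
  have c0: "continuous_on (hbox a b) (%X. \<zeta> s (pt3 (fst X,snd X,0)) $ i * T s (pt3 (fst X,snd X,0)) $ i $ 3)" for s i
   using continuous_on_box3_slice[OF cG 0] by (simp add: case_prod_unfold)
  have "(\<Sum>i\<in>UNIV. B s i 0) = integral (hbox a b) (%X. \<Sum>i\<in>UNIV. \<zeta> s (pt3 (fst X,snd X,0)) $ i * T s (pt3 (fst X,snd X,0)) $ i $ 3)" for s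
   unfolding B_def case_prod_unfold by (rule integral_sum[symmetric]) (auto intro!: integrable_hbox c0)
  then have "(\<Sum>i\<in>UNIV. B Lower i 0) - (\<Sum>i\<in>UNIV. B Upper i 0) = integral (hbox a b) (%X. (\<Sum>i\<in>UNIV. \<zeta> Lower (pt3 (fst X,snd X,0)) $ i * T Lower (pt3 (fst X,snd X,0)) $ i $ 3) - (\<Sum>i\<in>UNIV. \<zeta> Upper (pt3 (fst X,snd X,0)) $ i * T Upper (pt3 (fst X,snd X,0)) $ i $ 3))"
   by (subst integral_diff) (auto intro!: integrable_hbox continuous_on_sum c0)
  also have "\<dots> = integral (hbox a b) (%X. - (%(x,y). \<Sum>i\<in>UNIV. \<zeta> Upper (pt3 (x,y,0)) $ i * (T Upper (pt3 (x,y,0)) $ i $ 3 - T Lower (pt3 (x,y,0)) $ i $ 3)) X)"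
  proof (rule integral_cong)
   fix X assume "X \<in> hbox a b"
   then have "\<zeta> Lower (pt3 (fst X,snd X,0)) = \<zeta> Upper (pt3 (fst X,snd X,0))" using tf by (cases X) (auto simp: test_field_def mem_hbox)
   then show "(\<Sum>i\<in>UNIV. \<zeta> Lower (pt3 (fst X,snd X,0)) $ i * T Lower (pt3 (fst X,snd X,0)) $ i $ 3) - (\<Sum>i\<in>UNIV. \<zeta> Upper (pt3 (fst X,snd X,0)) $ i * T Upper (pt3 (fst X,snd X,0)) $ i $ 3)
    = - (%(x,y). \<Sum>i\<in>UNIV. \<zeta> Upper (pt3 (x,y,0)) $ i * (T Upper (pt3 (x,y,0)) $ i $ 3 - T Lower (pt3 (x,y,0)) $ i $ 3)) X"
    by (simp add: case_prod_unfold sum_3 algebra_simps)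
  qed
  finally show ?thesis by simp
 qed
 finally show ?thesis .
qed

end


section \<open>The weak form of the linearized problem\<close>

locale lin_sol = rt +
 fixes \<eta> v :: "side => real => real^3 => real^3" and q :: "side => real => real^3 => real"
 assumes sol: "lin_solution p \<eta> v q"
begin

abbreviation "w s \<equiv> dt (v s)"
abbreviation "Dv s t \<equiv> Dmat (cs s) (v s t)"
abbreviation "Dw s t \<equiv> Dmat (cs s) (w s t)"
abbreviation "Deta s t \<equiv> Dmat (cs s) (\<eta> s t)"

lemma td: "time_diff (cs s) (\<eta> s)" "time_diff (cs s) (v s)" "time_diff (cs s) (w s)" "time_diff (cs s) (q s)"
 using sol by (simp_all add: lin_solution_def regular_fields_def Let_def)

lemma cr: "Creg (cs s) (Suc (Suc 0)) (\<eta> s)" "Creg (cs s) (Suc (Suc 0)) (dt (\<eta> s))" "Creg (cs s) (Suc (Suc 0)) (v s)"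
 "Creg (cs s) (Suc (Suc 0)) (w s)" "Creg (cs s) 0 (dt (w s))" "Creg (cs s) (Suc 0) (q s)" "Creg (cs s) (Suc 0) (dt (q s))"
 using sol unfolding lin_solution_def regular_fields_def Let_def numeral_2_eq_2 One_nat_def by blast+

lemmas joint_cont = cr[THEN Creg_continuous]

lemma slice: "t \<ge> 0 ==> continuous_on (cs s) (\<eta> s t)" "t \<ge> 0 ==> continuous_on (cs s) (dt (\<eta> s) t)" "t \<ge> 0 ==> continuous_on (cs s) (v s t)"
 "t \<ge> 0 ==> continuous_on (cs s) (w s t)" "t \<ge> 0 ==> continuous_on (cs s) (dt (w s) t)" "t \<ge> 0 ==> continuous_on (cs s) (q s t)" "t \<ge> 0 ==> continuous_on (cs s) (dt (q s) t)"
 by (rule joint_cont[THEN continuous_on_slice_x]; assumption)+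

lemma D_slice: "t \<ge> 0 ==> continuous_on (cs s) (Dv s t)" "t \<ge> 0 ==> continuous_on (cs s) (Dw s t)" "t \<ge> 0 ==> continuous_on (cs s) (Deta s t)"
 by (rule Dmat_cont[OF cr(3), THEN continuous_on_slice_x] Dmat_cont[OF cr(4), THEN continuous_on_slice_x] Dmat_cont[OF cr(1), THEN continuous_on_slice_x]; assumption)+

lemma rho_third_cont: "continuous_on (cs s) (%x. rho p s (x $ 3))" "continuous_on (cs s) (%x. dpres p s (x $ 3))"
 by (rule continuous_on_compose2[OF coeff_cont(1)] continuous_on_compose2[OF coeff_cont(2)]; auto intro!: continuous_intros simp: mem_cs)+

lemma eta_eq: 
 assumes "t > 0" "x \<in> cs s" shows "dt (\<eta> s) t x = v s t x"
proof (rule eq_on_closed_slab[OF _ _ _ assms(2)])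
 fix x assume "x \<in> open_slab p s"
 then show "dt (\<eta> s) t x = v s t x" using sol assms(1) unfolding lin_solution_def Let_def by blast
qed (use assms(1) slice in auto)

lemma q_eq: 
 assumes "t > 0" "x \<in> cs s" shows "dt (q s) t x = - rho p s (x $ 3) * trace (Dv s t x)"
proof (rule eq_on_closed_slab[OF _ _ _ assms(2)])
 fix x assume "x \<in> open_slab p s"
 then have "dt (q s) t x + rho p s (x $ 3) * divg (cs s) (v s t) x = 0" using sol assms(1) unfolding lin_solution_def Let_def by blast
 then show "dt (q s) t x = - rho p s (x $ 3) * trace (Dv s t x)" by (simp add: divg_trace)
next
 have "continuous_on (cs s) (%x. trace (Dv s t x))"
  unfolding trace_def using D_slice(1)[of t s] assms(1) by (intro continuous_on_sum continuous_on_component) auto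
 then show "continuous_on (cs s) (%x. - rho p s (x $ 3) * trace (Dv s t x))"
  by (intro continuous_on_mult continuous_on_minus rho_third_cont)
qed (use assms(1) slice in auto)

text \<open>The total stress (pressure minus viscous stress).\<close>

definition Tm :: "side => real => real^3 => real^3^3" where
 "Tm s t x = (dpres p s (x $ 3) * q s t x) *\<^sub>R mat 1 - stressm s (x $ 3) (Dv s t x)"

lemma Tm_nth: "Tm s t x $ i $ j = (if i = j then 1 else 0) * (dpres p s (x $ 3) * q s t x) + (- 1) * stressm s (x $ 3) (Dv s t x) $ i $ j"
 by (simp add: Tm_def mat_def)

lemma stress_C1: "t \<ge> 0 ==> C1on s (%x. stressm s (x $ 3) (Dv s t x) $ i $ j)"
proof -
 assume t: "t \<ge> 0"
 note D = C1on_Dmat[OF cr(3) t]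
 have neg: "C1on s f ==> C1on s g ==> C1on s (%x. f x - g x)" for f g
  using C1on_add[of s f "%x. (- 1) * g x"] C1on_mult[OF C1on_const[of s "-1"], of g] by simp
 show ?thesis unfolding stressm_nth
  by (intro C1on_add neg C1on_mult C1on_const coeff_C1 D)
qed

lemma Pq_C1: "t \<ge> 0 ==> C1on s (%x. dpres p s (x $ 3) * q s t x)"
 by (rule C1on_mult[OF coeff_C1(1) C1on_Creg[OF cr(6)]])

lemma Tm_C1: "t \<ge> 0 ==> C1on s (%x. Tm s t x $ i $ j)"
 unfolding Tm_nth by (intro C1on_add C1on_mult C1on_const Pq_C1 stress_C1)

lemma momentum:
 assumes t: "t > 0" and x: "x \<in> open_slab p s"
 shows "(\<Sum>j\<in>UNIV. pd (cs s) j (%y. Tm s t y $ i $ j) x) = 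
  - (rho p s (x $ 3) * w s t x $ i + grav p * q s t x * (if i = 3 then 1 else 0) + grav p * rho p s (x $ 3) * Deta s t x $ 3 $ i)"
proof -
 have xc: "x \<in> cs s" using x unfolding mem_open_slab mem_cs by simp
 have t0: "t \<ge> 0" using t by simp
 have pdT: "pd (cs s) j (%y. Tm s t y $ i $ j) x = (if i = j then 1 else 0) * pd (cs s) j (%y. dpres p s (y $ 3) * q s t y) x
  + (- 1) * pd (cs s) j (%y. stressm s (y $ 3) (Dv s t y) $ i $ j) x" for j
  unfolding Tm_nth
  by (rule pd_eq[OF has_pd_add[OF has_pd_bounded_linear[OF C1on_pd[OF Pq_C1[OF t0]] bounded_linear_mult_right]
   has_pd_bounded_linear[OF C1on_pd[OF stress_C1[OF t0]] bounded_linear_mult_right]] xc])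
 have sum: "(\<Sum>j\<in>UNIV. pd (cs s) j (%y. Tm s t y $ i $ j) x) = pd (cs s) i (%y. dpres p s (y $ 3) * q s t y) x
  - (\<Sum>j\<in>UNIV. pd (cs s) j (%y. stressm s (y $ 3) (Dv s t y) $ i $ j) x)"
  unfolding pdT using exhaust_3[of i] by (auto simp: sum_3)
 have "rho p s (x $ 3) *\<^sub>R w s t x + grad (cs s) (%y. dpres p s (y $ 3) * q s t y) x
     + (grav p * q s t x) *\<^sub>R e3 + (grav p * rho p s (x $ 3)) *\<^sub>R grad (cs s) (%y. \<eta> s t y $ 3) x
    = divmat (cs s) (visc_stress p s (v s t)) x"
  using sol t x unfolding lin_solution_def Let_def by blast
 then have "(rho p s (x $ 3) *\<^sub>R w s t x + grad (cs s) (%y. dpres p s (y $ 3) * q s t y) x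
     + (grav p * q s t x) *\<^sub>R e3 + (grav p * rho p s (x $ 3)) *\<^sub>R grad (cs s) (%y. \<eta> s t y $ 3) x) $ i
    = divmat (cs s) (visc_stress p s (v s t)) x $ i" by simp
 then have "rho p s (x $ 3) * w s t x $ i + pd (cs s) i (%y. dpres p s (y $ 3) * q s t y) x + grav p * q s t x * (if i = 3 then 1 else 0)
  + grav p * rho p s (x $ 3) * Deta s t x $ 3 $ i = (\<Sum>j\<in>UNIV. pd (cs s) j (%y. stressm s (y $ 3) (Dv s t y) $ i $ j) x)"
  by (simp add: grad_def divmat_def visc_stress_eq e3_def axis_def Dmat_def)
 then show ?thesis unfolding sum by linarith
qed

lemma jump_stress_Tm: "jump_stress p s (q s t) (v s t) x = Tm s t x"
 unfolding vec_eq_iff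
 by (simp add: jump_stress_def Let_def Tm_nth stressm_nth divg_trace trace_def sum_3 mat_def transpose_def algebra_simps)

text \<open>The jump condition: only surface tension acts, and only in the normal direction.\<close>

lemma jump_Tm:
 assumes t: "t > 0" and x: "x $ 3 = 0"
 shows "Tm Upper t x $ i $ 3 - Tm Lower t x $ i $ 3 = (if i = 3 then surf p * hlap (cs Upper) (%y. \<eta> Upper t y $ 3) x else 0)"
proof -
 have "(jump_stress p Upper (q Upper t) (v Upper t) x - jump_stress p Lower (q Lower t) (v Lower t) x) *v e3
    = (surf p * hlap (cs Upper) (%y. \<eta> Upper t y $ 3) x) *\<^sub>R e3"
  using sol t x unfolding lin_solution_def Let_def by blast
 then have "((Tm Upper t x - Tm Lower t x) *v e3) $ i = ((surf p * hlap (cs Upper) (%y. \<eta> Upper t y $ 3) x) *\<^sub>R e3) $ i"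
  by (simp only: jump_stress_Tm)
 then show ?thesis by (simp add: matrix_vector_mult_def sum_3 e3_def axis_def)
qed

lemma v_boundary:
 assumes t: "t \<ge> 0"
 shows "v Upper t (pt3 (x,y,0)) = v Lower t (pt3 (x,y,0))" "v Lower t (pt3 (x,y,- depth p)) = 0" "v Upper t (pt3 (x,y,height p)) = 0"
proof -
 have ext: "f t = 0" if "continuous_on {0..} f" "\<And>t. t > 0 ==> f t = 0" for f :: "real => real^3"
  using continuous_constant_on_closure[of "{0<..}" f 0 t] that t by simp
 have m: "pt3 (x,y,0) \<in> cs s" "pt3 (x,y,- depth p) \<in> cs Lower" "pt3 (x,y,height p) \<in> cs Upper" for s
  unfolding mem_cs using depth_pos height_pos by (cases s; simp)+
 have "v Upper t (pt3 (x,y,0)) - v Lower t (pt3 (x,y,0)) = 0"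
 proof (rule ext)
  fix t :: real assume t: "t > 0"
  have "\<forall>x. x $ 3 = 0 \<longrightarrow> v Upper t x - v Lower t x = 0" using sol t unfolding lin_solution_def by blast
  then show "v Upper t (pt3 (x,y,0)) - v Lower t (pt3 (x,y,0)) = 0" by simp
 qed (intro continuous_on_diff continuous_on_slice_t[OF joint_cont(3)] m)
 then show "v Upper t (pt3 (x,y,0)) = v Lower t (pt3 (x,y,0))" by simp
 have bd: "\<forall>x. (x $ 3 = - depth p \<longrightarrow> v Lower t x = 0) \<and> (x $ 3 = height p \<longrightarrow> v Upper t x = 0)" if "t > 0" for t
  using sol that unfolding lin_solution_def by blast
 show "v Lower t (pt3 (x,y,- depth p)) = 0" 
  by (rule ext[OF continuous_on_slice_t[OF joint_cont(3) m(2)]]) (use bd in simp)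
 show "v Upper t (pt3 (x,y,height p)) = 0"
  by (rule ext[OF continuous_on_slice_t[OF joint_cont(3) m(3)]]) (use bd in simp)
qed

lemma dt_unique:
 assumes "((%\<tau>. f \<tau>) has_vector_derivative d) (at t within {0..})" "\<And>\<tau>. \<tau> \<ge> 0 ==> f \<tau> = 0" "t \<ge> 0"
 shows "d = 0"
proof -
 have "((%\<tau>. 0) has_vector_derivative d) (at t within {0..})"
  by (rule has_vector_derivative_transform[OF _ _ assms(1)]) (use assms in auto)
 then show ?thesis using vector_derivative_unique_within[OF time_nontrivial[OF assms(3)]] has_vector_derivative_const by blast
qed

text \<open>The boundary conditions hold for all times and can be differentiated.\<close>

lemma w_boundary:
 assumes t: "t \<ge> 0"
 shows "w Upper t (pt3 (x,y,0)) = w Lower t (pt3 (x,y,0))" "w Lower t (pt3 (x,y,- depth p)) = 0" "w Upper t (pt3 (x,y,height p)) = 0"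
proof -
 have m: "pt3 (x,y,0) \<in> cs s" "pt3 (x,y,- depth p) \<in> cs Lower" "pt3 (x,y,height p) \<in> cs Upper" for s
  unfolding mem_cs using depth_pos height_pos by (cases s; simp)+
 have "w Upper t (pt3 (x,y,0)) - w Lower t (pt3 (x,y,0)) = 0"
  by (rule dt_unique[OF has_vector_derivative_diff[OF time_diff_dt[OF td(2) t m(1)] time_diff_dt[OF td(2) t m(1)]] _ t]) (simp add: v_boundary)
 then show "w Upper t (pt3 (x,y,0)) = w Lower t (pt3 (x,y,0))" by simp
 show "w Lower t (pt3 (x,y,- depth p)) = 0" by (rule dt_unique[OF time_diff_dt[OF td(2) t m(2)] _ t]) (simp add: v_boundary)
 show "w Upper t (pt3 (x,y,height p)) = 0" by (rule dt_unique[OF time_diff_dt[OF td(2) t m(3)] _ t]) (simp add: v_boundary)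
qed

context
 fixes a b :: real and \<zeta> :: "side => real^3 => real^3" and Z :: "side => real^3 => real^3^3"
 assumes ab: "a <= b" and tf: "test_field a b \<zeta> Z"
  and lat1: "\<And>t s z i j. t > 0 ==> z \<in> (ivl p s) ==> faces_match a b z (%x. \<zeta> s x $ i * Tm s t x $ i $ j)"
  and lat2: "\<And>t k. t > 0 ==> k \<noteq> 3 ==> faces_match a b 0 (%x. \<zeta> Upper x $ 3 * Deta Upper t x $ 3 $ k)"
begin

lemma zeta_cont: "continuous_on (slabbox a b s) (\<zeta> s)" "continuous_on (slabbox a b s) (Z s)"
 using tf by (simp_all add: test_field_def)

definition "Wd s t x = rho p s (x $ 3) * (\<zeta> s x \<bullet> w s t x) + grav p * q s t x * \<zeta> s x $ 3 + grav p * rho p s (x $ 3) * (\<zeta> s x \<bullet> Deta s t x $ 3)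
 - Z s x \<bullet> Tm s t x"

definition "Wi t X = Z Upper (pt3 (fst X, snd X, 0)) $ 3 $ 1 * Deta Upper t (pt3 (fst X, snd X, 0)) $ 3 $ 1
 + Z Upper (pt3 (fst X, snd X, 0)) $ 3 $ 2 * Deta Upper t (pt3 (fst X, snd X, 0)) $ 3 $ 2"

text \<open>One horizontal derivative of surface tension is moved to the test field.\<close>

lemma interface_by_parts:
 assumes t: "t > 0"
 shows "integral (hbox a b) (%X. \<zeta> Upper (pt3 (fst X, snd X, 0)) $ 3 * hlap (cs Upper) (%y. \<eta> Upper t y $ 3) (pt3 (fst X, snd X, 0))) = - integral (hbox a b) (Wi t)"
proof -
 have t0: "t \<ge> 0" using t by simp
 have z0: "0 \<in> {zlo p Upper..zhi p Upper}" using height_pos by simp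
 have D: "C1on Upper (%x. Deta Upper t x $ 3 $ k)" for k by (rule C1on_Dmat[OF cr(1) t0])
 have pe: "(%x. Deta Upper t x $ 3 $ k) = pd (cs Upper) k (%y. \<eta> Upper t y $ 3)" for k by (simp add: Dmat_def fun_eq_iff)
 define G where "G k = (%x. \<zeta> Upper x $ 3 * pd (cs Upper) k (%x. Deta Upper t x $ 3 $ k) x + Z Upper x $ 3 $ k * Deta Upper t x $ 3 $ k)" for k
 have pdG: "has_pd (slabbox a b Upper) k (%x. \<zeta> Upper x $ 3 * Deta Upper t x $ 3 $ k) (G k)" for k
  unfolding G_def by (rule has_pd_mult[OF _ has_pd_subset[OF C1on_pd[OF D] slabbox_subset_cs]]) (use tf in \<open>simp add: test_field_def del: zlo.simps zhi.simps\<close>)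
 have c1: "continuous_on (slabbox a b Upper) (%x. \<zeta> Upper x $ 3 * pd (cs Upper) k (%x. Deta Upper t x $ 3 $ k) x)" for k
  by (intro continuous_on_mult continuous_on_component zeta_cont continuous_on_subset[OF C1on_pd_cont[OF D] slabbox_subset_cs])
 have c2: "continuous_on (slabbox a b Upper) (%x. Z Upper x $ 3 $ k * Deta Upper t x $ 3 $ k)" for k
  by (intro continuous_on_mult continuous_on_component zeta_cont continuous_on_subset[OF D_slice(3)[OF t0] slabbox_subset_cs])
 note sl = continuous_on_box3_slice[OF _ z0, unfolded case_prod_unfold]
 have G0: "integral (hbox a b) (%X. G k (pt3 (fst X, snd X, 0))) = 0" if "k \<noteq> 3" for k
 proof -
  have cG: "continuous_on (slabbox a b Upper) (G k)" unfolding G_def by (intro continuous_on_add c1 c2)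
  have "integral (hbox a b) (%(x,y). G k (pt3 (x,y,0))) = 0"
   by (rule integral_hbox_pd_eq_0[OF ab pdG that slab_plane continuous_on_box3_slice[OF cG z0] lat2[OF t that]])
  then show ?thesis by (simp add: case_prod_unfold)
 qed
 have split: "integral (hbox a b) (%X. \<zeta> Upper (pt3 (fst X, snd X, 0)) $ 3 * pd (cs Upper) k (%x. Deta Upper t x $ 3 $ k) (pt3 (fst X, snd X, 0)))
  = - integral (hbox a b) (%X. Z Upper (pt3 (fst X, snd X, 0)) $ 3 $ k * Deta Upper t (pt3 (fst X, snd X, 0)) $ 3 $ k)" if "k \<noteq> 3" for k
  using G0[OF that] unfolding G_def
  by (subst (asm) integral_add[OF integrable_hbox[OF sl[OF c1]] integrable_hbox[OF sl[OF c2]]]) simp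
 have 12: "(1::3) \<noteq> 3" "(2::3) \<noteq> 3" by auto
 have "integral (hbox a b) (%X. \<zeta> Upper (pt3 (fst X, snd X, 0)) $ 3 * hlap (cs Upper) (%y. \<eta> Upper t y $ 3) (pt3 (fst X, snd X, 0)))
  = integral (hbox a b) (%X. \<zeta> Upper (pt3 (fst X, snd X, 0)) $ 3 * pd (cs Upper) 1 (%x. Deta Upper t x $ 3 $ 1) (pt3 (fst X, snd X, 0))
   + \<zeta> Upper (pt3 (fst X, snd X, 0)) $ 3 * pd (cs Upper) 2 (%x. Deta Upper t x $ 3 $ 2) (pt3 (fst X, snd X, 0)))"
  unfolding hlap_def pe by (simp add: distrib_left)
 also have "\<dots> = - integral (hbox a b) (%X. Z Upper (pt3 (fst X, snd X, 0)) $ 3 $ 1 * Deta Upper t (pt3 (fst X, snd X, 0)) $ 3 $ 1)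
  - integral (hbox a b) (%X. Z Upper (pt3 (fst X, snd X, 0)) $ 3 $ 2 * Deta Upper t (pt3 (fst X, snd X, 0)) $ 3 $ 2)"
  by (subst integral_add[OF integrable_hbox[OF sl[OF c1]] integrable_hbox[OF sl[OF c1]]]) (simp add: split 12 del: closed_slab.simps)
 also have "\<dots> = - integral (hbox a b) (Wi t)"
  unfolding Wi_def[abs_def] by (subst integral_add[OF integrable_hbox[OF sl[OF c2]] integrable_hbox[OF sl[OF c2]]]) simp
 finally show ?thesis .
qed

text \<open>The momentum equation tested with a fixed field, at positive times.\<close>

lemma weak_form:
 assumes t: "t > 0"
 shows "(\<Sum>s\<in>sides. integral (slabbox a b s) (Wd s t)) + surf p * integral (hbox a b) (Wi t) = 0"
proof -
 have t0: "t \<ge> 0" using t by simp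
 have "integral (slabbox a b s) (%x. (\<Sum>i\<in>UNIV. \<zeta> s x $ i * (\<Sum>j\<in>UNIV. pd (cs s) j (%y. Tm s t y $ i $ j) x)) + Z s x \<bullet> Tm s t x)
  = integral (slabbox a b s) (%x. - Wd s t x)" for s
 proof (rule integral_slabbox_cong)
  fix x assume x: "x \<in> open_slab p s"
  show "(\<Sum>i\<in>UNIV. \<zeta> s x $ i * (\<Sum>j\<in>UNIV. pd (cs s) j (%y. Tm s t y $ i $ j) x)) + Z s x \<bullet> Tm s t x = - Wd s t x"
   unfolding momentum[OF t x] Wd_def by (simp add: inner_vec_def[of "\<zeta> s x"] sum_3 algebra_simps)
 qed
 then have "- (\<Sum>s\<in>sides. integral (slabbox a b s) (Wd s t)) = - integral (hbox a b) (%(x,y). \<Sum>i\<in>UNIV. \<zeta> Upper (pt3 (x,y,0)) $ i * (Tm Upper t (pt3 (x,y,0)) $ i $ 3 - Tm Lower t (pt3 (x,y,0)) $ i $ 3))"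
  using test_integral_by_parts[OF ab tf Tm_C1[OF t0] lat1[OF t]] by simp
 also have "\<dots> = - integral (hbox a b) (%X. surf p * (\<zeta> Upper (pt3 (fst X, snd X, 0)) $ 3 * hlap (cs Upper) (%y. \<eta> Upper t y $ 3) (pt3 (fst X, snd X, 0))))"
 proof -
  have "(\<Sum>i\<in>UNIV. \<zeta> Upper (pt3 (x,y,0)) $ i * (Tm Upper t (pt3 (x,y,0)) $ i $ 3 - Tm Lower t (pt3 (x,y,0)) $ i $ 3))
   = surf p * (\<zeta> Upper (pt3 (x,y,0)) $ 3 * hlap (cs Upper) (%y. \<eta> Upper t y $ 3) (pt3 (x,y,0)))" for x y
   by (subst jump_Tm[OF t]) (simp_all add: sum_3)
  then show ?thesis by (simp add: case_prod_unfold)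
 qed
 also have "\<dots> = surf p * integral (hbox a b) (Wi t)" by (simp only: integral_mult_right interface_by_parts[OF t] mult_minus_right minus_minus)
 finally show ?thesis by simp
qed

definition "Wd' s t x = rho p s (x $ 3) * (\<zeta> s x \<bullet> dt (w s) t x) + grav p * dt (q s) t x * \<zeta> s x $ 3
 + grav p * rho p s (x $ 3) * (\<zeta> s x \<bullet> Dmat (cs s) (dt (\<eta> s) t) x $ 3)
 - Z s x \<bullet> ((dpres p s (x $ 3) * dt (q s) t x) *\<^sub>R mat 1 - stressm s (x $ 3) (Dw s t x))"

definition "Wi' t X = Z Upper (pt3 (fst X, snd X, 0)) $ 3 $ 1 * Dmat (cs Upper) (dt (\<eta> Upper) t) (pt3 (fst X, snd X, 0)) $ 3 $ 1
 + Z Upper (pt3 (fst X, snd X, 0)) $ 3 $ 2 * Dmat (cs Upper) (dt (\<eta> Upper) t) (pt3 (fst X, snd X, 0)) $ 3 $ 2"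

lemma Wd_deriv:
 assumes t: "t \<ge> 0" and x: "x \<in> slabbox a b s"
 shows "((%\<tau>. Wd s \<tau> x) has_real_derivative Wd' s t x) (at t within {0..})"
proof -
 have xc: "x \<in> cs s" using x slabbox_subset_cs by blast
 note d = time_diff_dt[OF td(3) t xc] time_diff_dt[OF td(4) t xc] Dmat_dt[OF td(1) cr(1,2) xc t] Dmat_dt[OF td(2) cr(3,4) xc t]
 have 1: "((%\<tau>. \<zeta> s x \<bullet> w s \<tau> x) has_vector_derivative \<zeta> s x \<bullet> dt (w s) t x) (at t within {0..})"
  by (rule bounded_linear.has_vector_derivative[OF bounded_linear_inner_right d(1)])
 have 2: "((%\<tau>. \<zeta> s x \<bullet> Deta s \<tau> x $ 3) has_vector_derivative \<zeta> s x \<bullet> Dmat (cs s) (dt (\<eta> s) t) x $ 3) (at t within {0..})"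
  by (rule bounded_linear.has_vector_derivative[OF bounded_linear_compose[OF bounded_linear_inner_right bounded_linear_vec_nth] d(3)])
 have 3: "((%\<tau>. Tm s \<tau> x) has_vector_derivative (dpres p s (x $ 3) * dt (q s) t x) *\<^sub>R mat 1 - stressm s (x $ 3) (Dw s t x)) (at t within {0..})"
  unfolding Tm_def
  by (intro has_vector_derivative_diff bounded_linear.has_vector_derivative[OF stressm_bounded_linear d(4)]
    bounded_linear.has_vector_derivative[OF bounded_linear_scaleR_left] has_vector_derivative_mult_right d(2))
 have 4: "((%\<tau>. Z s x \<bullet> Tm s \<tau> x) has_vector_derivative Z s x \<bullet> ((dpres p s (x $ 3) * dt (q s) t x) *\<^sub>R mat 1 - stressm s (x $ 3) (Dw s t x))) (at t within {0..})"
  by (rule bounded_linear.has_vector_derivative[OF bounded_linear_inner_right 3])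
 show ?thesis unfolding Wd_def Wd'_def
  by (rule derivative_eq_intros 1[folded has_real_derivative_iff_has_vector_derivative] 2[folded has_real_derivative_iff_has_vector_derivative]
   4[folded has_real_derivative_iff_has_vector_derivative] d(2)[folded has_real_derivative_iff_has_vector_derivative] refl)+ simp
qed

lemma third_joint: "continuous_on ({0..} \<times> slabbox a b s) (%X. rho p s (snd X $ 3))" "continuous_on ({0..} \<times> slabbox a b s) (%X. dpres p s (snd X $ 3))"
 by (rule continuous_on_compose2[OF coeff_cont(1)] continuous_on_compose2[OF coeff_cont(2)]; auto intro!: continuous_intros simp: mem_box3)+

lemma zeta_joint: "continuous_on ({0..} \<times> slabbox a b s) (%X. \<zeta> s (snd X))" "continuous_on ({0..} \<times> slabbox a b s) (%X. Z s (snd X))"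
 by (rule continuous_on_compose2[OF zeta_cont(1)] continuous_on_compose2[OF zeta_cont(2)]; auto intro!: continuous_intros)+

lemma joint_sub: "continuous_on ({0..} \<times> cs s) (%(t, x). F t x) ==> continuous_on ({0..} \<times> slabbox a b s) (%X. F (fst X) (snd X))"
 using slabbox_subset_cs[of a b s] by (simp add: case_prod_unfold) (erule continuous_on_subset, blast)

lemma Wd'_joint: "continuous_on ({0..} \<times> slabbox a b s) (%X. Wd' s (fst X) (snd X))"
proof -
 have st: "continuous_on ({0..} \<times> slabbox a b s) (%X. stressm s (snd X $ 3) (Dw s (fst X) (snd X)))"
  by (rule stressm_cont[OF joint_sub[OF Dmat_cont[OF cr(4)]]]) (auto intro!: continuous_intros simp: mem_box3)
 show ?thesis unfolding Wd'_def
  by (intro continuous_on_add continuous_on_diff continuous_on_mult continuous_on_inner continuous_on_const continuous_on_component continuous_on_scaleR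
   third_joint zeta_joint joint_sub[OF joint_cont(5)] joint_sub[OF joint_cont(7)] joint_sub[OF Dmat_cont[OF cr(2)]] st)
qed

lemma Wd_integrable: 
 assumes t: "t \<ge> 0" shows "Wd s t integrable_on slabbox a b s"
proof (rule integrable_box3)
 have sub: "continuous_on (cs s) f ==> continuous_on (slabbox a b s) f" for f :: "real^3 => 'b::real_normed_vector"
  by (erule continuous_on_subset) (rule slabbox_subset_cs)
 have "continuous_on (slabbox a b s) (%x. stressm s (x $ 3) (Dv s t x))"
  by (rule stressm_cont[OF sub[OF D_slice(1)[OF t]]]) (auto intro!: continuous_intros simp: mem_box3)
 then show "continuous_on (slabbox a b s) (Wd s t)"
  unfolding Wd_def[abs_def] Tm_def
  by (intro continuous_on_add continuous_on_diff continuous_on_mult continuous_on_inner continuous_on_const continuous_on_component continuous_on_scaleR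
   zeta_cont sub[OF rho_third_cont(1)] sub[OF rho_third_cont(2)] sub[OF slice(4)] sub[OF slice(6)] sub[OF D_slice(3)] t)
qed

text \<open>The tested equation is an identity in time, so its derivative vanishes too. Afterwards the first two
  equations replace \<open>\<eta>\<^sub>t\<close> by \<open>v\<close> and \<open>q\<^sub>t\<close> by
  \<open>- \<rho> div v\<close>. The test field does not move; it may therefore be chosen as
  \<open>v\<^sub>t\<close> at the time under consideration.\<close>

lemma weak_form_dt:
 assumes t: "t > 0"
 shows "(\<Sum>s\<in>sides. integral (slabbox a b s) (%x. rho p s (x $ 3) * (\<zeta> s x \<bullet> dt (w s) t x) - grav p * rho p s (x $ 3) * trace (Dv s t x) * \<zeta> s x $ 3
  + grav p * rho p s (x $ 3) * (\<zeta> s x \<bullet> Dv s t x $ 3) + dpres p s (x $ 3) * rho p s (x $ 3) * trace (Dv s t x) * trace (Z s x) + Z s x \<bullet> stressm s (x $ 3) (Dw s t x)))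
  + surf p * integral (hbox a b) (%X. Z Upper (pt3 (fst X, snd X, 0)) $ 3 $ 1 * Dv Upper t (pt3 (fst X, snd X, 0)) $ 3 $ 1
   + Z Upper (pt3 (fst X, snd X, 0)) $ 3 $ 2 * Dv Upper t (pt3 (fst X, snd X, 0)) $ 3 $ 2) = 0"
proof -
 have t0: "t \<ge> 0" using t by simp
 have dI: "((%\<tau>. integral (slabbox a b s) (Wd s \<tau>)) has_real_derivative integral (slabbox a b s) (Wd' s t)) (at t within {0..})" for s
  unfolding box3_def
 proof (rule leibniz_rule_field_derivative)
  show "continuous_on ({0..} \<times> cbox (pt3 (a,a,zlo p s)) (pt3 (b,b,zhi p s))) (%(t, x). Wd' s t x)"
   using Wd'_joint[of s] by (simp add: box3_def case_prod_unfold)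
 qed (use Wd_deriv[unfolded box3_def] Wd_integrable[unfolded box3_def] t0 in auto)
 have pl: "pt3 (fst X, snd X, 0) \<in> slabbox a b Upper" if "X \<in> hbox a b" for X using slab_plane[of "fst X" a b "snd X"] that by (cases X) (simp add: mem_hbox del: zlo.simps zhi.simps)
 have pc: "pt3 (fst X, snd X, 0) \<in> cs Upper" for X unfolding mem_cs using height_pos by simp
 have cZ: "continuous_on (hbox a b) (%X. Z Upper (pt3 (fst X, snd X, 0)))"
  by (rule continuous_on_compose2[OF zeta_cont(2)[of Upper]]) (auto intro!: continuous_intros pl simp del: zlo.simps zhi.simps)
 have dW: "((%\<tau>. integral (hbox a b) (Wi \<tau>)) has_real_derivative integral (hbox a b) (Wi' t)) (at t within {0..})"
  unfolding hbox_def
 proof (rule leibniz_rule_field_derivative)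
  fix t :: real and X assume tX: "t \<in> {0..}" "X \<in> cbox (a,a) (b,b)"
  have "((%\<tau>. Deta Upper \<tau> (pt3 (fst X, snd X, 0)) $ 3 $ k) has_vector_derivative Dmat (cs Upper) (dt (\<eta> Upper) t) (pt3 (fst X, snd X, 0)) $ 3 $ k) (at t within {0..})" for k
   by (rule bounded_linear.has_vector_derivative[OF bounded_linear_compose[OF bounded_linear_vec_nth bounded_linear_vec_nth] Dmat_dt[OF td(1) cr(1,2) pc]]) (use tX in simp)
  note dk = this[folded has_real_derivative_iff_has_vector_derivative]
  show "((%\<tau>. Wi \<tau> X) has_real_derivative Wi' t X) (at t within {0..})"
   unfolding Wi_def Wi'_def by (intro DERIV_add DERIV_cmult dk)
 next
  fix t :: real assume "t \<in> {0..}"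
  then have c: "continuous_on (hbox a b) (%X. Deta Upper t (pt3 (fst X, snd X, 0)))"
   by (intro continuous_on_compose2[OF D_slice(3)]) (auto intro!: continuous_intros pc simp del: closed_slab.simps)
  show "Wi t integrable_on cbox (a,a) (b,b)"
   unfolding Wi_def[abs_def] hbox_def[symmetric] 
   by (intro integrable_hbox continuous_on_add continuous_on_mult continuous_on_component cZ c)
 next
  have c: "continuous_on ({0..} \<times> hbox a b) (%Y. Dmat (cs Upper) (dt (\<eta> Upper) (fst Y)) (pt3 (fst (snd Y), snd (snd Y), 0)))"
  proof -
   have "continuous_on ({0..} \<times> hbox a b) (%Y. (%(t, x). Dmat (cs Upper) (dt (\<eta> Upper) t) x) (fst Y, pt3 (fst (snd Y), snd (snd Y), 0)))"
    by (rule continuous_on_compose2[OF Dmat_cont[OF cr(2)]]) (auto intro!: continuous_intros pc simp del: closed_slab.simps)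
   then show ?thesis by simp
  qed
  have cZ2: "continuous_on ({0..} \<times> hbox a b) (%Y. Z Upper (pt3 (fst (snd Y), snd (snd Y), 0)))"
   by (rule continuous_on_compose2[OF cZ]) (auto intro!: continuous_intros)
  show "continuous_on ({0..} \<times> cbox (a,a) (b,b)) (%(t, X). Wi' t X)"
   unfolding Wi'_def hbox_def[symmetric] case_prod_unfold
   by (intro continuous_on_add continuous_on_mult continuous_on_component c cZ2)
 qed (use t0 in auto)
 have tot: "((%\<tau>. (\<Sum>s\<in>sides. integral (slabbox a b s) (Wd s \<tau>)) + surf p * integral (hbox a b) (Wi \<tau>)) has_real_derivative
  (\<Sum>s\<in>sides. integral (slabbox a b s) (Wd' s t)) + surf p * integral (hbox a b) (Wi' t)) (at t within {0..})"
  by (intro DERIV_add DERIV_sum DERIV_cmult dI dW)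
 have "((%\<tau>. 0) has_real_derivative (\<Sum>s\<in>sides. integral (slabbox a b s) (Wd' s t)) + surf p * integral (hbox a b) (Wi' t)) (at t within {0..})"
  by (rule has_field_derivative_transform_within[OF tot t]) (use t weak_form in \<open>auto simp: dist_real_def simp del: sum.insert\<close>)
 moreover have "((%\<tau>. 0) has_real_derivative 0) (at t within {0..})" by simp
 ultimately have zero: "(\<Sum>s\<in>sides. integral (slabbox a b s) (Wd' s t)) + surf p * integral (hbox a b) (Wi' t) = 0"
  using vector_derivative_unique_within[OF time_nontrivial[OF t0]] unfolding has_real_derivative_iff_has_vector_derivative by blast
 have De: "Dmat (cs s) (dt (\<eta> s) t) x = Dv s t x" if x: "x \<in> cs s" for s x
 proof -
  have "pd (cs s) j (dt (\<eta> s) t) x = pd (cs s) j (v s t) x" for j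
   by (rule pd_eq[OF has_pd_cong[OF Creg_Suc_has_pd[OF cr(3) t0] eta_eq[OF t, symmetric]] x])
  then show ?thesis by (simp add: vec_eq_iff Dmat_nth[OF Creg_Suc_has_pd[OF cr(2) t0] x] Dmat_nth[OF Creg_Suc_has_pd[OF cr(3) t0] x])
 qed
 have Wd'_eq: "integral (slabbox a b s) (Wd' s t) = integral (slabbox a b s) (%x. rho p s (x $ 3) * (\<zeta> s x \<bullet> dt (w s) t x) - grav p * rho p s (x $ 3) * trace (Dv s t x) * \<zeta> s x $ 3
  + grav p * rho p s (x $ 3) * (\<zeta> s x \<bullet> Dv s t x $ 3) + dpres p s (x $ 3) * rho p s (x $ 3) * trace (Dv s t x) * trace (Z s x) + Z s x \<bullet> stressm s (x $ 3) (Dw s t x))" for s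
 proof (rule integral_cong)
  fix x assume "x \<in> slabbox a b s"
  then have x: "x \<in> cs s" using slabbox_subset_cs by blast
  have tr: "Z s x \<bullet> mat 1 = trace (Z s x)" by (simp add: inner_vec_def mat_def trace_def sum_3)
  show "Wd' s t x = rho p s (x $ 3) * (\<zeta> s x \<bullet> dt (w s) t x) - grav p * rho p s (x $ 3) * trace (Dv s t x) * \<zeta> s x $ 3
  + grav p * rho p s (x $ 3) * (\<zeta> s x \<bullet> Dv s t x $ 3) + dpres p s (x $ 3) * rho p s (x $ 3) * trace (Dv s t x) * trace (Z s x) + Z s x \<bullet> stressm s (x $ 3) (Dw s t x)"
   unfolding Wd'_def De[OF x] q_eq[OF t x] inner_diff_right inner_scaleR_right tr by (simp add: algebra_simps)
 qed
 have Wi'_eq: "Wi' t = (%X. Z Upper (pt3 (fst X, snd X, 0)) $ 3 $ 1 * Dv Upper t (pt3 (fst X, snd X, 0)) $ 3 $ 1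
   + Z Upper (pt3 (fst X, snd X, 0)) $ 3 $ 2 * Dv Upper t (pt3 (fst X, snd X, 0)) $ 3 $ 2)"
  unfolding Wi'_def[abs_def] De[OF pc] ..
 show ?thesis using zero unfolding Wd'_eq Wi'_eq .
qed

end

end


section \<open>A Gronwall argument\<close>

definition gronwall_const :: "real => real" where
 "gronwall_const L = (1 + (2 + 2 * L) * L) * (1 + 1 / L\<^sup>2 + 1 / L) + (2 + 2 * L) * (1 + 1 / L)"

text \<open>Only the interior of the time interval is tested, since the equations hold for positive times.\<close>

lemma nonincreasing_within:
 fixes f f' :: "real => real"
 assumes T: "0 <= t" "t <= T" and d: "\<And>t. 0 <= t ==> t <= T ==> (f has_real_derivative f' t) (at t within {0..T})"
  and n: "\<And>t. 0 < t ==> t < T ==> f' t <= 0"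
 shows "f t <= f 0"
proof (cases "t = 0")
 case False
 then have t: "0 < t" using T by simp
 show ?thesis
 proof (rule DERIV_nonpos_imp_decreasing_open[OF less_imp_le[OF t]])
  fix x assume x: "0 < x" "x < t"
  have "at x within {0..T} = at x" by (rule at_within_Icc_at) (use x T in auto)
  then show "\<exists>y. (f has_real_derivative y) (at x) \<and> y <= 0" using d[of x] n[of x] x T by auto
 next
  have "continuous_on {0..T} f" by (rule DERIV_continuous_on[where D=f']) (use d in auto)
  then show "continuous_on {0..t} f" by (rule continuous_on_subset) (use T in auto)
 qed
qed simp

text \<open>The rate \<open>L\<close> enters twice: the growing quantities \<open>N\<close>, \<open>D\<close> grow at most like their time
  derivatives \<open>S\<close>, \<open>G\<close> allow, and the energy bounds \<open>S\<close>, \<open>G\<close> by \<open>N\<close>, \<open>D\<close> with the matching weights, so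
  that the combination \<open>N + \<integral> D\<close> satisfies a linear differential inequality with rate \<open>2 L\<close>.\<close>

lemma energy_gronwall:
 fixes N N' D D' S G :: "real => real"
 assumes L: "L > 0" and t: "0 <= t" "t <= T"
  and dN: "\<And>t. 0 <= t ==> t <= T ==> (N has_real_derivative N' t) (at t within {0..T})"
  and dD: "\<And>t. 0 <= t ==> t <= T ==> (D has_real_derivative D' t) (at t within {0..T})"
  and N': "\<And>t. 0 <= t ==> t <= T ==> N' t <= L * N t + S t / L"
  and D': "\<And>t. 0 <= t ==> t <= T ==> D' t <= L * D t + G t / L"
  and G: "continuous_on {0..T} G"
  and E: "\<And>t. 0 <= t ==> t <= T ==> 1/2 * S t + integral {0..t} G <= K + L\<^sup>2 / 2 * N t + L / 2 * D t"
  and nn: "\<And>t. 0 <= t ==> t <= T ==> 0 <= N t" "\<And>t. 0 <= t ==> t <= T ==> 0 <= D t" "\<And>t. 0 <= t ==> t <= T ==> 0 <= S t" "0 <= K"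
 shows "N t + D t + S t <= gronwall_const L * exp (2 * L * t) * (N 0 + D 0 + K)"
proof -
 have cD: "continuous_on {0..T} D" by (rule DERIV_continuous_on[where D=D']) (use dD in auto)
 have iG: "((%t. integral {0..t} G) has_real_derivative G t) (at t within {0..T})" if "0 <= t" "t <= T" for t
  unfolding has_real_derivative_iff_has_vector_derivative by (rule integral_has_vector_derivative[OF G]) (use that in simp)
 have iD: "((%t. integral {0..t} D) has_real_derivative D t) (at t within {0..T})" if "0 <= t" "t <= T" for t
  unfolding has_real_derivative_iff_has_vector_derivative by (rule integral_has_vector_derivative[OF cD]) (use that in simp)
 have Dle: "D t <= D 0 + L * integral {0..t} D + 1 / L * integral {0..t} G" if t: "0 <= t" "t <= T" for t
 proof -
  have "D t - (L * integral {0..t} D + 1 / L * integral {0..t} G) <= D 0 - (L * integral {0..0} D + 1 / L * integral {0..0} G)"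
  proof (rule nonincreasing_within[OF t])
   fix t assume t: "0 <= t" "t <= T"
   show "((%t. D t - (L * integral {0..t} D + 1 / L * integral {0..t} G)) has_real_derivative (D' t - (L * D t + 1 / L * G t))) (at t within {0..T})"
    by (intro DERIV_diff DERIV_add DERIV_cmult dD iD iG t)
  next
   fix t assume t: "0 < t" "t < T" then show "D' t - (L * D t + 1 / L * G t) <= 0" using D'[of t] by simp
  qed
  then show ?thesis by simp
 qed
 have E2: "1 / L * S t + 2 / L * integral {0..t} G <= 2 * K / L + L * N t + D t" if "0 <= t" "t <= T" for t
 proof -
  have "2 / L * (1/2 * S t + integral {0..t} G) <= 2 / L * (K + L\<^sup>2 / 2 * N t + L / 2 * D t)"
   by (rule mult_left_mono[OF E[OF that]]) (use L in simp)
  moreover have "2 / L * (1/2 * S t + integral {0..t} G) = 1 / L * S t + 2 / L * integral {0..t} G" by (simp add: algebra_simps)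
  moreover have "2 / L * (K + L\<^sup>2 / 2 * N t + L / 2 * D t) = 2 * K / L + L * N t + D t" using L by (simp add: field_simps power2_eq_square)
  ultimately show ?thesis by simp
 qed
 define K1 where "K1 = 2 * K / L + 2 * D 0"
 define Y where "Y t = N t + integral {0..t} D" for t
 have dY: "(Y has_real_derivative N' t + D t) (at t within {0..T})" if "0 <= t" "t <= T" for t
  unfolding Y_def by (intro DERIV_add dN iD that)
 have Y': "N' t + D t <= K1 + 2 * L * Y t" if t: "0 <= t" "t <= T" for t
  using N'[OF t] Dle[OF t] E2[OF t] L unfolding K1_def Y_def by (simp add: algebra_simps)
 have "(Y t + K1 / (2 * L)) * exp (- (2 * L * t)) <= (Y 0 + K1 / (2 * L)) * exp (- (2 * L * 0))"
 proof (rule nonincreasing_within[OF t])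
  fix t assume t: "0 <= t" "t <= T"
  show "((%t. (Y t + K1 / (2 * L)) * exp (- (2 * L * t))) has_real_derivative
   (N' t + D t) * exp (- (2 * L * t)) + (Y t + K1 / (2 * L)) * (exp (- (2 * L * t)) * (- (2 * L)))) (at t within {0..T})"
   by (rule derivative_eq_intros dY[OF t] refl | simp)+
 next
  fix t assume t: "0 < t" "t < T"
  have "(N' t + D t) - (K1 + 2 * L * Y t) <= 0" using Y'[of t] t by simp
  then have "((N' t + D t) - (K1 + 2 * L * Y t)) * exp (- (2 * L * t)) <= 0" by (simp add: mult_nonpos_nonneg)
  moreover have "(N' t + D t) * exp (- (2 * L * t)) + (Y t + K1 / (2 * L)) * (exp (- (2 * L * t)) * (- (2 * L))) = ((N' t + D t) - (K1 + 2 * L * Y t)) * exp (- (2 * L * t))"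
   using L by (simp add: field_simps)
  ultimately show "(N' t + D t) * exp (- (2 * L * t)) + (Y t + K1 / (2 * L)) * (exp (- (2 * L * t)) * (- (2 * L))) <= 0" by simp
 qed
 then have "(Y t + K1 / (2 * L)) * exp (- (2 * L * t)) * exp (2 * L * t) <= (N 0 + K1 / (2 * L)) * exp (2 * L * t)"
  by (intro mult_right_mono) (simp_all add: Y_def)
 then have "Y t + K1 / (2 * L) <= (N 0 + K1 / (2 * L)) * exp (2 * L * t)" by (simp add: mult.assoc exp_minus_inverse flip: exp_add)
 moreover have K10: "K1 / (2 * L) = K / L\<^sup>2 + D 0 / L" using L by (simp add: K1_def field_simps power2_eq_square)
 moreover have n0: "N 0 \<ge> 0" "D 0 \<ge> 0" using nn t by simp_all
 moreover have "0 <= K / L\<^sup>2 + D 0 / L" using L nn n0 by simp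
 ultimately have "Y t <= (N 0 + (K / L\<^sup>2 + D 0 / L)) * exp (2 * L * t)" by simp
 then have Yle: "Y t <= exp (2 * L * t) * (N 0 + K / L\<^sup>2 + D 0 / L)" by (simp only: mult.commute[of "exp _"] add.assoc)
 have ID: "integral {0..t} D \<ge> 0"
  by (intro integral_nonneg integrable_continuous_real continuous_on_subset[OF cD]) (use t nn in auto)
 have "1 / L * integral {0..t} G <= K / L + L / 2 * N t + D t / 2 - 1 / (2 * L) * S t" using E2[OF t] by (simp add: field_simps)
 moreover have "0 <= L * N t" using L nn(1)[OF t] by simp
 moreover have "L * Y t = L * N t + L * integral {0..t} D" by (simp add: Y_def algebra_simps)
 moreover have "L / 2 * N t = (L * N t) / 2" by simp
 ultimately have DS: "D t / 2 + 1 / (2 * L) * S t <= D 0 + K / L + L * Y t" using Dle[OF t] by linarith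
 define X where "X = D 0 + K / L + L * Y t"
 have s0: "0 <= D t" "0 <= S t" "0 <= N t" using nn t by auto
 have "0 <= 1 / (2 * L) * S t" using s0 L by simp
 then have D2: "D t <= 2 * X" using DS unfolding X_def[symmetric] by linarith
 have "1 / (2 * L) * S t <= X" using DS s0 unfolding X_def[symmetric] by linarith
 then have S2: "S t <= 2 * L * X" using L by (simp add: field_simps)
 have N2: "N t <= Y t" using ID by (simp add: Y_def)
 have e1: "exp (2 * L * t) \<ge> 1" using L t by simp
 have "N t + D t + S t <= Y t + (2 + 2 * L) * X" using N2 D2 S2 by (simp add: algebra_simps)
 also have "\<dots> = (1 + (2 + 2 * L) * L) * Y t + (2 + 2 * L) * (D 0 + K / L)" by (simp add: X_def algebra_simps)
 also have "\<dots> <= (1 + (2 + 2 * L) * L) * (exp (2 * L * t) * ((1 + 1 / L\<^sup>2 + 1 / L) * (N 0 + D 0 + K))) + (2 + 2 * L) * (exp (2 * L * t) * ((1 + 1 / L) * (N 0 + D 0 + K)))"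
 proof (rule add_mono)
  have "N 0 + K / L\<^sup>2 + D 0 / L <= (1 + 1 / L\<^sup>2 + 1 / L) * (N 0 + D 0 + K)"
  proof -
   have "0 <= (1 / L\<^sup>2 + 1 / L) * N 0 + (1 + 1 / L\<^sup>2) * D 0 + (1 + 1 / L) * K" using L n0 nn by simp
   moreover have "(1 + x + y) * (n + d + k) - (n + k * x + d * y) = (x + y) * n + (1 + x) * d + (1 + y) * k" for x y n d k :: real
    by (simp add: algebra_simps)
   from this[of "1 / L\<^sup>2" "1 / L" "N 0" "D 0" K]
   have "(1 + 1 / L\<^sup>2 + 1 / L) * (N 0 + D 0 + K) - (N 0 + K / L\<^sup>2 + D 0 / L) = (1 / L\<^sup>2 + 1 / L) * N 0 + (1 + 1 / L\<^sup>2) * D 0 + (1 + 1 / L) * K" by simp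
   ultimately show ?thesis by linarith
  qed
  then have "exp (2 * L * t) * (N 0 + K / L\<^sup>2 + D 0 / L) <= exp (2 * L * t) * ((1 + 1 / L\<^sup>2 + 1 / L) * (N 0 + D 0 + K))" by simp
  with Yle have "Y t <= exp (2 * L * t) * ((1 + 1 / L\<^sup>2 + 1 / L) * (N 0 + D 0 + K))" by linarith
  then show "(1 + (2 + 2 * L) * L) * Y t <= (1 + (2 + 2 * L) * L) * (exp (2 * L * t) * ((1 + 1 / L\<^sup>2 + 1 / L) * (N 0 + D 0 + K)))"
   by (rule mult_left_mono) (use L in simp)
  have "D 0 + K / L <= 1 * ((1 + 1 / L) * (N 0 + D 0 + K))"
  proof -
   have "0 <= (1 + 1 / L) * N 0 + (1 / L) * D 0 + K" using L n0 nn by simp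
   moreover have "(1 + y) * (n + d + k) - (d + k * y) = (1 + y) * n + y * d + k" for y n d k :: real
    by (simp add: algebra_simps)
   from this[of "1 / L" "N 0" "D 0" K]
   have "(1 + 1 / L) * (N 0 + D 0 + K) - (D 0 + K / L) = (1 + 1 / L) * N 0 + (1 / L) * D 0 + K" by simp
   ultimately show ?thesis by linarith
  qed
  also have "\<dots> <= exp (2 * L * t) * ((1 + 1 / L) * (N 0 + D 0 + K))" by (rule mult_right_mono[OF e1]) (use L n0 nn in simp)
  finally show "(2 + 2 * L) * (D 0 + K / L) <= (2 + 2 * L) * (exp (2 * L * t) * ((1 + 1 / L) * (N 0 + D 0 + K)))"
   by (rule mult_left_mono) (use L in simp)
 qed
 also have "\<dots> = gronwall_const L * exp (2 * L * t) * (N 0 + D 0 + K)"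
 proof -
  have "x * (e * (y * c)) + x' * (e * (y' * c)) = (x * y + x' * y') * e * c" for x y x' y' e c :: real by (simp add: algebra_simps)
  then show ?thesis unfolding gronwall_const_def .
 qed
 finally show ?thesis .
qed

lemma gronwall_const_pos: "L > 0 ==> gronwall_const L > 0"
 unfolding gronwall_const_def by (intro add_pos_pos mult_pos_pos) (auto intro: add_pos_pos)

section \<open>Algebra of the energy densities\<close>

text \<open>The gradient of \<open>\<theta> w\<close> is \<open>\<theta> A\<close> plus this matrix, when
  \<open>A\<close> is the gradient of \<open>w\<close> and \<open>g\<close> that of
  \<open>\<theta>\<close>.\<close>

definition outer :: "real^3 => real^3 => real^3^3" where
 "outer w g = (\<chi> i j. w $ i * g $ j)"

lemma outer_nth [simp]: "outer w g $ i $ j = w $ i * g $ j" by (simp add: outer_def)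

lemma entry_le: "\<bar>A $ i $ j\<bar> <= norm (A :: real^3^3)" "\<bar>w $ i\<bar> <= norm (w :: real^3)"
proof -
 show "\<bar>w $ i\<bar> <= norm w" for w :: "real^3" by (rule component_le_norm_cart)
 from this[of "A $ i"] show "\<bar>A $ i $ j\<bar> <= norm A"
  using component_le_norm_cart[of "A $ i" j] Finite_Cartesian_Product.norm_nth_le[of A i] by linarith
qed

lemma trace3: "trace (A :: real^3^3) = A$1$1 + A$2$2 + A$3$3" by (simp add: trace_def sum_3)

lemma sq_perturb:
 fixes l m th k x y :: real
 assumes "\<bar>l\<bar> <= 3 * x" "\<bar>m\<bar> <= 3 * k * y" "0 <= th" "th <= 1" "0 <= k" "k <= 1" "0 <= x" "0 <= y"
 shows "\<bar>(th * l + m)\<^sup>2 - th\<^sup>2 * l\<^sup>2\<bar> <= 18 * k * (x\<^sup>2 + y\<^sup>2)"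
proof -
 have "(th * l + m)\<^sup>2 - th\<^sup>2 * l\<^sup>2 = 2 * th * (l * m) + m * m" by (simp add: power2_eq_square algebra_simps)
 moreover have "\<bar>l * m\<bar> <= (3 * x) * (3 * k * y)" unfolding abs_mult by (rule mult_mono) (use assms in auto)
 moreover have "\<bar>m * m\<bar> <= (3 * k * y) * (3 * k * y)" unfolding abs_mult by (rule mult_mono) (use assms in auto)
 moreover have "\<bar>2 * th * (l * m)\<bar> <= 2 * \<bar>l * m\<bar>"
  using assms mult_right_mono[of th 1 "\<bar>l * m\<bar>"] by (simp add: abs_mult)
 moreover have "(3 * k * y) * (3 * k * y) <= 9 * k * y\<^sup>2"
  using mult_right_mono[of k 1 "9 * k * y\<^sup>2"] assms by (simp add: power2_eq_square algebra_simps)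
 moreover have "2 * ((3 * x) * (3 * k * y)) <= 9 * k * (x\<^sup>2 + y\<^sup>2)"
  using mult_left_mono[OF sum_squares_bound[of x y], of "9 * k"] assms by (simp add: algebra_simps)
 moreover have "0 <= 9 * k * x\<^sup>2" using assms by simp
 ultimately have "\<bar>(th * l + m)\<^sup>2 - th\<^sup>2 * l\<^sup>2\<bar> <= 9 * k * (x\<^sup>2 + y\<^sup>2) + 9 * k * y\<^sup>2 + 9 * k * x\<^sup>2" by linarith
 then show ?thesis by (simp add: algebra_simps)
qed

lemma abs_combination_le:
 fixes t :: real
 assumes "\<bar>t\<bar> <= B" "\<bar>o1\<bar> <= B" "\<bar>o2\<bar> <= B" "\<bar>o3\<bar> <= B" "\<bar>d1\<bar> <= B" "\<bar>d2\<bar> <= B" "\<bar>d3\<bar> <= B"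
 shows "\<bar>o1 + o2 + o3 + 2 * (d1 + d2 + d3) - 2/3 * t\<bar> <= 10 * B"
 using assms unfolding abs_le_iff by (auto simp: algebra_simps)

text \<open>Cutting off changes a quadratic form of field and gradient only by terms carrying the
  gradient of the cutoff.\<close>

lemma qform_cutoff:
 fixes w g :: "real^3" and A :: "real^3^3"
 assumes th: "0 <= th" "th <= 1" and k: "0 <= k" "k <= 1" and g: "\<And>j. \<bar>g $ j\<bar> <= k" 
 shows "\<bar>qform \<alpha> \<beta> \<gamma> \<kappa> (th *\<^sub>R w) (th *\<^sub>R A + outer w g) - th\<^sup>2 * qform \<alpha> \<beta> \<gamma> \<kappa> w A\<bar>
  <= (18 * \<bar>\<alpha>\<bar> + 180 * \<bar>\<beta>\<bar> + 4 * \<bar>\<gamma>\<bar>) * k * ((norm w)\<^sup>2 + (norm A)\<^sup>2)"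
proof -
 define Q where "Q = (norm w)\<^sup>2 + (norm A)\<^sup>2"
 have Q0: "Q \<ge> 0" by (simp add: Q_def)
 have b: "\<bar>w $ i * g $ j\<bar> <= k * norm w" for i j
  using mult_mono[OF entry_le(2)[of w i] g[of j]] k by (simp add: abs_mult mult.commute)
 have sq: "\<bar>(th * l + m)\<^sup>2 - th\<^sup>2 * l\<^sup>2\<bar> <= 18 * k * Q" if "\<bar>l\<bar> <= 3 * norm A" "\<bar>m\<bar> <= 3 * k * norm w" for l m
  using sq_perturb[OF that th k norm_ge_zero norm_ge_zero] by (simp add: Q_def add.commute)
 have A1: "\<bar>A $ i $ j\<bar> <= 3 * norm A" for i j using entry_le(1)[of A i j] norm_ge_zero[of A] by linarith
 have A2: "\<bar>A $ i $ j + A $ i' $ j'\<bar> <= 3 * norm A" for i j i' j' using entry_le(1)[of A i j] entry_le(1)[of A i' j'] norm_ge_zero[of A] by linarith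
 have A3: "\<bar>A$1$1 + A$2$2 + A$3$3\<bar> <= 3 * norm A" using entry_le(1)[of A 1 1] entry_le(1)[of A 2 2] entry_le(1)[of A 3 3] by linarith
 have kw: "k * norm w \<ge> 0" using k by simp
 have B1: "\<bar>w $ i * g $ j\<bar> <= 3 * k * norm w" for i j using b[of i j] kw by linarith
 have B2: "\<bar>w $ i * g $ j + w $ i' * g $ j'\<bar> <= 3 * k * norm w" for i j i' j' using b[of i j] b[of i' j'] kw by linarith
 have B3: "\<bar>w$1 * g$1 + w$2 * g$2 + w$3 * g$3\<bar> <= 3 * k * norm w" using b[of 1 1] b[of 2 2] b[of 3 3] by linarith
 define t o1 o2 o3 d1 d2 d3 where "t = (th * (A$1$1 + A$2$2 + A$3$3) + (w$1 * g$1 + w$2 * g$2 + w$3 * g$3))\<^sup>2 - th\<^sup>2 * (A$1$1 + A$2$2 + A$3$3)\<^sup>2"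
  and "o1 = (th * (A$1$2 + A$2$1) + (w$1 * g$2 + w$2 * g$1))\<^sup>2 - th\<^sup>2 * (A$1$2 + A$2$1)\<^sup>2"
  and "o2 = (th * (A$1$3 + A$3$1) + (w$1 * g$3 + w$3 * g$1))\<^sup>2 - th\<^sup>2 * (A$1$3 + A$3$1)\<^sup>2"
  and "o3 = (th * (A$2$3 + A$3$2) + (w$2 * g$3 + w$3 * g$2))\<^sup>2 - th\<^sup>2 * (A$2$3 + A$3$2)\<^sup>2"
  and "d1 = (th * A$1$1 + w$1 * g$1)\<^sup>2 - th\<^sup>2 * (A$1$1)\<^sup>2" and "d2 = (th * A$2$2 + w$2 * g$2)\<^sup>2 - th\<^sup>2 * (A$2$2)\<^sup>2" and "d3 = (th * A$3$3 + w$3 * g$3)\<^sup>2 - th\<^sup>2 * (A$3$3)\<^sup>2"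
 have bd: "\<bar>t\<bar> <= 18 * k * Q" "\<bar>o1\<bar> <= 18 * k * Q" "\<bar>o2\<bar> <= 18 * k * Q" "\<bar>o3\<bar> <= 18 * k * Q"
  "\<bar>d1\<bar> <= 18 * k * Q" "\<bar>d2\<bar> <= 18 * k * Q" "\<bar>d3\<bar> <= 18 * k * Q"
  unfolding t_def o1_def o2_def o3_def d1_def d2_def d3_def by (rule sq[OF A3 B3] sq[OF A2 B2] sq[OF A1 B1])+
 have dev: "\<bar>o1 + o2 + o3 + 2 * (d1 + d2 + d3) - 2/3 * t\<bar> <= 180 * k * Q"
  using abs_combination_le[OF bd] by simp
 define c where "c = th * w$3 * (w$1 * g$1 + w$2 * g$2)"
 have cb: "\<bar>c\<bar> <= 2 * k * Q"
 proof -
  have "\<bar>w$1 * g$1 + w$2 * g$2\<bar> <= 2 * (k * norm w)" using b[of 1 1] b[of 2 2] by linarith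
  moreover have "\<bar>th * w$3\<bar> <= norm w" using mult_mono[OF th(2) entry_le(2)[of w 3]] th by (simp add: abs_mult)
  ultimately have "\<bar>th * w$3\<bar> * \<bar>w$1 * g$1 + w$2 * g$2\<bar> <= norm w * (2 * (k * norm w))" by (intro mult_mono) auto
  also have "\<dots> <= 2 * k * Q" using k by (simp add: Q_def power2_eq_square algebra_simps)
  finally show ?thesis by (simp add: c_def abs_mult)
 qed
 let ?N = "th *\<^sub>R A + outer w g"
 have N: "?N $ i $ j = th * A $ i $ j + w $ i * g $ j" for i j by simp
 have tN: "?N$1$1 + ?N$2$2 + ?N$3$3 = th * (A$1$1 + A$2$2 + A$3$3) + (w$1 * g$1 + w$2 * g$2 + w$3 * g$3)"
  and oN: "?N$i$j + ?N$j$i = th * (A$i$j + A$j$i) + (w$i * g$j + w$j * g$i)" for i j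
  unfolding N by (simp_all only: distrib_left ac_simps)
 have dN: "dev_energy ?N = th\<^sup>2 * dev_energy A + (o1 + o2 + o3 + 2 * (d1 + d2 + d3) - 2/3 * t)"
 proof -
  have sq: "(?N$1$1 + ?N$2$2 + ?N$3$3)\<^sup>2 = th\<^sup>2 * (A$1$1 + A$2$2 + A$3$3)\<^sup>2 + t" "(?N$1$2 + ?N$2$1)\<^sup>2 = th\<^sup>2 * (A$1$2 + A$2$1)\<^sup>2 + o1"
   "(?N$1$3 + ?N$3$1)\<^sup>2 = th\<^sup>2 * (A$1$3 + A$3$1)\<^sup>2 + o2" "(?N$2$3 + ?N$3$2)\<^sup>2 = th\<^sup>2 * (A$2$3 + A$3$2)\<^sup>2 + o3"
   unfolding tN oN t_def o1_def o2_def o3_def by simp_all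
  have sd: "(?N$1$1)\<^sup>2 = th\<^sup>2 * (A$1$1)\<^sup>2 + d1" "(?N$2$2)\<^sup>2 = th\<^sup>2 * (A$2$2)\<^sup>2 + d2" "(?N$3$3)\<^sup>2 = th\<^sup>2 * (A$3$3)\<^sup>2 + d3"
   unfolding N d1_def d2_def d3_def by simp_all
  have id: "x * y1 + o1 + (x * y2 + o2) + (x * y3 + o3) + 2 * (x * y4 + d1 + (x * y5 + d2) + (x * y6 + d3)) - 2/3 * (x * y7 + t)
   = x * (y1 + y2 + y3 + 2 * (y4 + y5 + y6) - 2/3 * y7) + (o1 + o2 + o3 + 2 * (d1 + d2 + d3) - 2/3 * t)" for x y1 y2 y3 y4 y5 y6 y7 :: real
   by (simp add: algebra_simps)
  show ?thesis unfolding dev_energy_def sq sd by (rule id)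
 qed
 have cN: "(th *\<^sub>R w) $ 3 * (?N$1$1 + ?N$2$2) = th\<^sup>2 * (w$3 * (A$1$1 + A$2$2)) + c"
  unfolding N c_def by (simp add: power2_eq_square algebra_simps)
 have sN: "((th *\<^sub>R w)$1)\<^sup>2 + ((th *\<^sub>R w)$2)\<^sup>2 + ((th *\<^sub>R w)$3)\<^sup>2 = th\<^sup>2 * ((w$1)\<^sup>2 + (w$2)\<^sup>2 + (w$3)\<^sup>2)"
  by (simp add: power_mult_distrib algebra_simps)
 have "qform \<alpha> \<beta> \<gamma> \<kappa> (th *\<^sub>R w) (th *\<^sub>R A + outer w g) - th\<^sup>2 * qform \<alpha> \<beta> \<gamma> \<kappa> w A
  = \<alpha> * t + \<beta> * (o1 + o2 + o3 + 2 * (d1 + d2 + d3) - 2/3 * t) - 2 * \<gamma> * c"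
 proof -
  have q: "qform \<alpha> \<beta> \<gamma> \<kappa> u B = \<alpha> * (B$1$1 + B$2$2 + B$3$3)\<^sup>2 + \<beta> * dev_energy B - 2 * \<gamma> * (u$3 * (B$1$1 + B$2$2)) + \<kappa> * ((u$1)\<^sup>2 + (u$2)\<^sup>2 + (u$3)\<^sup>2)" for u B
   by (simp only: qform_def mult.assoc)
  have tN2: "(?N$1$1 + ?N$2$2 + ?N$3$3)\<^sup>2 = th\<^sup>2 * (A$1$1 + A$2$2 + A$3$3)\<^sup>2 + t" unfolding tN t_def by simp
  have id: "\<alpha> * (x * y1 + t) + \<beta> * (x * y2 + y) - 2 * \<gamma> * (x * y3 + c) + \<kappa> * (x * y4) - x * (\<alpha> * y1 + \<beta> * y2 - 2 * \<gamma> * y3 + \<kappa> * y4) = \<alpha> * t + \<beta> * y - 2 * \<gamma> * c" for x y1 y2 y3 y4 y :: real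
   by (simp add: algebra_simps)
  show ?thesis unfolding q tN2 dN cN sN by (rule id)
 qed
 moreover have "\<bar>\<alpha> * t\<bar> <= \<bar>\<alpha>\<bar> * (18 * k * Q)" unfolding abs_mult by (rule mult_left_mono[OF bd(1)]) simp
 moreover have "\<bar>\<beta> * (o1 + o2 + o3 + 2 * (d1 + d2 + d3) - 2/3 * t)\<bar> <= \<bar>\<beta>\<bar> * (180 * k * Q)"
  unfolding abs_mult by (rule mult_left_mono[OF dev]) simp
 moreover have "\<bar>2 * \<gamma> * c\<bar> <= \<bar>\<gamma>\<bar> * (4 * k * Q)"
  using mult_left_mono[OF cb, of "2 * \<bar>\<gamma>\<bar>"] by (simp add: abs_mult algebra_simps)
 ultimately have "\<bar>qform \<alpha> \<beta> \<gamma> \<kappa> (th *\<^sub>R w) (th *\<^sub>R A + outer w g) - th\<^sup>2 * qform \<alpha> \<beta> \<gamma> \<kappa> w A\<bar> <= \<bar>\<alpha>\<bar> * (18 * k * Q) + \<bar>\<beta>\<bar> * (180 * k * Q) + \<bar>\<gamma>\<bar> * (4 * k * Q)" by linarith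
 then show ?thesis by (simp add: Q_def algebra_simps)
qed

context rt begin

lemma stress_sym: "A \<bullet> stressm s z B = B \<bullet> stressm s z A"
 by (simp add: inner_vec_def sum_3 stressm_nth algebra_simps)

lemma stress_energy: "A \<bullet> stressm s z A = eps0 p s z * dev_energy A + del0 p s z * (A$1$1 + A$2$2 + A$3$3)\<^sup>2"
 by (simp add: inner_vec_def sum_3 stressm_nth dev_energy_def power2_eq_square algebra_simps add_divide_distrib)

lemma dev_energy_nonneg: "dev_energy A \<ge> 0"
proof -
 have "2 * (x\<^sup>2 + y\<^sup>2 + z\<^sup>2) - 2/3 * (x + y + z)\<^sup>2 = 2/3 * ((x - y)\<^sup>2 + (y - z)\<^sup>2 + (x - z)\<^sup>2)" for x y z :: real
  by (simp add: power2_eq_square field_simps)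
 from this[of "A$1$1" "A$2$2" "A$3$3"] 
 have "dev_energy A = (A$1$2 + A$2$1)\<^sup>2 + (A$1$3 + A$3$1)\<^sup>2 + (A$2$3 + A$3$2)\<^sup>2 + 2/3 * ((A$1$1 - A$2$2)\<^sup>2 + (A$2$2 - A$3$3)\<^sup>2 + (A$1$1 - A$3$3)\<^sup>2)"
  unfolding dev_energy_def by linarith
 then show ?thesis by simp
qed

lemma stress_nonneg: "z \<in> (ivl p s) ==> A \<bullet> stressm s z A \<ge> 0"
 unfolding stress_energy using eps0_pos[of z s] del0_nonneg[of z s] dev_energy_nonneg[of A] by (intro add_nonneg_nonneg mult_nonneg_nonneg) auto

text \<open>Cauchy-Schwarz and Young for the positive semidefinite viscous form.\<close>

lemma stress_young:
 assumes z: "z \<in> (ivl p s)" and L: "L > 0"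
 shows "2 * (B \<bullet> stressm s z A) <= L * (A \<bullet> stressm s z A) + (B \<bullet> stressm s z B) / L"
proof -
 interpret bounded_linear "stressm s z" by (rule stressm_bounded_linear)
 have "0 <= (L *\<^sub>R A - B) \<bullet> stressm s z (L *\<^sub>R A - B)" by (rule stress_nonneg[OF z])
 also have "\<dots> = L * (L * (A \<bullet> stressm s z A)) - 2 * L * (B \<bullet> stressm s z A) + B \<bullet> stressm s z B"
  by (simp add: diff scaleR inner_diff_left inner_diff_right stress_sym[of A s z B] algebra_simps)
 finally have "0 <= (L * (L * (A \<bullet> stressm s z A)) - 2 * L * (B \<bullet> stressm s z A) + B \<bullet> stressm s z B) / L" using L by simp
 also have "\<dots> = L * (A \<bullet> stressm s z A) - 2 * (B \<bullet> stressm s z A) + (B \<bullet> stressm s z B) / L" using L by (simp add: field_simps)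
 finally show ?thesis by simp
qed

lemma outer_stress_le:
 assumes e: "\<bar>eps0 p s z\<bar> <= c" "\<bar>del0 p s z\<bar> <= c" and g: "\<And>j. \<bar>g $ j\<bar> <= k" and k: "k \<ge> 0"
 shows "\<bar>outer w g \<bullet> stressm s z A\<bar> <= 63 * c * k * ((norm w)\<^sup>2 + (norm A)\<^sup>2)"
proof -
 have c: "c \<ge> 0" using e by linarith
 have st: "\<bar>stressm s z A $ i $ j\<bar> <= 7 * c * norm A" for i j
 proof -
  have tr: "\<bar>A$1$1 + A$2$2 + A$3$3\<bar> <= 3 * norm A" using entry_le(1)[of A 1 1] entry_le(1)[of A 2 2] entry_le(1)[of A 3 3] by linarith
  have sy: "\<bar>A $ i $ j + A $ j $ i\<bar> <= 2 * norm A" using entry_le(1)[of A i j] entry_le(1)[of A j i] by linarith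
  have gen: "\<bar>x - 2/3 * T * e\<bar> <= 4 * n" if "\<bar>x\<bar> <= 2 * n" "\<bar>T\<bar> <= 3 * n" "e = 0 \<or> e = 1" for x T n e :: real
  proof -
   have h: "x <= 2 * n" "- x <= 2 * n" "T <= 3 * n" "- T <= 3 * n" "n \<ge> 0" using that by linarith+
   have "2/3 * T * e <= 2 * n" "- (2/3 * T * e) <= 2 * n" using that(3) h by auto
   then show ?thesis using h by (intro abs_leI) linarith+
  qed
  have gen': "\<bar>T * e\<bar> <= 3 * n" if "\<bar>T\<bar> <= 3 * n" "e = 0 \<or> e = 1" for T n e :: real
   using that(2) order_trans[OF abs_ge_zero that(1)] that(1) by auto
  have d: "\<bar>A $ i $ j + A $ j $ i - 2/3 * (A$1$1 + A$2$2 + A$3$3) * (if i = j then 1 else 0)\<bar> <= 4 * norm A"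
   by (rule gen[OF sy tr]) simp
  have t: "\<bar>(A$1$1 + A$2$2 + A$3$3) * (if i = j then 1 else 0)\<bar> <= 3 * norm A"
   by (rule gen'[OF tr]) simp
  have "\<bar>eps0 p s z * (A $ i $ j + A $ j $ i - 2/3 * (A$1$1 + A$2$2 + A$3$3) * (if i = j then 1 else 0))\<bar> <= c * (4 * norm A)"
   unfolding abs_mult[of "eps0 p s z"] by (rule mult_mono[OF e(1) d c]) simp
  moreover have "\<bar>del0 p s z * ((A$1$1 + A$2$2 + A$3$3) * (if i = j then 1 else 0))\<bar> <= c * (3 * norm A)"
   unfolding abs_mult[of "del0 p s z"] by (rule mult_mono[OF e(2) t c]) simp
  ultimately have "\<bar>stressm s z A $ i $ j\<bar> <= c * (4 * norm A) + c * (3 * norm A)"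
   unfolding stressm_nth mult.assoc[of "del0 p s z"] by (intro order_trans[OF abs_triangle_ineq add_mono])
  then show ?thesis by simp
 qed
 have "\<bar>(w $ i * g $ j) * stressm s z A $ i $ j\<bar> <= (norm w * k) * (7 * c * norm A)" for i j
  unfolding abs_mult by (intro mult_mono entry_le g st) (use k in auto)
 then have each: "\<bar>(w $ i * g $ j) * stressm s z A $ i $ j\<bar> <= 7 * c * k * (norm w * norm A)" for i j by (simp add: mult_ac)
 have "\<bar>outer w g \<bullet> stressm s z A\<bar> = \<bar>\<Sum>i\<in>UNIV. \<Sum>j\<in>UNIV. (w $ i * g $ j) * stressm s z A $ i $ j\<bar>" by (simp add: inner_vec_def)
 also have "\<dots> <= (\<Sum>i\<in>(UNIV::3 set). \<Sum>j\<in>(UNIV::3 set). 7 * c * k * (norm w * norm A))"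
  by (rule order_trans[OF sum_abs]) (intro sum_mono order_trans[OF sum_abs] each)
 also have "\<dots> = 63 * c * k * (norm w * norm A)" by simp
 also have "\<dots> <= 63 * c * k * ((norm w)\<^sup>2 + (norm A)\<^sup>2)"
 proof (rule mult_left_mono)
  have "0 <= norm w * norm A" by simp
  then show "norm w * norm A <= (norm w)\<^sup>2 + (norm A)\<^sup>2" using sum_squares_bound[of "norm w" "norm A"] by linarith
 qed (use c k in simp)
 finally show ?thesis .
qed

end


section \<open>Localization by a horizontal cutoff\<close>

lemma has_pd_third_horizontal: "i \<noteq> 3 ==> has_pd S i (%x. f (x $ 3)) (%x. 0)"
 unfolding has_pd_def by (simp add: axis_def)

lemma faces_match_cong_mult:
 fixes f g :: "real^3 => real"
 shows "faces_match a b z f ==> faces_match a b z g ==> faces_match a b z (%x. f x * g x)"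
 by (simp add: faces_match_def)

lemma faces_match_comp: "faces_match a b z f ==> faces_match a b z (%x. h (f x))"
 by (simp add: faces_match_def)

context rt begin

lemma slabbox_third: "x \<in> slabbox a b s ==> x $ 3 \<in> (ivl p s)" by (simp add: mem_box3)

text \<open>The normal component vanishes at the top, so its square at the interface is minus the integral of a
  vertical derivative.\<close>

lemma trace_square_le:
 assumes ab: "a <= b" and tf: "test_field a b u D"
 shows "integral (hbox a b) (%X. (u Upper (pt3 (fst X, snd X, 0)) $ 3)\<^sup>2) <= integral (slabbox a b Upper) (%x. (norm (u Upper x))\<^sup>2 + (norm (D Upper x))\<^sup>2)"
proof -
 have cu: "continuous_on (slabbox a b Upper) (u Upper)" and cD: "continuous_on (slabbox a b Upper) (D Upper)"
  and pd: "has_pd (slabbox a b Upper) 3 (%x. u Upper x $ 3) (%x. D Upper x $ 3 $ 3)"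
  and top: "\<And>x y. x \<in> {a..b} ==> y \<in> {a..b} ==> u Upper (pt3 (x,y,height p)) = 0"
  using tf unfolding test_field_def by blast+
 let ?f' = "%x. u Upper x $ 3 * D Upper x $ 3 $ 3 + D Upper x $ 3 $ 3 * u Upper x $ 3"
 have cf': "continuous_on (slabbox a b Upper) ?f'" by (intro continuous_on_add continuous_on_mult continuous_on_component cu cD)
 have z: "integral (hbox a b) (%(x,y). u Upper (pt3 (x,y,height p)) $ 3 * u Upper (pt3 (x,y,height p)) $ 3) = 0"
 proof -
  have "integral (hbox a b) (%(x,y). u Upper (pt3 (x,y,height p)) $ 3 * u Upper (pt3 (x,y,height p)) $ 3) = integral (hbox a b) (%X. 0::real)"
   by (rule integral_cong) (clarsimp simp: mem_hbox top)
  then show ?thesis by simp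
 qed
 have "integral (slabbox a b Upper) ?f' = - integral (hbox a b) (%X. (u Upper (pt3 (fst X, snd X, 0)) $ 3)\<^sup>2)"
  using integral_box3_pd_vertical[OF less_imp_le[OF zlo_less_zhi[of Upper]] has_pd_mult[OF pd pd] cf'
   continuous_on_mult[OF continuous_on_component[OF cu] continuous_on_component[OF cu]]] z
  by (simp add: case_prod_unfold power2_eq_square)
 then have "integral (hbox a b) (%X. (u Upper (pt3 (fst X, snd X, 0)) $ 3)\<^sup>2) = integral (slabbox a b Upper) (%x. - ?f' x)" by simp
 also have "\<dots> <= integral (slabbox a b Upper) (%x. (norm (u Upper x))\<^sup>2 + (norm (D Upper x))\<^sup>2)"
 proof (rule integral_le)
  show "(%x. - ?f' x) integrable_on slabbox a b Upper" by (intro integrable_box3 continuous_on_minus cf')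
  show "(%x. (norm (u Upper x))\<^sup>2 + (norm (D Upper x))\<^sup>2) integrable_on slabbox a b Upper"
   by (intro integrable_box3 continuous_on_add continuous_on_power continuous_on_norm cu cD)
  fix x
  have "(u Upper x $ 3)\<^sup>2 <= (norm (u Upper x))\<^sup>2" "(D Upper x $ 3 $ 3)\<^sup>2 <= (norm (D Upper x))\<^sup>2"
   using entry_le by (metis abs_ge_zero power2_abs power_mono)+
  moreover have "0 <= (u Upper x $ 3 + D Upper x $ 3 $ 3)\<^sup>2" by simp
  ultimately show "- ?f' x <= (norm (u Upper x))\<^sup>2 + (norm (D Upper x))\<^sup>2" by (simp add: power2_eq_square algebra_simps)
 qed
 finally show ?thesis .
qed

definition vol :: "real => real => (side => real^3 => real) => real" where
 "vol a b f = (\<Sum>s\<in>sides. integral (slabbox a b s) (f s))"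

definition ifc :: "real => real => (real^3 => real) => real" where
 "ifc a b f = integral (hbox a b) (%X. f (pt3 (fst X, snd X, 0)))"

abbreviation "bcont a b f \<equiv> (\<forall>s. continuous_on (slabbox a b s) (f s))"

lemma vol_add: "bcont a b f ==> bcont a b g ==> vol a b (%s x. f s x + g s x) = vol a b f + vol a b g"
 unfolding vol_def sum.distrib[symmetric] by (intro sum.cong refl integral_add integrable_box3) blast+

lemma vol_diff: "bcont a b f ==> bcont a b g ==> vol a b (%s x. f s x - g s x) = vol a b f - vol a b g"
 unfolding vol_def sum_subtractf[symmetric] by (intro sum.cong refl integral_diff integrable_box3) blast+

lemma vol_cmult: "vol a b (%s x. c * f s x) = c * vol a b f"
 unfolding vol_def by (simp only: integral_mult_right sum_distrib_left)

lemma vol_mono: "bcont a b f ==> bcont a b g ==> (\<And>s x. x \<in> slabbox a b s ==> f s x <= g s x) ==> vol a b f <= vol a b g"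
 unfolding vol_def by (intro sum_mono integral_le integrable_box3) blast+


lemma vol_nonneg: "(\<And>s x. x \<in> slabbox a b s ==> 0 <= f s x) ==> bcont a b f ==> 0 <= vol a b f"
 unfolding vol_def by (intro sum_nonneg integral_nonneg integrable_box3) blast+

lemma plane_in: "X \<in> hbox a b ==> pt3 (fst X, snd X, 0) \<in> slabbox a b Upper"
 by (rule slab_plane) (use mem_hbox[of "fst X" "snd X" a b] in auto)

lemma ifc_integrable: "continuous_on (slabbox a b Upper) f ==> (%X. f (pt3 (fst X, snd X, 0)) :: real) integrable_on hbox a b"
 by (rule integrable_hbox, rule continuous_on_compose2[where f="%X. pt3 (fst X, snd X, 0)"], assumption)
  (intro continuous_on_pt3 continuous_on_Pair continuous_on_fst continuous_on_snd continuous_on_id continuous_on_const, intro image_subsetI plane_in)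

lemma ifc_add: "continuous_on (slabbox a b Upper) f ==> continuous_on (slabbox a b Upper) g ==> ifc a b (%x. f x + g x) = ifc a b f + ifc a b g"
 unfolding ifc_def by (intro integral_add ifc_integrable)

lemma ifc_cmult: "ifc a b (%x. c * f x) = c * ifc a b f"
 unfolding ifc_def by simp

lemma ifc_mono: "continuous_on (slabbox a b Upper) f ==> continuous_on (slabbox a b Upper) g ==> (\<And>x. f x <= g x) ==> ifc a b f <= ifc a b g"
 unfolding ifc_def by (intro integral_le ifc_integrable)

abbreviation "tcont a b s f \<equiv> continuous_on ({0..} \<times> slabbox a b s) (%X. f (fst X) (snd X))"

lemma tcont_slice: "tcont a b s f ==> t \<ge> 0 ==> continuous_on (slabbox a b s) (f t)"
 by (rule continuous_on_slice_x) (simp_all add: case_prod_unfold)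

text \<open>Joint continuity of the time derivative of the density up to time zero allows differentiation under
  the integral.\<close>

lemma vol_deriv:
 assumes d: "\<And>s x t. x \<in> slabbox a b s ==> t \<ge> 0 ==> ((%\<tau>. f s \<tau> x) has_real_derivative f' s t x) (at t within {0..})"
  and c: "\<And>s. tcont a b s (f s)" and c': "\<And>s. tcont a b s (f' s)" and t: "t \<ge> 0"
 shows "((%t. vol a b (%s. f s t)) has_real_derivative vol a b (%s. f' s t)) (at t within {0..})"
 unfolding vol_def
proof (rule DERIV_sum)
 fix s
 show "((%\<tau>. integral (slabbox a b s) (f s \<tau>)) has_real_derivative integral (slabbox a b s) (f' s t)) (at t within {0..})"
  unfolding box3_def
 proof (rule leibniz_rule_field_derivative)
  show "continuous_on ({0..} \<times> cbox (pt3 (a,a,zlo p s)) (pt3 (b,b,zhi p s))) (%(t, x). f' s t x)"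
   using c'[of s] by (simp add: box3_def case_prod_unfold)
 qed (use d[unfolded box3_def] integrable_box3[OF tcont_slice[OF c], unfolded box3_def] t in auto)
qed

lemma ifc_deriv:
 assumes d: "\<And>x t. x \<in> slabbox a b Upper ==> t \<ge> 0 ==> ((%\<tau>. f \<tau> x) has_real_derivative f' t x) (at t within {0..})"
  and c: "tcont a b Upper f" and c': "tcont a b Upper f'" and t: "t \<ge> 0"
 shows "((%t. ifc a b (f t)) has_real_derivative ifc a b (f' t)) (at t within {0..})"
 unfolding ifc_def hbox_def
proof (rule leibniz_rule_field_derivative)
 have "continuous_on ({0..} \<times> hbox a b) (%Y. f' (fst (fst Y, pt3 (fst (snd Y), snd (snd Y), 0))) (snd (fst Y, pt3 (fst (snd Y), snd (snd Y), 0))))"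
  by (rule continuous_on_compose2[OF c'])
   (intro continuous_on_pt3 continuous_on_Pair continuous_on_fst continuous_on_snd continuous_on_id continuous_on_const, use plane_in in \<open>force simp del: zlo.simps zhi.simps\<close>)
 then show "continuous_on ({0..} \<times> cbox (a,a) (b,b)) (%(t, X). f' t (pt3 (fst X, snd X, 0)))"
  by (simp add: hbox_def case_prod_unfold)
 show "((%\<tau>. f \<tau> (pt3 (fst X, snd X, 0))) has_real_derivative f' t (pt3 (fst X, snd X, 0))) (at t within {0..})" if "t \<in> {0..}" "X \<in> cbox (a,a) (b,b)" for t :: real and X
  by (rule d[OF plane_in]) (use that in \<open>simp_all add: hbox_def\<close>)
 show "(%X. f t (pt3 (fst X, snd X, 0))) integrable_on cbox (a,a) (b,b)" if "t \<in> {0..}" for t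
  using ifc_integrable[OF tcont_slice[OF c]] that by (simp add: hbox_def)
qed (use t in auto)

end

lemma (in lin_sol) test_v: "t \<ge> 0 ==> test_field a b (%s. v s t) (%s. Dv s t)"
 unfolding test_field_def
 by (intro conjI allI ballI has_pd_subset[OF Dmat_has_pd[OF cr(3)] slabbox_subset_cs] continuous_on_subset[OF slice(3) slabbox_subset_cs]
  continuous_on_subset[OF D_slice(1) slabbox_subset_cs] v_boundary v_boundary(1)[symmetric])

lemma (in lin_sol) test_w: "t \<ge> 0 ==> test_field a b (%s. w s t) (%s. Dw s t)"
 unfolding test_field_def
 by (intro conjI allI ballI has_pd_subset[OF Dmat_has_pd[OF cr(4)] slabbox_subset_cs] continuous_on_subset[OF slice(4) slabbox_subset_cs]
  continuous_on_subset[OF D_slice(2) slabbox_subset_cs] w_boundary w_boundary(1)[symmetric])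

text \<open>A solution together with a horizontal cutoff. The hypotheses \<open>lat\<close> hold if
  \<open>\<theta>\<close> vanishes on the lateral faces, and also if \<open>\<theta>\<close> is
  constant and the fields are periodic.\<close>

locale cut_sol = lin_sol +
 fixes a b \<kappa> c :: real and \<theta> :: "real^3 => real" and gr :: "real^3 => real^3"
 assumes ab: "a < b"
  and th_pd: "\<And>j. has_pd UNIV j \<theta> (%x. gr x $ j)"
  and th_cont: "continuous_on UNIV \<theta>" "continuous_on UNIV gr"
  and th_range: "\<And>x. 0 <= \<theta> x" "\<And>x. \<theta> x <= 1"
  and gr_le: "\<And>x j. \<bar>gr x $ j\<bar> <= \<kappa>" and kap: "0 <= \<kappa>" "\<kappa> <= 1"
  and lat: "\<And>s t z. t \<ge> 0 ==> z \<in> (ivl p s) ==> faces_match a b z (%x. \<theta> x *\<^sub>R v s t x)"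
   "\<And>s t z. t \<ge> 0 ==> z \<in> (ivl p s) ==> faces_match a b z (%x. \<theta> x *\<^sub>R w s t x)"
   "\<And>s t z. t \<ge> 0 ==> z \<in> (ivl p s) ==> faces_match a b z (%x. \<theta> x *\<^sub>R Tm s t x)"
   "\<And>s t z. t \<ge> 0 ==> z \<in> (ivl p s) ==> faces_match a b z (%x. \<theta> x *\<^sub>R Deta s t x)"
  and cbound: "\<And>s z. z \<in> (ivl p s) ==> \<bar>rho p s z\<bar> <= c" "\<And>s z. z \<in> (ivl p s) ==> \<bar>dpres p s z * rho p s z\<bar> <= c"
   "\<And>s z. z \<in> (ivl p s) ==> \<bar>eps0 p s z\<bar> <= c" "\<And>s z. z \<in> (ivl p s) ==> \<bar>del0 p s z\<bar> <= c"
begin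

abbreviation "B s \<equiv> slabbox a b s"

lemma c_nonneg: "0 <= c" using cbound(1)[of "zlo p Upper" Upper] zlo_less_zhi[of Upper] by auto

definition "cutf u = (%s x. \<theta> x *\<^sub>R u s x)" for u :: "side => real^3 => real^3"
definition "cutD u D = (%s x. \<theta> x *\<^sub>R D s x + outer (u s x) (gr x))" for u :: "side => real^3 => real^3" and D :: "side => real^3 => real^3^3"

lemma cut_nth: "cutf u s x $ i = \<theta> x * u s x $ i" "cutD u D s x $ i $ j = \<theta> x * D s x $ i $ j + gr x $ j * u s x $ i"
 by (simp_all add: cutf_def cutD_def mult.commute)

lemma continuous_on_outer: "continuous_on S f ==> continuous_on S g ==> continuous_on S (%x. outer (f x) (g x))"
 unfolding outer_def by (intro continuous_on_vec_lambda continuous_on_mult continuous_on_component)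

lemma th_sub: "continuous_on S \<theta>" "continuous_on S gr" 
 using th_cont by (blast intro: continuous_on_subset)+

text \<open>Applied twice, it gives the test field \<open>\<theta>\<^sup>2 v\<^sub>t\<close>.\<close>

lemma test_field_cut:
 assumes tf: "test_field a b u D" shows "test_field a b (cutf u) (cutD u D)"
proof -
 have cu: "continuous_on (B s) (u s)" and cD: "continuous_on (B s) (D s)" and pd: "has_pd (B s) j (%x. u s x $ i) (%x. D s x $ i $ j)" for s i j
  using tf unfolding test_field_def by blast+
 have bd: "u Lower (pt3 (x,y,0)) = u Upper (pt3 (x,y,0))" "u Lower (pt3 (x,y,- depth p)) = 0" "u Upper (pt3 (x,y,height p)) = 0" if "x \<in> {a..b}" "y \<in> {a..b}" for x y
  using tf that unfolding test_field_def by blast+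
 show ?thesis unfolding test_field_def
 proof (intro conjI allI ballI)
  show "has_pd (B s) j (%x. cutf u s x $ i) (%x. cutD u D s x $ i $ j)" for s i j
   unfolding cut_nth by (rule has_pd_mult[OF has_pd_subset[OF th_pd subset_UNIV] pd])
  show "continuous_on (B s) (cutf u s)" for s unfolding cutf_def by (intro continuous_on_scaleR th_sub cu)
  show "continuous_on (B s) (cutD u D s)" for s unfolding cutD_def by (intro continuous_on_add continuous_on_scaleR continuous_on_outer th_sub cu cD)
 qed (simp_all add: cutf_def bd)
qed

lemma jc: "tcont a b s (v s)" "tcont a b s (w s)" "tcont a b s (dt (w s))" "tcont a b s (Dv s)" "tcont a b s (Dw s)"
proof -
 have sub: "continuous_on ({0..} \<times> cs s) (%(t, x). F t x) ==> tcont a b s F" for F :: "real => real^3 => 'z::real_normed_vector"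
  unfolding case_prod_unfold by (erule continuous_on_subset) (rule Sigma_mono[OF order_refl slabbox_subset_cs])
 show "tcont a b s (v s)" "tcont a b s (w s)" "tcont a b s (dt (w s))" "tcont a b s (Dv s)" "tcont a b s (Dw s)"
  by (rule sub[OF joint_cont(3)] sub[OF joint_cont(4)] sub[OF joint_cont(5)] sub[OF Dmat_cont[OF cr(3)]] sub[OF Dmat_cont[OF cr(4)]])+
qed

lemma jcoef: "continuous_on ({0..} \<times> B s) (%X. rho p s (snd X $ 3))" "continuous_on ({0..} \<times> B s) (%X. dpres p s (snd X $ 3))"
 by (rule continuous_on_compose2[OF coeff_cont(1)] continuous_on_compose2[OF coeff_cont(2)]; auto intro!: continuous_intros simp: mem_box3)+

lemma jth: "continuous_on ({0..} \<times> B s) (%X. \<theta> (snd X))" "continuous_on ({0..} \<times> B s) (%X. gr (snd X))"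
 by (rule continuous_on_compose2[OF th_cont(1)] continuous_on_compose2[OF th_cont(2)]; auto intro!: continuous_intros)+

lemma jst: "continuous_on ({0..} \<times> B s) (%X. stressm s (snd X $ 3) (Dv s (fst X) (snd X)))" "continuous_on ({0..} \<times> B s) (%X. stressm s (snd X $ 3) (Dw s (fst X) (snd X)))"
 by (rule stressm_cont[OF jc(4)] stressm_cont[OF jc(5)]; auto intro!: continuous_intros simp: mem_box3)+

lemmas jintros = continuous_on_add continuous_on_diff continuous_on_mult continuous_on_power continuous_on_inner continuous_on_norm continuous_on_component continuous_on_const
 jc jcoef jth jst continuous_on_outer continuous_on_scaleR

text \<open>The weight is \<open>\<theta>\<^sup>2\<close>, so that the weighted forms are forms of the cut-off field up to terms with the gradient of
  \<open>\<theta>\<close>. A prime marks a time derivative.\<close>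

definition "nd s t x = (\<theta> x)\<^sup>2 * (rho p s (x $ 3) * (v s t x \<bullet> v s t x))"
definition "nd' s t x = (\<theta> x)\<^sup>2 * (rho p s (x $ 3) * (2 * (v s t x \<bullet> w s t x)))"
definition "dd s t x = (\<theta> x)\<^sup>2 * (Dv s t x \<bullet> stressm s (x $ 3) (Dv s t x))"
definition "dd' s t x = (\<theta> x)\<^sup>2 * (2 * (Dv s t x \<bullet> stressm s (x $ 3) (Dw s t x)))"
definition "sd s t x = (\<theta> x)\<^sup>2 * (rho p s (x $ 3) * (w s t x \<bullet> w s t x))"
definition "sd' s t x = (\<theta> x)\<^sup>2 * (rho p s (x $ 3) * (2 * (w s t x \<bullet> dt (w s) t x)))"
definition "gd s t x = (\<theta> x)\<^sup>2 * (Dw s t x \<bullet> stressm s (x $ 3) (Dw s t x))"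
definition "tr (A :: real^3^3) = A$1$1 + A$2$2 + A$3$3"
definition "vd s t x = (\<theta> x)\<^sup>2 * (1/2 * (dpres p s (x $ 3) * rho p s (x $ 3)) * (tr (Dv s t x))\<^sup>2
 - grav p * rho p s (x $ 3) * (v s t x $ 3 * (Dv s t x $1$1 + Dv s t x $2$2)))"
definition "vd' s t x = (\<theta> x)\<^sup>2 * ((dpres p s (x $ 3) * rho p s (x $ 3)) * (tr (Dv s t x) * tr (Dw s t x))
 - grav p * rho p s (x $ 3) * (w s t x $ 3 * (Dv s t x $1$1 + Dv s t x $2$2) + v s t x $ 3 * (Dw s t x $1$1 + Dw s t x $2$2)))"
definition "hd0 t x = (\<theta> x)\<^sup>2 * ((Dv Upper t x $3$1)\<^sup>2 + (Dv Upper t x $3$2)\<^sup>2)"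
definition "hd' t x = (\<theta> x)\<^sup>2 * (2 * (Dv Upper t x $3$1 * Dw Upper t x $3$1 + Dv Upper t x $3$2 * Dw Upper t x $3$2))"

lemma density_cont: "tcont a b s (nd s)" "tcont a b s (nd' s)" "tcont a b s (dd s)" "tcont a b s (dd' s)" "tcont a b s (sd s)" "tcont a b s (sd' s)"
 "tcont a b s (gd s)" "tcont a b s (vd s)" "tcont a b s (vd' s)" "tcont a b Upper hd0" "tcont a b Upper hd'"
 unfolding nd_def nd'_def dd_def dd'_def sd_def sd'_def gd_def vd_def vd'_def hd0_def hd'_def tr_def
 by (intro jintros)+

lemmas density_slice = density_cont[THEN tcont_slice]

lemma base_deriv:
 assumes "x \<in> B s" "t \<ge> 0"
 shows "((%\<tau>. v s \<tau> x) has_vector_derivative w s t x) (at t within {0..})"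
  "((%\<tau>. w s \<tau> x) has_vector_derivative dt (w s) t x) (at t within {0..})"
  "((%\<tau>. Dv s \<tau> x) has_vector_derivative Dw s t x) (at t within {0..})"
proof -
 have x: "x \<in> cs s" using assms(1) slabbox_subset_cs by blast
 show "((%\<tau>. v s \<tau> x) has_vector_derivative w s t x) (at t within {0..})" by (rule time_diff_dt[OF td(2) assms(2) x])
 show "((%\<tau>. w s \<tau> x) has_vector_derivative dt (w s) t x) (at t within {0..})" by (rule time_diff_dt[OF td(3) assms(2) x])
 show "((%\<tau>. Dv s \<tau> x) has_vector_derivative Dw s t x) (at t within {0..})" by (rule Dmat_dt[OF td(2) cr(3,4) x assms(2)])
qed

lemma entry_deriv:
 assumes "x \<in> B s" "t \<ge> 0"
 shows "((%\<tau>. v s \<tau> x $ i) has_real_derivative w s t x $ i) (at t within {0..})"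
  "((%\<tau>. Dv s \<tau> x $ i $ j) has_real_derivative Dw s t x $ i $ j) (at t within {0..})"
 unfolding has_real_derivative_iff_has_vector_derivative
 by (rule bounded_linear.has_vector_derivative[OF bounded_linear_vec_nth base_deriv(1)[OF assms]]
  bounded_linear.has_vector_derivative[OF bounded_linear_compose[OF bounded_linear_vec_nth bounded_linear_vec_nth] base_deriv(3)[OF assms]])+

lemma inner_deriv:
 fixes f :: "real => 'b::real_inner"
 assumes "(f has_vector_derivative f') F" "(g has_vector_derivative g') F" "F = at t within S"
 shows "((%\<tau>. f \<tau> \<bullet> g \<tau>) has_real_derivative f t \<bullet> g' + f' \<bullet> g t) (at t within S)"
 using bounded_bilinear.has_vector_derivative[OF bounded_bilinear_inner, of f f' t S g g'] assms
 by (simp add: has_real_derivative_iff_has_vector_derivative)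

lemma density_deriv:
 assumes x: "x \<in> B s" and t: "t \<ge> 0"
 shows "((%\<tau>. nd s \<tau> x) has_real_derivative nd' s t x) (at t within {0..})"
  "((%\<tau>. dd s \<tau> x) has_real_derivative dd' s t x) (at t within {0..})"
  "((%\<tau>. sd s \<tau> x) has_real_derivative sd' s t x) (at t within {0..})"
  "((%\<tau>. vd s \<tau> x) has_real_derivative vd' s t x) (at t within {0..})"
proof -
 note b = base_deriv[OF x t] and e = entry_deriv[OF x t]
 have eq: "(f has_real_derivative d') F" if "(f has_real_derivative d) F" "d = d'" for f d d' F using that by simp
 show "((%\<tau>. nd s \<tau> x) has_real_derivative nd' s t x) (at t within {0..})"
  unfolding nd_def nd'_def by (rule eq[OF DERIV_cmult[OF DERIV_cmult[OF inner_deriv[OF b(1) b(1) refl]]]]) (simp add: inner_commute)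
 show "((%\<tau>. sd s \<tau> x) has_real_derivative sd' s t x) (at t within {0..})"
  unfolding sd_def sd'_def by (rule eq[OF DERIV_cmult[OF DERIV_cmult[OF inner_deriv[OF b(2) b(2) refl]]]]) (simp add: inner_commute)
 show "((%\<tau>. dd s \<tau> x) has_real_derivative dd' s t x) (at t within {0..})"
  unfolding dd_def dd'_def
  by (rule eq[OF DERIV_cmult[OF inner_deriv[OF b(3) bounded_linear.has_vector_derivative[OF stressm_bounded_linear b(3)] refl]]]) (simp add: stress_sym[of "Dw s t x" s _ "Dv s t x"])
 have T: "((%\<tau>. tr (Dv s \<tau> x)) has_real_derivative tr (Dw s t x)) (at t within {0..})"
  unfolding tr_def by (intro DERIV_add e)
 have T2: "((%\<tau>. (tr (Dv s \<tau> x))\<^sup>2) has_real_derivative 2 * (tr (Dv s t x) * tr (Dw s t x))) (at t within {0..})"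
  unfolding power2_eq_square by (rule eq[OF DERIV_mult[OF T T]]) simp
 show "((%\<tau>. vd s \<tau> x) has_real_derivative vd' s t x) (at t within {0..})"
  unfolding vd_def vd'_def
  by (rule eq[OF DERIV_cmult[OF DERIV_diff[OF DERIV_cmult[OF T2] DERIV_cmult[OF DERIV_mult[OF e(1)[of 3] DERIV_add[OF e(2)[of 1 1] e(2)[of 2 2]]]]]]])
   (simp add: algebra_simps)
qed

lemma hd_deriv:
 assumes x: "x \<in> B Upper" and t: "t \<ge> 0"
 shows "((%\<tau>. hd0 \<tau> x) has_real_derivative hd' t x) (at t within {0..})"
proof -
 note e = entry_deriv(2)[OF x t]
 have "((%\<tau>. (Dv Upper \<tau> x $ 3 $ j)\<^sup>2) has_real_derivative Dv Upper t x $ 3 $ j * Dw Upper t x $ 3 $ j + Dw Upper t x $ 3 $ j * Dv Upper t x $ 3 $ j) (at t within {0..})" for j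
  unfolding power2_eq_square using DERIV_mult[OF e[of 3 j] e[of 3 j]] by (simp add: add.commute mult.commute)
 then have "((%\<tau>. hd0 \<tau> x) has_real_derivative (\<theta> x)\<^sup>2 * ((Dv Upper t x $ 3 $ 1 * Dw Upper t x $ 3 $ 1 + Dw Upper t x $ 3 $ 1 * Dv Upper t x $ 3 $ 1)
  + (Dv Upper t x $ 3 $ 2 * Dw Upper t x $ 3 $ 2 + Dw Upper t x $ 3 $ 2 * Dv Upper t x $ 3 $ 2))) (at t within {0..})"
  unfolding hd0_def by (intro DERIV_cmult DERIV_add)
 then show ?thesis by (simp add: hd'_def algebra_simps)
qed

end


section \<open>The weighted energy estimate on a box\<close>

context cut_sol begin

definition "Nt t = vol a b (%s. nd s t)"
definition "Dt t = vol a b (%s. dd s t)"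
definition "St t = vol a b (%s. sd s t)"
definition "Gt t = vol a b (%s. gd s t)"
definition "Vt t = vol a b (%s. vd s t)"
definition "Ht t = ifc a b (hd0 t)"
definition "Q s t x = (norm (v s t x))\<^sup>2 + (norm (Dv s t x))\<^sup>2 + (norm (w s t x))\<^sup>2 + (norm (Dw s t x))\<^sup>2"
definition "hg t x = (Dv Upper t x $3$1)\<^sup>2 + (Dv Upper t x $3$2)\<^sup>2"

text \<open>The mass that the cutoff error terms are measured against.\<close>

definition "Mt t = vol a b (%s. Q s t) + surf p * ifc a b (hg t)"

lemma Q_cont: "tcont a b s (Q s)" "tcont a b Upper hg"
 unfolding Q_def hg_def by (intro jintros)+

lemmas Q_slice = Q_cont[THEN tcont_slice]

lemma Q_nonneg: "0 <= Q s t x" by (simp add: Q_def)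

lemma vol_Q_nonneg: "t \<ge> 0 ==> 0 <= vol a b (%s. Q s t)"
 by (intro vol_nonneg Q_nonneg allI Q_slice)

lemma ifc_nonneg: "(\<And>x. 0 <= f x) ==> continuous_on (B Upper) f ==> 0 <= ifc a b f"
 using ifc_mono[of a b "%x. 0" f] by (simp add: ifc_def)

lemma ifc_hg_nonneg: "t \<ge> 0 ==> 0 <= ifc a b (hg t)"
 by (intro ifc_nonneg Q_slice) (simp_all add: hg_def)

lemma vol_Q_le: "t \<ge> 0 ==> vol a b (%s. Q s t) <= Mt t" "t \<ge> 0 ==> surf p * ifc a b (hg t) <= Mt t" "t \<ge> 0 ==> 0 <= Mt t"
 using vol_Q_nonneg[of t] mult_nonneg_nonneg[OF surf_nonneg ifc_hg_nonneg[of t]] by (simp_all add: Mt_def)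

text \<open>Interface errors are absorbed into volume errors; the boundary integral of the gradient occurs only
  with the factor \<open>\<sigma>\<close>.\<close>

lemma trace_Q:
 assumes t: "t \<ge> 0"
 shows "ifc a b (%x. (v Upper t x $ 3)\<^sup>2) <= vol a b (%s. Q s t)" "ifc a b (%x. (w Upper t x $ 3)\<^sup>2) <= vol a b (%s. Q s t)"
proof -
 have le: "integral (B Upper) f <= vol a b (%s. Q s t)" if "continuous_on (B Upper) f" "\<And>x. f x <= Q Upper t x" for f
 proof -
  have "integral (B Upper) f <= integral (B Upper) (Q Upper t)"
   by (intro integral_le integrable_box3 that Q_slice t)
  moreover have "0 <= integral (B Lower) (Q Lower t)" by (intro integral_nonneg integrable_box3 Q_slice t Q_nonneg)
  ultimately show ?thesis by (simp add: vol_def del: zlo.simps zhi.simps)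
 qed
 have c: "continuous_on (B Upper) (v Upper t)" "continuous_on (B Upper) (Dv Upper t)" "continuous_on (B Upper) (w Upper t)" "continuous_on (B Upper) (Dw Upper t)"
  by (rule jc[THEN tcont_slice, OF t])+
 show "ifc a b (%x. (v Upper t x $ 3)\<^sup>2) <= vol a b (%s. Q s t)" unfolding ifc_def
  by (rule order_trans[OF trace_square_le[OF less_imp_le[OF ab] test_v[OF t]] le]) (intro continuous_on_add continuous_on_power continuous_on_norm c, simp add: Q_def)
 show "ifc a b (%x. (w Upper t x $ 3)\<^sup>2) <= vol a b (%s. Q s t)" unfolding ifc_def
  by (rule order_trans[OF trace_square_le[OF less_imp_le[OF ab] test_w[OF t]] le]) (intro continuous_on_add continuous_on_power continuous_on_norm c, simp add: Q_def)
qed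

lemma cross_le:
 fixes th x y g :: real
 assumes "0 <= th" "th <= 1" "\<bar>g\<bar> <= \<kappa>"
 shows "2 * th * g * x * y <= \<kappa> * (x\<^sup>2 + y\<^sup>2)" "- (2 * th * g * x * y) <= \<kappa> * (x\<^sup>2 + y\<^sup>2)"
proof -
 have "\<bar>th * g\<bar> * (2 * \<bar>x * y\<bar>) <= \<kappa> * (x\<^sup>2 + y\<^sup>2)"
 proof (rule mult_mono)
  show "\<bar>th * g\<bar> <= \<kappa>" using mult_mono[OF assms(2,3)] assms by (simp add: abs_mult)
  show "2 * \<bar>x * y\<bar> <= x\<^sup>2 + y\<^sup>2" using sum_squares_bound[of "\<bar>x\<bar>" "\<bar>y\<bar>"] by (simp add: abs_mult)
 qed (use kap in auto)
 moreover have "\<bar>2 * th * g * x * y\<bar> = \<bar>th * g\<bar> * (2 * \<bar>x * y\<bar>)" by (simp add: abs_mult)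
 ultimately have "\<bar>2 * th * g * x * y\<bar> <= \<kappa> * (x\<^sup>2 + y\<^sup>2)" by simp
 then show "2 * th * g * x * y <= \<kappa> * (x\<^sup>2 + y\<^sup>2)" "- (2 * th * g * x * y) <= \<kappa> * (x\<^sup>2 + y\<^sup>2)" by linarith+
qed

text \<open>The gravity terms of the tested equation and of the derivative of the potential energy
  differ by a horizontal divergence.\<close>

definition "div_dens s t x = grav p * (rho p s (x $ 3) * (cutf (%s. v s t) s x $ 3 * cutD (%s. w s t) (%s. Dw s t) s x $1$1
  + cutD (%s. v s t) (%s. Dv s t) s x $3$1 * cutf (%s. w s t) s x $ 1))
 + grav p * (rho p s (x $ 3) * (cutf (%s. v s t) s x $ 3 * cutD (%s. w s t) (%s. Dw s t) s x $2$2
  + cutD (%s. v s t) (%s. Dv s t) s x $3$2 * cutf (%s. w s t) s x $ 2))"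

lemma div_dens_cont: "t \<ge> 0 ==> continuous_on (B s) (div_dens s t)"
proof -
 assume t: "t \<ge> 0"
 have c: "continuous_on (B s) (cutf (%s. v s t) s)" "continuous_on (B s) (cutf (%s. w s t) s)"
  "continuous_on (B s) (cutD (%s. v s t) (%s. Dv s t) s)" "continuous_on (B s) (cutD (%s. w s t) (%s. Dw s t) s)"
  using test_field_cut[OF test_v[OF t]] test_field_cut[OF test_w[OF t]] unfolding test_field_def by blast+
 show ?thesis unfolding div_dens_def
  by (intro continuous_on_add continuous_on_mult continuous_on_const continuous_on_component c continuous_on_third[OF coeff_cont(1)])
qed

lemma div_dens_vol: "t \<ge> 0 ==> vol a b (%s. div_dens s t) = 0"
proof -
 assume t: "t \<ge> 0"
 have c: "continuous_on (B s) (cutf (%s. v s t) s)" "continuous_on (B s) (cutf (%s. w s t) s)"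
  "continuous_on (B s) (cutD (%s. v s t) (%s. Dv s t) s)" "continuous_on (B s) (cutD (%s. w s t) (%s. Dw s t) s)"
  and pdv: "has_pd (B s) j (%x. cutf (%s. v s t) s x $ i) (%x. cutD (%s. v s t) (%s. Dv s t) s x $ i $ j)"
  and pdw: "has_pd (B s) j (%x. cutf (%s. w s t) s x $ i) (%x. cutD (%s. w s t) (%s. Dw s t) s x $ i $ j)" for s i j
  using test_field_cut[OF test_v[OF t]] test_field_cut[OF test_w[OF t]] unfolding test_field_def by blast+
 have z: "integral (B s) (%x. rho p s (x $ 3) * (cutf (%s. v s t) s x $ 3 * cutD (%s. w s t) (%s. Dw s t) s x $k$k
  + cutD (%s. v s t) (%s. Dv s t) s x $3$k * cutf (%s. w s t) s x $ k)) = 0" 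
  and cz: "continuous_on (B s) (%x. rho p s (x $ 3) * (cutf (%s. v s t) s x $ 3 * cutD (%s. w s t) (%s. Dw s t) s x $k$k
  + cutD (%s. v s t) (%s. Dv s t) s x $3$k * cutf (%s. w s t) s x $ k))" if k: "k \<noteq> 3" for s k
 proof -
  show cc: "continuous_on (B s) (%x. rho p s (x $ 3) * (cutf (%s. v s t) s x $ 3 * cutD (%s. w s t) (%s. Dw s t) s x $k$k
  + cutD (%s. v s t) (%s. Dv s t) s x $3$k * cutf (%s. w s t) s x $ k))"
   by (intro continuous_on_add continuous_on_mult continuous_on_component c continuous_on_third[OF coeff_cont(1)])
  have h: "has_pd (B s) k (%x. rho p s (x $ 3) * (cutf (%s. v s t) s x $ 3 * cutf (%s. w s t) s x $ k))
   (%x. rho p s (x $ 3) * (cutf (%s. v s t) s x $ 3 * cutD (%s. w s t) (%s. Dw s t) s x $k$k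
  + cutD (%s. v s t) (%s. Dv s t) s x $3$k * cutf (%s. w s t) s x $ k))"
   using has_pd_mult[OF has_pd_third_horizontal[OF k, of "B s" "rho p s"] has_pd_mult[OF pdv[of s k 3] pdw[of s k k]]] by simp
  show "integral (B s) (%x. rho p s (x $ 3) * (cutf (%s. v s t) s x $ 3 * cutD (%s. w s t) (%s. Dw s t) s x $k$k
  + cutD (%s. v s t) (%s. Dv s t) s x $3$k * cutf (%s. w s t) s x $ k)) = 0"
  proof (rule integral_box3_pd_horizontal[OF less_imp_le[OF ab] h k cc])
   fix z assume z: "z \<in> (ivl p s)"
   show "faces_match a b z (%x. rho p s (x $ 3) * (cutf (%s. v s t) s x $ 3 * cutf (%s. w s t) s x $ k))"
    unfolding cutf_def
    by (intro faces_match_cong_mult faces_match_comp[OF lat(1)[OF t z]] faces_match_comp[OF lat(2)[OF t z]]) (simp add: faces_match_def)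
  qed
 qed
 have "integral (B s) (div_dens s t) = 0" for s
  unfolding div_dens_def
  by (subst integral_add) (intro integrable_box3 continuous_on_mult[OF continuous_on_const] cz, simp, intro integrable_box3 continuous_on_mult[OF continuous_on_const] cz, simp, simp only: integral_mult_right z[of 1] z[of 2], simp add: z)
 then show ?thesis unfolding vol_def by simp
qed

definition "err s t x = 2 * \<theta> x * (grav p * rho p s (x $ 3)) * (v s t x $ 3 * (gr x $ 1 * w s t x $ 1 + gr x $ 2 * w s t x $ 2))
 - dpres p s (x $ 3) * rho p s (x $ 3) * (tr (Dv s t x) * (2 * \<theta> x * (w s t x \<bullet> gr x)))
 - 2 * \<theta> x * (outer (w s t x) (gr x) \<bullet> stressm s (x $ 3) (Dw s t x))"

definition "ierr t x = 2 * \<theta> x * w Upper t x $ 3 * (gr x $ 1 * Dv Upper t x $3$1 + gr x $ 2 * Dv Upper t x $3$2)"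

lemma err_cont: "tcont a b s (err s)" "tcont a b Upper ierr"
 unfolding err_def ierr_def tr_def by (intro jintros)+

text \<open>The tested equation with \<open>\<theta>\<^sup>2 v\<^sub>t\<close>: its density is the derivative of
  the energy density plus the dissipation plus a horizontal divergence, up to terms that contain the
  gradient of \<open>\<theta>\<close>.\<close>

lemma energy_identity:
 assumes t: "t > 0"
 shows "1/2 * vol a b (%s. sd' s t) + vol a b (%s. vd' s t) + Gt t + surf p * (1/2 * ifc a b (hd' t))
  = vol a b (%s. err s t) - surf p * ifc a b (ierr t)"
proof -
 have t0: "t \<ge> 0" using t by simp
 let ?\<zeta> = "cutf (cutf (%s. w s t))" and ?Z = "cutD (cutf (%s. w s t)) (cutD (%s. w s t) (%s. Dw s t))"
 have tf: "test_field a b ?\<zeta> ?Z" by (intro test_field_cut test_w t0)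
 have z: "?\<zeta> s x = (\<theta> x)\<^sup>2 *\<^sub>R w s t x" for s x by (simp add: cutf_def power2_eq_square)
 have Z: "?Z s x = (\<theta> x)\<^sup>2 *\<^sub>R Dw s t x + (2 * \<theta> x) *\<^sub>R outer (w s t x) (gr x)" for s x
  by (simp add: vec_eq_iff cut_nth cutf_def power2_eq_square algebra_simps)
 have 1: "faces_match a b z (%x. ?\<zeta> s x $ i * Tm s \<tau> x $ i $ j)" if "\<tau> > 0" "z \<in> (ivl p s)" for \<tau> s z i j
 proof -
  have "faces_match a b z (%x. (\<theta> x *\<^sub>R w s t x) $ i * (\<theta> x *\<^sub>R Tm s \<tau> x) $ i $ j)"
   by (intro faces_match_cong_mult faces_match_comp[OF lat(2)[OF t0 that(2)]] faces_match_comp[OF lat(3)[OF _ that(2)]] less_imp_le that(1))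
  then show ?thesis by (simp add: z power2_eq_square mult_ac)
 qed
 have 2: "faces_match a b 0 (%x. ?\<zeta> Upper x $ 3 * Deta Upper \<tau> x $ 3 $ k)" if "\<tau> > 0" "k \<noteq> 3" for \<tau> k
 proof -
  have z0: "0 \<in> {zlo p Upper..zhi p Upper}" using height_pos by simp
  have "faces_match a b 0 (%x. (\<theta> x *\<^sub>R w Upper t x) $ 3 * (\<theta> x *\<^sub>R Deta Upper \<tau> x) $ 3 $ k)"
   by (intro faces_match_cong_mult faces_match_comp[OF lat(2)[OF t0 z0]] faces_match_comp[OF lat(4)[OF _ z0]] less_imp_le that(1))
  then show ?thesis by (simp add: z power2_eq_square mult_ac del: closed_slab.simps)
 qed
 have pt: "rho p s (x $ 3) * (?\<zeta> s x \<bullet> dt (w s) t x) - grav p * rho p s (x $ 3) * trace (Dv s t x) * ?\<zeta> s x $ 3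
  + grav p * rho p s (x $ 3) * (?\<zeta> s x \<bullet> Dv s t x $ 3) + dpres p s (x $ 3) * rho p s (x $ 3) * trace (Dv s t x) * trace (?Z s x) + ?Z s x \<bullet> stressm s (x $ 3) (Dw s t x)
  = 1/2 * sd' s t x + vd' s t x + gd s t x + div_dens s t x - err s t x" for s x
 proof -
  have a: "rho p s (x $ 3) * (?\<zeta> s x \<bullet> dt (w s) t x) = 1/2 * sd' s t x" by (simp add: z sd'_def)
  have b: "?Z s x \<bullet> stressm s (x $ 3) (Dw s t x) = gd s t x + 2 * \<theta> x * (outer (w s t x) (gr x) \<bullet> stressm s (x $ 3) (Dw s t x))"
   unfolding Z gd_def by (simp add: inner_add_left)
  have c: "trace (?Z s x) = (\<theta> x)\<^sup>2 * tr (Dw s t x) + 2 * \<theta> x * (w s t x \<bullet> gr x)"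
   unfolding Z trace3 tr_def inner_vec_def sum_3 by (simp add: algebra_simps)
  have d: "trace (Dv s t x) = tr (Dv s t x)" by (simp add: trace3 tr_def)
  have e: "- (grav p * rho p s (x $ 3) * trace (Dv s t x) * ?\<zeta> s x $ 3) + grav p * rho p s (x $ 3) * (?\<zeta> s x \<bullet> Dv s t x $ 3)
   = - ((\<theta> x)\<^sup>2 * (grav p * rho p s (x $ 3) * (w s t x $ 3 * (Dv s t x $1$1 + Dv s t x $2$2) + v s t x $ 3 * (Dw s t x $1$1 + Dw s t x $2$2)))) + div_dens s t x
    - 2 * \<theta> x * (grav p * rho p s (x $ 3)) * (v s t x $ 3 * (gr x $ 1 * w s t x $ 1 + gr x $ 2 * w s t x $ 2))"
  proof -
   have 1: "?\<zeta> s x \<bullet> Dv s t x $ 3 = (\<theta> x)\<^sup>2 * (w s t x $ 1 * Dv s t x $3$1 + w s t x $ 2 * Dv s t x $3$2 + w s t x $ 3 * Dv s t x $3$3)"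
    by (simp add: z inner_vec_def sum_3 algebra_simps)
   have 2: "?\<zeta> s x $ 3 = (\<theta> x)\<^sup>2 * w s t x $ 3" by (simp add: z)
   show ?thesis unfolding 1 2 d tr_def div_dens_def cut_nth power2_eq_square by (simp only: distrib_left distrib_right minus_add_distrib diff_conv_add_uminus minus_mult_left[symmetric] minus_mult_right[symmetric] ac_simps)
  qed
  have f: "dpres p s (x $ 3) * rho p s (x $ 3) * trace (Dv s t x) * trace (?Z s x) = (\<theta> x)\<^sup>2 * (dpres p s (x $ 3) * rho p s (x $ 3) * (tr (Dv s t x) * tr (Dw s t x)))
   + dpres p s (x $ 3) * rho p s (x $ 3) * (tr (Dv s t x) * (2 * \<theta> x * (w s t x \<bullet> gr x)))"
   unfolding c d by (simp add: algebra_simps)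
  have g: "vd' s t x = (\<theta> x)\<^sup>2 * (dpres p s (x $ 3) * rho p s (x $ 3) * (tr (Dv s t x) * tr (Dw s t x)))
   - (\<theta> x)\<^sup>2 * (grav p * rho p s (x $ 3) * (w s t x $ 3 * (Dv s t x $1$1 + Dv s t x $2$2) + v s t x $ 3 * (Dw s t x $1$1 + Dw s t x $2$2)))"
   unfolding vd'_def by (rule right_diff_distrib)
  show ?thesis unfolding a b f g err_def using e by linarith
 qed
 have ipt: "?Z Upper x $ 3 $ 1 * Dv Upper t x $ 3 $ 1 + ?Z Upper x $ 3 $ 2 * Dv Upper t x $ 3 $ 2 = 1/2 * hd' t x + ierr t x" for x
  unfolding Z hd'_def ierr_def by (simp add: algebra_simps del: closed_slab.simps)
 have "vol a b (%s x. 1/2 * sd' s t x + vd' s t x + gd s t x + div_dens s t x - err s t x) + surf p * ifc a b (%x. 1/2 * hd' t x + ierr t x) = 0"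
  using weak_form_dt[OF less_imp_le[OF ab] tf 1 2 t] unfolding pt ipt vol_def ifc_def .
 moreover have "vol a b (%s x. 1/2 * sd' s t x + vd' s t x + gd s t x + div_dens s t x - err s t x)
  = 1/2 * vol a b (%s. sd' s t) + vol a b (%s. vd' s t) + Gt t + 0 - vol a b (%s. err s t)"
  unfolding Gt_def div_dens_vol[OF t0, symmetric] vol_cmult[symmetric]
  by (subst vol_add[symmetric] vol_diff[symmetric]; (intro allI continuous_on_add continuous_on_mult[OF continuous_on_const] density_slice div_dens_cont err_cont[THEN tcont_slice] t0; fail)?)+ simp
 moreover have "ifc a b (%x. 1/2 * hd' t x + ierr t x) = 1/2 * ifc a b (hd' t) + ifc a b (ierr t)"
  unfolding ifc_cmult[symmetric] by (intro ifc_add continuous_on_mult[OF continuous_on_const] density_slice err_cont[THEN tcont_slice] t0)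
 ultimately show ?thesis by (simp add: algebra_simps)
qed

lemma inner3_le: "\<bar>u \<bullet> gr x\<bar> <= 3 * \<kappa> * norm u"
proof -
 have "\<bar>u $ i * gr x $ i\<bar> <= norm u * \<kappa>" for i unfolding abs_mult by (rule mult_mono[OF entry_le(2) gr_le]) simp_all
 from this[of 1] this[of 2] this[of 3] have "\<bar>u $ 1 * gr x $ 1 + u $ 2 * gr x $ 2 + u $ 3 * gr x $ 3\<bar> <= 3 * (norm u * \<kappa>)" by linarith
 then show ?thesis unfolding inner_vec_def sum_3 inner_real_def by (simp add: mult_ac)
qed

lemma err_le:
 assumes x: "x \<in> B s" shows "err s t x <= ((2 * grav p + 135) * c) * \<kappa> * Q s t x"
proof -
 note z = slabbox_third[OF x]
 define V W A where "V = norm (v s t x)" and "W = norm (w s t x)" and "A = norm (Dv s t x)"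
 have nn: "V \<ge> 0" "W \<ge> 0" "A \<ge> 0" by (simp_all add: V_def W_def A_def)
 have th: "\<bar>2 * \<theta> x * r\<bar> <= 2 * \<bar>r\<bar>" for r using mult_right_mono[OF th_range(2)[of x], of "\<bar>r\<bar>"] th_range(1)[of x] by (simp add: abs_mult)
 have "\<bar>gr x $ i * w s t x $ i\<bar> <= \<kappa> * W" for i unfolding abs_mult W_def by (rule mult_mono[OF gr_le entry_le(2)]) (use kap in simp_all)
 from this[of 1] this[of 2] have "\<bar>gr x $ 1 * w s t x $ 1 + gr x $ 2 * w s t x $ 2\<bar> <= 2 * \<kappa> * W" by linarith
 then have "\<bar>v s t x $ 3\<bar> * \<bar>gr x $ 1 * w s t x $ 1 + gr x $ 2 * w s t x $ 2\<bar> <= V * (2 * \<kappa> * W)"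
  by (intro mult_mono) (use entry_le(2)[of "v s t x" 3] V_def in auto)
 then have "(grav p * \<bar>rho p s (x $ 3)\<bar>) * (\<bar>v s t x $ 3\<bar> * \<bar>gr x $ 1 * w s t x $ 1 + gr x $ 2 * w s t x $ 2\<bar>) <= (grav p * c) * (V * (2 * \<kappa> * W))"
  by (rule mult_mono[rotated]) (use g_pos c_nonneg cbound(1)[OF z] in \<open>simp_all only: mult_nonneg_nonneg mult_left_mono abs_ge_zero less_imp_le\<close>)
 then have e1: "\<bar>2 * \<theta> x * ((grav p * rho p s (x $ 3)) * (v s t x $ 3 * (gr x $ 1 * w s t x $ 1 + gr x $ 2 * w s t x $ 2)))\<bar> <= 2 * ((grav p * c) * (V * (2 * \<kappa> * W)))"
  using g_pos by (intro order_trans[OF th]) (simp add: abs_mult mult_ac)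
 have "\<bar>tr (Dv s t x)\<bar> <= 3 * A" unfolding tr_def A_def using entry_le(1)[of "Dv s t x" 1 1] entry_le(1)[of "Dv s t x" 2 2] entry_le(1)[of "Dv s t x" 3 3] by linarith
 then have "\<bar>dpres p s (x $ 3) * rho p s (x $ 3)\<bar> * (\<bar>tr (Dv s t x)\<bar> * \<bar>w s t x \<bullet> gr x\<bar>) <= c * ((3 * A) * (3 * \<kappa> * W))"
  by (intro mult_mono) (use cbound(2)[OF z] inner3_le[of "w s t x" x] W_def c_nonneg nn in auto)
 then have e2: "\<bar>2 * \<theta> x * ((dpres p s (x $ 3) * rho p s (x $ 3)) * (tr (Dv s t x) * (w s t x \<bullet> gr x)))\<bar> <= 2 * (c * ((3 * A) * (3 * \<kappa> * W)))"
  by (intro order_trans[OF th]) (simp add: abs_mult mult_ac)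
 have e3: "\<bar>2 * \<theta> x * (outer (w s t x) (gr x) \<bullet> stressm s (x $ 3) (Dw s t x))\<bar> <= 2 * (63 * c * \<kappa> * (W\<^sup>2 + (norm (Dw s t x))\<^sup>2))"
  unfolding W_def by (intro order_trans[OF th] mult_left_mono outer_stress_le cbound(3,4) z gr_le kap) simp
 have "err s t x <= 2 * ((grav p * c) * (V * (2 * \<kappa> * W))) + 2 * (c * ((3 * A) * (3 * \<kappa> * W))) + 2 * (63 * c * \<kappa> * (W\<^sup>2 + (norm (Dw s t x))\<^sup>2))"
 proof -
  have "err s t x = 2 * \<theta> x * ((grav p * rho p s (x $ 3)) * (v s t x $ 3 * (gr x $ 1 * w s t x $ 1 + gr x $ 2 * w s t x $ 2)))
   - 2 * \<theta> x * ((dpres p s (x $ 3) * rho p s (x $ 3)) * (tr (Dv s t x) * (w s t x \<bullet> gr x))) - 2 * \<theta> x * (outer (w s t x) (gr x) \<bullet> stressm s (x $ 3) (Dw s t x))"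
   unfolding err_def by (simp only: mult_ac)
  then show ?thesis using abs_le_D1[OF e1] abs_le_D2[OF e2] abs_le_D2[OF e3] by linarith
 qed
 also have "\<dots> = (2 * grav p) * (c * \<kappa>) * (2 * V * W) + 9 * (c * \<kappa>) * (2 * A * W) + 126 * (c * \<kappa>) * (W\<^sup>2 + (norm (Dw s t x))\<^sup>2)" by (simp add: algebra_simps)
 also have "\<dots> <= (2 * grav p) * (c * \<kappa>) * Q s t x + 9 * (c * \<kappa>) * Q s t x + 126 * (c * \<kappa>) * Q s t x"
 proof (intro add_mono mult_left_mono)
  show "2 * V * W <= Q s t x" "2 * A * W <= Q s t x" "W\<^sup>2 + (norm (Dw s t x))\<^sup>2 <= Q s t x"
   using sum_squares_bound[of V W] sum_squares_bound[of A W] unfolding Q_def V_def W_def A_def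
   by (smt (verit) zero_le_power2)+
 qed (use c_nonneg kap g_pos in auto)
 also have "\<dots> = ((2 * grav p + 135) * c) * \<kappa> * Q s t x" by (simp add: algebra_simps)
 finally show ?thesis .
qed

definition "C1 = (2 * grav p + 135) * c + 2 * surf p + 1"

lemma energy_derivative_le:
 assumes t: "t > 0"
 shows "1/2 * vol a b (%s. sd' s t) + vol a b (%s. vd' s t) + surf p * (1/2 * ifc a b (hd' t)) + Gt t <= C1 * \<kappa> * Mt t"
proof -
 have t0: "t \<ge> 0" using t by simp
 have e: "vol a b (%s. err s t) <= ((2 * grav p + 135) * c) * \<kappa> * vol a b (%s. Q s t)"
  unfolding vol_cmult[symmetric]
  by (intro vol_mono err_le allI continuous_on_mult[OF continuous_on_const] err_cont[THEN tcont_slice] Q_slice t0)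
 have cw: "continuous_on (B Upper) (%x. (w Upper t x $ 3)\<^sup>2)"
  by (intro continuous_on_power continuous_on_component jc(2)[THEN tcont_slice, OF t0])
 have "- 1 * ifc a b (ierr t) <= ifc a b (%x. \<kappa> * (hg t x + 2 * (w Upper t x $ 3)\<^sup>2))"
  unfolding ifc_cmult[symmetric]
 proof (rule ifc_mono)
  fix x
  have "ierr t x = 2 * \<theta> x * gr x $ 1 * w Upper t x $ 3 * Dv Upper t x $3$1 + 2 * \<theta> x * gr x $ 2 * w Upper t x $ 3 * Dv Upper t x $3$2"
   unfolding ierr_def by (simp add: algebra_simps del: closed_slab.simps)
  then show "- 1 * ierr t x <= \<kappa> * (hg t x + 2 * (w Upper t x $ 3)\<^sup>2)"
   using cross_le(2)[OF th_range gr_le, of x x 1 "w Upper t x $ 3" "Dv Upper t x $3$1"] cross_le(2)[OF th_range gr_le, of x x 2 "w Upper t x $ 3" "Dv Upper t x $3$2"]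
   unfolding hg_def by (simp add: distrib_left del: closed_slab.simps)
 qed (intro continuous_on_mult[OF continuous_on_const] continuous_on_add err_cont[THEN tcont_slice] Q_slice t0 cw)+
 also have "\<dots> = \<kappa> * (ifc a b (hg t) + 2 * ifc a b (%x. (w Upper t x $ 3)\<^sup>2))"
 proof -
  have "ifc a b (%x. hg t x + 2 * (w Upper t x $ 3)\<^sup>2) = ifc a b (hg t) + ifc a b (%x. 2 * (w Upper t x $ 3)\<^sup>2)"
   by (intro ifc_add continuous_on_mult[OF continuous_on_const] Q_slice t0 cw)
  then show ?thesis by (simp only: ifc_cmult)
 qed
 also have "\<dots> <= \<kappa> * (ifc a b (hg t) + 2 * vol a b (%s. Q s t))"
  using trace_Q(2)[OF t0] kap by (intro mult_left_mono) auto
 finally have i: "surf p * (- 1 * ifc a b (ierr t)) <= surf p * (\<kappa> * (ifc a b (hg t) + 2 * vol a b (%s. Q s t)))"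
  by (rule mult_left_mono[OF _ surf_nonneg])
 have m1: "((2 * grav p + 135) * c + 2 * surf p) * \<kappa> * vol a b (%s. Q s t) <= ((2 * grav p + 135) * c + 2 * surf p) * \<kappa> * Mt t"
  using vol_Q_le(1)[OF t0] g_pos c_nonneg surf_nonneg kap by (intro mult_left_mono) auto
 have m2: "\<kappa> * (surf p * ifc a b (hg t)) <= \<kappa> * Mt t" using vol_Q_le(2)[OF t0] kap by (intro mult_left_mono) auto
 have "vol a b (%s. err s t) - surf p * ifc a b (ierr t) <= ((2 * grav p + 135) * c) * \<kappa> * vol a b (%s. Q s t) + surf p * (\<kappa> * (ifc a b (hg t) + 2 * vol a b (%s. Q s t)))"
  using e i by simp
 also have "\<dots> = ((2 * grav p + 135) * c + 2 * surf p) * \<kappa> * vol a b (%s. Q s t) + \<kappa> * (surf p * ifc a b (hg t))" by (simp add: algebra_simps)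
 also have "\<dots> <= C1 * \<kappa> * Mt t" using m1 m2 by (simp add: C1_def algebra_simps)
 finally show ?thesis using energy_identity[OF t] by simp
qed

end


context rt begin

lemma cell_freq_nonneg: "0 <= cell_freq a b m k" by (simp add: cell_freq_def)

text \<open>The modewise form of the initial bound: the viscous form dominates the potential energy.
  The two squares \<open>(\<psi>' - r \<phi>)\<^sup>2\<close> and \<open>(\<psi>' + r \<phi>)\<^sup>2\<close> together control \<open>r\<^sup>2 \<phi>\<^sup>2\<close>.\<close>

lemma viscous_mode_nonneg:
 fixes e d P R c r \<phi> \<phi>' \<psi> \<psi>' g :: real
 assumes e: "e > 0" and d: "d \<ge> 0" and P: "P \<ge> 0" and R: "R > 0" and g: "g > 0" and c: "6 * P <= c * e" "2 * g * R <= c * e" "g <= c"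
 shows "0 <= mode_dens (c * d - P) (c * e) (- (g * R)) (c * R) r \<phi> \<phi>' \<psi> \<psi>'"
proof -
 have c0: "c \<ge> 0" using c(3) g by simp
 define A where "A = (\<psi>' + r * \<phi>)\<^sup>2" define B where "B = (\<psi>' - r * \<phi>)\<^sup>2"
 have A: "A \<ge> 0" and B: "B \<ge> 0" by (simp_all add: A_def B_def)
 have 1: "P * A <= c * e * (A / 6)" using mult_right_mono[OF c(1) A] by simp
 have 2: "(r * \<phi>)\<^sup>2 / 2 <= B + A / 6"
 proof -
  have "0 <= (7/6) * (\<psi>' - (5/7) * (r * \<phi>))\<^sup>2 + (1/14) * (r * \<phi>)\<^sup>2" by simp
  also have "\<dots> = B + A / 6 - (r * \<phi>)\<^sup>2 / 2" by (simp add: A_def B_def power2_eq_square field_simps)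
  finally show ?thesis by simp
 qed
 have 3: "c * e * ((r * \<phi>)\<^sup>2 / 2) <= c * e * (B + A / 6)" by (rule mult_left_mono[OF 2]) (use c0 e in simp)
 have 4: "g * R * (r * \<phi>)\<^sup>2 <= c * e * ((r * \<phi>)\<^sup>2 / 2)" using mult_right_mono[OF c(2), of "(r * \<phi>)\<^sup>2 / 2"] by simp
 have 5: "g * R * \<psi>\<^sup>2 <= c * R * \<psi>\<^sup>2" by (intro mult_right_mono c(3)) (use R in simp_all)
 have 6: "0 <= g * R * (r * \<phi> + \<psi>)\<^sup>2" using g R by simp
 have 7: "0 <= c * d * A + c * e * (\<phi>' - r * \<psi>)\<^sup>2 + c * R * \<phi>\<^sup>2" using c0 d e R A by simp
 have "mode_dens (c * d - P) (c * e) (- (g * R)) (c * R) r \<phi> \<phi>' \<psi> \<psi>'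
  = (c * d * A + c * e * (\<phi>' - r * \<psi>)\<^sup>2 + c * R * \<phi>\<^sup>2) - P * A + c * e * (A / 6) + c * e * (B + A / 6) + g * R * (r * \<phi> + \<psi>)\<^sup>2 - g * R * (r * \<phi>)\<^sup>2 - g * R * \<psi>\<^sup>2 + c * R * \<psi>\<^sup>2"
  unfolding A_def[symmetric] B_def[symmetric] by (simp add: power2_sum power_mult_distrib algebra_simps)
 then show ?thesis using 1 3 4 5 6 7 by linarith
qed

end

context cut_sol begin

definition "C2 K = K + 4 * surf p + 1"

text \<open>The positivity on modes is applied to the field \<open>\<theta> v\<close>, which is an admissible
  field on the box, and the weight \<open>\<theta>\<^sup>2\<close> is recovered up to cutoff errors.\<close>

lemma cut_qform_nonneg:
 fixes \<alpha> \<beta> \<gamma> \<kappa>' :: "side => real => real"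
 assumes t: "t \<ge> 0"
  and co: "\<And>s. continuous_on (ivl p s) (\<alpha> s)" "\<And>s. continuous_on (ivl p s) (\<beta> s)"
   "\<And>s. continuous_on (ivl p s) (\<gamma> s)" "\<And>s. continuous_on (ivl p s) (\<kappa>' s)"
  and nn: "\<And>s z. z \<in> (ivl p s) ==> \<beta> s z \<ge> 0" "\<And>s z. z \<in> (ivl p s) ==> \<kappa>' s z \<ge> 0"
  and K: "\<And>s z. z \<in> (ivl p s) ==> 18 * \<bar>\<alpha> s z\<bar> + 180 * \<bar>\<beta> s z\<bar> + 4 * \<bar>\<gamma> s z\<bar> <= K"
  and \<tau>: "0 <= \<tau>" "\<tau> <= surf p"
  and modes: "\<And>m k \<phi> \<phi>' \<psi> \<psi>'. vmode p \<phi> \<phi>' ==> vmode p \<psi> \<psi>' ==>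
   0 <= \<tau> * (cell_freq a b m k)\<^sup>2 * (\<psi> Upper 0)\<^sup>2 + (\<Sum>s\<in>sides. integral (ivl p s)
    (%z. mode_dens (\<alpha> s z) (\<beta> s z) (\<gamma> s z) (\<kappa>' s z) (cell_freq a b m k) (\<phi> s z) (\<phi>' s z) (\<psi> s z) (\<psi>' s z)))"
 shows "0 <= vol a b (%s x. (\<theta> x)\<^sup>2 * qform (\<alpha> s (x$3)) (\<beta> s (x$3)) (\<gamma> s (x$3)) (\<kappa>' s (x$3)) (v s t x) (Dv s t x)) + \<tau> * Ht t + C2 K * \<kappa> * Mt t"
proof -
 let ?V = "cutf (%s. v s t)" and ?D = "cutD (%s. v s t) (%s. Dv s t)"
 have tf: "test_field a b ?V ?D" by (rule test_field_cut[OF test_v[OF t]])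
 have F: "field_on a b ?V ?D" using tf lat(1)[OF t] unfolding test_field_def field_on_def by (simp add: cutf_def)
 have K0: "0 <= K" using K[of "zlo p Upper" Upper] zlo_less_zhi[of Upper] by simp
 have cc: "continuous_on (B s) (%x. f (x $ 3))" if "continuous_on (ivl p s) f" for f s by (rule continuous_on_third[OF that])
 have cV: "continuous_on (B s) (?V s)" "continuous_on (B s) (?D s)" for s using tf unfolding test_field_def by blast+
 have cv: "continuous_on (B s) (v s t)" "continuous_on (B s) (Dv s t)" for s by (rule jc[THEN tcont_slice, OF t])+
 have qc: "continuous_on (B s) (%x. qform (\<alpha> s (x$3)) (\<beta> s (x$3)) (\<gamma> s (x$3)) (\<kappa>' s (x$3)) (u x) (A x))" if "continuous_on (B s) u" "continuous_on (B s) A" for s u A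
  unfolding qform_def dev_energy_def
  by (intro continuous_on_add continuous_on_diff continuous_on_mult continuous_on_power continuous_on_component continuous_on_const cc co that)
 define q1 where "q1 s x = (\<theta> x)\<^sup>2 * qform (\<alpha> s (x$3)) (\<beta> s (x$3)) (\<gamma> s (x$3)) (\<kappa>' s (x$3)) (v s t x) (Dv s t x)" for s x
 have q1c: "continuous_on (B s) (q1 s)" for s unfolding q1_def by (intro continuous_on_mult continuous_on_power th_sub qc cv)
 have "vol a b (%s x. qform (\<alpha> s (x$3)) (\<beta> s (x$3)) (\<gamma> s (x$3)) (\<kappa>' s (x$3)) (?V s x) (?D s x)) <= vol a b (%s x. q1 s x + K * \<kappa> * Q s t x)"
 proof (rule vol_mono)
  fix s x assume x: "x \<in> B s"
  have "K * \<kappa> * ((norm (v s t x))\<^sup>2 + (norm (Dv s t x))\<^sup>2) <= K * \<kappa> * Q s t x"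
   by (rule mult_left_mono) (use K0 kap in \<open>simp_all add: Q_def\<close>)
  moreover have "(18 * \<bar>\<alpha> s (x$3)\<bar> + 180 * \<bar>\<beta> s (x$3)\<bar> + 4 * \<bar>\<gamma> s (x$3)\<bar>) * \<kappa> * ((norm (v s t x))\<^sup>2 + (norm (Dv s t x))\<^sup>2) <= K * \<kappa> * ((norm (v s t x))\<^sup>2 + (norm (Dv s t x))\<^sup>2)"
   by (intro mult_right_mono K slabbox_third[OF x] kap) simp
  moreover have "qform (\<alpha> s (x$3)) (\<beta> s (x$3)) (\<gamma> s (x$3)) (\<kappa>' s (x$3)) (?V s x) (?D s x) - q1 s x
    <= (18 * \<bar>\<alpha> s (x$3)\<bar> + 180 * \<bar>\<beta> s (x$3)\<bar> + 4 * \<bar>\<gamma> s (x$3)\<bar>) * \<kappa> * ((norm (v s t x))\<^sup>2 + (norm (Dv s t x))\<^sup>2)"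
   unfolding cutf_def cutD_def q1_def by (rule abs_le_D1[OF qform_cutoff[OF th_range kap gr_le]])
  ultimately show "qform (\<alpha> s (x$3)) (\<beta> s (x$3)) (\<gamma> s (x$3)) (\<kappa>' s (x$3)) (?V s x) (?D s x) <= q1 s x + K * \<kappa> * Q s t x" by linarith
 qed (intro allI qc cV continuous_on_add q1c continuous_on_mult[OF continuous_on_const] Q_slice t)+
 also have "\<dots> = vol a b q1 + K * \<kappa> * vol a b (%s. Q s t)"
  unfolding vol_cmult[symmetric] by (intro vol_add allI q1c continuous_on_mult[OF continuous_on_const] Q_slice t)
 finally have A: "vol a b (%s x. qform (\<alpha> s (x$3)) (\<beta> s (x$3)) (\<gamma> s (x$3)) (\<kappa>' s (x$3)) (?V s x) (?D s x)) <= vol a b q1 + K * \<kappa> * vol a b (%s. Q s t)" .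
 have cv3: "continuous_on (B Upper) (%x. (v Upper t x $ 3)\<^sup>2)" by (intro continuous_on_power continuous_on_component cv)
 have "ifc a b (%x. (?D Upper x $3$1)\<^sup>2 + (?D Upper x $3$2)\<^sup>2) <= ifc a b (%x. hd0 t x + \<kappa> * (hg t x + 4 * (v Upper t x $ 3)\<^sup>2))"
 proof (rule ifc_mono)
  fix x
  have one: "(\<theta> x * y + gr x $ j * z)\<^sup>2 <= (\<theta> x)\<^sup>2 * y\<^sup>2 + \<kappa> * (y\<^sup>2 + 2 * z\<^sup>2)" for j y z
  proof -
   have "\<bar>gr x $ j\<bar> * \<bar>gr x $ j\<bar> <= \<kappa> * 1" by (rule mult_mono) (use gr_le[of x j] kap in auto)
   then have "(gr x $ j)\<^sup>2 * z\<^sup>2 <= \<kappa> * z\<^sup>2" by (intro mult_right_mono) (simp_all add: power2_eq_square)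
   moreover have "(\<theta> x * y + gr x $ j * z)\<^sup>2 = (\<theta> x)\<^sup>2 * y\<^sup>2 + 2 * \<theta> x * gr x $ j * y * z + (gr x $ j)\<^sup>2 * z\<^sup>2"
    by (simp add: power2_sum power_mult_distrib)
   ultimately show ?thesis using cross_le(1)[OF th_range gr_le, of x x j y z] by (simp add: distrib_left)
  qed
  show "(?D Upper x $3$1)\<^sup>2 + (?D Upper x $3$2)\<^sup>2 <= hd0 t x + \<kappa> * (hg t x + 4 * (v Upper t x $ 3)\<^sup>2)"
   using one[of "Dv Upper t x $3$1" 1 "v Upper t x $ 3"] one[of "Dv Upper t x $3$2" 2 "v Upper t x $ 3"]
   unfolding cut_nth hd0_def hg_def by (simp add: distrib_left del: closed_slab.simps)
 qed (intro continuous_on_add continuous_on_power continuous_on_component continuous_on_mult[OF continuous_on_const] cV density_slice Q_slice t cv3)+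
 also have "\<dots> = Ht t + \<kappa> * (ifc a b (hg t) + 4 * ifc a b (%x. (v Upper t x $ 3)\<^sup>2))"
 proof -
  have "ifc a b (%x. hd0 t x + \<kappa> * (hg t x + 4 * (v Upper t x $ 3)\<^sup>2)) = ifc a b (hd0 t) + ifc a b (%x. \<kappa> * (hg t x + 4 * (v Upper t x $ 3)\<^sup>2))"
   by (intro ifc_add continuous_on_add continuous_on_mult[OF continuous_on_const] density_slice Q_slice t cv3)
  moreover have "ifc a b (%x. hg t x + 4 * (v Upper t x $ 3)\<^sup>2) = ifc a b (hg t) + ifc a b (%x. 4 * (v Upper t x $ 3)\<^sup>2)"
   by (intro ifc_add continuous_on_mult[OF continuous_on_const] Q_slice t cv3)
  ultimately show ?thesis by (simp only: ifc_cmult Ht_def)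
 qed
 also have "\<dots> <= Ht t + \<kappa> * (ifc a b (hg t) + 4 * vol a b (%s. Q s t))"
  using trace_Q(1)[OF t] kap by (intro add_left_mono mult_left_mono) auto
 finally have "\<tau> * ifc a b (%x. (?D Upper x $3$1)\<^sup>2 + (?D Upper x $3$2)\<^sup>2) <= \<tau> * (Ht t + \<kappa> * (ifc a b (hg t) + 4 * vol a b (%s. Q s t)))"
  by (rule mult_left_mono[OF _ \<tau>(1)])
 also have "\<dots> = \<tau> * Ht t + \<tau> * (\<kappa> * (ifc a b (hg t) + 4 * vol a b (%s. Q s t)))" by (rule distrib_left)
 also have "\<dots> <= \<tau> * Ht t + surf p * (\<kappa> * (ifc a b (hg t) + 4 * vol a b (%s. Q s t)))"
  using kap ifc_hg_nonneg[OF t] vol_Q_nonneg[OF t] by (intro add_left_mono mult_right_mono \<tau>) simp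
 finally have I: "\<tau> * ifc a b (%x. (?D Upper x $3$1)\<^sup>2 + (?D Upper x $3$2)\<^sup>2) <= \<tau> * Ht t + surf p * (\<kappa> * (ifc a b (hg t) + 4 * vol a b (%s. Q s t)))" .
 have "0 <= vol a b (%s x. qform (\<alpha> s (x$3)) (\<beta> s (x$3)) (\<gamma> s (x$3)) (\<kappa>' s (x$3)) (?V s x) (?D s x)) + \<tau> * ifc a b (%x. (?D Upper x $3$1)\<^sup>2 + (?D Upper x $3$2)\<^sup>2)"
  using qform_nonneg_from_modes[OF ab F co nn modes] unfolding vol_def ifc_def case_prod_unfold .
 also have "\<dots> <= vol a b q1 + K * \<kappa> * vol a b (%s. Q s t) + (\<tau> * Ht t + surf p * (\<kappa> * (ifc a b (hg t) + 4 * vol a b (%s. Q s t))))"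
  by (rule add_mono[OF A I])
 also have "\<dots> = vol a b q1 + \<tau> * Ht t + ((K + 4 * surf p) * \<kappa> * vol a b (%s. Q s t) + \<kappa> * (surf p * ifc a b (hg t)))" by (simp add: algebra_simps)
 also have "\<dots> <= vol a b q1 + \<tau> * Ht t + ((K + 4 * surf p) * \<kappa> * Mt t + \<kappa> * Mt t)"
  using vol_Q_le[OF t] K0 surf_nonneg kap by (intro add_mono order_refl mult_left_mono) auto
 finally show ?thesis unfolding q1_def C2_def by (simp add: algebra_simps)
qed

lemma coeff_signs: "z \<in> (ivl p s) ==> 0 < eps0 p s z" "z \<in> (ivl p s) ==> 0 <= del0 p s z" "z \<in> (ivl p s) ==> 0 < rho p s z"
 "z \<in> (ivl p s) ==> 0 < dpres p s z * rho p s z"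
 using eps0_pos del0_nonneg rho_pos dpres_pos by (auto intro: mult_pos_pos)

lemma qform_densities:
 "(\<theta> x)\<^sup>2 * qform (k * del0 p s (x$3) + r * (dpres p s (x$3) * rho p s (x$3))) (k * eps0 p s (x$3)) (r * (grav p * rho p s (x$3))) (l * rho p s (x$3)) (v s t x) (Dv s t x)
  = r * 2 * vd s t x + k * dd s t x + l * nd s t x"
proof -
 have n: "v s t x \<bullet> v s t x = (v s t x $ 1)\<^sup>2 + (v s t x $ 2)\<^sup>2 + (v s t x $ 3)\<^sup>2" by (simp add: inner_vec_def sum_3 power2_eq_square)
 have id: "h * ((k * d + r * P) * T + k * e * E - 2 * (r * G) * y * z + l * R * N) = r * 2 * (h * (1/2 * P * T - G * (y * z))) + k * (h * (e * E + d * T)) + l * (h * (R * N))" for h d P T e E G y z R N :: real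
  by (simp add: algebra_simps)
 show ?thesis unfolding qform_def vd_def dd_def nd_def stress_energy n tr_def by (rule id)
qed

lemma vol_densities:
 assumes t: "t \<ge> 0"
 shows "vol a b (%s x. r * 2 * vd s t x + k * dd s t x + l * nd s t x) = r * 2 * Vt t + k * Dt t + l * Nt t"
proof -
 have "vol a b (%s x. r * 2 * vd s t x + k * dd s t x + l * nd s t x) = vol a b (%s x. r * 2 * vd s t x + k * dd s t x) + vol a b (%s x. l * nd s t x)"
  by (intro vol_add allI continuous_on_add continuous_on_mult[OF continuous_on_const] density_slice t)
 also have "vol a b (%s x. r * 2 * vd s t x + k * dd s t x) = vol a b (%s x. r * 2 * vd s t x) + vol a b (%s x. k * dd s t x)"
  by (intro vol_add allI continuous_on_mult[OF continuous_on_const] density_slice t)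
 finally show ?thesis by (simp only: vol_cmult Vt_def Dt_def Nt_def)
qed

text \<open>The constants of \<open>qform_cutoff\<close> summed up.\<close>

lemma K_bound:
 assumes z: "z \<in> (ivl p s)" and k: "k \<ge> 0" and r: "\<bar>r\<bar> <= 1"
 shows "18 * \<bar>k * del0 p s z + r * (dpres p s z * rho p s z)\<bar> + 180 * \<bar>k * eps0 p s z\<bar> + 4 * \<bar>r * (grav p * rho p s z)\<bar> <= (198 * k + 18 + 4 * grav p) * c"
proof -
 have 1: "\<bar>k * del0 p s z\<bar> <= k * c" "\<bar>k * eps0 p s z\<bar> <= k * c"
  using mult_left_mono[OF cbound(4)[OF z] k] mult_left_mono[OF cbound(3)[OF z] k] k by (simp_all add: abs_mult)
 have 2: "\<bar>r * (dpres p s z * rho p s z)\<bar> <= 1 * c" unfolding abs_mult[of r] by (rule mult_mono[OF r cbound(2)[OF z]]) simp_all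
 have "\<bar>grav p * rho p s z\<bar> <= grav p * c" using mult_left_mono[OF cbound(1)[OF z], of "grav p"] g_pos by (simp add: abs_mult)
 then have 3: "\<bar>r * (grav p * rho p s z)\<bar> <= 1 * (grav p * c)" unfolding abs_mult[of r] by (intro mult_mono r) simp_all
 have "18 * \<bar>k * del0 p s z + r * (dpres p s z * rho p s z)\<bar> <= 18 * (k * c + c)" using abs_triangle_ineq[of "k * del0 p s z" "r * (dpres p s z * rho p s z)"] 1 2 by simp
 moreover have "(198 * k + 18 + 4 * grav p) * c = 18 * (k * c + c) + 180 * (k * c) + 4 * (grav p * c)" by (simp add: algebra_simps)
 moreover have "4 * \<bar>r * (grav p * rho p s z)\<bar> <= 4 * (grav p * c)" using 3 by simp
 ultimately show ?thesis using mult_left_mono[OF 1(2), of 180] by linarith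
qed

text \<open>The potential energy is bounded below with the growth rate, and above by the viscous form.\<close>

lemma potential_lower:
 assumes t: "t \<ge> 0" and L: "L > 0" and gr: "\<And>m k. 0 < cell_freq a b m k ==> ereal (cell_freq a b m k) < xi_c p ==> growth p (cell_freq a b m k) <= L"
 shows "0 <= 2 * Vt t + L * Dt t + L\<^sup>2 * Nt t + surf p * Ht t + C2 ((198 * L + 18 + 4 * grav p) * c) * \<kappa> * Mt t"
proof -
 have "0 <= vol a b (%s x. (\<theta> x)\<^sup>2 * qform (L * del0 p s (x$3) + 1 * (dpres p s (x$3) * rho p s (x$3))) (L * eps0 p s (x$3)) (1 * (grav p * rho p s (x$3))) (L\<^sup>2 * rho p s (x$3)) (v s t x) (Dv s t x))
  + surf p * Ht t + C2 ((198 * L + 18 + 4 * grav p) * c) * \<kappa> * Mt t"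
 proof (rule cut_qform_nonneg[OF t])
  fix m k \<phi> \<phi>' \<psi> \<psi>' assume vm: "vmode p \<phi> \<phi>'" "vmode p \<psi> \<psi>'"
  show "0 <= surf p * (cell_freq a b m k)\<^sup>2 * (\<psi> Upper 0)\<^sup>2 + (\<Sum>s\<in>sides. integral (ivl p s)
    (%z. mode_dens (L * del0 p s z + 1 * (dpres p s z * rho p s z)) (L * eps0 p s z) (1 * (grav p * rho p s z)) (L\<^sup>2 * rho p s z) (cell_freq a b m k) (\<phi> s z) (\<phi>' s z) (\<psi> s z) (\<psi>' s z)))"
  proof (rule order_trans[OF mode_energy_nonneg[OF cell_freq_nonneg L gr vm]])
   have id: "P * T - 2 * g * R * r * f * y + L * (d * T + e * E) + L\<^sup>2 * (R * N) = (L * d + 1 * P) * T + L * e * E - 2 * (1 * (g * R)) * r * f * y + L\<^sup>2 * R * N" for P T g R r f y d e E N :: real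
    by (simp add: algebra_simps)
   show "surf p * (cell_freq a b m k)\<^sup>2 * (\<psi> Upper 0)\<^sup>2 + (\<Sum>s\<in>sides. integral (ivl p s)
    (%x. dens0s (cell_freq a b m k) \<phi> \<psi> \<psi>' s x + L * dens1s (cell_freq a b m k) \<phi> \<phi>' \<psi> \<psi>' s x + L\<^sup>2 * (rho p s x * ((\<phi> s x)\<^sup>2 + (\<psi> s x)\<^sup>2))))
    <= surf p * (cell_freq a b m k)\<^sup>2 * (\<psi> Upper 0)\<^sup>2 + (\<Sum>s\<in>sides. integral (ivl p s)
    (%z. mode_dens (L * del0 p s z + 1 * (dpres p s z * rho p s z)) (L * eps0 p s z) (1 * (grav p * rho p s z)) (L\<^sup>2 * rho p s z) (cell_freq a b m k) (\<phi> s z) (\<phi>' s z) (\<psi> s z) (\<psi>' s z)))"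
    unfolding id by (rule order_refl)
  qed
 next
  fix s z assume z: "z \<in> (ivl p s)"
  show "18 * \<bar>L * del0 p s z + 1 * (dpres p s z * rho p s z)\<bar> + 180 * \<bar>L * eps0 p s z\<bar> + 4 * \<bar>1 * (grav p * rho p s z)\<bar> <= (198 * L + 18 + 4 * grav p) * c"
   by (rule K_bound[OF z]) (use L in simp_all)
  show "0 <= L * eps0 p s z" using coeff_signs(1)[OF z] L by simp
  show "0 <= L\<^sup>2 * rho p s z" using coeff_signs(3)[OF z] by simp
 qed (use surf_nonneg in \<open>intro continuous_on_add continuous_on_mult continuous_on_const coeff_cont order_refl | assumption\<close>)+
 then show ?thesis unfolding qform_densities vol_densities[OF t] by simp
qed

lemma potential_upper:
 assumes t: "t \<ge> 0" and k: "\<And>s z. z \<in> (ivl p s) ==> 6 * (dpres p s z * rho p s z) <= k * eps0 p s z" "\<And>s z. z \<in> (ivl p s) ==> 2 * grav p * rho p s z <= k * eps0 p s z" "grav p <= k"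
 shows "2 * Vt t <= k * Dt t + k * Nt t + C2 ((198 * k + 18 + 4 * grav p) * c) * \<kappa> * Mt t"
proof -
 have k0: "k > 0" using k(3) g_pos by simp
 have "0 <= vol a b (%s x. (\<theta> x)\<^sup>2 * qform (k * del0 p s (x$3) + - 1 * (dpres p s (x$3) * rho p s (x$3))) (k * eps0 p s (x$3)) (- 1 * (grav p * rho p s (x$3))) (k * rho p s (x$3)) (v s t x) (Dv s t x))
  + 0 * Ht t + C2 ((198 * k + 18 + 4 * grav p) * c) * \<kappa> * Mt t"
 proof (rule cut_qform_nonneg[OF t])
  fix m j \<phi> \<phi>' \<psi> \<psi>' assume vm: "vmode p \<phi> \<phi>'" "vmode p \<psi> \<psi>'"
  let ?f = "%s z. mode_dens (k * del0 p s z + - 1 * (dpres p s z * rho p s z)) (k * eps0 p s z) (- 1 * (grav p * rho p s z)) (k * rho p s z) (cell_freq a b m j) (\<phi> s z) (\<phi>' s z) (\<psi> s z) (\<psi>' s z)"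
  have "0 <= integral (ivl p s) (?f s)" for s
  proof (rule integral_nonneg)
   show "?f s integrable_on (ivl p s)"
    by (intro integrable_continuous_real continuous_on_add continuous_on_diff continuous_on_mult continuous_on_power continuous_on_const coeff_cont vmode_cont[OF vm(1)] vmode_cont[OF vm(2)])
   fix z assume z: "z \<in> (ivl p s)"
   have "0 <= mode_dens (k * del0 p s z - dpres p s z * rho p s z) (k * eps0 p s z) (- (grav p * rho p s z)) (k * rho p s z) (cell_freq a b m j) (\<phi> s z) (\<phi>' s z) (\<psi> s z) (\<psi>' s z)"
    by (rule viscous_mode_nonneg[OF coeff_signs(1)[OF z] coeff_signs(2)[OF z] less_imp_le[OF coeff_signs(4)[OF z]] coeff_signs(3)[OF z] g_pos k(1)[OF z] k(2)[OF z] k(3)])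
   then show "0 <= ?f s z" by simp
  qed
  then show "0 <= 0 * (cell_freq a b m j)\<^sup>2 * (\<psi> Upper 0)\<^sup>2 + (\<Sum>s\<in>sides. integral (ivl p s) (?f s))"
   by (simp only: mult_zero_left add_0) (rule sum_nonneg, assumption)
 next
  fix s z assume z: "z \<in> (ivl p s)"
  show "18 * \<bar>k * del0 p s z + - 1 * (dpres p s z * rho p s z)\<bar> + 180 * \<bar>k * eps0 p s z\<bar> + 4 * \<bar>- 1 * (grav p * rho p s z)\<bar> <= (198 * k + 18 + 4 * grav p) * c"
   by (rule K_bound[OF z]) (use k0 in simp_all)
  show "0 <= k * eps0 p s z" using coeff_signs(1)[OF z] k0 by simp
  show "0 <= k * rho p s z" using coeff_signs(3)[OF z] k0 by simp
 qed (use surf_nonneg in \<open>intro continuous_on_add continuous_on_mult continuous_on_const coeff_cont order_refl | assumption\<close>)+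
 then show ?thesis unfolding qform_densities vol_densities[OF t] by simp
qed

lemma energies_nonneg: "t \<ge> 0 ==> 0 <= Nt t" "t \<ge> 0 ==> 0 <= Dt t" "t \<ge> 0 ==> 0 <= St t" "t \<ge> 0 ==> 0 <= Ht t"
proof -
 assume t: "t \<ge> 0"
 have r: "0 <= rho p s (x $ 3)" if "x \<in> B s" for s x using coeff_signs(3)[OF slabbox_third[OF that]] by simp
 show "0 <= Nt t" unfolding Nt_def by (intro vol_nonneg allI density_slice t) (simp add: nd_def r)
 show "0 <= St t" unfolding St_def by (intro vol_nonneg allI density_slice t) (simp add: sd_def r)
 show "0 <= Dt t" unfolding Dt_def by (intro vol_nonneg allI density_slice t) (simp add: dd_def stress_nonneg[OF slabbox_third])
 show "0 <= Ht t" unfolding Ht_def by (intro ifc_nonneg density_slice t) (simp add: hd0_def)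
qed

lemma Gt_cont: "continuous_on {0..} Gt"
proof -
 have "continuous_on {0..} (%t. integral (B s) (gd s t))" for s
  unfolding box3_def
  by (rule integral_continuous_on_param) (use density_cont(7)[of s] in \<open>simp add: box3_def case_prod_unfold\<close>)
 then show ?thesis unfolding Gt_def[abs_def] vol_def by (intro continuous_on_sum)
qed

text \<open>The estimate on one box: the error terms of the cutoff carry the factor \<open>\<kappa>\<close>.\<close>

definition "C3 L k = C1 + C2 ((198 * L + 18 + 4 * grav p) * c) + C2 ((198 * k + 18 + 4 * grav p) * c)"

theorem box_estimate:
 assumes T: "T \<ge> 0" and L: "L > 0" and gr: "\<And>m k. 0 < cell_freq a b m k ==> ereal (cell_freq a b m k) < xi_c p ==> growth p (cell_freq a b m k) <= L"
  and k: "\<And>s z. z \<in> (ivl p s) ==> 6 * (dpres p s z * rho p s z) <= k * eps0 p s z" "\<And>s z. z \<in> (ivl p s) ==> 2 * grav p * rho p s z <= k * eps0 p s z" "grav p <= k"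
  and M: "\<And>t. 0 <= t ==> t <= T ==> Mt t <= M"
 shows "Nt T + Dt T + St T <= gronwall_const L * exp (2 * L * T) * (Nt 0 + Dt 0 +
  (1/2 * St 0 + k / 2 * (Nt 0 + Dt 0) + surf p / 2 * Ht 0 + (T + 1) * (C3 L k * \<kappa> * M)))"
proof -
 have M0: "M \<ge> 0" using M[of 0] vol_Q_le(3)[of 0] T by simp
 have k0: "k > 0" using k(3) g_pos by simp
 have C: "C1 \<ge> 0" "C2 ((198 * L + 18 + 4 * grav p) * c) \<ge> 0" "C2 ((198 * k + 18 + 4 * grav p) * c) \<ge> 0"
  using g_pos c_nonneg surf_nonneg L k0 by (simp_all add: C1_def C2_def)
 have C3: "C3 L k \<ge> 0" using C by (simp add: C3_def)
 define m where "m = C3 L k * \<kappa> * M"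
 have m0: "m \<ge> 0" using C3 M0 kap by (simp add: m_def)
 have mle: "C' * \<kappa> * Mt t <= m" if "0 <= C'" "C' <= C3 L k" "0 <= t" "t <= T" for C' t
 proof -
  have "C' * (\<kappa> * Mt t) <= C3 L k * (\<kappa> * M)" by (intro mult_mono that M mult_nonneg_nonneg kap vol_Q_le(3) C3) simp
  then show ?thesis by (simp add: m_def mult.assoc)
 qed
 have DERIV_sub: "(f has_real_derivative d) (at t within {0..}) ==> (f has_real_derivative d) (at t within {0..T})" for f d t
  by (erule DERIV_subset) auto
 note dv = vol_deriv[OF density_deriv(1) density_cont(1,2)] vol_deriv[OF density_deriv(2) density_cont(3,4)]
  vol_deriv[OF density_deriv(3) density_cont(5,6)] vol_deriv[OF density_deriv(4) density_cont(8,9)] ifc_deriv[OF hd_deriv density_cont(10,11)]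
 have dN: "(Nt has_real_derivative vol a b (%s. nd' s t)) (at t within {0..})" and dD: "(Dt has_real_derivative vol a b (%s. dd' s t)) (at t within {0..})"
  and dS: "(St has_real_derivative vol a b (%s. sd' s t)) (at t within {0..})" and dV: "(Vt has_real_derivative vol a b (%s. vd' s t)) (at t within {0..})"
  and dH: "(Ht has_real_derivative ifc a b (hd' t)) (at t within {0..})" if t: "t \<ge> 0" for t
  unfolding Nt_def[abs_def] Dt_def[abs_def] St_def[abs_def] Vt_def[abs_def] Ht_def[abs_def]
  by (rule dv; use t in simp)+
 have cG: "continuous_on {0..T} Gt" by (rule continuous_on_subset[OF Gt_cont]) auto
 have iG: "((%t. integral {0..t} Gt) has_real_derivative Gt t) (at t within {0..T})" if "0 <= t" "t <= T" for t
  unfolding has_real_derivative_iff_has_vector_derivative by (rule integral_has_vector_derivative[OF cG]) (use that in simp)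
 define Y where "Y t = 1/2 * St t + Vt t + surf p * (1/2 * Ht t) + integral {0..t} Gt - m * t" for t
 have energy: "Y t <= Y 0" if t: "0 <= t" "t <= T" for t
 proof (rule nonincreasing_within[OF t])
  fix t assume t: "0 <= t" "t <= T"
  show "(Y has_real_derivative 1/2 * vol a b (%s. sd' s t) + vol a b (%s. vd' s t) + surf p * (1/2 * ifc a b (hd' t)) + Gt t - m * 1) (at t within {0..T})"
   unfolding Y_def[abs_def]
   by (intro DERIV_diff DERIV_add DERIV_cmult DERIV_ident iG t DERIV_sub[OF dS[OF t(1)]] DERIV_sub[OF dV[OF t(1)]] DERIV_sub[OF dH[OF t(1)]])
 next
  fix t assume t: "0 < t" "t < T"
  show "1/2 * vol a b (%s. sd' s t) + vol a b (%s. vd' s t) + surf p * (1/2 * ifc a b (hd' t)) + Gt t - m * 1 <= 0"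
   using energy_derivative_le[OF t(1)] mle[OF C(1), of t] C t by (simp add: C3_def)
 qed
 define K where "K = 1/2 * St 0 + k / 2 * (Nt 0 + Dt 0) + surf p / 2 * Ht 0 + (T + 1) * m"
 have K0: "K \<ge> 0" unfolding K_def using energies_nonneg[of 0] k0 surf_nonneg T m0 by (intro add_nonneg_nonneg mult_nonneg_nonneg) auto
 have "Nt T + Dt T + St T <= gronwall_const L * exp (2 * L * T) * (Nt 0 + Dt 0 + K)"
 proof (rule energy_gronwall[OF L T order_refl, where G = Gt])
  fix t assume t: "0 <= t" "t <= T"
  show "(Nt has_real_derivative vol a b (%s. nd' s t)) (at t within {0..T})" by (rule DERIV_sub[OF dN[OF t(1)]])
  show "(Dt has_real_derivative vol a b (%s. dd' s t)) (at t within {0..T})" by (rule DERIV_sub[OF dD[OF t(1)]])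
  show "vol a b (%s. nd' s t) <= L * Nt t + St t / L"
  proof -
   have "vol a b (%s. nd' s t) <= vol a b (%s x. L * nd s t x + (1 / L) * sd s t x)"
   proof (rule vol_mono)
    fix s x assume x: "x \<in> B s"
    have "0 <= (L *\<^sub>R v s t x - w s t x) \<bullet> (L *\<^sub>R v s t x - w s t x) / L" using L by simp
    also have "\<dots> = L * (v s t x \<bullet> v s t x) + (1 / L) * (w s t x \<bullet> w s t x) - 2 * (v s t x \<bullet> w s t x)"
    proof -
     have 1: "(L *\<^sub>R X - Y) \<bullet> (L *\<^sub>R X - Y) = L * (L * (X \<bullet> X)) - 2 * L * (X \<bullet> Y) + Y \<bullet> Y" for X Y :: "real^3"
      by (simp add: inner_diff_left inner_diff_right inner_commute[of Y X] algebra_simps)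
     have 2: "(L * (L * r1) - 2 * L * r2 + r3) / L = L * r1 + (1 / L) * r3 - 2 * r2" for r1 r2 r3
      using L by (simp add: field_simps)
     show ?thesis unfolding 1 2 ..
    qed
    finally have y: "2 * (v s t x \<bullet> w s t x) <= L * (v s t x \<bullet> v s t x) + (1 / L) * (w s t x \<bullet> w s t x)" by simp
    have "(\<theta> x)\<^sup>2 * (rho p s (x $ 3) * (2 * (v s t x \<bullet> w s t x))) <= (\<theta> x)\<^sup>2 * (rho p s (x $ 3) * (L * (v s t x \<bullet> v s t x) + (1 / L) * (w s t x \<bullet> w s t x)))"
     by (intro mult_left_mono y less_imp_le[OF coeff_signs(3)[OF slabbox_third[OF x]]]) simp
    then show "nd' s t x <= L * nd s t x + (1 / L) * sd s t x" unfolding nd'_def nd_def sd_def by (simp only: distrib_left mult.left_commute[of _ L] mult.left_commute[of _ "1 / L"])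
   qed (intro allI continuous_on_add continuous_on_mult[OF continuous_on_const] density_slice t)+
   also have "\<dots> = L * Nt t + (1 / L) * St t" unfolding Nt_def St_def vol_cmult[symmetric]
    by (intro vol_add allI continuous_on_mult[OF continuous_on_const] density_slice t)
   finally show ?thesis by simp
  qed
  show "vol a b (%s. dd' s t) <= L * Dt t + Gt t / L"
  proof -
   have "vol a b (%s. dd' s t) <= vol a b (%s x. L * dd s t x + (1 / L) * gd s t x)"
   proof (rule vol_mono)
    fix s x assume x: "x \<in> B s"
    have "2 * (Dv s t x \<bullet> stressm s (x $ 3) (Dw s t x)) <= L * (Dv s t x \<bullet> stressm s (x $ 3) (Dv s t x)) + (1 / L) * (Dw s t x \<bullet> stressm s (x $ 3) (Dw s t x))"
     using stress_young[OF slabbox_third[OF x] L, of "Dw s t x" "Dv s t x"] unfolding stress_sym[of "Dw s t x" s _ "Dv s t x"] by simp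
    then have "(\<theta> x)\<^sup>2 * (2 * (Dv s t x \<bullet> stressm s (x $ 3) (Dw s t x))) <= (\<theta> x)\<^sup>2 * (L * (Dv s t x \<bullet> stressm s (x $ 3) (Dv s t x)) + (1 / L) * (Dw s t x \<bullet> stressm s (x $ 3) (Dw s t x)))"
     by (rule mult_left_mono) simp
    then show "dd' s t x <= L * dd s t x + (1 / L) * gd s t x" unfolding dd'_def dd_def gd_def by (simp only: distrib_left mult.left_commute[of _ L] mult.left_commute[of _ "1 / L"])
   qed (intro allI continuous_on_add continuous_on_mult[OF continuous_on_const] density_slice t)+
   also have "\<dots> = L * Dt t + (1 / L) * Gt t" unfolding Dt_def Gt_def vol_cmult[symmetric]
    by (intro vol_add allI continuous_on_mult[OF continuous_on_const] density_slice t)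
   finally show ?thesis by simp
  qed
  have lo: "0 <= 2 * Vt t + L * Dt t + L\<^sup>2 * Nt t + surf p * Ht t + m"
   using potential_lower[OF t(1) L gr] mle[OF C(2) _ t] C by (simp add: C3_def)
  have up: "2 * Vt 0 <= k * Dt 0 + k * Nt 0 + m"
   using potential_upper[OF order_refl k] mle[OF C(3) _ order_refl T] C by (simp add: C3_def)
  have "m * t <= m * T" using t m0 by (intro mult_left_mono)
  moreover have "(T + 1) * m = m * T + m" by (simp add: algebra_simps)
  moreover have "k / 2 * (Nt 0 + Dt 0) = (k * Dt 0 + k * Nt 0) / 2" by (simp add: algebra_simps)
  ultimately show "1/2 * St t + integral {0..t} Gt <= K + L\<^sup>2 / 2 * Nt t + L / 2 * Dt t"
   using energy[OF t] lo up unfolding Y_def K_def by (simp, linarith)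
 qed (use energies_nonneg K0 cG in auto)
 then show ?thesis unfolding K_def m_def .
qed

end


section \<open>Norms as integrals over boxes\<close>

lemma cutoff_integral_tendsto:
 fixes f :: "'a::euclidean_space => real"
 assumes f: "set_integrable lborel U f" and s: "\<And>n. set_integrable lborel (A n) (%x. ch n x * f x)" "\<And>n. A n \<subseteq> U"
  and r: "\<And>n x. 0 <= ch n x" "\<And>n x. ch n x <= 1" and e: "\<And>x. x \<in> U ==> \<forall>\<^sub>F n in sequentially. x \<in> A n"
  and c: "\<And>x. x \<in> U ==> (%n. ch n x) \<longlonglongrightarrow> 1"
 shows "(%n. LBINT x:A n. ch n x * f x) \<longlonglongrightarrow> (LBINT x:U. f x)"
 unfolding set_lebesgue_integral_def
proof (rule integral_dominated_convergence[where w="%x. norm (indicator U x *\<^sub>R f x)"])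
 show "(%x. indicat_real U x *\<^sub>R f x) \<in> borel_measurable lborel" "integrable lborel (%x. norm (indicat_real U x *\<^sub>R f x))"
  using f unfolding set_integrable_def by (rule borel_measurable_integrable integrable_norm)+
 show "(%x. indicat_real (A n) x *\<^sub>R (ch n x * f x)) \<in> borel_measurable lborel" for n
  using s(1)[of n] unfolding set_integrable_def by (rule borel_measurable_integrable)
 show "AE x in lborel. (%n. indicat_real (A n) x *\<^sub>R (ch n x * f x)) \<longlonglongrightarrow> indicat_real U x *\<^sub>R f x"
 proof (rule AE_I2)
  fix x :: 'a
  show "(%n. indicat_real (A n) x *\<^sub>R (ch n x * f x)) \<longlonglongrightarrow> indicat_real U x *\<^sub>R f x"
  proof (cases "x \<in> U")
   case True
   have "(%n. ch n x * f x) \<longlonglongrightarrow> 1 * f x" by (intro tendsto_mult c True tendsto_const)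
   then have "(%n. indicat_real (A n) x *\<^sub>R (ch n x * f x)) \<longlonglongrightarrow> 1 * f x"
    by (rule Lim_transform_eventually) (use e[OF True] in \<open>eventually_elim, simp\<close>)
   then show ?thesis using True by simp
  next
   case False
   then have "x \<notin> A n" for n using s(2) by blast
   then show ?thesis using False by simp
  qed
 qed
 show "AE x in lborel. norm (indicat_real (A n) x *\<^sub>R (ch n x * f x)) <= norm (indicat_real U x *\<^sub>R f x)" for n
 proof (rule AE_I2)
  fix x :: 'a
  have "\<bar>ch n x\<bar> * \<bar>f x\<bar> <= \<bar>f x\<bar>" using mult_right_mono[OF r(2)[of n x], of "\<bar>f x\<bar>"] r(1)[of n x] by simp
  then show "norm (indicat_real (A n) x *\<^sub>R (ch n x * f x)) <= norm (indicat_real U x *\<^sub>R f x)"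
   using s(2)[of n] by (auto simp: indicator_def abs_mult)
 qed
qed

context rt begin

lemma open_slab_borel: "open_slab p s \<in> sets borel"
proof -
 have "open_slab p s = {x. zlo p s < x $ 3} \<inter> {x. x $ 3 < zhi p s}" using mem_open_slab by auto
 then show ?thesis by (simp add: open_Int open_halfspace_component_gt_cart open_halfspace_component_lt_cart)
qed

text \<open>The open slab and the closed box differ by faces, a null set; Lebesgue and gauge integrals agree for
  continuous functions.\<close>

lemma box_part_integral:
 fixes f :: "real^3 => real"
 assumes f: "continuous_on (slabbox a b s) f"
 shows "set_integrable lborel (open_slab p s \<inter> slabbox a b s) f" "(LBINT x:open_slab p s \<inter> slabbox a b s. f x) = integral (slabbox a b s) f"
proof -
 have "set_integrable lborel (slabbox a b s) f"
  unfolding set_integrable_def by (rule borel_integrable_compact[OF compact_box3 f])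
 then show i: "set_integrable lborel (open_slab p s \<inter> slabbox a b s) f"
  by (rule set_integrable_subset) (simp_all add: sets.Int open_slab_borel borel_closed[OF compact_imp_closed[OF compact_box3]] del: zlo.simps zhi.simps)
 have "negligible (slabbox a b s - (open_slab p s \<inter> slabbox a b s))"
 proof (rule negligible_subset[OF negligible_frontier_interval])
  show "slabbox a b s - open_slab p s \<inter> slabbox a b s \<subseteq> cbox (pt3 (a,a,zlo p s)) (pt3 (b,b,zhi p s)) - box (pt3 (a,a,zlo p s)) (pt3 (b,b,zhi p s))"
  proof
   fix x assume x: "x \<in> slabbox a b s - open_slab p s \<inter> slabbox a b s"
   have 1: "x \<in> slabbox a b s" using x by (rule DiffD1)
   have "x \<notin> open_slab p s"
   proof
    assume "x \<in> open_slab p s"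
    then show False by (rule DiffD2[OF x IntI[OF _ 1]])
   qed
   with 1 show "x \<in> cbox (pt3 (a,a,zlo p s)) (pt3 (b,b,zhi p s)) - box (pt3 (a,a,zlo p s)) (pt3 (b,b,zhi p s))"
    by (simp add: box3_def mem_open_slab mem_box_cart forall_3)
  qed
 qed
 then have "integral (slabbox a b s) f = integral (open_slab p s \<inter> slabbox a b s) f"
  by (intro integral_spike_set) (auto elim: negligible_subset)
 then show "(LBINT x:open_slab p s \<inter> slabbox a b s. f x) = integral (slabbox a b s) f"
  using set_borel_integral_eq_integral(2)[OF i] by simp
qed

lemma box_part_le:
 fixes f :: "real^3 => real"
 assumes f: "continuous_on (slabbox a b s) f" and i: "set_integrable lborel (open_slab p s) f" and nn: "\<And>x. 0 <= f x"
 shows "integral (slabbox a b s) f <= (LBINT x:open_slab p s. f x)"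
 unfolding box_part_integral(2)[OF f, symmetric] set_lebesgue_integral_def
 by (rule integral_mono) (use i box_part_integral(1)[OF f] nn in \<open>auto simp: set_integrable_def indicator_def\<close>)

lemma slab_over_cell: "slab_over p (cell L) s = open_slab p s \<inter> slabbox 0 (2 * pi * L) s"
 by (auto simp: slab_over_def cell_def mem_box3 mem_open_slab)

lemma slab_over_UNIV: "slab_over p UNIV s = open_slab p s"
 by (simp add: slab_over_def)

lemma cell_hbox: "cell L = hbox 0 (2 * pi * L)"
 by (auto simp: cell_def mem_hbox)

lemma hgrad3_sq_eq: "hgrad3_sq p u X = (Dmat (cs Upper) (u Upper) (pt3 (fst X, snd X, 0)) $3$1)\<^sup>2 + (Dmat (cs Upper) (u Upper) (pt3 (fst X, snd X, 0)) $3$2)\<^sup>2"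
 by (simp add: hgrad3_sq_def Let_def Dmat_def pt3_def del: closed_slab.simps)

text \<open>The density of the second norm is the quadratic form of the viscous stress.\<close>

lemma dissipation_density:
 "eps0 p s z / 2 * (norm (dev_sym (cs s) u x))\<^sup>2 + del0 p s z * \<bar>divg (cs s) u x\<bar>\<^sup>2 = Dmat (cs s) u x \<bullet> stressm s z (Dmat (cs s) u x)"
proof -
 define A where "A = Dmat (cs s) u x"
 have n: "dev_sym (cs s) u x $ i $ j = A $ i $ j + A $ j $ i - 2/3 * (A$1$1 + A$2$2 + A$3$3) * (if i = j then 1 else 0)" for i j
  by (simp add: dev_sym_def A_def[symmetric] divg_trace trace3 transpose_def mat_def)
 have "(norm (dev_sym (cs s) u x))\<^sup>2 = 2 * dev_energy A"
  unfolding power2_norm_eq_inner inner_vec_def sum_3 n inner_real_def dev_energy_def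
  by (simp add: power2_eq_square field_simps)
 then show ?thesis unfolding stress_energy A_def[symmetric] by (simp add: divg_trace A_def[symmetric] trace3)
qed

lemma stress_le:
 assumes e: "\<bar>eps0 p s z\<bar> <= c" "\<bar>del0 p s z\<bar> <= c"
 shows "\<bar>A \<bullet> stressm s z A\<bar> <= 27 * c * (norm A)\<^sup>2"
proof -
 have sq: "x\<^sup>2 <= m\<^sup>2 * (norm A)\<^sup>2" if "\<bar>x\<bar> <= m * norm A" for x m :: real
  using power_mono[OF that abs_ge_zero, of 2] by (simp add: power_mult_distrib)
 have o: "(A $ i $ j + A $ j $ i)\<^sup>2 <= 4 * (norm A)\<^sup>2" for i j using sq[of "A $ i $ j + A $ j $ i" 2] entry_le(1)[of A i j] entry_le(1)[of A j i] by simp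
 have d: "(A $ i $ i)\<^sup>2 <= (norm A)\<^sup>2" for i using sq[of "A $ i $ i" 1] entry_le(1)[of A i i] by simp
 have t: "(A$1$1 + A$2$2 + A$3$3)\<^sup>2 <= 3\<^sup>2 * (norm A)\<^sup>2" by (rule sq) (use entry_le(1)[of A 1 1] entry_le(1)[of A 2 2] entry_le(1)[of A 3 3] in linarith)
 have "dev_energy A <= 18 * (norm A)\<^sup>2"
 proof -
  have "x1 + x2 + x3 + 2 * (y1 + y2 + y3) - 2/3 * r <= 18 * n" if "x1 <= 4 * n" "x2 <= 4 * n" "x3 <= 4 * n" "y1 <= n" "y2 <= n" "y3 <= n" "0 <= r" for x1 x2 x3 y1 y2 y3 r n :: real
   using that by simp
  from this[OF o o o d d d zero_le_power2] show ?thesis unfolding dev_energy_def .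
 qed
 then have "\<bar>eps0 p s z\<bar> * \<bar>dev_energy A\<bar> <= c * (18 * (norm A)\<^sup>2)" using dev_energy_nonneg[of A] e by (intro mult_mono) auto
 moreover have "\<bar>del0 p s z\<bar> * \<bar>(A$1$1 + A$2$2 + A$3$3)\<^sup>2\<bar> <= c * (9 * (norm A)\<^sup>2)" using t e by (intro mult_mono) auto
 ultimately show ?thesis unfolding stress_energy abs_mult[symmetric]
  using abs_triangle_ineq[of "eps0 p s z * dev_energy A" "del0 p s z * (A$1$1 + A$2$2 + A$3$3)\<^sup>2"] by linarith
qed

lemma coeff_uniform_bound:
 assumes c: "\<And>s. continuous_on (ivl p s) (f s)"
 shows "\<exists>b>0. \<forall>s. \<forall>z\<in>(ivl p s). \<bar>f s z :: real\<bar> <= b"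
proof -
 have "\<exists>b>0. \<forall>z\<in>(ivl p s). \<bar>f s z\<bar> + 1 <= b" for s
  by (rule pos_bounds(2)) (intro continuous_on_add continuous_on_rabs continuous_on_const c, linarith)
 then obtain b where b: "\<And>s. b s > 0" "\<And>s z. z \<in> (ivl p s) ==> \<bar>f s z\<bar> + 1 <= b s" by metis
 show ?thesis
 proof (intro exI[of _ "b Lower + b Upper"] conjI allI ballI)
  show "0 < b Lower + b Upper" using b(1)[of Lower] b(1)[of Upper] by linarith
  fix s z assume "z \<in> (ivl p s)"
  then show "\<bar>f s z\<bar> <= b Lower + b Upper" using b(2)[of z s] b(1)[of Lower] b(1)[of Upper] by (cases s) fastforce+
 qed
qed

text \<open>The constants depend on the parameters only, in particular not on the box.\<close>

lemma coeff_constants: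
 obtains c k where "\<And>s z. z \<in> (ivl p s) ==> \<bar>rho p s z\<bar> <= c" "\<And>s z. z \<in> (ivl p s) ==> \<bar>dpres p s z * rho p s z\<bar> <= c"
   "\<And>s z. z \<in> (ivl p s) ==> \<bar>eps0 p s z\<bar> <= c" "\<And>s z. z \<in> (ivl p s) ==> \<bar>del0 p s z\<bar> <= c"
   "\<And>s z. z \<in> (ivl p s) ==> 6 * (dpres p s z * rho p s z) <= k * eps0 p s z" "\<And>s z. z \<in> (ivl p s) ==> 2 * grav p * rho p s z <= k * eps0 p s z" "grav p <= k" "0 < c"
proof -
 obtain c1 where c1: "c1 > 0" "\<And>s z. z \<in> (ivl p s) ==> \<bar>rho p s z\<bar> <= c1" using coeff_uniform_bound[OF coeff_cont(1)] by metis
 obtain c2 where c2: "c2 > 0" "\<And>s z. z \<in> (ivl p s) ==> \<bar>dpres p s z * rho p s z\<bar> <= c2" using coeff_uniform_bound[OF continuous_on_mult[OF coeff_cont(2,1)]] by metis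
 obtain c3 where c3: "c3 > 0" "\<And>s z. z \<in> (ivl p s) ==> \<bar>eps0 p s z\<bar> <= c3" using coeff_uniform_bound[OF coeff_cont(3)] by metis
 obtain c4 where c4: "c4 > 0" "\<And>s z. z \<in> (ivl p s) ==> \<bar>del0 p s z\<bar> <= c4" using coeff_uniform_bound[OF coeff_cont(4)] by metis
 have nz: "eps0 p s z \<noteq> 0" if "z \<in> (ivl p s)" for s z using eps0_pos[OF that] by simp
 have ci: "continuous_on (ivl p s) (%z. 1 / eps0 p s z)" for s
  by (intro continuous_on_divide continuous_on_const coeff_cont(3) ballI nz)
 obtain d where d: "d > 0" "\<And>s z. z \<in> (ivl p s) ==> \<bar>1 / eps0 p s z\<bar> <= d" using coeff_uniform_bound[OF ci] by metis
 have de: "1 <= d * eps0 p s z" if "z \<in> (ivl p s)" for s z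
  using d(2)[OF that] eps0_pos[OF that] by (simp add: field_simps)
 define k where "k = (6 * c2 + 2 * grav p * c1) * d + grav p"
 have k: "6 * c2 + 2 * grav p * c1 <= k * eps0 p s z" if z: "z \<in> (ivl p s)" for s z
 proof -
  have 1: "6 * c2 + 2 * grav p * c1 <= (6 * c2 + 2 * grav p * c1) * (d * eps0 p s z)"
   using mult_left_mono[OF de[OF z], of "6 * c2 + 2 * grav p * c1"] c1 c2 g_pos by simp
  have 2: "0 <= grav p * eps0 p s z" using g_pos eps0_pos[OF z] by simp
  have 3: "k * eps0 p s z = (6 * c2 + 2 * grav p * c1) * (d * eps0 p s z) + grav p * eps0 p s z" by (simp add: k_def algebra_simps)
  show ?thesis unfolding 3 by (rule order_trans[OF 1]) (simp add: 2)
 qed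
 show thesis
 proof (rule that[of "c1 + c2 + c3 + c4" k])
  fix s z assume z: "z \<in> (ivl p s)"
  have gr: "grav p * rho p s z <= grav p * c1" using c1(2)[OF z] g_pos by (intro mult_left_mono) auto
  have gc: "0 <= grav p * c1" using g_pos c1 by simp
  show "\<bar>rho p s z\<bar> <= c1 + c2 + c3 + c4" using c1(2)[OF z] c1 c2 c3 c4 by linarith
  show "\<bar>dpres p s z * rho p s z\<bar> <= c1 + c2 + c3 + c4" using c2(2)[OF z] c1 c2 c3 c4 by linarith
  show "\<bar>eps0 p s z\<bar> <= c1 + c2 + c3 + c4" using c3(2)[OF z] c1 c2 c3 c4 by linarith
  show "\<bar>del0 p s z\<bar> <= c1 + c2 + c3 + c4" using c4(2)[OF z] c1 c2 c3 c4 by linarith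
  show "6 * (dpres p s z * rho p s z) <= k * eps0 p s z" using k[OF z] c2(2)[OF z] gc by linarith
  show "2 * grav p * rho p s z <= k * eps0 p s z" using k[OF z] gr c2(1) by linarith
 qed (use c1 c2 c3 c4 d g_pos in \<open>auto simp: k_def\<close>)
qed

end

section \<open>Periodic solutions\<close>

context lin_sol begin

lemma dt_periodic:
 assumes F: "time_diff (cs s) F" and per: "\<And>t x. t \<ge> 0 ==> x \<in> cs s ==> F t (x + h) = F t x"
  and x: "x \<in> cs s" "x + h \<in> cs s" and t: "t \<ge> 0"
 shows "dt F t (x + h) = (dt F t x :: real^3)"
proof -
 have "dt F t (x + h) - dt F t x = 0"
  by (rule dt_unique[OF has_vector_derivative_diff[OF time_diff_dt[OF F t x(2)] time_diff_dt[OF F t x(1)]] _ t]) (simp add: per x)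
 then show ?thesis by simp
qed

text \<open>Both the derivative and its translate are derivatives of the same function.\<close>

lemma Dmat_periodic:
 fixes F :: "real => real^3 => real^3"
 assumes F: "Creg (cs s) (Suc n) F" and t: "t \<ge> 0" and per: "\<And>x. x \<in> cs s ==> F t (x + h) = F t x"
  and h: "h $ 3 = 0" and x: "x \<in> cs s"
 shows "Dmat (cs s) (F t) (x + h) = Dmat (cs s) (F t) x"
 unfolding vec_eq_iff
proof (intro allI)
 fix i j
 have sh: "y + h \<in> cs s \<longleftrightarrow> y \<in> cs s" for y by (simp add: mem_cs h)
 have D: "has_pd (cs s) j (%y. F t y $ i) (%y. Dmat (cs s) (F t) y $ i $ j)" by (rule Dmat_has_pd[OF F t])
 have "has_pd (cs s) j (%y. F t (y + h) $ i) (%y. Dmat (cs s) (F t) (y + h) $ i $ j)"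
  unfolding has_pd_def
 proof
  fix y assume y: "y \<in> cs s"
  have dom: "pd_dom (cs s) j (y + h) = pd_dom (cs s) j y" by (simp only: pd_dom_cs sh) (simp add: h)
  have "((%r. F t (y + h + r *\<^sub>R axis j 1) $ i) has_vector_derivative Dmat (cs s) (F t) (y + h) $ i $ j) (at 0 within pd_dom (cs s) j (y + h))"
   using D y unfolding has_pd_def sh[symmetric, of y] by blast
  then show "((%r. F t (y + r *\<^sub>R axis j 1 + h) $ i) has_vector_derivative Dmat (cs s) (F t) (y + h) $ i $ j) (at 0 within pd_dom (cs s) j y)"
   unfolding dom by (simp only: add.assoc add.commute[of h])
 qed
 then have "has_pd (cs s) j (%y. F t y $ i) (%y. Dmat (cs s) (F t) (y + h) $ i $ j)"
  by (rule has_pd_cong) (simp add: per)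
 then show "Dmat (cs s) (F t) (x + h) $ i $ j = Dmat (cs s) (F t) x $ i $ j" by (rule has_pd_unique[OF _ D x])
qed

lemma faces_match_periodic:
 assumes f: "\<And>x i. x \<in> cs s ==> i \<in> {1,2} ==> f (x + l *\<^sub>R axis i 1) = f x" and z: "z \<in> (ivl p s)"
 shows "faces_match 0 l z f"
proof -
 have m: "pt3 (x,y,z) \<in> cs s" for x y unfolding mem_cs using z by simp
 have "f (pt3 (l,r,z)) = f (pt3 (0,r,z))" "f (pt3 (r,l,z)) = f (pt3 (r,0,z))" for r
  using f[OF m, of 1 0 r] f[OF m, of 2 r 0] by (simp_all add: pt3_axis)
 then show ?thesis unfolding faces_match_def by blast
qed

end


context rt begin

lemma plane_continuous: "continuous_on (slabbox a b Upper) f ==> continuous_on (hbox a b) (%X. f (pt3 (fst X, snd X, 0)) :: real)"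
 by (rule continuous_on_compose2[where f="%X. pt3 (fst X, snd X, 0)"], assumption)
  (intro continuous_on_pt3 continuous_on_Pair continuous_on_fst continuous_on_snd continuous_on_id continuous_on_const, intro image_subsetI plane_in)

lemma hbox_integral:
 assumes "continuous_on (slabbox a b Upper) f"
 shows "set_integrable lborel (hbox a b) (%X. f (pt3 (fst X, snd X, 0)) :: real)" "(LBINT X:hbox a b. f (pt3 (fst X, snd X, 0))) = ifc a b f"
proof -
 show i: "set_integrable lborel (hbox a b) (%X. f (pt3 (fst X, snd X, 0)) :: real)"
  unfolding set_integrable_def by (rule borel_integrable_compact[OF _ plane_continuous[OF assms]]) (simp add: hbox_def)
 show "(LBINT X:hbox a b. f (pt3 (fst X, snd X, 0))) = ifc a b f" using set_borel_integral_eq_integral(2)[OF i] by (simp add: ifc_def)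
qed

end

context cut_sol begin

lemma Mt_bounded: "\<exists>M. \<forall>t\<in>{0..T}. Mt t <= M"
proof (cases "T < 0")
 case False
 have "continuous_on {0..} (%t. integral (B s) (Q s t))" for s
  unfolding box3_def
  by (rule integral_continuous_on_param) (use Q_cont(1)[of s] in \<open>simp add: box3_def case_prod_unfold\<close>)
 then have 1: "continuous_on {0..} (%t. vol a b (%s. Q s t))" unfolding vol_def by (intro continuous_on_sum)
 have 2: "continuous_on {0..} (%t. ifc a b (hg t))"
  unfolding ifc_def hbox_def
 proof (rule integral_continuous_on_param)
  have "continuous_on ({0..} \<times> hbox a b) (%Y. hg (fst (fst Y, pt3 (fst (snd Y), snd (snd Y), 0))) (snd (fst Y, pt3 (fst (snd Y), snd (snd Y), 0))))"
   by (rule continuous_on_compose2[OF Q_cont(2)])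
    (intro continuous_on_pt3 continuous_on_Pair continuous_on_fst continuous_on_snd continuous_on_id continuous_on_const, use plane_in in \<open>force simp del: zlo.simps zhi.simps\<close>)
  then show "continuous_on ({0..} \<times> cbox (a,a) (b,b)) (%(t, X). hg t (pt3 (fst X, snd X, 0)))"
   by (simp add: hbox_def case_prod_unfold)
 qed
 have "continuous_on {0..T} Mt" unfolding Mt_def[abs_def]
  by (rule continuous_on_subset[of "{0..}"]) (intro continuous_on_add continuous_on_mult[OF continuous_on_const] 1 2, auto)
 then show ?thesis using continuous_attains_sup[of "{0..T}" Mt] False by (metis compact_Icc atLeastatMost_empty_iff2 not_less)
qed auto

end

context lin_sol begin

text \<open>The cutoff is constant on a period cell, and the frequencies of the cell are those in the supremum.\<close>

lemma periodic_estimate: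
 assumes L: "L > 0" and per: "periodic_field p L \<eta>" "periodic_field p L v" "periodic_field p L q"
  and cb: "\<And>s z. z \<in> (ivl p s) ==> \<bar>rho p s z\<bar> <= c" "\<And>s z. z \<in> (ivl p s) ==> \<bar>dpres p s z * rho p s z\<bar> <= c"
   "\<And>s z. z \<in> (ivl p s) ==> \<bar>eps0 p s z\<bar> <= c" "\<And>s z. z \<in> (ivl p s) ==> \<bar>del0 p s z\<bar> <= c"
  and k: "\<And>s z. z \<in> (ivl p s) ==> 6 * (dpres p s z * rho p s z) <= k * eps0 p s z" "\<And>s z. z \<in> (ivl p s) ==> 2 * grav p * rho p s z <= k * eps0 p s z" "grav p <= k"
  and lam: "lam > 0" and gr: "\<And>a b :: int. 0 < norm (of_int a / L, of_int b / L) ==> ereal (norm (of_int a / L, of_int b / L)) < xi_c p ==> growth p (norm (of_int a / L, of_int b / L)) <= lam"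
 shows "growth_estimate p (cell L) (gronwall_const lam * (1 + k)) lam v"
proof -
 let ?b = "2 * pi * L"
 have k0: "k > 0" using k(3) g_pos by simp
 have pv: "v s t (x + ?b *\<^sub>R axis i 1) = v s t x" and pe: "\<eta> s t (x + ?b *\<^sub>R axis i 1) = \<eta> s t x" and pq: "q s t (x + ?b *\<^sub>R axis i 1) = q s t x"
  if "t \<ge> 0" "x \<in> cs s" "i \<in> {1,2}" for s t x i
  using per that unfolding periodic_field_def by blast+
 have h3: "(?b *\<^sub>R axis i 1 :: real^3) $ 3 = 0" if "i \<in> {1,2}" for i using that by (auto simp: axis_def)
 have sh: "x + ?b *\<^sub>R axis i 1 \<in> cs s" if "x \<in> cs s" "i \<in> {1,2}" for x s i
  using that(1) unfolding mem_cs vector_add_component h3[OF that(2)] by simp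
 have pw: "w s t (x + ?b *\<^sub>R axis i 1) = w s t x" if "t \<ge> 0" "x \<in> cs s" "i \<in> {1,2}" for s t x i
  by (rule dt_periodic[OF td(2) pv[OF _ _ that(3)] that(2) sh[OF that(2,3)] that(1)])
 have pDv: "Dv s t (x + ?b *\<^sub>R axis i 1) = Dv s t x" if "t \<ge> 0" "x \<in> cs s" "i \<in> {1,2}" for s t x i
 proof (rule Dmat_periodic[where F="v s" and h="?b *\<^sub>R axis i 1" and t=t and s=s and x=x, OF cr(3) that(1) _ h3[OF that(3)] that(2)])
  fix x assume "x \<in> cs s"
  then show "v s t (x + ?b *\<^sub>R axis i 1) = v s t x" by (rule pv[OF that(1) _ that(3)])
 qed
 have pDe: "Deta s t (x + ?b *\<^sub>R axis i 1) = Deta s t x" if "t \<ge> 0" "x \<in> cs s" "i \<in> {1,2}" for s t x i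
 proof (rule Dmat_periodic[where F="\<eta> s" and h="?b *\<^sub>R axis i 1" and t=t and s=s and x=x, OF cr(1) that(1) _ h3[OF that(3)] that(2)])
  fix x assume "x \<in> cs s"
  then show "\<eta> s t (x + ?b *\<^sub>R axis i 1) = \<eta> s t x" by (rule pe[OF that(1) _ that(3)])
 qed
 have pT: "Tm s t (x + ?b *\<^sub>R axis i 1) = Tm s t x" if "t \<ge> 0" "x \<in> cs s" "i \<in> {1,2}" for s t x i
  unfolding Tm_def pDv[OF that] pq[OF that] by (simp only: vector_add_component h3[OF that(3)] add_0_right)
 interpret P: cut_sol p \<eta> v q 0 ?b 0 c "%x. 1" "%x. 0"
 proof unfold_locales
  show "has_pd UNIV j (%x. 1) (%x. (0 :: real^3) $ j)" for j using has_pd_const[of UNIV j "1::real"] by simp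
  fix s t z assume t: "(t::real) \<ge> 0" and z: "z \<in> (ivl p s)"
  show "faces_match 0 ?b z (%x. 1 *\<^sub>R v s t x)" by (rule faces_match_periodic[OF _ z]) (simp only: pv[OF t])
  show "faces_match 0 ?b z (%x. 1 *\<^sub>R w s t x)" by (rule faces_match_periodic[OF _ z]) (simp only: pw[OF t])
  show "faces_match 0 ?b z (%x. 1 *\<^sub>R Tm s t x)" by (rule faces_match_periodic[OF _ z]) (simp only: pT[OF t])
  show "faces_match 0 ?b z (%x. 1 *\<^sub>R Deta s t x)" by (rule faces_match_periodic[OF _ z]) (simp only: pDe[OF t])
 qed (use L cb in simp_all)
 have cell: "(LBINT x:slab_over p (cell L) s. f x) = integral (slabbox 0 ?b s) f" if "continuous_on (slabbox 0 ?b s) f" for s and f :: "real^3 => real"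
  unfolding slab_over_cell by (rule box_part_integral(2)[OF that])
 have nd: "P.nd s t = (%x. rho p s (x $ 3) * (norm (v s t x))\<^sup>2)" and sd: "P.sd s t = (%x. rho p s (x $ 3) * (norm (w s t x))\<^sup>2)"
  and dd: "P.dd s t = (%x. eps0 p s (x $ 3) / 2 * (norm (dev_sym (cs s) (v s t) x))\<^sup>2 + del0 p s (x $ 3) * \<bar>divg (cs s) (v s t) x\<bar>\<^sup>2)" for s t
  unfolding P.nd_def P.sd_def P.dd_def dissipation_density by (simp_all add: power2_norm_eq_inner fun_eq_iff)
 have N: "norm1_sq p (cell L) (%s. v s t) = P.Nt t" and S: "norm1_sq p (cell L) (%s. w s t) = P.St t" and D: "norm2_sq p (cell L) (%s. v s t) = P.Dt t" if t: "t \<ge> 0" for t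
  unfolding norm1_sq_def norm2_sq_def P.Nt_def P.St_def P.Dt_def vol_def nd[symmetric] sd[symmetric] dd[symmetric]
  by (intro sum.cong refl cell P.density_slice t)+
 have H: "interface_int p (cell L) (%s. v s 0) = P.Ht 0"
 proof -
  have "hgrad3_sq p (%s. v s 0) = (%X. P.hd0 0 (pt3 (fst X, snd X, 0)))" by (simp add: fun_eq_iff hgrad3_sq_eq P.hd0_def del: closed_slab.simps)
  then show ?thesis unfolding interface_int_def cell_hbox P.Ht_def by (simp only: hbox_integral(2)[OF P.density_slice(10)[OF order_refl]])
 qed
 have freq: "cell_freq 0 ?b m j = norm (of_int m / L :: real, of_int j / L :: real)" for m j
  using L by (simp add: cell_freq_def norm_Pair field_simps)
 show ?thesis unfolding growth_estimate_def
 proof (intro allI impI)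
  fix T :: real assume T: "T \<ge> 0"
  obtain M where M: "\<forall>t\<in>{0..T}. P.Mt t <= M" using P.Mt_bounded by blast
  have "P.Nt T + P.Dt T + P.St T <= gronwall_const lam * exp (2 * lam * T) * (P.Nt 0 + P.Dt 0 +
   (1/2 * P.St 0 + k / 2 * (P.Nt 0 + P.Dt 0) + surf p / 2 * P.Ht 0 + (T + 1) * (P.C3 lam k * 0 * M)))"
   by (rule P.box_estimate[OF T lam _ k]) (use gr M in \<open>simp_all add: freq\<close>)
  also have "\<dots> <= gronwall_const lam * exp (2 * lam * T) * ((1 + k) * (P.St 0 + P.Nt 0 + P.Dt 0 + surf p * P.Ht 0))"
  proof (rule mult_left_mono)
   have "0 <= (1/2 + k) * P.St 0 + k / 2 * (P.Nt 0 + P.Dt 0) + (1/2 + k) * (surf p * P.Ht 0)"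
    using P.energies_nonneg[of 0] k0 surf_nonneg by (intro add_nonneg_nonneg mult_nonneg_nonneg) auto
   then show "P.Nt 0 + P.Dt 0 + (1/2 * P.St 0 + k / 2 * (P.Nt 0 + P.Dt 0) + surf p / 2 * P.Ht 0 + (T + 1) * (P.C3 lam k * 0 * M)) <= (1 + k) * (P.St 0 + P.Nt 0 + P.Dt 0 + surf p * P.Ht 0)"
    by (simp add: algebra_simps)
  qed (use gronwall_const_pos[OF lam] in simp)
  finally show "norm1_sq p (cell L) (%s. v s T) + norm2_sq p (cell L) (%s. v s T) + norm1_sq p (cell L) (%s. w s T) <= gronwall_const lam * (1 + k) * exp (2 * lam * T) *
   (norm1_sq p (cell L) (%s. w s 0) + norm1_sq p (cell L) (%s. v s 0) + norm2_sq p (cell L) (%s. v s 0) + surf p * interface_int p (cell L) (%s. v s 0))"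
   unfolding N[OF T] N[OF order_refl] D[OF T] D[OF order_refl] S[OF T] S[OF order_refl] H by (simp only: mult_ac)
 qed
qed

end


section \<open>Decaying solutions\<close>

text \<open>A cutoff that is smooth on the whole plane, has values in the unit interval, and vanishes on the
  lateral faces of the box of half width \<open>R\<close>. Its gradient is at most \<open>2 /
  R\<close>.\<close>

definition coscut :: "real => real^3 => real" where
 "coscut R x = (1 + cos (pi / R * x$1)) / 2 * ((1 + cos (pi / R * x$2)) / 2)"

definition cosgrad :: "real => real^3 => real^3" where
 "cosgrad R x = (- (pi / R * sin (pi / R * x$1)) / 2 * ((1 + cos (pi / R * x$2)) / 2)) *\<^sub>R axis 1 1
  + (- (pi / R * sin (pi / R * x$2)) / 2 * ((1 + cos (pi / R * x$1)) / 2)) *\<^sub>R axis 2 1"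

lemma cosgrad_nth: "cosgrad R x $ 1 = - (pi / R * sin (pi / R * x$1)) / 2 * ((1 + cos (pi / R * x$2)) / 2)"
 "cosgrad R x $ 2 = - (pi / R * sin (pi / R * x$2)) / 2 * ((1 + cos (pi / R * x$1)) / 2)" "cosgrad R x $ 3 = 0"
 by (simp_all add: cosgrad_def axis_def)

lemma coscut_pd: "has_pd UNIV j (coscut R) (%x. cosgrad R x $ j)"
 unfolding has_pd_def
proof
 fix x :: "real^3"
 have d: "((%r. (1 + cos (k * (u + r))) / 2 * c) has_vector_derivative - (k * sin (k * u)) / 2 * c) (at 0)" for k u c :: real
  unfolding has_real_derivative_iff_has_vector_derivative[symmetric] by (auto intro!: derivative_eq_intros)
 have dom: "pd_dom UNIV j x = UNIV" by (simp add: pd_dom_def)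
 consider "j = 1" | "j = 2" | "j = 3" using exhaust_3 by blast
 then show "((%r. coscut R (x + r *\<^sub>R axis j 1)) has_vector_derivative cosgrad R x $ j) (at 0 within pd_dom UNIV j x)"
 proof cases
  case 1
  have "coscut R (x + r *\<^sub>R axis j 1) = (1 + cos (pi / R * (x$1 + r))) / 2 * ((1 + cos (pi / R * x$2)) / 2)" for r
   by (simp add: coscut_def 1 axis_def)
  then show ?thesis unfolding dom using d[of "pi / R" "x$1" "(1 + cos (pi / R * x$2)) / 2"] by (simp only: cosgrad_nth 1)
 next
  case 2
  have "coscut R (x + r *\<^sub>R axis j 1) = (1 + cos (pi / R * (x$2 + r))) / 2 * ((1 + cos (pi / R * x$1)) / 2)" for r
   by (simp add: coscut_def 2 axis_def)
  then show ?thesis unfolding dom using d[of "pi / R" "x$2" "(1 + cos (pi / R * x$1)) / 2"] by (simp only: cosgrad_nth 2)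
 next
  case 3
  have "coscut R (x + r *\<^sub>R axis j 1) = coscut R x" for r by (simp add: coscut_def 3 axis_def)
  then show ?thesis by (simp only: cosgrad_nth 3 has_vector_derivative_const)
 qed
qed

lemma half_cos: "0 <= (1 + cos y) / 2" "(1 + cos y) / 2 <= (1::real)"
proof -
 have "0 <= 1 + cos y" "1 + cos y <= 2" using cos_ge_minus_one[of y] cos_le_one[of y] by linarith+
 then show "0 <= (1 + cos y) / 2" "(1 + cos y) / 2 <= 1" by simp_all
qed

lemma coscut_range: "0 <= coscut R x" "coscut R x <= 1"
 unfolding coscut_def by (rule mult_nonneg_nonneg[OF half_cos(1) half_cos(1)] mult_le_one[OF half_cos(2) half_cos(1) half_cos(2)])+

lemma cosgrad_le:
 assumes R: "R > 0" shows "\<bar>cosgrad R x $ j\<bar> <= 2 / R"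
proof -
 have b: "\<bar>- (pi / R * sin u) / 2 * ((1 + cos y) / 2)\<bar> <= 2 / R" for u y :: real
 proof -
  have "\<bar>- (pi / R * sin u) / 2\<bar> <= 2 / R"
  proof -
   have "pi * \<bar>sin u\<bar> <= 4 * 1" by (rule mult_mono) (use pi_less_4 in simp_all)
   then show ?thesis using R by (simp add: abs_mult field_simps)
  qed
  then have "\<bar>- (pi / R * sin u) / 2\<bar> * \<bar>(1 + cos y) / 2\<bar> <= 2 / R * 1"
   by (rule mult_mono) (use half_cos[of y] R in auto)
  then show ?thesis by (simp only: abs_mult mult_1_right)
 qed
 consider "j = 1" | "j = 2" | "j = 3" using exhaust_3 by blast
 then show ?thesis by cases (use R in \<open>simp_all only: cosgrad_nth b abs_zero, simp\<close>)
qed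

lemma coscut_cont: "continuous_on S (coscut R)" "continuous_on S (cosgrad R)"
 unfolding coscut_def[abs_def] cosgrad_def[abs_def]
 by (intro continuous_on_add continuous_on_mult continuous_on_divide continuous_on_cos continuous_on_sin continuous_on_minus continuous_on_const continuous_on_component continuous_on_id continuous_on_scaleR; simp)+

lemma coscut_faces:
 assumes "R > 0" shows "faces_match (- R) R z (%x. coscut R x *\<^sub>R (f x :: 'a::real_vector))"
proof -
 have "pi / R * - R = - pi" "pi / R * R = pi" using assms by simp_all
 then show ?thesis by (simp add: faces_match_def coscut_def)
qed

lemma coscut_tendsto: "(%n. (coscut (real (n + 2)) x)\<^sup>2) \<longlonglongrightarrow> 1"
proof -
 have k: "(%n. pi / real (n + 2)) \<longlonglongrightarrow> 0" by (rule LIMSEQ_ignore_initial_segment[OF lim_const_over_n])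
 have "(%n. ((1 + cos (pi / real (n + 2) * x$1)) / 2 * ((1 + cos (pi / real (n + 2) * x$2)) / 2))\<^sup>2)
  \<longlonglongrightarrow> ((1 + cos (0 * x$1)) / 2 * ((1 + cos (0 * x$2)) / 2))\<^sup>2"
  by (intro tendsto_power tendsto_mult tendsto_divide tendsto_add tendsto_cos tendsto_const k) simp_all
 then show ?thesis by (simp add: coscut_def)
qed

lemma coscut_sq_range: "0 <= (coscut R x)\<^sup>2" "(coscut R x)\<^sup>2 <= 1"
 using coscut_range[of R x] by (simp_all add: power_le_one)

lemma eventually_ge: "\<forall>\<^sub>F n in sequentially. (r::real) <= real (n + 2)"
proof -
 have "r <= real (n + 2)" if "n \<ge> nat \<lceil>r\<rceil>" for n using that real_nat_ceiling_ge[of r] by linarith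
 then show ?thesis unfolding eventually_sequentially by blast
qed

context rt begin

text \<open>Dominated convergence, as the cutoffs tend to one and the boxes exhaust the slab.\<close>

lemma vol_tendsto:
 fixes f :: "side => real^3 => real"
 assumes c: "\<And>s. continuous_on (cs s) (f s)" and i: "\<And>s. set_integrable lborel (open_slab p s) (f s)"
 shows "(%n. vol (- real (n + 2)) (real (n + 2)) (%s x. (coscut (real (n + 2)) x)\<^sup>2 * f s x)) \<longlonglongrightarrow> (\<Sum>s\<in>sides. LBINT x:open_slab p s. f s x)"
 unfolding vol_def
proof (rule tendsto_sum)
 fix s
 let ?A = "%n. open_slab p s \<inter> slabbox (- real (n + 2)) (real (n + 2)) s"
 have cc: "continuous_on (slabbox (- real (n + 2)) (real (n + 2)) s) (%x. (coscut (real (n + 2)) x)\<^sup>2 * f s x)" for n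
  by (intro continuous_on_mult continuous_on_power coscut_cont continuous_on_subset[OF c slabbox_subset_cs])
 have "(%n. LBINT x:?A n. (coscut (real (n + 2)) x)\<^sup>2 * f s x) \<longlonglongrightarrow> (LBINT x:open_slab p s. f s x)"
 proof (rule cutoff_integral_tendsto[OF i box_part_integral(1)[OF cc] Int_lower1 coscut_sq_range _ coscut_tendsto])
  fix x assume x: "x \<in> open_slab p s"
  show "\<forall>\<^sub>F n in sequentially. x \<in> ?A n"
   using eventually_ge[of "\<bar>x$1\<bar> + \<bar>x$2\<bar>"]
  proof eventually_elim
   case (elim n)
   then have "x $ 1 \<in> {- real (n + 2)..real (n + 2)}" "x $ 2 \<in> {- real (n + 2)..real (n + 2)}" by auto
   moreover have "x $ 3 \<in> (ivl p s)" using x unfolding mem_open_slab by simp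
   ultimately have "x \<in> slabbox (- real (n + 2)) (real (n + 2)) s" unfolding mem_box3 by blast
   then show ?case using x by (rule IntI[rotated])
  qed
 qed
 then show "(%n. integral (slabbox (- real (n + 2)) (real (n + 2)) s) (%x. (coscut (real (n + 2)) x)\<^sup>2 * f s x)) \<longlonglongrightarrow> (LBINT x:open_slab p s. f s x)"
  by (simp only: box_part_integral(2)[OF cc])
qed

lemma ifc_tendsto:
 assumes c: "continuous_on (cs Upper) h" and i: "integrable lborel (%X. h (pt3 (fst X, snd X, 0)) :: real)"
 shows "(%n. ifc (- real (n + 2)) (real (n + 2)) (%x. (coscut (real (n + 2)) x)\<^sup>2 * h x)) \<longlonglongrightarrow> (LBINT X. h (pt3 (fst X, snd X, 0)))"
proof -
 let ?A = "%n. hbox (- real (n + 2)) (real (n + 2))" and ?h = "%X. h (pt3 (fst X, snd X, 0))"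
 have cc: "continuous_on (slabbox (- real (n + 2)) (real (n + 2)) Upper) (%x. (coscut (real (n + 2)) x)\<^sup>2 * h x)" for n
  by (intro continuous_on_mult continuous_on_power coscut_cont continuous_on_subset[OF c slabbox_subset_cs])
 have U: "set_integrable lborel UNIV ?h" "(LBINT X:UNIV. ?h X) = (LBINT X. ?h X)"
  using i by (simp_all add: set_integrable_def set_lebesgue_integral_def)
 have "(%n. LBINT X:?A n. (coscut (real (n + 2)) (pt3 (fst X, snd X, 0)))\<^sup>2 * ?h X) \<longlonglongrightarrow> (LBINT X:UNIV. ?h X)"
 proof (rule cutoff_integral_tendsto[OF U(1) hbox_integral(1)[OF cc] subset_UNIV coscut_sq_range _ coscut_tendsto])
  fix X :: "real \<times> real"
  obtain x y where X: "X = (x,y)" by fastforce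
  show "\<forall>\<^sub>F n in sequentially. X \<in> ?A n"
   using eventually_ge[of "\<bar>x\<bar> + \<bar>y\<bar>"]
  proof eventually_elim
   case (elim n)
   then have "x \<in> {- real (n + 2)..real (n + 2)}" "y \<in> {- real (n + 2)..real (n + 2)}" by auto
   then show ?case unfolding X mem_hbox by blast
  qed
 qed
 then show ?thesis by (simp only: hbox_integral(2)[OF cc] U(2))
qed

lemma ifc_le:
 assumes c: "continuous_on (slabbox a b Upper) h" and i: "integrable lborel (%X. h (pt3 (fst X, snd X, 0)) :: real)" and nn: "\<And>x. 0 <= h x"
 shows "ifc a b h <= (LBINT X. h (pt3 (fst X, snd X, 0)))"
 unfolding hbox_integral(2)[OF c, symmetric] set_lebesgue_integral_def
 by (rule integral_mono) (use i hbox_integral(1)[OF c] nn in \<open>auto simp: set_integrable_def indicator_def\<close>)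

lemma integrable_density:
 fixes f g :: "real^3 => real"
 assumes f: "set_integrable lborel (open_slab p s) f" and g: "continuous_on (cs s) g" and le: "\<And>x. x \<in> cs s ==> \<bar>g x\<bar> <= K * f x"
 shows "set_integrable lborel (open_slab p s) g"
proof (rule set_integrable_bound)
 have sub: "open_slab p s \<subseteq> cs s"
 proof
  fix x assume "x \<in> open_slab p s" then show "x \<in> cs s" unfolding mem_open_slab mem_cs by simp
 qed
 show "set_integrable lborel (open_slab p s) (%x. K * f x)" using f by (rule set_integrable_mult_right)
 show "set_borel_measurable lborel (open_slab p s) g"
  using borel_measurable_continuous_on_indicator[OF open_slab_borel continuous_on_subset[OF g sub]] unfolding set_borel_measurable_def by simp
 show "AE x in lborel. x \<in> open_slab p s \<longrightarrow> norm (g x) <= norm (K * f x)"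
 proof (rule AE_I2, rule impI)
  fix x assume "x \<in> open_slab p s"
  then have "\<bar>g x\<bar> <= K * f x" using le sub by blast
  then show "norm (g x) <= norm (K * f x)" by simp
 qed
qed

end

context lin_sol begin

text \<open>The decay bounds the mass that multiplies the cutoff errors, uniformly in the box and on bounded
  time intervals; the half widths \<open>n + 2\<close> make the gradient of the cutoff at most one.\<close>

lemma decaying_estimate:
 assumes dec: "decaying p v"
  and cb: "\<And>s z. z \<in> (ivl p s) ==> \<bar>rho p s z\<bar> <= c" "\<And>s z. z \<in> (ivl p s) ==> \<bar>dpres p s z * rho p s z\<bar> <= c"
   "\<And>s z. z \<in> (ivl p s) ==> \<bar>eps0 p s z\<bar> <= c" "\<And>s z. z \<in> (ivl p s) ==> \<bar>del0 p s z\<bar> <= c" and c0: "0 < c"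
  and k: "\<And>s z. z \<in> (ivl p s) ==> 6 * (dpres p s z * rho p s z) <= k * eps0 p s z" "\<And>s z. z \<in> (ivl p s) ==> 2 * grav p * rho p s z <= k * eps0 p s z" "grav p <= k"
  and lam: "lam > 0" and gr: "\<And>r. 0 < r ==> ereal r < xi_c p ==> growth p r <= lam"
 shows "growth_estimate p UNIV (gronwall_const lam * (1 + k)) lam v"
 unfolding growth_estimate_def
proof (intro allI impI)
 fix T :: real assume T: "T \<ge> 0"
 have k0: "k > 0" using k(3) g_pos by simp
 define qf where "qf t s x = (norm (v s t x))\<^sup>2 + (norm (Dv s t x))\<^sup>2 + (norm (w s t x))\<^sup>2 + (norm (Dw s t x))\<^sup>2" for t s x
 define nf where "nf t s x = rho p s (x $ 3) * (v s t x \<bullet> v s t x)" for t s x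
 define sf where "sf t s x = rho p s (x $ 3) * (w s t x \<bullet> w s t x)" for t s x
 define df where "df t s x = Dv s t x \<bullet> stressm s (x $ 3) (Dv s t x)" for t s x
 define hf where "hf t x = (Dv Upper t x $3$1)\<^sup>2 + (Dv Upper t x $3$2)\<^sup>2" for t x
 have hgr: "hgrad3_sq p (%s. v s t) = (%X. hf t (pt3 (fst X, snd X, 0)))" for t by (simp add: fun_eq_iff hgrad3_sq_eq hf_def del: closed_slab.simps)
 have "\<exists>M. \<forall>t\<in>{0..T}. (\<forall>s. set_integrable lborel (open_slab p s) (qf t s) \<and> (LBINT x:open_slab p s. qf t s x) <= M) \<and>
   (surf p > 0 \<longrightarrow> integrable lborel (%X. hf t (pt3 (fst X, snd X, 0))) \<and> (LBINT X. hf t (pt3 (fst X, snd X, 0))) <= M)"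
  unfolding qf_def[abs_def] using dec[unfolded decaying_def Let_def hgr, THEN spec[of _ T], THEN mp, OF T] .
 then obtain M where M0: "\<forall>t\<in>{0..T}. (\<forall>s. set_integrable lborel (open_slab p s) (qf t s) \<and> (LBINT x:open_slab p s. qf t s x) <= M) \<and>
   (surf p > 0 \<longrightarrow> integrable lborel (%X. hf t (pt3 (fst X, snd X, 0))) \<and> (LBINT X. hf t (pt3 (fst X, snd X, 0))) <= M)" ..
 have M: "\<And>t s. t \<in> {0..T} ==> set_integrable lborel (open_slab p s) (qf t s)" "\<And>t s. t \<in> {0..T} ==> (LBINT x:open_slab p s. qf t s x) <= M"
  "\<And>t. t \<in> {0..T} ==> surf p > 0 ==> integrable lborel (%X. hf t (pt3 (fst X, snd X, 0)))" "\<And>t. t \<in> {0..T} ==> surf p > 0 ==> (LBINT X. hf t (pt3 (fst X, snd X, 0))) <= M"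
  by (rule bspec[OF M0, THEN conjunct1, THEN spec, THEN conjunct1] bspec[OF M0, THEN conjunct1, THEN spec, THEN conjunct2]
    bspec[OF M0, THEN conjunct2, THEN mp, THEN conjunct1] bspec[OF M0, THEN conjunct2, THEN mp, THEN conjunct2]; assumption)+
 have sub: "x $ 3 \<in> (ivl p s)" if "x \<in> cs s" for x s using that unfolding mem_cs .
 have cD: "continuous_on (cs s) (%x. stressm s (x $ 3) (Dv s t x))" if "t \<ge> 0" for s t
  by (rule stressm_cont[OF D_slice(1)[OF that]]) (intro continuous_on_component continuous_on_id, rule sub)
 have cont: "continuous_on (cs s) (nf t s)" "continuous_on (cs s) (sf t s)" "continuous_on (cs s) (df t s)" "continuous_on (cs Upper) (hf t)" if t: "t \<ge> 0" for t s
  unfolding nf_def[abs_def] sf_def[abs_def] df_def[abs_def] hf_def[abs_def]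
  by (intro continuous_on_add continuous_on_mult continuous_on_inner continuous_on_power continuous_on_component rho_third_cont slice(3)[OF t] slice(4)[OF t] D_slice(1)[OF t] cD[OF t])+
 have q0: "0 <= (norm (v s t x))\<^sup>2" "0 <= (norm (Dv s t x))\<^sup>2" "0 <= (norm (w s t x))\<^sup>2" "0 <= (norm (Dw s t x))\<^sup>2" for s t x by simp_all
 have le: "\<bar>nf t s x\<bar> <= c * qf t s x" "\<bar>sf t s x\<bar> <= c * qf t s x" "\<bar>df t s x\<bar> <= (27 * c) * qf t s x" if x: "x \<in> cs s" for t s x
 proof -
  have "\<bar>nf t s x\<bar> = \<bar>rho p s (x $ 3)\<bar> * (norm (v s t x))\<^sup>2" "\<bar>sf t s x\<bar> = \<bar>rho p s (x $ 3)\<bar> * (norm (w s t x))\<^sup>2"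
   unfolding nf_def sf_def power2_norm_eq_inner[symmetric] abs_mult by simp_all
  moreover have "\<bar>rho p s (x $ 3)\<bar> * (norm (v s t x))\<^sup>2 <= c * qf t s x" "\<bar>rho p s (x $ 3)\<bar> * (norm (w s t x))\<^sup>2 <= c * qf t s x"
   by (rule mult_mono[OF cb(1)[OF sub[OF x]]]; use q0[of s t x] c0 in \<open>simp add: qf_def\<close>)+
  ultimately show "\<bar>nf t s x\<bar> <= c * qf t s x" "\<bar>sf t s x\<bar> <= c * qf t s x" by simp_all
  have "(27 * c) * (norm (Dv s t x))\<^sup>2 <= (27 * c) * qf t s x" by (rule mult_left_mono) (use q0[of s t x] c0 in \<open>simp_all add: qf_def\<close>)
  then show "\<bar>df t s x\<bar> <= (27 * c) * qf t s x"
   using stress_le[OF cb(3)[OF sub[OF x]] cb(4)[OF sub[OF x]], of "Dv s t x"] unfolding df_def by (rule order_trans[rotated])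
 qed
 have int: "set_integrable lborel (open_slab p s) (nf t s)" "set_integrable lborel (open_slab p s) (sf t s)" "set_integrable lborel (open_slab p s) (df t s)" if t: "t \<in> {0..T}" for t s
 proof -
  have t0: "t \<ge> 0" using t by simp
  show "set_integrable lborel (open_slab p s) (nf t s)" by (rule integrable_density[OF M(1)[OF t] cont(1)[OF t0] le(1)])
  show "set_integrable lborel (open_slab p s) (sf t s)" by (rule integrable_density[OF M(1)[OF t] cont(2)[OF t0] le(2)])
  show "set_integrable lborel (open_slab p s) (df t s)" by (rule integrable_density[OF M(1)[OF t] cont(3)[OF t0] le(3)])
 qed
 define Nn where "Nn t n = vol (- real (n + 2)) (real (n + 2)) (%s x. (coscut (real (n + 2)) x)\<^sup>2 * nf t s x)" for t n
 define Sn where "Sn t n = vol (- real (n + 2)) (real (n + 2)) (%s x. (coscut (real (n + 2)) x)\<^sup>2 * sf t s x)" for t n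
 define Dn where "Dn t n = vol (- real (n + 2)) (real (n + 2)) (%s x. (coscut (real (n + 2)) x)\<^sup>2 * df t s x)" for t n
 define Hn where "Hn n = ifc (- real (n + 2)) (real (n + 2)) (%x. (coscut (real (n + 2)) x)\<^sup>2 * hf 0 x)" for n
 define M' where "M' = 2 * M + surf p * M"
 define Kc where "Kc = (2 * grav p + 135) * c + 2 * surf p + 1 + ((198 * lam + 18 + 4 * grav p) * c + 4 * surf p + 1) + ((198 * k + 18 + 4 * grav p) * c + 4 * surf p + 1)"
 have est: "Nn T n + Dn T n + Sn T n <= gronwall_const lam * exp (2 * lam * T) * (Nn 0 n + Dn 0 n +
   (1/2 * Sn 0 n + k / 2 * (Nn 0 n + Dn 0 n) + surf p / 2 * Hn n + (T + 1) * (Kc * (2 / real (n + 2)) * M')))" for n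
 proof -
  let ?R = "real (n + 2)"
  have R: "?R > 0" "?R \<ge> 2" by simp_all
  interpret P: cut_sol p \<eta> v q "- ?R" ?R "2 / ?R" c "coscut ?R" "cosgrad ?R"
  proof unfold_locales
   show "- ?R < ?R" "0 <= 2 / ?R" "2 / ?R <= 1" using R by (simp_all add: divide_le_eq)
  qed (use R in \<open>simp_all only: coscut_pd coscut_cont coscut_range cosgrad_le coscut_faces cb\<close>)
  have "P.Mt t <= M'" if t: "0 <= t" "t <= T" for t
  proof -
   have Q: "P.Q s t = qf t s" for s by (simp add: fun_eq_iff P.Q_def qf_def)
   have "integral (slabbox (- ?R) ?R s) (qf t s) <= M" for s
    by (rule order_trans[OF box_part_le[OF P.Q_slice(1)[OF t(1), unfolded Q] M(1)] M(2)]) (use t q0 in \<open>simp_all add: qf_def\<close>)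
   from this[of Lower] this[of Upper] have 1: "vol (- ?R) ?R (%s. P.Q s t) <= 2 * M" unfolding Q vol_def by simp
   have hg: "P.hg t = hf t" by (simp add: fun_eq_iff P.hg_def hf_def del: closed_slab.simps)
   have "surf p * ifc (- ?R) ?R (hf t) <= surf p * M"
   proof (cases "surf p = 0")
    case False
    then have s: "surf p > 0" using surf_nonneg by simp
    have "ifc (- ?R) ?R (hf t) <= M"
     by (rule order_trans[OF ifc_le[OF P.Q_slice(2)[OF t(1), unfolded hg] M(3)] M(4)]) (use t s in \<open>simp_all add: hf_def\<close>)
    then show ?thesis using s by simp
   qed simp
   with 1 show ?thesis unfolding P.Mt_def hg M'_def by linarith
  qed
  note est = P.box_estimate[OF T lam gr k this, unfolded P.C3_def P.C1_def P.C2_def]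
  have "P.Nt t = Nn t n" "P.Dt t = Dn t n" "P.St t = Sn t n" "P.Ht 0 = Hn n" for t
   unfolding P.Nt_def P.Dt_def P.St_def P.Ht_def Nn_def Dn_def Sn_def Hn_def P.nd_def[abs_def] P.dd_def[abs_def] P.sd_def[abs_def] P.hd0_def[abs_def] nf_def df_def sf_def hf_def by (rule refl)+
  with est show ?thesis unfolding Kc_def by simp
 qed
 have z0: "0 \<in> {0..T}" and T0: "T \<in> {0..T}" using T by simp_all
 have limN: "Nn t \<longlonglongrightarrow> norm1_sq p UNIV (%s. v s t)" and limS: "Sn t \<longlonglongrightarrow> norm1_sq p UNIV (%s. w s t)" and limD: "Dn t \<longlonglongrightarrow> norm2_sq p UNIV (%s. v s t)"
  if t: "t \<in> {0..T}" for t
 proof -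
  have t0: "t \<ge> 0" using t by simp
  have "norm1_sq p UNIV (%s. v s t) = (\<Sum>s\<in>sides. LBINT x:open_slab p s. nf t s x)" "norm1_sq p UNIV (%s. w s t) = (\<Sum>s\<in>sides. LBINT x:open_slab p s. sf t s x)"
   unfolding norm1_sq_def slab_over_UNIV nf_def sf_def power2_norm_eq_inner by (rule refl)+
  moreover have "norm2_sq p UNIV (%s. v s t) = (\<Sum>s\<in>sides. LBINT x:open_slab p s. df t s x)"
   unfolding norm2_sq_def slab_over_UNIV df_def dissipation_density by (rule refl)
  ultimately show "Nn t \<longlonglongrightarrow> norm1_sq p UNIV (%s. v s t)" "Sn t \<longlonglongrightarrow> norm1_sq p UNIV (%s. w s t)" "Dn t \<longlonglongrightarrow> norm2_sq p UNIV (%s. v s t)"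
   unfolding Nn_def[abs_def] Sn_def[abs_def] Dn_def[abs_def] using vol_tendsto[OF cont(1)[OF t0] int(1)[OF t]] vol_tendsto[OF cont(2)[OF t0] int(2)[OF t]] vol_tendsto[OF cont(3)[OF t0] int(3)[OF t]]
   by simp_all
 qed
 have limH: "(%n. surf p / 2 * Hn n) \<longlonglongrightarrow> surf p / 2 * interface_int p UNIV (%s. v s 0)"
 proof (cases "surf p = 0")
  case False
  then have s: "surf p > 0" using surf_nonneg by simp
  have i: "interface_int p UNIV (%s. v s 0) = (LBINT X. hf 0 (pt3 (fst X, snd X, 0)))" unfolding interface_int_def hgr by (simp add: set_lebesgue_integral_def)
  show ?thesis unfolding i Hn_def by (rule tendsto_mult_left[OF ifc_tendsto[OF cont(4)[OF order_refl] M(3)[OF z0 s]]])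
 qed simp
 let ?N = "norm1_sq p UNIV (%s. v s 0)" and ?S = "norm1_sq p UNIV (%s. w s 0)" and ?D = "norm2_sq p UNIV (%s. v s 0)" and ?H = "interface_int p UNIV (%s. v s 0)"
 have limK: "(%n. 2 / real (n + 2)) \<longlonglongrightarrow> 0" by (rule LIMSEQ_ignore_initial_segment[OF lim_const_over_n])
 have "norm1_sq p UNIV (%s. v s T) + norm2_sq p UNIV (%s. v s T) + norm1_sq p UNIV (%s. w s T)
  <= gronwall_const lam * exp (2 * lam * T) * (?N + ?D + (1/2 * ?S + k / 2 * (?N + ?D) + surf p / 2 * ?H + (T + 1) * (Kc * 0 * M')))"
 proof (rule LIMSEQ_le)
  show "(%n. Nn T n + Dn T n + Sn T n) \<longlonglongrightarrow> norm1_sq p UNIV (%s. v s T) + norm2_sq p UNIV (%s. v s T) + norm1_sq p UNIV (%s. w s T)"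
   by (intro tendsto_add limN limD limS T0)
  show "(%n. gronwall_const lam * exp (2 * lam * T) * (Nn 0 n + Dn 0 n + (1/2 * Sn 0 n + k / 2 * (Nn 0 n + Dn 0 n) + surf p / 2 * Hn n + (T + 1) * (Kc * (2 / real (n + 2)) * M'))))
   \<longlonglongrightarrow> gronwall_const lam * exp (2 * lam * T) * (?N + ?D + (1/2 * ?S + k / 2 * (?N + ?D) + surf p / 2 * ?H + (T + 1) * (Kc * 0 * M')))"
   by (intro tendsto_add tendsto_mult_left tendsto_mult_right limN limD limS limH limK z0)
 qed (use est in blast)
 also have "\<dots> <= gronwall_const lam * exp (2 * lam * T) * ((1 + k) * (?S + ?N + ?D + surf p * ?H))"
 proof (rule mult_left_mono)
  have nn: "0 <= ?N" "0 <= ?S" "0 <= ?D" "0 <= ?H"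
  proof -
   have r: "0 <= rho p s (x $ 3)" "0 <= eps0 p s (x $ 3)" "0 <= del0 p s (x $ 3)" if "x \<in> open_slab p s" for s x
    using that rho_pos[of "x $ 3" s] eps0_pos[of "x $ 3" s] del0_nonneg[of "x $ 3" s] unfolding mem_open_slab by (auto intro: less_imp_le)
   have g: "0 <= (LBINT x:open_slab p s. f x)" if "\<And>x. x \<in> open_slab p s ==> 0 <= f x" for s and f :: "real^3 => real"
    unfolding set_lebesgue_integral_def by (rule integral_nonneg_AE) (use that in \<open>simp add: indicator_def\<close>)
   show "0 <= ?N" "0 <= ?S" "0 <= ?D" unfolding norm1_sq_def norm2_sq_def slab_over_UNIV
    by (intro sum_nonneg g add_nonneg_nonneg mult_nonneg_nonneg r; simp add: r)+
   show "0 <= ?H" unfolding interface_int_def set_lebesgue_integral_def hgr by (rule integral_nonneg_AE) (simp add: hf_def)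
  qed
  have "0 <= (1/2 + k) * ?S + k / 2 * (?N + ?D) + (1/2 + k) * (surf p * ?H)"
   using nn k0 surf_nonneg by (intro add_nonneg_nonneg mult_nonneg_nonneg) auto
  then show "?N + ?D + (1/2 * ?S + k / 2 * (?N + ?D) + surf p / 2 * ?H + (T + 1) * (Kc * 0 * M')) <= (1 + k) * (?S + ?N + ?D + surf p * ?H)"
   by (simp add: algebra_simps)
 qed (use gronwall_const_pos[OF lam] in simp)
 finally show "norm1_sq p UNIV (%s. v s T) + norm2_sq p UNIV (%s. v s T) + norm1_sq p UNIV (%s. w s T)
  <= gronwall_const lam * (1 + k) * exp (2 * lam * T) * (?S + ?N + ?D + surf p * ?H)" by (simp only: mult_ac)
qed

end

theorem theorem2p5:
  fixes p :: rt_params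
  assumes "rt_admissible p"
  shows "\<exists>C :: real \<Rightarrow> real. (\<forall>r. C r > 0) \<and>
    (\<forall>\<eta> v q. lin_solution p \<eta> v q \<and> decaying p v \<longrightarrow>
       growth_estimate p UNIV (C (growth_max p)) (growth_max p) v) \<and>
    (\<forall>L>0. sqrt (surf p / (grav p * jump_rho p)) < L \<longrightarrow>
       (\<forall>\<eta> v q. lin_solution p \<eta> v q \<and>
          periodic_field p L \<eta> \<and> periodic_field p L v \<and> periodic_field p L q \<longrightarrow>
          growth_estimate p (cell L) (C (growth_sup_per p L)) (growth_sup_per p L) v))"
proof -
  interpret rt p by unfold_locales (rule assms)
  obtain c k where ck: "\<And>s z. z \<in> {zlo p s..zhi p s} \<Longrightarrow> \<bar>rho p s z\<bar> \<le> c" "\<And>s z. z \<in> {zlo p s..zhi p s} \<Longrightarrow> \<bar>dpres p s z * rho p s z\<bar> \<le> c"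
      "\<And>s z. z \<in> {zlo p s..zhi p s} \<Longrightarrow> \<bar>eps0 p s z\<bar> \<le> c" "\<And>s z. z \<in> {zlo p s..zhi p s} \<Longrightarrow> \<bar>del0 p s z\<bar> \<le> c"
      "\<And>s z. z \<in> {zlo p s..zhi p s} \<Longrightarrow> 6 * (dpres p s z * rho p s z) \<le> k * eps0 p s z" "\<And>s z. z \<in> {zlo p s..zhi p s} \<Longrightarrow> 2 * grav p * rho p s z \<le> k * eps0 p s z" "grav p \<le> k" "0 < c"
    using coeff_constants by blast
  have k0: "1 + k > 0" using ck(7) g_pos by simp
  define C where "C r = (if r > 0 then gronwall_const r * (1 + k) else 1)" for r
  have L: "lin_sol p \<eta> v q" if "lin_solution p \<eta> v q" for \<eta> v q by unfold_locales (rule that)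
  show ?thesis
  proof (intro exI[of _ C] conjI allI impI)
    show "C r > 0" for r using gronwall_const_pos k0 by (simp add: C_def)
    show "growth_estimate p UNIV (C (growth_max p)) (growth_max p) v" if "lin_solution p \<eta> v q \<and> decaying p v" for \<eta> v q
      using lin_sol.decaying_estimate[OF L[OF conjunct1[OF that]] conjunct2[OF that] ck(1-4,8,5-7) growth_max_facts] growth_max_facts(1) by (simp add: C_def)
    show "growth_estimate p (cell l) (C (growth_sup_per p l)) (growth_sup_per p l) v"
      if l: "0 < l" "sqrt (surf p / (grav p * jump_rho p)) < l" and s: "lin_solution p \<eta> v q \<and> periodic_field p l \<eta> \<and> periodic_field p l v \<and> periodic_field p l q" for l \<eta> v q
    proof -
      from s have s': "lin_solution p \<eta> v q" "periodic_field p l \<eta>" "periodic_field p l v" "periodic_field p l q" by simp_all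
      show ?thesis using lin_sol.periodic_estimate[OF L[OF s'(1)] l(1) s'(2-4) ck(1-7) growth_sup_per_facts[OF l]] growth_sup_per_facts(1)[OF l] by (simp add: C_def)
    qed
  qed
qed

end
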